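(* Let $d=3$ or $d=4$. Then there exist a smooth curve $C\subset\mathbb{P}^2$ of degree $d$, a line $p^\perp\subset(\mathbb{P}^2)^*$ (where $p\in\mathbb{P}^2$ is a point) transversal to $C^*$, a smooth projective curve $C'$, and a holomorphic mapping $\pi\colon C'\to p^\perp$ with simple ramification such that $\deg\pi=d$ and $\pi$ is ramified exactly over $C^*\cap p^\perp$, with the following properties. (1) For a point $t_0\in p^\perp\setminus C^*$, the fiber monodromy homomorphism $\pi_1(p^\perp\setminus C^*,t_0)\to\mathrm{Perm}(\pi^{-1}(t_0))$ can be factored through the homomorphism $\pi_1(p^\perp\setminus C^*,t_0)\to\pi_1((\mathbb{P}^2)^*\setminus C^*,t_0)$ induced by the embedding $p^\perp\setminus C^*\hookrightarrow(\mathbb{P}^2)^*\setminus C^*$. (2) The mapping $\pi\colon C'\to p^\perp$ is not equivalent to the projection $\mathrm{pr}_p\colon C\to p^\perp$, i.e. there is no isomorphism $\psi\colon C'\to C$ with $\mathrm{pr}_p\circ\psi=\pi$.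
   Context: The base field is $\mathbb{C}$; curves are irreducible. For a point $p\in\mathbb{P}^2$, $p^\perp\subset(\mathbb{P}^2)^*$ is the line consisting of all lines through $p$; for $p\notin C$, $\mathrm{pr}_p\colon C\to p^\perp$ sends $x$ to the line joining $p$ and $x$. The dual curve $C^*\subset(\mathbb{P}^2)^*$ is the closure of the set of lines tangent to $C$ at smooth points. A line is transversal to a curve if it does not pass through singular points of the curve and is not tangent to it at any smooth point (so transversality of $p^\perp$ to $C^*$ implies $p\notin C$). A finite morphism from a smooth projective curve to $\mathbb{P}^1$ has simple ramification if, for each branch point (critical value), the monodromy of a small loop around it acts on a fiber as a transposition. The fiber monodromy of a covering is the action of the fundamental group of the base on a fiber via loop lifting; $\mathrm{Perm}(S)$ is the permutation group of the set $S$. *)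

theory Defs
  imports
    "HOL-Complex_Analysis.Complex_Analysis"
    "HOL-Library.Poly_Mapping"
    "HOL-Combinatorics.Transposition"
    "HOL-Algebra.Bij"
begin

section \<open>Projective spaces\<close>

text \<open>The dimension of the ambient space of a projective curve is not fixed in advance, so all
  the spaces \<open>\<P>\<^sup>N\<close> live in one type \<open>proj\<close>, whose points are the classes of nonzero
  finitely supported sequences up to scaling; \<open>\<P>\<^sup>N\<close> is the set of points with homogeneous
  coordinates \<open>x\<^sub>0, \<dots>, x\<^sub>N\<close> only. The type carries the quotient topology of the
  product topology on sequences. Since the quotient map is open, this induces on each \<open>\<P>\<^sup>N\<close>
  the usual quotient topology from \<open>\<complex>\<^bsup>N+1\<^esup> - {0}\<close>.\<close>

definition hvec :: "(nat \<Rightarrow> complex) set" where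
  "hvec = {v. finite {i. v i \<noteq> 0} \<and> (\<exists>i. v i \<noteq> 0)}"

definition proportional :: "(nat \<Rightarrow> complex) \<Rightarrow> (nat \<Rightarrow> complex) \<Rightarrow> bool" where
  "proportional v w \<longleftrightarrow> v \<in> hvec \<and> w \<in> hvec \<and> (\<exists>c. c \<noteq> 0 \<and> w = (\<lambda>i. c * v i))"

quotient_type proj = "nat \<Rightarrow> complex" / partial: proportional
  morphisms rep_proj abs_proj
proof (rule part_equivpI)
  show "\<exists>v. proportional v v"
  proof
    have "{i. (if i = (0::nat) then 1 else 0::complex) \<noteq> 0} = {0}" by auto
    then have "(\<lambda>i. if i = 0 then 1 else 0) \<in> hvec" by (auto simp: hvec_def)
    then show "proportional (\<lambda>i. if i = 0 then 1 else 0) (\<lambda>i. if i = 0 then 1 else 0)"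
      unfolding proportional_def by (intro conjI exI[of _ 1]) auto
  qed
  show "symp proportional"
  proof (rule sympI)
    fix v w assume "proportional v w"
    then obtain c where c: "v \<in> hvec" "w \<in> hvec" "c \<noteq> 0" "w = (\<lambda>i. c * v i)"
      by (auto simp: proportional_def)
    then show "proportional w v"
      unfolding proportional_def by (intro conjI exI[of _ "inverse c"]) auto
  qed
  show "transp proportional"
  proof (rule transpI)
    fix u v w assume "proportional u v" "proportional v w"
    then obtain b c where "u \<in> hvec" "w \<in> hvec" "b \<noteq> 0" "c \<noteq> 0"
      "v = (\<lambda>i. b * u i)" "w = (\<lambda>i. c * v i)"
      by (auto simp: proportional_def)
    then show "proportional u w"
      unfolding proportional_def by (intro conjI exI[of _ "c * b"]) (auto simp: mult.assoc)
  qed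
qed

instantiation proj :: topological_space
begin

definition open_proj :: "proj set \<Rightarrow> bool" where
  "open_proj U \<longleftrightarrow> openin (top_of_set hvec) {v \<in> hvec. abs_proj v \<in> U}"

instance
proof
  show "open (UNIV :: proj set)" by (simp add: open_proj_def)
next
  fix S T :: "proj set" assume "open S" "open T"
  moreover have "{v \<in> hvec. abs_proj v \<in> S \<inter> T} =
      {v \<in> hvec. abs_proj v \<in> S} \<inter> {v \<in> hvec. abs_proj v \<in> T}" by auto
  ultimately show "open (S \<inter> T)" by (simp add: open_proj_def openin_Int)
next
  fix K :: "proj set set" assume "\<forall>S\<in>K. open S"
  moreover have "{v \<in> hvec. abs_proj v \<in> \<Union> K} = (\<Union>S\<in>K. {v \<in> hvec. abs_proj v \<in> S})" by auto
  ultimately show "open (\<Union> K)" by (auto simp: open_proj_def intro!: openin_Union)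
qed

end

definition proj_space :: "nat \<Rightarrow> proj set" where
  "proj_space N = {abs_proj v |v. v \<in> hvec \<and> (\<forall>i>N. v i = 0)}"

text \<open>The point of \<open>(\<P>\<^sup>2)\<^sup>*\<close> with coordinates \<open>a\<close> is the line \<open>perp a\<close>, that is,
  \<open>a\<^sub>0x\<^sub>0 + a\<^sub>1x\<^sub>1 + a\<^sub>2x\<^sub>2 = 0\<close>, so \<open>(\<P>\<^sup>2)\<^sup>*\<close> is again \<open>proj_space 2\<close>. By the symmetry of
  the incidence relation, for a point \<open>p\<close> of the plane \<open>perp p\<close> is the line of the dual
  plane consisting of all lines through \<open>p\<close>.\<close>

definition perp :: "proj \<Rightarrow> proj set" where
  "perp a = {x \<in> proj_space 2. (\<Sum>i\<le>2. rep_proj a i * rep_proj x i) = 0}"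

definition is_line :: "proj set \<Rightarrow> bool" where
  "is_line L \<longleftrightarrow> (\<exists>a\<in>hvec. \<exists>b\<in>hvec. \<not> proportional a b \<and>
     L = {abs_proj v |v. v \<in> hvec \<and> (\<exists>s t. v = (\<lambda>i. s * a i + t * b i))})"

section \<open>Projective algebraic curves\<close>

type_synonym cpoly = "(nat \<Rightarrow>\<^sub>0 nat) \<Rightarrow>\<^sub>0 complex"

definition poly_eval :: "cpoly \<Rightarrow> (nat \<Rightarrow> complex) \<Rightarrow> complex" where
  "poly_eval F v = (\<Sum>m\<in>Poly_Mapping.keys F.
     Poly_Mapping.lookup F m * (\<Prod>i\<in>Poly_Mapping.keys m. v i ^ Poly_Mapping.lookup m i))"

definition partial_deriv :: "nat \<Rightarrow> cpoly \<Rightarrow> (nat \<Rightarrow> complex) \<Rightarrow> complex" where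
  "partial_deriv i F v = deriv (\<lambda>z. poly_eval F (v(i := z))) (v i)"

definition form :: "nat \<Rightarrow> nat \<Rightarrow> cpoly \<Rightarrow> bool" where
  "form N d F \<longleftrightarrow> (\<forall>m\<in>Poly_Mapping.keys F.
     Poly_Mapping.keys m \<subseteq> {..N} \<and> (\<Sum>i\<in>Poly_Mapping.keys m. Poly_Mapping.lookup m i) = d)"

definition zero_locus :: "nat \<Rightarrow> cpoly set \<Rightarrow> proj set" where
  "zero_locus N S = {x \<in> proj_space N. \<forall>F\<in>S. poly_eval F (rep_proj x) = 0}"

definition algebraic_set :: "nat \<Rightarrow> proj set \<Rightarrow> bool" where
  "algebraic_set N X \<longleftrightarrow> (\<exists>S. (\<forall>F\<in>S. \<exists>d. form N d F) \<and> X = zero_locus N S)"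

definition variety :: "nat \<Rightarrow> proj set \<Rightarrow> bool" where
  "variety N X \<longleftrightarrow> algebraic_set N X \<and> X \<noteq> {} \<and>
     (\<forall>A B. algebraic_set N A \<longrightarrow> algebraic_set N B \<longrightarrow> X = A \<union> B \<longrightarrow> X = A \<or> X = B)"

text \<open>A projective curve is a variety of Krull dimension one.\<close>

definition projective_curve :: "nat \<Rightarrow> proj set \<Rightarrow> bool" where
  "projective_curve N X \<longleftrightarrow> variety N X \<and>
     (\<exists>Z. variety N Z \<and> Z \<subset> X) \<and>
     \<not> (\<exists>Y Z. variety N Y \<and> variety N Z \<and> Y \<subset> Z \<and> Z \<subset> X)"

definition tangent_space :: "nat \<Rightarrow> proj set \<Rightarrow> proj \<Rightarrow> proj set" where
  "tangent_space N X x = {abs_proj w |w. w \<in> hvec \<and> (\<forall>i>N. w i = 0) \<and>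
     (\<forall>F d. form N d F \<longrightarrow> (\<forall>y\<in>X. poly_eval F (rep_proj y) = 0) \<longrightarrow>
        (\<Sum>i\<le>N. partial_deriv i F (rep_proj x) * w i) = 0)}"

text \<open>Jacobian criterion: a point of a curve is smooth iff the embedded tangent space there
  has dimension one.\<close>

definition smooth_point :: "nat \<Rightarrow> proj set \<Rightarrow> proj \<Rightarrow> bool" where
  "smooth_point N X x \<longleftrightarrow> x \<in> X \<and> is_line (tangent_space N X x)"

definition smooth_curve :: "nat \<Rightarrow> proj set \<Rightarrow> bool" where
  "smooth_curve N X \<longleftrightarrow> projective_curve N X \<and> (\<forall>x\<in>X. smooth_point N X x)"

definition plane_curve_degree :: "proj set \<Rightarrow> nat \<Rightarrow> bool" where
  "plane_curve_degree C d \<longleftrightarrow> (\<exists>F. form 2 d F \<and> irreducible F \<and> C = zero_locus 2 {F})"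

definition dual_curve :: "proj set \<Rightarrow> proj set" where
  "dual_curve C =
     closure {l \<in> proj_space 2. \<exists>x. smooth_point 2 C x \<and> perp l = tangent_space 2 C x}"

definition transversal :: "proj set \<Rightarrow> proj set \<Rightarrow> bool" where
  "transversal L X \<longleftrightarrow> (\<forall>x \<in> L \<inter> X. smooth_point 2 X x) \<and>
     (\<forall>x. smooth_point 2 X x \<longrightarrow> L \<noteq> tangent_space 2 X x)"

definition line_through :: "proj \<Rightarrow> proj \<Rightarrow> proj" where
  "line_through p x = (THE l. l \<in> proj_space 2 \<and> p \<in> perp l \<and> x \<in> perp l)"

section \<open>Holomorphic maps\<close>

definition holomorphic_lift ::
    "complex set \<Rightarrow> (complex \<Rightarrow> nat \<Rightarrow> complex) \<Rightarrow> (complex \<Rightarrow> proj) \<Rightarrow> bool" where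
  "holomorphic_lift U F g \<longleftrightarrow> open U \<and> (\<forall>w\<in>U. F w \<in> hvec \<and> g w = abs_proj (F w)) \<and>
     (\<forall>i. (\<lambda>w. F w i) holomorphic_on U)"

definition proj_holomorphic_on :: "(complex \<Rightarrow> proj) \<Rightarrow> complex set \<Rightarrow> bool" where
  "proj_holomorphic_on g D \<longleftrightarrow> (\<forall>z\<in>D. \<exists>U F. z \<in> U \<and> U \<subseteq> D \<and> holomorphic_lift U F g)"

text \<open>Inverse charts of a smooth curve \<open>X\<close>: a homeomorphism from an open set of the complex
  plane onto an open subset of \<open>X\<close> that is holomorphic as a map into projective space is
  biholomorphic for the complex structure that \<open>X\<close> has as a submanifold.\<close>

definition chart :: "proj set \<Rightarrow> complex set \<Rightarrow> (complex \<Rightarrow> proj) \<Rightarrow> bool" where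
  "chart X D g \<longleftrightarrow> open D \<and> proj_holomorphic_on g D \<and>
     openin (top_of_set X) (g ` D) \<and> (\<exists>h. homeomorphism D (g ` D) g h)"

definition holomorphic_map :: "proj set \<Rightarrow> proj set \<Rightarrow> (proj \<Rightarrow> proj) \<Rightarrow> bool" where
  "holomorphic_map X Y f \<longleftrightarrow> f ` X \<subseteq> Y \<and>
     (\<forall>x\<in>X. \<exists>D g. chart X D g \<and> x \<in> g ` D \<and> proj_holomorphic_on (f \<circ> g) D)"

definition isomorphism :: "proj set \<Rightarrow> proj set \<Rightarrow> (proj \<Rightarrow> proj) \<Rightarrow> bool" where
  "isomorphism X Y f \<longleftrightarrow> bij_betw f X Y \<and> holomorphic_map X Y f \<and>
     holomorphic_map Y X (inv_into X f)"

text \<open>The derivative of a map \<open>z \<mapsto> [F z]\<close> into projective space vanishes at \<open>z\<close> iff the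
  derivative of \<open>F\<close> at \<open>z\<close> is a multiple of \<open>F z\<close>.\<close>

definition critical_point :: "proj set \<Rightarrow> (proj \<Rightarrow> proj) \<Rightarrow> proj \<Rightarrow> bool" where
  "critical_point X f x \<longleftrightarrow> (\<exists>D g U F z c. chart X D g \<and> U \<subseteq> D \<and> z \<in> U \<and> g z = x \<and>
     holomorphic_lift U F (f \<circ> g) \<and> (\<forall>i. deriv (\<lambda>w. F w i) z = c * F z i))"

definition branch_points :: "proj set \<Rightarrow> (proj \<Rightarrow> proj) \<Rightarrow> proj set" where
  "branch_points X f = f ` {x \<in> X. critical_point X f x}"

definition fiber :: "proj set \<Rightarrow> (proj \<Rightarrow> proj) \<Rightarrow> proj \<Rightarrow> proj set" where
  "fiber X f t = {x \<in> X. f x = t}"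

text \<open>Degree of a finite map onto a line \<open>L\<close>; only used with \<open>d > 0\<close>, which makes the fibers
  finite and nonempty.\<close>

definition map_degree :: "proj set \<Rightarrow> proj set \<Rightarrow> (proj \<Rightarrow> proj) \<Rightarrow> nat \<Rightarrow> bool" where
  "map_degree X L f d \<longleftrightarrow> (\<forall>t \<in> L - branch_points X f. card (fiber X f t) = d)"

section \<open>Fundamental group and monodromy\<close>

definition loops :: "'a::topological_space set \<Rightarrow> 'a \<Rightarrow> (real \<Rightarrow> 'a) set" where
  "loops S a = {\<gamma>. path \<gamma> \<and> path_image \<gamma> \<subseteq> S \<and> pathstart \<gamma> = a \<and> pathfinish \<gamma> = a}"

text \<open>In the product \<open>A \<otimes> B\<close> the loop \<open>B\<close> is traversed first. With this convention, and with
  permutations composed as functions, the fiber monodromy is a homomorphism rather than an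
  antihomomorphism.\<close>

definition fundamental_group ::
    "'a::topological_space set \<Rightarrow> 'a \<Rightarrow> (real \<Rightarrow> 'a) set monoid" where
  "fundamental_group S a =
     \<lparr>carrier = {{\<delta>. homotopic_paths S \<gamma> \<delta>} |\<gamma>. \<gamma> \<in> loops S a},
      mult = \<lambda>A B. {\<delta>. \<exists>\<alpha>\<in>A. \<exists>\<beta>\<in>B. homotopic_paths S (\<beta> +++ \<alpha>) \<delta>},
      one = {\<delta>. homotopic_paths S (\<lambda>_. a) \<delta>}\<rparr>"

text \<open>The homomorphism of fundamental groups induced by the inclusion of a set in \<open>T\<close>.\<close>

definition induced_inclusion ::
    "'a::topological_space set \<Rightarrow> (real \<Rightarrow> 'a) set \<Rightarrow> (real \<Rightarrow> 'a) set" where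
  "induced_inclusion T A = {\<delta>. \<exists>\<gamma>\<in>A. homotopic_paths T \<gamma> \<delta>}"

definition lift_end ::
    "proj set \<Rightarrow> (proj \<Rightarrow> proj) \<Rightarrow> (real \<Rightarrow> proj) \<Rightarrow> proj \<Rightarrow> proj" where
  "lift_end X f \<gamma> s = (THE y. \<exists>\<delta>. path \<delta> \<and> path_image \<delta> \<subseteq> X \<and>
     (\<forall>u\<in>{0..1}. f (\<delta> u) = \<gamma> u) \<and> pathstart \<delta> = s \<and> pathfinish \<delta> = y)"

definition fiber_monodromy ::
    "proj set \<Rightarrow> (proj \<Rightarrow> proj) \<Rightarrow> proj \<Rightarrow> (real \<Rightarrow> proj) set \<Rightarrow> proj \<Rightarrow> proj" where
  "fiber_monodromy X f a A = (\<lambda>s\<in>fiber X f a. lift_end X f (SOME \<gamma>. \<gamma> \<in> A) s)"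

text \<open>The small loops around a branch point \<open>b\<close> are the images of small circles in a local
  coordinate of the line \<open>L\<close> near \<open>b\<close>.\<close>

definition simple_ramification :: "proj set \<Rightarrow> proj set \<Rightarrow> (proj \<Rightarrow> proj) \<Rightarrow> bool" where
  "simple_ramification X L f \<longleftrightarrow> (\<forall>b \<in> branch_points X f.
     \<exists>D g z. chart L D g \<and> z \<in> D \<and> g z = b \<and>
       (\<forall>\<^sub>F r in at_right 0.
          let S = fiber X f (g (z + of_real r)) in
          \<exists>x\<in>S. \<exists>y\<in>S. x \<noteq> y \<and>
            (\<forall>s\<in>S. lift_end X f (g \<circ> circlepath z r) s = Transposition.transpose x y s)))"

end

theory Submission
  imports Defs "HOL-Computational_Algebra.Fundamental_Theorem_Algebra"
begin

text \<open>For each \<open>d\<close> we start from a covering of degree \<open>d\<close> of the whole complement of a dual curve that is not the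
  tautological one. For the curve \<open>x\<^sup>3 + y\<^sup>3 = 4z\<^sup>3\<close> it is defined by the resolvent
  cubic; for \<open>x\<^sup>4 = y\<^sup>4 + z\<^sup>4\<close> by a binary quartic form that has a double zero exactly over the dual curve. The
  restriction to a pencil of lines is completed by an explicit curve \<open>y\<^sup>n = \<beta>(s, t)\<close>, so \<open>\<pi>\<close> has the required
  factorization by the uniqueness of lifts. Over a special line the fiber has \<open>d - 1\<close> points, which forces simple
  ramification. An isomorphism with the projection would carry a suitable path joining two points of a fiber, along
  which the lines are real up to a constant factor, to a path of the plane curve; but sign considerations show
  that the endpoints of such a path coincide.\<close>

subsection \<open>The topology of projective space\<close>

text \<open>Any covering of the whole complement has monodromy that factors; the difficulty is to
  find a second covering branched along the same dual curve. For the cubic, the dual sextic has an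
  equation F^2 = 4 G^3 with F = a^3 + b^3 + c^3/4 and G = ab, and this is the discriminant condition
  of r^3 - 3Gr = F. For the quartic, the dual is the preimage of the astroid A^(2/3) = B^(2/3) +
  C^(2/3) under (A : B : C) = (a^2 : b^2 : c^2). Up to scaling of the coordinates the astroid is the
  evolute of a conic, where two of the four normals through a point coincide; the feet of the
  normals solve A/X = B/Y + C/Z on X^2 = Y^2 + Z^2, and they form the covering. The paths that
  exclude an isomorphism follow a segment of lines from t = 0 to a branch value and back, while the
  point on the covering curve passes through a ramification point to another sheet. Coverings enter
  only as open maps with finite fibers of constant size, so that counting zeros and continuity of
  roots replace local trivializations.\<close>

lemma rep_proj_hvec [simp]: "rep_proj x \<in> hvec"
  using Quotient3_rep_reflp[OF Quotient3_proj] by (simp add: proportional_def)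

lemma abs_rep_proj [simp]: "abs_proj (rep_proj x) = x"
  by (rule Quotient3_abs_rep[OF Quotient3_proj])

lemma proportional_refl: "v \<in> hvec \<Longrightarrow> proportional v v"
  unfolding proportional_def by (intro conjI exI[of _ 1]) auto

lemma abs_proj_eq_iff:
  assumes "v \<in> hvec" "w \<in> hvec"
  shows "abs_proj v = abs_proj w \<longleftrightarrow> (\<exists>c. c \<noteq> 0 \<and> w = (\<lambda>i. c * v i))"
  using Quotient3_rel[OF Quotient3_proj, of v w] proportional_refl[OF assms(1)]
    proportional_refl[OF assms(2)] assms by (auto simp: proportional_def)

lemma hvec_scale: "c \<noteq> 0 \<Longrightarrow> v \<in> hvec \<Longrightarrow> (\<lambda>i. c * v i) \<in> hvec"
  by (auto simp: hvec_def)

lemma abs_proj_scale: "c \<noteq> 0 \<Longrightarrow> v \<in> hvec \<Longrightarrow> abs_proj (\<lambda>i. c * v i) = abs_proj v"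
  by (subst eq_commute, subst abs_proj_eq_iff) (auto simp: hvec_scale)

lemma rep_abs_proj:
  assumes "v \<in> hvec" obtains c where "c \<noteq> 0" "rep_proj (abs_proj v) = (\<lambda>i. c * v i)"
  using abs_proj_eq_iff[OF assms rep_proj_hvec[of "abs_proj v"]] by auto

lemma abs_proj_cases:
  obtains v where "v \<in> hvec" "x = abs_proj v"
  by (metis abs_rep_proj rep_proj_hvec)

lemma open_proj_iff: "open U \<longleftrightarrow> openin (top_of_set hvec) {v \<in> hvec. abs_proj v \<in> U}"
  by (rule open_proj_def)

lemma continuous_on_abs_proj: "continuous_on hvec abs_proj"
  unfolding continuous_on_open_invariant
proof (intro allI impI)
  fix B :: "proj set" assume "open B"
  then obtain W where "open W" "{v \<in> hvec. abs_proj v \<in> B} = hvec \<inter> W"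
    by (auto simp: open_proj_iff openin_open)
  then show "\<exists>A. open A \<and> A \<inter> hvec = abs_proj -` B \<inter> hvec" by (intro exI[of _ W]) auto
qed

lemma continuous_on_coord: "continuous_on S (\<lambda>v. v i)" for S :: "('i \<Rightarrow> 'b::topological_space) set"
  by (rule continuous_on_subset[OF continuous_on_product_coordinates]) simp

text \<open>The saturation of \<open>W\<close> under scaling is the union of the preimages of
  \<open>W\<close> under multiplication by the nonzero constants, each of which is open.\<close>

lemma open_abs_proj_image:
  assumes "open W" shows "open (abs_proj ` (hvec \<inter> W))"
proof -
  have "{v \<in> hvec. abs_proj v \<in> abs_proj ` (hvec \<inter> W)} =
      (\<Union>c\<in>-{0}. hvec \<inter> (\<lambda>v i. c * v i) -` W)" (is "?L = ?R")
  proof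
    show "?L \<subseteq> ?R"
    proof
      fix v assume "v \<in> ?L"
      then obtain w where w: "v \<in> hvec" "w \<in> hvec" "w \<in> W" "abs_proj v = abs_proj w" by auto
      then obtain c where "c \<noteq> 0" "w = (\<lambda>i. c * v i)" using abs_proj_eq_iff by blast
      with w show "v \<in> ?R" by auto
    qed
    show "?R \<subseteq> ?L"
    proof
      fix v assume "v \<in> ?R"
      then obtain c where c: "c \<noteq> 0" "v \<in> hvec" "(\<lambda>i. c * v i) \<in> W" by auto
      then have "abs_proj v = abs_proj (\<lambda>i. c * v i)" "(\<lambda>i. c * v i) \<in> hvec"
        by (simp_all add: abs_proj_scale hvec_scale)
      with c show "v \<in> ?L" by auto
    qed
  qed
  moreover have "openin (top_of_set hvec) (hvec \<inter> (\<lambda>v i. c * v i) -` W)" for c :: complex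
    by (rule continuous_openin_preimage_gen[OF _ assms])
       (intro continuous_on_coordinatewise_then_product continuous_intros continuous_on_coord)
  ultimately show ?thesis unfolding open_proj_iff by (metis (no_types, lifting) openin_Union imageE)
qed

text \<open>As the quotient map is open, continuity can be tested on homogeneous coordinates over an
  arbitrary subset \<open>S\<close>, such as a curve, and not only over open sets.\<close>

lemma continuous_on_projI:
  assumes "continuous_on {v \<in> hvec. abs_proj v \<in> S} (\<lambda>v. f (abs_proj v))"
  shows "continuous_on S f"
  unfolding continuous_on_open_invariant
proof (intro allI impI)
  fix B :: "'a set" assume "open B"
  with assms obtain W where W: "open W"
    "W \<inter> {v \<in> hvec. abs_proj v \<in> S} = (\<lambda>v. f (abs_proj v)) -` B \<inter> {v \<in> hvec. abs_proj v \<in> S}"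
    unfolding continuous_on_open_invariant by blast
  have "abs_proj ` (hvec \<inter> W) \<inter> S = f -` B \<inter> S"
  proof (intro Set.set_eqI iffI)
    fix x assume "x \<in> abs_proj ` (hvec \<inter> W) \<inter> S"
    then show "x \<in> f -` B \<inter> S" using W(2) by auto
  next
    fix x assume x: "x \<in> f -` B \<inter> S"
    obtain v where v: "v \<in> hvec" "x = abs_proj v" by (rule abs_proj_cases)
    with x W(2) have "v \<in> W" by auto
    with v x show "x \<in> abs_proj ` (hvec \<inter> W) \<inter> S" by auto
  qed
  with open_abs_proj_image[OF W(1)] show "\<exists>A. open A \<and> A \<inter> S = f -` B \<inter> S" by blast
qed

lemma continuous_on_into_proj:
  assumes "\<And>i. continuous_on A (\<lambda>x. F x i)" "\<And>x. x \<in> A \<Longrightarrow> F x \<in> hvec"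
  shows "continuous_on A (\<lambda>x. abs_proj (F x))"
  by (rule continuous_on_compose2[OF continuous_on_abs_proj continuous_on_coordinatewise_then_product])
     (use assms in auto)

instance proj :: t2_space
proof
  fix x y :: proj assume "x \<noteq> y"
  define v w where "v = rep_proj x" and "w = rep_proj y"
  have vw: "v \<in> hvec" "w \<in> hvec" "x = abs_proj v" "y = abs_proj w" by (auto simp: v_def w_def)
  have "\<exists>i j. v i * w j \<noteq> v j * w i"
  proof (rule ccontr)
    assume *: "\<not> ?thesis"
    obtain i where i: "v i \<noteq> 0" using vw(1) by (auto simp: hvec_def)
    have eq: "w j = (w i / v i) * v j" for j using * i by (auto simp: field_simps)
    obtain j where "w j \<noteq> 0" using vw(2) by (auto simp: hvec_def)
    with eq have "w i / v i \<noteq> 0" by (metis mult_zero_left)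
    moreover have "w = (\<lambda>j. (w i / v i) * v j)" using eq by blast
    ultimately have "abs_proj v = abs_proj w" using vw abs_proj_eq_iff by blast
    with vw \<open>x \<noteq> y\<close> show False by simp
  qed
  then obtain i j where ij: "v i * w j \<noteq> v j * w i" by blast
  \<comment> \<open>Both functions are scaled by |c| when \<open>u\<close> is multiplied by
    \<open>c\<close>, so comparing them is a condition on the point. \<open>F\<close> vanishes at
    \<open>w\<close> and \<open>G\<close> at \<open>v\<close>, while \<open>F v = G w\<close> is
    positive.\<close>
  define F G where "F u = cmod (u i * w j - u j * w i)" and "G u = cmod (u i * v j - u j * v i)"
    for u :: "nat \<Rightarrow> complex"
  define U V where "U = abs_proj ` (hvec \<inter> {u. G u < F u})" and "V = abs_proj ` (hvec \<inter> {u. F u < G u})"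
  have cF: "continuous_on UNIV F" "continuous_on UNIV G"
    unfolding F_def G_def by (intro continuous_intros continuous_on_coord)+
  have "open U" "open V" unfolding U_def V_def
    by (intro open_abs_proj_image open_Collect_less cF)+
  moreover have "x \<in> U" unfolding U_def vw F_def G_def using ij vw by auto
  moreover have "y \<in> V" unfolding V_def vw F_def G_def using ij vw
    by (auto intro!: image_eqI[of _ _ w] simp: mult.commute)
  moreover have "U \<inter> V = {}"
  proof (rule ccontr)
    assume "U \<inter> V \<noteq> {}"
    then obtain a b where ab: "a \<in> hvec" "b \<in> hvec" "G a < F a" "F b < G b" "abs_proj a = abs_proj b"
      by (auto simp: U_def V_def)
    then obtain c where c: "c \<noteq> 0" "b = (\<lambda>i. c * a i)" using abs_proj_eq_iff by blast
    have "b i * w j - b j * w i = c * (a i * w j - a j * w i)"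
      "b i * v j - b j * v i = c * (a i * v j - a j * v i)"
      by (simp_all add: c algebra_simps)
    then have "F b = cmod c * F a" "G b = cmod c * G a"
      by (simp_all only: F_def G_def norm_mult)
    moreover have "cmod c * G a < cmod c * F a" using ab c by simp
    ultimately show False using ab by simp
  qed
  ultimately show "\<exists>U V. open U \<and> open V \<and> x \<in> U \<and> y \<in> V \<and> U \<inter> V = {}" by blast
qed

lemma rep_abs_zero_iff: "v \<in> hvec \<Longrightarrow> rep_proj (abs_proj v) j = 0 \<longleftrightarrow> v j = 0"
  by (rule rep_abs_proj[of v]) auto

text \<open>Unlike \<open>rep_proj\<close>, which is an arbitrary choice of coordinates, this
  quotient depends only on the point and is continuous where the denominator does not
  vanish.\<close>

definition ratio :: "nat \<Rightarrow> nat \<Rightarrow> proj \<Rightarrow> complex" where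
  "ratio i j x = rep_proj x i / rep_proj x j"

lemma ratio_abs: "v \<in> hvec \<Longrightarrow> ratio i j (abs_proj v) = v i / v j"
  unfolding ratio_def by (rule rep_abs_proj[of v]) auto

lemma continuous_on_ratio:
  assumes "\<And>x. x \<in> S \<Longrightarrow> rep_proj x j \<noteq> 0"
  shows "continuous_on S (ratio i j)"
proof (rule continuous_on_projI)
  have "continuous_on {v \<in> hvec. abs_proj v \<in> S} (\<lambda>v. v i / v j)"
    by (intro continuous_intros continuous_on_coord) (use assms rep_abs_zero_iff in force)
  then show "continuous_on {v \<in> hvec. abs_proj v \<in> S} (\<lambda>v. ratio i j (abs_proj v))"
    by (rule continuous_on_eq) (simp add: ratio_abs)
qed

lemma open_rep_nonzero: "open {x. rep_proj x j \<noteq> 0}"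
proof -
  have "{x. rep_proj x j \<noteq> 0} = abs_proj ` (hvec \<inter> {v. v j \<noteq> 0})"
    using rep_abs_zero_iff by (auto intro!: image_eqI[of _ abs_proj "rep_proj _"])
  moreover have "open {v. (v j :: complex) \<noteq> 0}"
    by (intro open_Collect_neq continuous_intros continuous_on_coord)
  ultimately show ?thesis by (simp add: open_abs_proj_image)
qed

lemma proj_space_abs_iff: "v \<in> hvec \<Longrightarrow> abs_proj v \<in> proj_space N \<longleftrightarrow> (\<forall>i>N. v i = 0)"
proof
  assume v: "v \<in> hvec" and "abs_proj v \<in> proj_space N"
  then obtain w where w: "abs_proj w = abs_proj v" "w \<in> hvec" "\<forall>i>N. w i = 0"
    by (force simp: proj_space_def)
  then obtain c where "v = (\<lambda>i. c * w i)" using abs_proj_eq_iff[OF w(2) v] by blast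
  with w show "\<forall>i>N. v i = 0" by simp
qed (auto simp: proj_space_def)

lemma rep_proj_space: "x \<in> proj_space N \<Longrightarrow> i > N \<Longrightarrow> rep_proj x i = 0"
  using proj_space_abs_iff[of "rep_proj x" N] by simp

lemma hvecI: "(\<And>i. i > N \<Longrightarrow> v i = 0) \<Longrightarrow> v i \<noteq> 0 \<Longrightarrow> v \<in> hvec"
proof -
  assume *: "\<And>i. i > N \<Longrightarrow> v i = 0" and "v i \<noteq> 0"
  then have "{i. v i \<noteq> 0} \<subseteq> {..N}" by (force simp: not_less[symmetric])
  then show ?thesis using finite_subset \<open>v i \<noteq> 0\<close> unfolding hvec_def by blast
qed

subsection \<open>Polynomials as functions\<close>

lemma poly_eval_superset:
  assumes "finite K" "Poly_Mapping.keys F \<subseteq> K"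
  shows "poly_eval F v = (\<Sum>m\<in>K. Poly_Mapping.lookup F m *
     (\<Prod>i\<in>Poly_Mapping.keys m. v i ^ Poly_Mapping.lookup m i))"
  unfolding poly_eval_def by (rule sum.mono_neutral_left) (use assms in \<open>auto simp: in_keys_iff\<close>)

lemma monomial_superset:
  assumes "finite K" "Poly_Mapping.keys m \<subseteq> K"
  shows "(\<Prod>i\<in>Poly_Mapping.keys m. v i ^ Poly_Mapping.lookup m i) =
    (\<Prod>i\<in>K. (v i::complex) ^ Poly_Mapping.lookup m i)"
  by (rule prod.mono_neutral_left) (use assms in \<open>auto simp: in_keys_iff\<close>)

lemma poly_eval_add: "poly_eval (F + G) v = poly_eval F v + poly_eval G v"
proof -
  let ?K = "Poly_Mapping.keys F \<union> Poly_Mapping.keys G"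
  have "Poly_Mapping.keys (F + G) \<subseteq> ?K" by (rule Poly_Mapping.keys_add)
  then show ?thesis
    by (simp add: poly_eval_superset[of ?K] lookup_add distrib_right sum.distrib)
qed

lemma poly_eval_zero [simp]: "poly_eval 0 v = 0" by (simp add: poly_eval_def)

lemma poly_eval_uminus: "poly_eval (- F) v = - poly_eval F v"
  using poly_eval_add[of F "- F" v] by (simp add: add_eq_0_iff)

lemma poly_eval_diff: "poly_eval (F - G) v = poly_eval F v - poly_eval G v"
  using poly_eval_add[of F "- G" v] by (simp add: poly_eval_uminus)

lemma poly_eval_single: "poly_eval (Poly_Mapping.single m c) v =
    c * (\<Prod>i\<in>Poly_Mapping.keys m. v i ^ Poly_Mapping.lookup m i)"
  by (simp add: poly_eval_def)

lemma poly_mapping_update_eq: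
  "a \<notin> Poly_Mapping.keys f \<Longrightarrow> Poly_Mapping.update a b f = f + Poly_Mapping.single a b"
  for f :: "'k \<Rightarrow>\<^sub>0 'v::comm_monoid_add"
  by (rule poly_mapping_eqI) (auto simp: lookup_update lookup_add lookup_single when_def in_keys_iff)

lemma cpoly_induct:
  fixes F :: "'k \<Rightarrow>\<^sub>0 'v::comm_monoid_add"
  assumes "P 0" "\<And>F m c. P F \<Longrightarrow> P (F + Poly_Mapping.single m c)"
  shows "P F"
  by (induct F rule: update_induct) (use assms in \<open>auto simp: poly_mapping_update_eq\<close>)

lemma poly_eval_mult_single: "poly_eval (Poly_Mapping.single m c * Poly_Mapping.single l e) v =
    poly_eval (Poly_Mapping.single m c) v * poly_eval (Poly_Mapping.single l e) v"
proof -
  let ?K = "Poly_Mapping.keys m \<union> Poly_Mapping.keys l"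
  have "Poly_Mapping.keys (m + l) \<subseteq> ?K" by (rule Poly_Mapping.keys_add)
  from monomial_superset[OF _ this] show ?thesis
    by (simp add: mult_single poly_eval_single monomial_superset[of ?K m] monomial_superset[of ?K l]
        lookup_add power_add prod.distrib)
qed

lemma poly_eval_mult: "poly_eval (F * G) v = poly_eval F v * poly_eval G v"
proof (induct F rule: cpoly_induct)
  case (2 F m c)
  have "poly_eval (Poly_Mapping.single m c * G) v = poly_eval (Poly_Mapping.single m c) v * poly_eval G v"
    by (induct G rule: cpoly_induct) (simp_all add: distrib_left poly_eval_add poly_eval_mult_single)
  with 2 show ?case by (simp add: distrib_right poly_eval_add)
qed simp

definition Const :: "complex \<Rightarrow> cpoly" where "Const c = Poly_Mapping.single 0 c"
definition Var :: "nat \<Rightarrow> cpoly" where "Var i = Poly_Mapping.single (Poly_Mapping.single i 1) 1"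

lemma poly_eval_Const [simp]: "poly_eval (Const c) v = c"
  by (simp add: Const_def poly_eval_single)

lemma poly_eval_Var [simp]: "poly_eval (Var i) v = v i"
  by (simp add: Var_def poly_eval_single)

lemma poly_eval_one [simp]: "poly_eval 1 v = 1"
  using poly_eval_Const[of 1 v] by (simp add: Const_def single_one)

lemma poly_eval_power: "poly_eval (F ^ n) v = poly_eval F v ^ n"
  by (induct n) (simp_all add: poly_eval_mult)

lemma poly_eval_sum: "poly_eval (sum F I) v = (\<Sum>i\<in>I. poly_eval (F i) v)"
  by (induct I rule: infinite_finite_induct) (simp_all add: poly_eval_add)

lemmas poly_eval_simps = poly_eval_add poly_eval_diff poly_eval_uminus poly_eval_mult
  poly_eval_power poly_eval_sum

section \<open>Forms: closure properties and homogeneity\<close>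

lemma form_add:
  assumes "form N d F" "form N d G" shows "form N d (F + G)"
  unfolding form_def
proof
  fix m assume "m \<in> Poly_Mapping.keys (F + G)"
  then have "m \<in> Poly_Mapping.keys F \<or> m \<in> Poly_Mapping.keys G"
    using Poly_Mapping.keys_add[of F G] by blast
  then show "Poly_Mapping.keys m \<subseteq> {..N} \<and> sum (Poly_Mapping.lookup m) (Poly_Mapping.keys m) = d"
    using assms[unfolded form_def] by (elim disjE) (erule (1) bspec[rotated])+
qed

lemma form_uminus: assumes "form N d F" shows "form N d (- F)"
proof -
  have "Poly_Mapping.keys (- F) = Poly_Mapping.keys F" by (simp add: Set.set_eq_iff in_keys_iff)
  with assms show ?thesis by (simp only: form_def)
qed

lemma form_diff: "form N d F \<Longrightarrow> form N d G \<Longrightarrow> form N d (F - G)"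
  by (subst diff_conv_add_uminus) (intro form_add form_uminus)

lemma form_zero: "form N d 0"
  by (simp add: form_def)

lemma form_sum: "(\<And>i. i \<in> I \<Longrightarrow> form N d (F i)) \<Longrightarrow> form N d (sum F I)"
proof (induct I rule: infinite_finite_induct)
  case (insert x I)
  then have "form N d (F x)" "form N d (sum F I)" by auto
  then show ?case using insert.hyps by (simp add: form_add)
qed (simp_all add: form_zero)

lemma form_mult: assumes "form N d F" "form N e G" shows "form N (d + e) (F * G)"
  unfolding form_def
proof
  fix m assume "m \<in> Poly_Mapping.keys (F * G)"
  then obtain a b where ab: "m = a + b" "a \<in> Poly_Mapping.keys F" "b \<in> Poly_Mapping.keys G"
    using keys_mult[of F G] by blast
  let ?K = "Poly_Mapping.keys a \<union> Poly_Mapping.keys b"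
  have k: "Poly_Mapping.keys m \<subseteq> ?K" unfolding ab by (rule Poly_Mapping.keys_add)
  have *: "sum (Poly_Mapping.lookup x) (Poly_Mapping.keys x) = sum (Poly_Mapping.lookup x) ?K"
    if "Poly_Mapping.keys x \<subseteq> ?K" for x :: "nat \<Rightarrow>\<^sub>0 nat"
    by (rule sum.mono_neutral_left) (use that in \<open>auto simp: in_keys_iff\<close>)
  have "sum (Poly_Mapping.lookup m) (Poly_Mapping.keys m) = sum (Poly_Mapping.lookup m) ?K"
    using *[OF k] .
  also have "\<dots> = sum (Poly_Mapping.lookup a) ?K + sum (Poly_Mapping.lookup b) ?K"
    by (simp add: ab lookup_add sum.distrib)
  also have "\<dots> = d + e" using *[of a] *[of b] assms ab by (simp add: form_def)
  finally show "Poly_Mapping.keys m \<subseteq> {..N} \<and> sum (Poly_Mapping.lookup m) (Poly_Mapping.keys m) = d + e"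
    using k ab assms unfolding form_def by blast
qed

lemma form_Const: "form N 0 (Const c)"
  by (cases "c = 0") (auto simp: form_def Const_def)

lemma form_Var: "i \<le> N \<Longrightarrow> form N 1 (Var i)"
  by (auto simp: form_def Var_def)

lemma form_power: "form N d F \<Longrightarrow> form N (d * n) (F ^ n)"
proof (induct n)
  case 0 then show ?case using form_Const[of N 1] by (simp add: Const_def single_one)
next
  case (Suc n) then show ?case using form_mult[of N d F "d * n" "F ^ n"] by simp
qed

lemma form_Const_mult: "form N d F \<Longrightarrow> form N d (Const c * F)"
  using form_mult[OF form_Const, of N d F] by simp

lemma form_Var_power: "i \<le> N \<Longrightarrow> form N n (Var i ^ n)"
  using form_power[OF form_Var, of i N n] by simp

lemma poly_eval_scale:
  assumes "form N d F" shows "poly_eval F (\<lambda>i. c * v i) = c ^ d * poly_eval F v"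
proof -
  have "(\<Prod>i\<in>Poly_Mapping.keys m. (c * v i) ^ Poly_Mapping.lookup m i) =
      c ^ d * (\<Prod>i\<in>Poly_Mapping.keys m. v i ^ Poly_Mapping.lookup m i)"
    if "m \<in> Poly_Mapping.keys F" for m
  proof -
    have "(\<Prod>i\<in>Poly_Mapping.keys m. (c * v i) ^ Poly_Mapping.lookup m i) =
      (\<Prod>i\<in>Poly_Mapping.keys m. c ^ Poly_Mapping.lookup m i) *
      (\<Prod>i\<in>Poly_Mapping.keys m. v i ^ Poly_Mapping.lookup m i)"
      by (simp add: power_mult_distrib prod.distrib)
    then show ?thesis using assms that by (simp add: form_def flip: power_sum)
  qed
  then show ?thesis unfolding poly_eval_def
    by (simp add: sum_distrib_left mult_ac)
qed

text \<open>The coordinates chosen by \<open>rep_proj\<close> are unknown, but by homogeneity a form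
  vanishes at all coordinates of a point or at none.\<close>

lemma poly_eval_rep_abs:
  assumes "form N d F" "v \<in> hvec"
  shows "poly_eval F (rep_proj (abs_proj v)) = 0 \<longleftrightarrow> poly_eval F v = 0"
proof -
  obtain c where "c \<noteq> 0" "rep_proj (abs_proj v) = (\<lambda>i. c * v i)" using assms(2) by (rule rep_abs_proj)
  then show ?thesis by (simp add: poly_eval_scale[OF assms(1)])
qed

lemma poly_eval_restrict:
  assumes "form N d F" "\<And>i. i \<le> N \<Longrightarrow> v i = w i"
  shows "poly_eval F v = poly_eval F w"
proof -
  have "v i = w i" if "m \<in> Poly_Mapping.keys F" "i \<in> Poly_Mapping.keys m" for m i
    using assms that unfolding form_def by blast
  then show ?thesis unfolding poly_eval_def by simp
qed

text \<open>The domain is an infinite product of lines without a norm. Differentiability is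
  therefore expressed along curves \<open>F\<close> whose coordinates are all differentiable, with
  finitely many coordinates \<open>J\<close> contributing to the derivative.\<close>

definition has_gradient ::
    "((nat \<Rightarrow> complex) \<Rightarrow> complex) \<Rightarrow> nat set \<Rightarrow> (nat \<Rightarrow> (nat \<Rightarrow> complex) \<Rightarrow> complex) \<Rightarrow> bool" where
  "has_gradient \<phi> J g \<longleftrightarrow> finite J \<and>
     (\<forall>F D w. (\<forall>i. ((\<lambda>z. F z i) has_field_derivative D i) (at w)) \<longrightarrow>
       ((\<lambda>z. \<phi> (F z)) has_field_derivative (\<Sum>i\<in>J. g i (F w) * D i)) (at w))"

lemma has_gradientD:
  assumes "has_gradient \<phi> J g" "\<forall>i. ((\<lambda>z. F z i) has_field_derivative D i) (at w)"
  shows "((\<lambda>z. \<phi> (F z)) has_field_derivative (\<Sum>i\<in>J. g i (F w) * D i)) (at w)"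
  by (rule assms(1)[unfolded has_gradient_def, THEN conjunct2, THEN spec[of _ F], THEN spec[of _ D],
        THEN spec[of _ w], THEN mp, OF assms(2)])

lemma has_gradient_finite: "has_gradient \<phi> J g \<Longrightarrow> finite J"
  by (simp add: has_gradient_def)

lemma has_gradientI:
  assumes "finite J" "\<And>F D w. \<forall>i. ((\<lambda>z. F z i) has_field_derivative D i) (at w) \<Longrightarrow>
    ((\<lambda>z. \<phi> (F z)) has_field_derivative (\<Sum>i\<in>J. g i (F w) * D i)) (at w)"
  shows "has_gradient \<phi> J g"
  unfolding has_gradient_def by (rule conjI[OF assms(1)]) (rule allI, rule allI, rule allI, rule impI, rule assms(2))

definition has_some_gradient where "has_some_gradient \<phi> \<longleftrightarrow> (\<exists>J g. has_gradient \<phi> J g)"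

lemma has_some_gradient_const: "has_some_gradient (\<lambda>v. c)"
proof -
  have "has_gradient (\<lambda>v. c) {} (\<lambda>i v. 0)" by (rule has_gradientI) auto
  then show ?thesis unfolding has_some_gradient_def by blast
qed

lemma has_some_gradient_coord: "has_some_gradient (\<lambda>v. v i)"
proof -
  have "has_gradient (\<lambda>v. v i) {i} (\<lambda>i v. 1)"
  proof (rule has_gradientI)
    fix F :: "complex \<Rightarrow> nat \<Rightarrow> complex" and D w
    assume "\<forall>i. ((\<lambda>z. F z i) has_field_derivative D i) (at w)"
    from spec[OF this, of i]
    show "((\<lambda>z. F z i) has_field_derivative (\<Sum>i\<in>{i}. 1 * D i)) (at w)" by simp
  qed simp
  then show ?thesis unfolding has_some_gradient_def by blast
qed

lemma sum_if_Un:
  fixes u :: "'i \<Rightarrow> 'a::semiring_0"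
  assumes "finite J" "finite K"
  shows "(\<Sum>i\<in>J \<union> K. ((if i \<in> J then u i else 0) + (if i \<in> K then v i else 0)) * D i) =
    (\<Sum>i\<in>J. u i * D i) + (\<Sum>i\<in>K. v i * D i)"
proof -
  have "(\<Sum>i\<in>J \<union> K. (if i \<in> J then u i else 0) * D i) = (\<Sum>i\<in>J. u i * D i)"
    by (rule sum.mono_neutral_cong_right) (use assms in auto)
  moreover have "(\<Sum>i\<in>J \<union> K. (if i \<in> K then v i else 0) * D i) = (\<Sum>i\<in>K. v i * D i)"
    by (rule sum.mono_neutral_cong_right) (use assms in auto)
  ultimately show ?thesis by (simp only: distrib_right sum.distrib)
qed

lemma has_some_gradient_add:
  assumes "has_some_gradient \<phi>" "has_some_gradient \<psi>"
  shows "has_some_gradient (\<lambda>v. \<phi> v + \<psi> v)"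
proof -
  obtain J g K h where *: "has_gradient \<phi> J g" "has_gradient \<psi> K h"
    using assms unfolding has_some_gradient_def by blast
  have "has_gradient (\<lambda>v. \<phi> v + \<psi> v) (J \<union> K)
      (\<lambda>i v. (if i \<in> J then g i v else 0) + (if i \<in> K then h i v else 0))"
    unfolding has_gradient_def using *[THEN has_gradient_finite]
    by (simp add: sum_if_Un) (intro allI impI DERIV_add *[THEN has_gradientD], auto)
  then show ?thesis unfolding has_some_gradient_def by blast
qed

lemma has_some_gradient_mult:
  assumes "has_some_gradient \<phi>" "has_some_gradient \<psi>"
  shows "has_some_gradient (\<lambda>v. \<phi> v * \<psi> v)"
proof -
  obtain J g K h where *: "has_gradient \<phi> J g" "has_gradient \<psi> K h"
    using assms unfolding has_some_gradient_def by blast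
  note fin = *[THEN has_gradient_finite]
  have "has_gradient (\<lambda>v. \<phi> v * \<psi> v) (J \<union> K)
      (\<lambda>i v. (if i \<in> J then g i v * \<psi> v else 0) + (if i \<in> K then h i v * \<phi> v else 0))"
  proof (rule has_gradientI)
    fix F :: "complex \<Rightarrow> nat \<Rightarrow> complex" and D w
    assume D: "\<forall>i. ((\<lambda>z. F z i) has_field_derivative D i) (at w)"
    have "((\<lambda>z. \<phi> (F z) * \<psi> (F z)) has_field_derivative
      (\<Sum>i\<in>J. g i (F w) * D i) * \<psi> (F w) + (\<Sum>i\<in>K. h i (F w) * D i) * \<phi> (F w)) (at w)"
      by (rule DERIV_mult[OF *[THEN has_gradientD, OF D]])
    moreover have "(\<Sum>i\<in>J. g i (F w) * D i) * \<psi> (F w) + (\<Sum>i\<in>K. h i (F w) * D i) * \<phi> (F w) =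
      (\<Sum>i\<in>J. g i (F w) * \<psi> (F w) * D i) + (\<Sum>i\<in>K. h i (F w) * \<phi> (F w) * D i)"
      unfolding sum_distrib_right by (intro arg_cong2[where f="(+)"] sum.cong) (simp_all only: mult_ac)
    ultimately show "((\<lambda>z. \<phi> (F z) * \<psi> (F z)) has_field_derivative
      (\<Sum>i\<in>J \<union> K. ((if i \<in> J then g i (F w) * \<psi> (F w) else 0) +
        (if i \<in> K then h i (F w) * \<phi> (F w) else 0)) * D i)) (at w)"
      using fin by (simp only: sum_if_Un)
  qed (use fin in auto)
  then show ?thesis unfolding has_some_gradient_def by blast
qed

lemma has_some_gradient_power: "has_some_gradient \<phi> \<Longrightarrow> has_some_gradient (\<lambda>v. \<phi> v ^ n)"
  by (induct n) (simp_all add: has_some_gradient_const has_some_gradient_mult)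

lemma has_some_gradient_prod:
  "(\<And>i. has_some_gradient (\<phi> i)) \<Longrightarrow> has_some_gradient (\<lambda>v. \<Prod>i\<in>K. \<phi> i v)"
  by (induct K rule: infinite_finite_induct)
     (simp_all add: has_some_gradient_const has_some_gradient_mult)

lemma has_some_gradient_sum:
  "(\<And>i. has_some_gradient (\<phi> i)) \<Longrightarrow> has_some_gradient (\<lambda>v. \<Sum>i\<in>K. \<phi> i v)"
  by (induct K rule: infinite_finite_induct)
     (simp_all add: has_some_gradient_const has_some_gradient_add)

lemma poly_eval_gradient: "has_some_gradient (poly_eval G)"
proof -
  have "has_some_gradient (\<lambda>v. poly_eval G v)" unfolding poly_eval_def
    by (intro has_some_gradient_sum has_some_gradient_mult has_some_gradient_const
        has_some_gradient_prod has_some_gradient_power has_some_gradient_coord)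
  then show ?thesis by simp
qed

text \<open>The functions of an abstract gradient are identified with \<open>partial_deriv\<close>
  by testing them on lines parallel to the axes.\<close>

lemma partial_deriv_chain:
  assumes "form N d G" and D: "\<And>i. i \<le> N \<Longrightarrow> ((\<lambda>z. F z i) has_field_derivative D i) (at w)"
  shows "((\<lambda>z. poly_eval G (F z)) has_field_derivative (\<Sum>i\<le>N. partial_deriv i G (F w) * D i)) (at w)"
proof -
  obtain J g where Jg: "has_gradient (poly_eval G) J g"
    using poly_eval_gradient unfolding has_some_gradient_def by blast
  note g = has_gradientD[OF Jg]
  have J: "finite J" using Jg by (simp add: has_gradient_def)
  have pd: "partial_deriv i G v = (if i \<in> J then g i v else 0)" for i v
  proof -
    have *: "\<forall>j. ((\<lambda>z. (v(i := z)) j) has_field_derivative (if j = i then 1 else 0)) (at (v i))" by auto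
    have "((\<lambda>z. poly_eval G (v(i := z))) has_field_derivative
      (\<Sum>j\<in>J. g j (v(i := v i)) * (if j = i then 1 else 0))) (at (v i))"
      using g[of "\<lambda>z. v(i := z)" "\<lambda>j. if j = i then 1 else 0" "v i"] * by blast
    moreover have "(\<Sum>j\<in>J. g j (v(i := v i)) * (if j = i then 1 else 0)) = (if i \<in> J then g i v else 0)"
      using J by (simp add: if_distrib[of "\<lambda>x. _ * x"] cong: if_cong)
    ultimately show ?thesis unfolding partial_deriv_def by (metis DERIV_imp_deriv)
  qed
  \<comment> \<open>Only the coordinates of \<open>F\<close> with index at most \<open>N\<close> are
    assumed to be differentiable; freezing the others leaves the value of the form
    unchanged.\<close>
  define F' where "F' z i = (if i \<le> N then F z i else F w i)" for z i
  define D' where "D' i = (if i \<le> N then D i else 0)" for i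
  have "\<forall>i. ((\<lambda>z. F' z i) has_field_derivative D' i) (at w)" using D by (simp add: F'_def D'_def)
  then have "((\<lambda>z. poly_eval G (F' z)) has_field_derivative (\<Sum>i\<in>J. g i (F' w) * D' i)) (at w)" by (rule g)
  moreover have "(\<lambda>z. poly_eval G (F' z)) = (\<lambda>z. poly_eval G (F z))"
    by (intro ext poly_eval_restrict[OF assms(1)]) (auto simp: F'_def)
  moreover have "F' w = F w" by (auto simp: F'_def)
  moreover have "(\<Sum>i\<in>J. g i (F w) * D' i) = (\<Sum>i\<le>N. partial_deriv i G (F w) * D i)"
  proof -
    have "(\<Sum>i\<in>J. g i (F w) * D' i) = (\<Sum>i\<in>J \<union> {..N}. partial_deriv i G (F w) * D' i)"
      by (rule sum.mono_neutral_cong_left) (use J in \<open>auto simp: pd\<close>)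
    also have "\<dots> = (\<Sum>i\<le>N. partial_deriv i G (F w) * D i)"
      by (rule sum.mono_neutral_cong_right) (use J in \<open>auto simp: D'_def\<close>)
    finally show ?thesis .
  qed
  ultimately show ?thesis by simp
qed

lemma poly_eval_partial_derivative:
  assumes "form N d G" "i \<le> N"
  shows "((\<lambda>z. poly_eval G (v(i := z))) has_field_derivative partial_deriv i G v) (at (v i))"
proof -
  have "((\<lambda>z. poly_eval G (v(i := z))) has_field_derivative
      (\<Sum>j\<le>N. partial_deriv j G (v(i := v i)) * (if j = i then 1 else 0))) (at (v i))"
    by (rule partial_deriv_chain[OF assms(1)]) auto
  moreover have "(\<Sum>j\<le>N. partial_deriv j G (v(i := v i)) * (if j = i then 1 else 0)) = partial_deriv i G v"
    using assms(2) by (simp add: if_distrib[of "\<lambda>x. _ * x"] cong: if_cong)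
  ultimately show ?thesis by simp
qed

lemma euler_identity:
  assumes "form N d G" shows "(\<Sum>i\<le>N. partial_deriv i G v * v i) = of_nat d * poly_eval G v"
proof -
  have "((\<lambda>z. poly_eval G (\<lambda>i. z * v i)) has_field_derivative
      (\<Sum>i\<le>N. partial_deriv i G (\<lambda>i. 1 * v i) * v i)) (at 1)"
    by (rule partial_deriv_chain[OF assms]) (auto intro!: derivative_eq_intros)
  moreover have "((\<lambda>z. poly_eval G (\<lambda>i. z * v i)) has_field_derivative of_nat d * poly_eval G v) (at 1)"
    unfolding poly_eval_scale[OF assms] by (auto intro!: derivative_eq_intros)
  ultimately show ?thesis using DERIV_unique by fastforce
qed

text \<open>The extra factor \<open>c\<close> on the left expresses homogeneity of degree d - 1
  without a subtraction, which also covers d = 0.\<close>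

lemma partial_deriv_scale:
  assumes "form N d G" "i \<le> N" "c \<noteq> 0"
  shows "c * partial_deriv i G (\<lambda>j. c * v j) = c ^ d * partial_deriv i G v"
proof -
  have "((\<lambda>z. poly_eval G (\<lambda>j. c * (v(i := z)) j)) has_field_derivative
      (\<Sum>j\<le>N. partial_deriv j G (\<lambda>j. c * (v(i := v i)) j) * (if j = i then c else 0))) (at (v i))"
    by (rule partial_deriv_chain[OF assms(1)]) (auto intro!: derivative_eq_intros)
  moreover have "(\<Sum>j\<le>N. partial_deriv j G (\<lambda>j. c * (v(i := v i)) j) * (if j = i then c else 0)) =
      c * partial_deriv i G (\<lambda>j. c * v j)"
    using assms(2) by (simp add: if_distrib[of "\<lambda>x. _ * x"] cong: if_cong)
  moreover have "((\<lambda>z. poly_eval G (\<lambda>j. c * (v(i := z)) j)) has_field_derivative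
      c ^ d * partial_deriv i G v) (at (v i))"
    unfolding poly_eval_scale[OF assms(1)]
    by (intro DERIV_cmult poly_eval_partial_derivative[OF assms(1,2)])
  ultimately show ?thesis using DERIV_unique by metis
qed

subsection \<open>Coverings with finite fibers\<close>

text \<open>The relation behind \<open>lift_end\<close>. As a relation it can be used before lifts
  are known to exist and to be unique.\<close>

definition lifts_to where
  "lifts_to X f \<gamma> x y \<longleftrightarrow> (\<exists>\<delta>. path \<delta> \<and> path_image \<delta> \<subseteq> X \<and>
     (\<forall>u\<in>{0..1}. f (\<delta> u) = \<gamma> u) \<and> pathstart \<delta> = x \<and> pathfinish \<delta> = y)"

lemma finite_t2_separation:
  fixes F :: "'a::t2_space set"
  assumes "finite F"
  obtains N where "\<And>y. y \<in> F \<Longrightarrow> open (N y) \<and> y \<in> N y"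
    "\<And>y z. y \<in> F \<Longrightarrow> z \<in> F \<Longrightarrow> y \<noteq> z \<Longrightarrow> N y \<inter> N z = {}"
proof -
  define S where "S y z = (SOME p. open (fst p) \<and> open (snd p) \<and> y \<in> fst p \<and> z \<in> snd p \<and>
    fst p \<inter> snd p = {})" for y z :: 'a
  define A B where "A y z = fst (S y z)" and "B y z = snd (S y z)" for y z
  have AB: "open (A y z) \<and> open (B y z) \<and> y \<in> A y z \<and> z \<in> B y z \<and> A y z \<inter> B y z = {}"
    if yz: "y \<noteq> z" for y z
  proof -
    obtain U V where "open U" "open V" "y \<in> U" "z \<in> V" "U \<inter> V = {}" using hausdorff[OF yz] by blast
    then have "\<exists>p. open (fst p) \<and> open (snd p) \<and> y \<in> fst p \<and> z \<in> snd p \<and> fst p \<inter> snd p = {}"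
      by (intro exI[of _ "(U, V)"]) simp
    then show ?thesis unfolding A_def B_def S_def by (rule someI_ex)
  qed
  define N where "N y = (\<Inter>z\<in>F - {y}. A y z \<inter> B z y)" for y
  show ?thesis
  proof
    fix y assume "y \<in> F"
    have "open (A y z \<inter> B z y)" "y \<in> A y z \<inter> B z y" if "z \<in> F - {y}" for z
      using AB[of y z] AB[of z y] that by (auto intro: open_Int)
    then show "open (N y) \<and> y \<in> N y" unfolding N_def using assms by (auto intro!: open_INT)
  next
    fix y z assume "y \<in> F" "z \<in> F" "y \<noteq> z"
    then have "N y \<subseteq> A y z" "N z \<subseteq> B y z" unfolding N_def by auto
    with AB[OF \<open>y \<noteq> z\<close>] show "N y \<inter> N z = {}" by blast
  qed
qed

text \<open>Over a Hausdorff total space an open map with finite fibers of constant cardinality is a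
  covering. In this form the coverings defined by zeros of polynomials and the unramified part of
  \<pi> can be recognized by counting.\<close>

locale finite_cover =
  fixes X :: "'a::t2_space set" and f :: "'a \<Rightarrow> 'b::topological_space" and B :: "'b set" and d :: nat
  assumes cont: "continuous_on X f" and into: "\<And>x. x \<in> X \<Longrightarrow> f x \<in> B"
    and open_map: "\<And>U. open U \<Longrightarrow> openin (top_of_set B) (f ` (X \<inter> U))"
    and card_fiber: "\<And>b. b \<in> B \<Longrightarrow> card {x \<in> X. f x = b} = d"
    and d_pos: "d > 0"
begin

abbreviation "fib b \<equiv> {x \<in> X. f x = b}"

lemma finite_fib: "b \<in> B \<Longrightarrow> finite (fib b)"
  using card_fiber d_pos card_gt_0_iff by metis

text \<open>The \<open>d\<close> points over \<open>b\<close> have disjoint neighborhoods, and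
  \<open>T\<close> is the intersection of their images. A fiber over a point of \<open>T\<close>
  meets every neighborhood and has only \<open>d\<close> points, hence exactly one in each;
  continuity of the resulting sections is the openness of \<open>f\<close>.\<close>

lemma local_sections:
  assumes b: "b \<in> B"
  obtains T N \<sigma> where "openin (top_of_set B) T" "b \<in> T"
    "\<And>y. y \<in> fib b \<Longrightarrow> open (N y) \<and> y \<in> N y"
    "\<And>y. y \<in> fib b \<Longrightarrow> continuous_on T (\<sigma> y)"
    "\<And>y t. y \<in> fib b \<Longrightarrow> t \<in> T \<Longrightarrow> \<sigma> y t \<in> X \<inter> N y \<and> f (\<sigma> y t) = t"
    "\<And>y x. y \<in> fib b \<Longrightarrow> x \<in> X \<inter> N y \<Longrightarrow> f x \<in> T \<Longrightarrow> x = \<sigma> y (f x)"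
    "\<And>x. x \<in> X \<Longrightarrow> f x \<in> T \<Longrightarrow> \<exists>y\<in>fib b. x \<in> N y"
proof -
  have fin: "finite (fib b)" by (rule finite_fib[OF b])
  have ne: "fib b \<noteq> {}" using card_fiber[OF b] d_pos by fastforce
  obtain N where N: "\<And>y. y \<in> fib b \<Longrightarrow> open (N y) \<and> y \<in> N y"
    "\<And>y z. y \<in> fib b \<Longrightarrow> z \<in> fib b \<Longrightarrow> y \<noteq> z \<Longrightarrow> N y \<inter> N z = {}"
    using finite_t2_separation[OF fin] by blast
  define T where "T = (\<Inter>y\<in>fib b. f ` (X \<inter> N y))"
  have T: "openin (top_of_set B) T" unfolding T_def
    by (intro openin_INT2 fin ne open_map) (use N in auto)
  have "b \<in> T" unfolding T_def using N by force
  have TB: "T \<subseteq> B" using T openin_subset by fastforce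
  define \<sigma> where "\<sigma> y t = (SOME x. x \<in> X \<inter> N y \<and> f x = t)" for y t
  have \<sigma>: "\<sigma> y t \<in> X \<inter> N y \<and> f (\<sigma> y t) = t" if "y \<in> fib b" "t \<in> T" for y t
  proof -
    have "\<exists>x. x \<in> X \<inter> N y \<and> f x = t" using that unfolding T_def by blast
    then show ?thesis unfolding \<sigma>_def by (rule someI_ex)
  qed
  have surj: "(\<lambda>y. \<sigma> y t) ` fib b = fib t" if "t \<in> T" for t
  proof (rule card_seteq)
    show "finite (fib t)" using finite_fib TB that by blast
    show "(\<lambda>y. \<sigma> y t) ` fib b \<subseteq> fib t" using \<sigma> that by blast
    have "inj_on (\<lambda>y. \<sigma> y t) (fib b)"
    proof (rule inj_onI, rule ccontr)
      fix y z assume yz: "y \<in> fib b" "z \<in> fib b" "\<sigma> y t = \<sigma> z t" "y \<noteq> z"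
      with \<sigma>[OF yz(1) that] \<sigma>[OF yz(2) that] N(2)[OF yz(1,2,4)] show False by auto
    qed
    then have "card ((\<lambda>y. \<sigma> y t) ` fib b) = card (fib b)" by (rule card_image)
    then show "card (fib t) \<le> card ((\<lambda>y. \<sigma> y t) ` fib b)" using card_fiber that TB b by auto
  qed
  have uniq: "x = \<sigma> y (f x)" if "y \<in> fib b" "x \<in> X \<inter> N y" "f x \<in> T" for x y
  proof -
    have "x \<in> (\<lambda>y. \<sigma> y (f x)) ` fib b" using surj[OF that(3)] that by blast
    then obtain z where z: "z \<in> fib b" "x = \<sigma> z (f x)" by blast
    then have "x \<in> N z" using \<sigma>[OF z(1) that(3)] by simp
    then have "z = y" using N(2)[OF z(1) that(1)] that(2) by blast
    with z show ?thesis by simp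
  qed
  have cover: "\<exists>y\<in>fib b. x \<in> N y" if "x \<in> X" "f x \<in> T" for x
  proof -
    have "x \<in> (\<lambda>y. \<sigma> y (f x)) ` fib b" using surj[OF that(2)] that by blast
    then obtain y where "y \<in> fib b" "x = \<sigma> y (f x)" by blast
    with \<sigma>[of y "f x"] that show ?thesis by force
  qed
  have cont\<sigma>: "continuous_on T (\<sigma> y)" if y: "y \<in> fib b" for y
    unfolding continuous_on_open_invariant
  proof (intro allI impI)
    fix W :: "'a set" assume "open W"
    then have "open (N y \<inter> W)" using N y by blast
    then have "openin (top_of_set B) (f ` (X \<inter> (N y \<inter> W)))" by (rule open_map)
    then obtain A where A: "open A" "f ` (X \<inter> (N y \<inter> W)) = B \<inter> A" by (auto simp: openin_open)
    have "A \<inter> T = \<sigma> y -` W \<inter> T"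
    proof (intro Set.set_eqI iffI)
      fix t assume t: "t \<in> A \<inter> T"
      then have "t \<in> f ` (X \<inter> (N y \<inter> W))" using A TB by blast
      then obtain x where x: "x \<in> X" "x \<in> N y" "x \<in> W" "t = f x" by blast
      with uniq[OF y, of x] t show "t \<in> \<sigma> y -` W \<inter> T" by auto
    next
      fix t assume t: "t \<in> \<sigma> y -` W \<inter> T"
      with \<sigma>[OF y, of t] have "t \<in> f ` (X \<inter> (N y \<inter> W))" by (auto intro!: image_eqI[of _ f "\<sigma> y t"])
      with A t show "t \<in> A \<inter> T" by blast
    qed
    with A show "\<exists>A. open A \<and> A \<inter> T = \<sigma> y -` W \<inter> T" by blast
  qed
  show ?thesis by (rule that[OF T \<open>b \<in> T\<close> N(1) cont\<sigma> \<sigma> uniq cover])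
qed

text \<open>The set where the maps agree is open by the local sections and closed because the total
  space is Hausdorff. Since \<open>K\<close> is any connected space and \<open>h\<close> may be
  constant, this also shows that a point moving continuously in one fiber stands still.\<close>

lemma lift_unique:
  fixes K :: "'c::topological_space set"
  assumes K: "connected K" and g: "continuous_on K g" "continuous_on K h"
    and X: "\<And>k. k \<in> K \<Longrightarrow> g k \<in> X \<and> h k \<in> X \<and> f (g k) = f (h k)"
    and k0: "k0 \<in> K" "g k0 = h k0" and k: "k \<in> K"
  shows "g k = h k"
proof -
  define E where "E = {k \<in> K. g k = h k}"
  have op: "openin (top_of_set K) (K \<inter> u -` W)" if "continuous_on K u" "open W"
    for u :: "'c \<Rightarrow> 'a" and W using that by (rule continuous_openin_preimage_gen)
  have "openin (top_of_set K) E"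
  proof (subst openin_subopen, intro ballI)
    fix k assume "k \<in> E"
    then have kK: "k \<in> K" and gh: "g k = h k" by (auto simp: E_def)
    define b where "b = f (g k)"
    have b: "b \<in> B" using X[OF kK] into by (simp add: b_def)
    obtain T N \<sigma> where T: "openin (top_of_set B) T" "b \<in> T"
      "\<And>y. y \<in> fib b \<Longrightarrow> open (N y) \<and> y \<in> N y"
      "\<And>y. y \<in> fib b \<Longrightarrow> continuous_on T (\<sigma> y)"
      "\<And>y t. y \<in> fib b \<Longrightarrow> t \<in> T \<Longrightarrow> \<sigma> y t \<in> X \<inter> N y \<and> f (\<sigma> y t) = t"
      "\<And>y x. y \<in> fib b \<Longrightarrow> x \<in> X \<inter> N y \<Longrightarrow> f x \<in> T \<Longrightarrow> x = \<sigma> y (f x)"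
      "\<And>x. x \<in> X \<Longrightarrow> f x \<in> T \<Longrightarrow> \<exists>y\<in>fib b. x \<in> N y"
      by (rule local_sections[OF b]) (rule that)
    define y where "y = g k"
    have y: "y \<in> fib b" using X[OF kK] by (simp add: y_def b_def)
    have "continuous_on K (\<lambda>k. f (g k))"
      by (rule continuous_on_compose2[OF cont g(1)]) (use X in auto)
    then have 1: "openin (top_of_set K) (K \<inter> (\<lambda>k. f (g k)) -` T)"
      by (rule continuous_openin_preimage) (use X into T in auto)
    let ?V = "(K \<inter> (\<lambda>k. f (g k)) -` T) \<inter> ((K \<inter> g -` N y) \<inter> (K \<inter> h -` N y))"
    have "openin (top_of_set K) ?V" by (intro openin_Int 1 op g) (use T(3)[OF y] in auto)
    moreover have "k \<in> ?V" using kK gh T(2) T(3)[OF y] by (auto simp: y_def b_def)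
    moreover have "?V \<subseteq> E"
    proof
      fix l assume l: "l \<in> ?V"
      then have "g l = \<sigma> y (f (g l))" "h l = \<sigma> y (f (h l))" using T(6)[OF y, of "g l"] T(6)[OF y, of "h l"] X[of l] by auto
      with l X[of l] show "l \<in> E" by (auto simp: E_def)
    qed
    ultimately show "\<exists>V. openin (top_of_set K) V \<and> k \<in> V \<and> V \<subseteq> E" by blast
  qed
  moreover have "openin (top_of_set K) (K - E)"
  proof (subst openin_subopen, intro ballI)
    fix k assume k: "k \<in> K - E"
    then have "g k \<noteq> h k" by (auto simp: E_def)
    then obtain U V where UV: "open U" "open V" "g k \<in> U" "h k \<in> V" "U \<inter> V = {}" by (meson hausdorff)
    have "openin (top_of_set K) ((K \<inter> g -` U) \<inter> (K \<inter> h -` V))" by (intro openin_Int op g UV)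
    moreover have "k \<in> (K \<inter> g -` U) \<inter> (K \<inter> h -` V)" using UV k by auto
    moreover have "(K \<inter> g -` U) \<inter> (K \<inter> h -` V) \<subseteq> K - E" using UV by (auto simp: E_def)
    ultimately show "\<exists>V. openin (top_of_set K) V \<and> k \<in> V \<and> V \<subseteq> K - E" by blast
  qed
  then have "closedin (top_of_set K) E" by (simp add: closedin_def E_def) 
  ultimately have "E = {} \<or> E = K" using K connected_clopen by blast
  then show ?thesis using k0 k by (auto simp: E_def)
qed

lemma lifts_to_unique:
  assumes "lifts_to X f \<gamma> x y" "lifts_to X f \<gamma> x z" shows "y = z"
proof -
  obtain \<delta> where \<delta>: "path \<delta>" "path_image \<delta> \<subseteq> X" "\<forall>u\<in>{0..1}. f (\<delta> u) = \<gamma> u" "pathstart \<delta> = x" "pathfinish \<delta> = y"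
    using assms by (auto simp: lifts_to_def)
  obtain \<epsilon> where \<epsilon>: "path \<epsilon>" "path_image \<epsilon> \<subseteq> X" "\<forall>u\<in>{0..1}. f (\<epsilon> u) = \<gamma> u" "pathstart \<epsilon> = x" "pathfinish \<epsilon> = z"
    using assms by (auto simp: lifts_to_def)
  have "\<delta> 1 = \<epsilon> 1"
    by (rule lift_unique[of "{0..1::real}" \<delta> \<epsilon> 0])
       (use \<delta> \<epsilon> in \<open>auto simp: path_def path_image_def pathstart_def\<close>)
  with \<delta> \<epsilon> show ?thesis by (simp add: pathfinish_def)
qed

text \<open>The compactness argument along the path is Bolzano's interval principle.\<close>

lemma family_lift:
  fixes S0 :: "'p::topological_space set" and H :: "'p \<Rightarrow> real \<Rightarrow> 'b"
  assumes H: "continuous_on (S0 \<times> {0..1}) (\<lambda>(s, t). H s t)"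
    and HB: "\<And>s t. s \<in> S0 \<Longrightarrow> t \<in> {0..1} \<Longrightarrow> H s t \<in> B" and s0: "s0 \<in> S0"
    and c: "continuous_on S0 c" "\<And>s. s \<in> S0 \<Longrightarrow> c s \<in> X \<and> f (c s) = H s 0"
  obtains V c' where "openin (top_of_set S0) V" "s0 \<in> V" "continuous_on V c'"
    "\<And>s. s \<in> V \<Longrightarrow> c' s \<in> X \<and> f (c' s) = H s 1 \<and> lifts_to X f (H s) (c s) (c' s)"
proof -
  define good where "good a b V c V' c' \<longleftrightarrow> openin (top_of_set S0) V' \<and> s0 \<in> V' \<and> V' \<subseteq> V \<and>
     continuous_on V' c' \<and> (\<forall>s\<in>V'. c' s \<in> X \<and> f (c' s) = H s b \<and>
       (\<exists>\<delta>. continuous_on {a..b} \<delta> \<and> (\<forall>t\<in>{a..b}. \<delta> t \<in> X \<and> f (\<delta> t) = H s t) \<and> \<delta> a = c s \<and> \<delta> b = c' s))"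
    for a b V c V' c'
  \<comment> \<open>Quantifying over all \<open>V\<close> and \<open>c\<close> allows the end values
    obtained on one interval to be the initial values on the next, which is the transitivity
    demanded by the interval principle.\<close>
  define P where "P a b \<longleftrightarrow> (0 \<le> a \<and> b \<le> 1 \<longrightarrow> (\<forall>V c. openin (top_of_set S0) V \<and> s0 \<in> V \<and>
     continuous_on V c \<and> (\<forall>s\<in>V. c s \<in> X \<and> f (c s) = H s a) \<longrightarrow> (\<exists>V' c'. good a b V c V' c')))" for a b
  have "P 0 1"
  proof (rule Bolzano[of "0::real" 1 P])
    show "(0::real) \<le> 1" by simp
  next
    fix a b e assume trans: "P a b" "P b e" "a \<le> b" "b \<le> e"
    show "P a e" unfolding P_def
    proof (intro impI allI)
      fix V c assume ae: "0 \<le> a \<and> e \<le> 1" and V: "openin (top_of_set S0) V \<and> s0 \<in> V \<and>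
        continuous_on V c \<and> (\<forall>s\<in>V. c s \<in> X \<and> f (c s) = H s a)"
      then have "\<exists>V1 c1. good a b V c V1 c1"
        using trans(1)[unfolded P_def, rule_format, of V c] trans(4) by auto
      then obtain V1 c1 where 1: "good a b V c V1 c1" by blast
      have "\<exists>V2 c2. good b e V1 c1 V2 c2"
        by (rule trans(2)[unfolded P_def, rule_format]) (use 1 ae trans in \<open>auto simp: good_def\<close>)
      then obtain V2 c2 where 2: "good b e V1 c1 V2 c2" by blast
      have "good a e V c V2 c2" unfolding good_def
      proof (intro conjI ballI)
        fix s assume s: "s \<in> V2"
        obtain \<delta>1 where d1: "continuous_on {a..b} \<delta>1" "\<forall>t\<in>{a..b}. \<delta>1 t \<in> X \<and> f (\<delta>1 t) = H s t"
          "\<delta>1 a = c s" "\<delta>1 b = c1 s" using 1 2 s unfolding good_def by blast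
        obtain \<delta>2 where d2: "continuous_on {b..e} \<delta>2" "\<forall>t\<in>{b..e}. \<delta>2 t \<in> X \<and> f (\<delta>2 t) = H s t"
          "\<delta>2 b = c1 s" "\<delta>2 e = c2 s" using 2 s unfolding good_def by blast
        define \<delta> where "\<delta> t = (if t \<le> b then \<delta>1 t else \<delta>2 t)" for t
        have "continuous_on ({a..b} \<union> {b..e}) \<delta>" unfolding \<delta>_def
          by (rule continuous_on_If) (use d1 d2 in \<open>auto intro: antisym\<close>)
        moreover have "{a..b} \<union> {b..e} = {a..e}" using trans by auto
        ultimately show "\<exists>\<delta>. continuous_on {a..e} \<delta> \<and> (\<forall>t\<in>{a..e}. \<delta> t \<in> X \<and> f (\<delta> t) = H s t) \<and> \<delta> a = c s \<and> \<delta> e = c2 s"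
          using d1 d2 trans by (intro exI[of _ \<delta>]) (auto simp: \<delta>_def)
      qed (use 1 2 in \<open>auto simp: good_def\<close>)
      then show "\<exists>V' c'. good a e V c V' c'" by blast
    qed
  next
    fix t0 :: real assume "0 \<le> t0" "t0 \<le> 1"
    then have t0: "t0 \<in> {0..1}" by simp
    define b where "b = H s0 t0"
    have b: "b \<in> B" using HB[OF s0 t0] by (simp add: b_def)
    obtain T N \<sigma> where T: "openin (top_of_set B) T" "b \<in> T"
      "\<And>y. y \<in> fib b \<Longrightarrow> open (N y) \<and> y \<in> N y"
      "\<And>y. y \<in> fib b \<Longrightarrow> continuous_on T (\<sigma> y)"
      "\<And>y t. y \<in> fib b \<Longrightarrow> t \<in> T \<Longrightarrow> \<sigma> y t \<in> X \<inter> N y \<and> f (\<sigma> y t) = t"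
      "\<And>y x. y \<in> fib b \<Longrightarrow> x \<in> X \<inter> N y \<Longrightarrow> f x \<in> T \<Longrightarrow> x = \<sigma> y (f x)"
      "\<And>x. x \<in> X \<Longrightarrow> f x \<in> T \<Longrightarrow> \<exists>y\<in>fib b. x \<in> N y"
      by (rule local_sections[OF b]) (rule that)
    have "openin (top_of_set (S0 \<times> {0..1})) ((S0 \<times> {0..1}) \<inter> (\<lambda>(s, t). H s t) -` T)"
      by (rule continuous_openin_preimage[OF H _ T(1)]) (use HB in auto)
    then obtain W where W: "open W" "(S0 \<times> {0..1}) \<inter> (\<lambda>(s, t). H s t) -` T = (S0 \<times> {0..1}) \<inter> W"
      by (auto simp: openin_open)
    have "(s0, t0) \<in> W" using W(2) s0 t0 T(2) by (auto simp: b_def)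
    then obtain A J where AJ': "open A" "open J" "(s0, t0) \<in> A \<times> J" "A \<times> J \<subseteq> W"
      using open_prod_elim[OF W(1)] by blast
    then have AJ: "open A" "open J" "s0 \<in> A" "t0 \<in> J" "A \<times> J \<subseteq> W" by auto
    then obtain \<epsilon> where \<epsilon>: "\<epsilon> > 0" "ball t0 \<epsilon> \<subseteq> J" by (meson openE)
    have HT: "H s t \<in> T" if "s \<in> S0" "s \<in> A" "t \<in> {0..1}" "dist t0 t < \<epsilon>" for s t
    proof -
      have "(s, t) \<in> (S0 \<times> {0..1}) \<inter> W" using that AJ(5) \<epsilon>(2) by auto
      then show ?thesis unfolding W(2)[symmetric] by simp
    qed
    have "P a e" if ae: "a \<le> t0" "t0 \<le> e" "e - a < \<epsilon>" for a e
      unfolding P_def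
    proof (intro impI allI)
      fix V c assume 0: "0 \<le> a \<and> e \<le> 1" and V: "openin (top_of_set S0) V \<and> s0 \<in> V \<and>
        continuous_on V c \<and> (\<forall>s\<in>V. c s \<in> X \<and> f (c s) = H s a)"
      have HT': "H s t \<in> T" if "s \<in> S0" "s \<in> A" "t \<in> {a..e}" for s t
        by (rule HT) (use that ae 0 in \<open>auto simp: dist_real_def\<close>)
      have VS: "V \<subseteq> S0" using V openin_subset by fastforce
      have "f (c s0) \<in> T" "c s0 \<in> X" using V HT'[OF s0 AJ(3), of a] ae by auto
      then obtain y where y: "y \<in> fib b" "c s0 \<in> N y" using T(7) by blast
      \<comment> \<open>For all parameters whose initial value lies in \<open>N y\<close> the lift
        on the short interval is given by the same section \<open>\<sigma> y\<close>, hence it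
        depends continuously on the parameter.\<close>
      define V' where "V' = V \<inter> c -` N y \<inter> (V \<inter> A)"
      define c' where "c' s = \<sigma> y (H s e)" for s
      have Vc: "V' \<subseteq> S0" "V' \<subseteq> V" using VS by (auto simp: V'_def)
      have HT'': "H s t \<in> T" if "s \<in> V'" "t \<in> {a..e}" for s t
        using HT' that Vc by (auto simp: V'_def)
      have contH: "continuous_on V' (\<lambda>s. H s e)"
        by (rule continuous_on_compose2[OF H, of V' "\<lambda>s. (s, e)", simplified])
           (use Vc 0 ae in \<open>auto intro!: continuous_intros\<close>)
      have contH2: "continuous_on {a..e} (H s)" if "s \<in> V'" for s
        by (rule continuous_on_compose2[OF H, of "{a..e}" "\<lambda>t. (s, t)", simplified])
           (use Vc 0 ae that in \<open>auto intro!: continuous_intros\<close>)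
      have "good a e V c V' c'" unfolding good_def
      proof (intro conjI ballI)
        have "openin (top_of_set V) (V \<inter> c -` N y)" "openin (top_of_set V) (V \<inter> A)"
          using V T(3)[OF y(1)] AJ by (auto intro!: continuous_openin_preimage_gen)
        then have "openin (top_of_set V) V'" unfolding V'_def by (rule openin_Int)
        with V show "openin (top_of_set S0) V'" using openin_trans by blast
        show "s0 \<in> V'" using V y AJ by (auto simp: V'_def)
        show "continuous_on V' c'" unfolding c'_def
          by (rule continuous_on_compose2[OF T(4)[OF y(1)] contH]) (use HT'' ae in auto)
      next
        fix s assume s: "s \<in> V'"
        have e: "H s e \<in> T" "H s a \<in> T" using HT'' s ae by auto
        show "c' s \<in> X" "f (c' s) = H s e" using T(5)[OF y(1) e(1)] by (auto simp: c'_def)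
        have "c s = \<sigma> y (H s a)"
          using T(6)[OF y(1), of "c s"] s V Vc e by (auto simp: V'_def)
        moreover have "continuous_on {a..e} (\<lambda>t. \<sigma> y (H s t))"
          by (rule continuous_on_compose2[OF T(4)[OF y(1)] contH2[OF s]]) (use HT'' s in auto)
        moreover have "\<forall>t\<in>{a..e}. \<sigma> y (H s t) \<in> X \<and> f (\<sigma> y (H s t)) = H s t"
          using T(5)[OF y(1)] HT'' s by blast
        ultimately show "\<exists>\<delta>. continuous_on {a..e} \<delta> \<and> (\<forall>t\<in>{a..e}. \<delta> t \<in> X \<and> f (\<delta> t) = H s t) \<and> \<delta> a = c s \<and> \<delta> e = c' s"
          by (intro exI[of _ "\<lambda>t. \<sigma> y (H s t)"]) (auto simp: c'_def)
      qed (use Vc in auto)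
      then show "\<exists>V' c'. good a e V c V' c'" by blast
    qed
    with \<epsilon>(1) show "\<exists>d>0. \<forall>a b. a \<le> t0 \<and> t0 \<le> b \<and> b - a < d \<longrightarrow> P a b" by blast
  qed
  then have "\<exists>V' c'. good 0 1 S0 c V' c'"
    unfolding P_def by (elim impE allE[where x = S0] allE[where x = c]) (use s0 c in auto)
  then obtain V' c' where *: "good 0 1 S0 c V' c'" by blast
  show ?thesis
  proof
    fix s assume "s \<in> V'"
    with * obtain \<delta> where "continuous_on {0..1} \<delta>" "\<forall>t\<in>{0..1}. \<delta> t \<in> X \<and> f (\<delta> t) = H s t" "\<delta> 0 = c s" "\<delta> 1 = c' s"
      unfolding good_def by blast
    then have "lifts_to X f (H s) (c s) (c' s)" unfolding lifts_to_def
      by (intro exI[of _ \<delta>]) (auto simp: path_def path_image_def pathstart_def pathfinish_def)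
    with * \<open>s \<in> V'\<close> show "c' s \<in> X \<and> f (c' s) = H s 1 \<and> lifts_to X f (H s) (c s) (c' s)"
      by (auto simp: good_def)
  qed (use * in \<open>auto simp: good_def\<close>)
qed

lemma lifts_to_in:
  assumes "lifts_to X f \<gamma> x y" shows "x \<in> fib (pathstart \<gamma>)" "y \<in> fib (pathfinish \<gamma>)"
  using assms by (force simp: lifts_to_def path_image_def pathstart_def pathfinish_def)+

text \<open>A single path is a family over a one-point parameter space.\<close>

lemma lifts_to_exists:
  assumes "path \<gamma>" "path_image \<gamma> \<subseteq> B" "x \<in> fib (pathstart \<gamma>)"
  obtains y where "lifts_to X f \<gamma> x y"
proof -
  have c: "continuous_on ({0::real} \<times> {0..1}) (\<lambda>z. \<gamma> (snd z))"
    by (rule continuous_on_compose2[of "{0..1}" \<gamma>]) (use assms in \<open>auto intro!: continuous_intros simp: path_def\<close>)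
  show ?thesis
    by (rule family_lift[of "{0::real}" "\<lambda>s. \<gamma>" 0 "\<lambda>s. x"])
       (use assms c that in \<open>auto simp: path_image_def pathstart_def case_prod_unfold\<close>)
qed

text \<open>The end point of the lift depends continuously on the homotopy parameter and stays in
  the fiber over the fixed end of the paths, so it is locally constant.\<close>

lemma lifts_to_homotopic:
  assumes hom: "homotopic_paths B \<gamma> \<gamma>'" and l: "lifts_to X f \<gamma> x y"
  shows "lifts_to X f \<gamma>' x y"
proof -
  obtain h where h: "continuous_on ({0..1} \<times> {0..1}) h" "h \<in> ({0..1} \<times> {0..1}) \<rightarrow> B"
    "\<forall>t\<in>{0..1}. h (0, t) = \<gamma> t" "\<forall>t\<in>{0..1}. h (1, t) = \<gamma>' t"
    "\<forall>s\<in>{0..1::real}. pathstart (h \<circ> Pair s) = pathstart \<gamma> \<and> pathfinish (h \<circ> Pair s) = pathfinish \<gamma>"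
    using hom unfolding homotopic_paths by blast
  define H where "H s t = h (s, t)" for s t
  define P where "P a b \<longleftrightarrow> (0 \<le> a \<and> b \<le> 1 \<and> lifts_to X f (H a) x y \<longrightarrow> lifts_to X f (H b) x y)" for a b
  have x: "x \<in> X" "f x = pathstart \<gamma>" using lifts_to_in(1)[OF l] by auto
  have "P 0 1"
  proof (rule Bolzano[of "0::real" 1 P])
    show "(0::real) \<le> 1" by simp
  next
    fix a b c assume "P a b" "P b c" "a \<le> b" "b \<le> c" then show "P a c" by (auto simp: P_def)
  next
    fix s0 :: real assume local: "0 \<le> s0" "s0 \<le> 1"
    obtain V c' where V: "openin (top_of_set {0..1}) V" "s0 \<in> V" "continuous_on V c'"
      "\<And>s. s \<in> V \<Longrightarrow> c' s \<in> X \<and> f (c' s) = H s 1 \<and> lifts_to X f (H s) x (c' s)"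
    proof (rule family_lift[of "{0..1::real}" H s0 "\<lambda>s. x"])
      show "continuous_on ({0..1} \<times> {0..1}) (\<lambda>(s, t). H s t)" using h(1) by (simp add: H_def)
      show "\<And>s t. s \<in> {0..1} \<Longrightarrow> t \<in> {0..1} \<Longrightarrow> H s t \<in> B" using h(2) by (auto simp: H_def)
      show "\<And>s. s \<in> {0..1} \<Longrightarrow> x \<in> X \<and> f x = H s 0" using h(5) x by (auto simp: H_def pathstart_def)
    qed (use local in auto)
    obtain \<epsilon> where \<epsilon>: "\<epsilon> > 0" "ball s0 \<epsilon> \<inter> {0..1} \<subseteq> V"
      using V(1,2) by (meson openin_contains_ball)
    define K where "K = ball s0 \<epsilon> \<inter> {0..1}"
    have "connected K" unfolding K_def
      by (intro convex_connected convex_Int convex_ball) simp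
    have K: "c' s = c' s0" if "s \<in> K" for s
    proof (rule lift_unique[of K c' "\<lambda>_. c' s0" s0])
      show "continuous_on K c'" using V(3) \<epsilon> continuous_on_subset K_def by blast
      have s0V: "s0 \<in> K" using \<epsilon> local by (auto simp: K_def)
      then show "s0 \<in> K" .
      fix k assume "k \<in> K"
      then have "k \<in> V" "k \<in> {0..1}" "s0 \<in> {0..1}" using \<epsilon> s0V by (auto simp: K_def)
      moreover have "H k 1 = H s0 1" using h(5) calculation by (auto simp: H_def pathfinish_def)
      ultimately show "c' k \<in> X \<and> c' s0 \<in> X \<and> f (c' k) = f (c' s0)" using V by simp
    qed (use \<open>connected K\<close> that in auto)
    have "P a b" if "a \<le> s0" "s0 \<le> b" "b - a < \<epsilon>" for a b
      unfolding P_def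
    proof
      assume ab: "0 \<le> a \<and> b \<le> 1 \<and> lifts_to X f (H a) x y"
      then have "a \<in> K" "b \<in> K" using that by (auto simp: K_def dist_real_def)
      then have "lifts_to X f (H a) x (c' s0)" "lifts_to X f (H b) x (c' s0)"
        using V(4) K \<epsilon> K_def by (metis subsetD)+
      with ab lifts_to_unique show "lifts_to X f (H b) x y" by blast
    qed
    with \<epsilon>(1) show "\<exists>d>0. \<forall>a b. a \<le> s0 \<and> s0 \<le> b \<and> b - a < d \<longrightarrow> P a b" by blast
  qed
  moreover have "lifts_to X f (H 0) x y = lifts_to X f \<gamma> x y"
    using h(3) unfolding lifts_to_def H_def by auto
  moreover have "lifts_to X f (H 1) x y = lifts_to X f \<gamma>' x y"
    using h(4) unfolding lifts_to_def H_def by auto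
  ultimately show ?thesis using l by (simp add: P_def)
qed

lemma lifts_to_join:
  assumes "lifts_to X f \<gamma> x y" "lifts_to X f \<gamma>' y z"
  shows "lifts_to X f (\<gamma> +++ \<gamma>') x z"
proof -
  obtain \<delta> where \<delta>: "path \<delta>" "path_image \<delta> \<subseteq> X" "\<forall>u\<in>{0..1}. f (\<delta> u) = \<gamma> u" "pathstart \<delta> = x" "pathfinish \<delta> = y"
    using assms by (auto simp: lifts_to_def)
  obtain \<epsilon> where \<epsilon>: "path \<epsilon>" "path_image \<epsilon> \<subseteq> X" "\<forall>u\<in>{0..1}. f (\<epsilon> u) = \<gamma>' u" "pathstart \<epsilon> = y" "pathfinish \<epsilon> = z"
    using assms by (auto simp: lifts_to_def)
  show ?thesis unfolding lifts_to_def
  proof (intro exI[of _ "\<delta> +++ \<epsilon>"] conjI)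
    show "\<forall>u\<in>{0..1}. f ((\<delta> +++ \<epsilon>) u) = (\<gamma> +++ \<gamma>') u" using \<delta> \<epsilon> by (auto simp: joinpaths_def)
  qed (use \<delta> \<epsilon> in \<open>auto simp: path_image_join\<close>)
qed

lemma lifts_to_reverse:
  assumes "lifts_to X f \<gamma> x y" shows "lifts_to X f (reversepath \<gamma>) y x"
proof -
  obtain \<delta> where \<delta>: "path \<delta>" "path_image \<delta> \<subseteq> X" "\<forall>u\<in>{0..1}. f (\<delta> u) = \<gamma> u" "pathstart \<delta> = x" "pathfinish \<delta> = y"
    using assms by (auto simp: lifts_to_def)
  show ?thesis unfolding lifts_to_def
  proof (intro exI[of _ "reversepath \<delta>"] conjI)
    show "\<forall>u\<in>{0..1}. f (reversepath \<delta> u) = reversepath \<gamma> u" using \<delta> by (auto simp: reversepath_def)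
  qed (use \<delta> in auto)
qed

end

subsection \<open>Factoring the fiber monodromy\<close>

lemma lift_end_eq: "lift_end X f \<gamma> s = (THE y. lifts_to X f \<gamma> s y)"
  by (simp add: lift_end_def lifts_to_def)

text \<open>\<open>lift_end\<close> refers to lifts in the whole ramified curve, the covering lemmas
  to its part over \<open>B\<close>; over a path in \<open>B\<close> there is no difference.\<close>

lemma lifts_to_restrict:
  assumes "path_image \<gamma> \<subseteq> B"
  shows "lifts_to {x \<in> X. f x \<in> B} f \<gamma> s y \<longleftrightarrow> lifts_to X f \<gamma> s y"
proof -
  have "path_image \<delta> \<subseteq> {x \<in> X. f x \<in> B} \<longleftrightarrow> path_image \<delta> \<subseteq> X"
    if "\<forall>u\<in>{0..1}. f (\<delta> u) = \<gamma> u" for \<delta>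
    using that assms by (force simp: path_image_def)
  then show ?thesis unfolding lifts_to_def by blast
qed

lemma lifts_to_compose:
  assumes l: "lifts_to X f \<gamma> x y" and ev: "continuous_on X ev" "\<And>x. x \<in> X \<Longrightarrow> ev x \<in> Y \<and> q (ev x) = f x"
  shows "lifts_to Y q \<gamma> (ev x) (ev y)"
proof -
  obtain \<delta> where \<delta>: "path \<delta>" "path_image \<delta> \<subseteq> X" "\<forall>u\<in>{0..1}. f (\<delta> u) = \<gamma> u" "pathstart \<delta> = x" "pathfinish \<delta> = y"
    using l by (auto simp: lifts_to_def)
  show ?thesis unfolding lifts_to_def
  proof (intro exI[of _ "ev \<circ> \<delta>"] conjI)
    show "path (ev \<circ> \<delta>)" using \<delta> ev continuous_on_subset by (intro path_continuous_image) blast+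
    show "path_image (ev \<circ> \<delta>) \<subseteq> Y" using \<delta> ev by (auto simp: path_image_def)
    show "\<forall>u\<in>{0..1}. q ((ev \<circ> \<delta>) u) = \<gamma> u" using \<delta> ev by (auto simp: path_image_def)
  qed (use \<delta> in \<open>auto simp: pathstart_def pathfinish_def\<close>)
qed

text \<open>The map \<open>ev\<close> carries lifts in \<open>X\<close> to lifts in
  \<open>Y\<close>, and it identifies the fibers over \<open>t0\<close>, since it is injective
  between sets of \<open>d\<close> elements. So the monodromy of \<open>X\<close> along a loop in
  \<open>B'\<close> is that of \<open>Y\<close>, and the latter is defined for all loops in
  \<open>B\<close>.\<close>

theorem monodromy_factors:
  fixes X :: "proj set" and Y :: "'c::t2_space set" and q :: "'c \<Rightarrow> proj"
  assumes Y: "finite_cover Y q B d" and X: "finite_cover {x \<in> X. f x \<in> B'} f B' d"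
    and B': "B' \<subseteq> B" and t0: "t0 \<in> B'"
    and ev: "continuous_on {x \<in> X. f x \<in> B'} ev"
      "\<And>x. x \<in> X \<Longrightarrow> f x \<in> B' \<Longrightarrow> ev x \<in> Y \<and> q (ev x) = f x"
    and inj: "\<And>x x'. x \<in> X \<Longrightarrow> x' \<in> X \<Longrightarrow> f x \<in> B' \<Longrightarrow> f x = f x' \<Longrightarrow> ev x = ev x' \<Longrightarrow> x = x'"
  shows "\<exists>\<phi> \<in> hom (fundamental_group B t0) (BijGroup (fiber X f t0)).
    \<forall>A \<in> carrier (fundamental_group B' t0).
      fiber_monodromy X f t0 A = \<phi> (induced_inclusion B A)"
proof -
  interpret Y: finite_cover Y q B d by (rule Y)
  interpret X: finite_cover "{x \<in> X. f x \<in> B'}" f B' d by (rule X)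
  define F where "F = fiber X f t0"
  have F_eq: "F = {x \<in> {x \<in> X. f x \<in> B'}. f x = t0}" using t0 by (auto simp: F_def fiber_def)
  have t0B: "t0 \<in> B" using t0 B' by blast
  have finF: "finite F" unfolding F_eq by (rule X.finite_fib[OF t0])
  have evF: "ev ` F = {y \<in> Y. q y = t0}"
  proof (rule card_seteq)
    show "finite {y \<in> Y. q y = t0}" by (rule Y.finite_fib[OF t0B])
    show "ev ` F \<subseteq> {y \<in> Y. q y = t0}" using ev(2) by (auto simp: F_eq)
    have "inj_on ev F" by (rule inj_onI) (use inj in \<open>auto simp: F_eq\<close>)
    then show "card {y \<in> Y. q y = t0} \<le> card (ev ` F)"
      using X.card_fiber[OF t0] Y.card_fiber[OF t0B] by (simp add: card_image F_eq)
  qed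
  have injF: "x = x'" if "x \<in> F" "x' \<in> F" "ev x = ev x'" for x x'
    using inj that by (auto simp: F_eq)
  \<comment> \<open>The monodromy of \<open>Y\<close>, transported by \<open>ev\<close> to the fiber
    of \<open>X\<close>.\<close>
  define R where "R \<gamma> s x \<longleftrightarrow> x \<in> F \<and> lifts_to Y q \<gamma> (ev s) (ev x)" for \<gamma> s x
  have R_ex: "\<exists>x. R \<gamma> s x" if "\<gamma> \<in> loops B t0" "s \<in> F" for \<gamma> s
  proof -
    have 1: "path \<gamma>" "path_image \<gamma> \<subseteq> B" "ev s \<in> {y \<in> Y. q y = pathstart \<gamma>}"
      using evF that by (auto simp: loops_def)
    obtain y where y: "lifts_to Y q \<gamma> (ev s) y" using Y.lifts_to_exists[OF 1] by blast
    then have "y \<in> ev ` F" using Y.lifts_to_in(2)[OF y] that evF by (auto simp: loops_def)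
    with y show ?thesis by (auto simp: R_def)
  qed
  have R_un: "x = x'" if "R \<gamma> s x" "R \<gamma> s x'" for \<gamma> s x x'
    using that Y.lifts_to_unique injF unfolding R_def by blast
  have R_inj: "s = s'" if "R \<gamma> s x" "R \<gamma> s' x" "s \<in> F" "s' \<in> F" for \<gamma> s s' x
    using that Y.lifts_to_unique[OF Y.lifts_to_reverse Y.lifts_to_reverse] injF unfolding R_def by blast
  define \<rho> where "\<rho> \<gamma> = (\<lambda>s\<in>F. THE x. R \<gamma> s x)" for \<gamma>
  have \<rho>I: "\<rho> \<gamma> s = x" if "R \<gamma> s x" "s \<in> F" for \<gamma> s x
    using that R_un by (auto simp: \<rho>_def intro!: the_equality)
  have R\<rho>: "R \<gamma> s (\<rho> \<gamma> s)" if "\<gamma> \<in> loops B t0" "s \<in> F" for \<gamma> s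
    using R_ex[OF that] \<rho>I that by metis
  have \<rho>_ext: "\<rho> \<gamma> \<in> extensional F" for \<gamma> by (simp add: \<rho>_def)
  have \<rho>_Bij: "\<rho> \<gamma> \<in> Bij F" if g: "\<gamma> \<in> loops B t0" for \<gamma>
  proof -
    have "inj_on (\<rho> \<gamma>) F" by (rule inj_onI) (metis R\<rho>[OF g] R_inj)
    moreover have "\<rho> \<gamma> ` F \<subseteq> F" using R\<rho>[OF g] by (auto simp: R_def)
    ultimately have "bij_betw (\<rho> \<gamma>) F F" using finF by (simp add: bij_betw_def endo_inj_surj)
    then show ?thesis using \<rho>_ext by (simp add: Bij_def)
  qed
  have \<rho>_hom: "\<rho> \<gamma> = \<rho> \<gamma>'" if h: "homotopic_paths B \<gamma> \<gamma>'" for \<gamma> \<gamma>'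
  proof -
    have "R \<gamma> s x \<longleftrightarrow> R \<gamma>' s x" for s x
      using Y.lifts_to_homotopic[OF h] Y.lifts_to_homotopic[OF homotopic_paths_sym[OF h]]
      by (auto simp: R_def)
    then show ?thesis by (simp add: \<rho>_def)
  qed
  have loop_hom: "\<gamma>' \<in> loops B t0" if "\<gamma> \<in> loops B t0" "homotopic_paths B \<gamma> \<gamma>'" for \<gamma> \<gamma>'
    using that(1) homotopic_paths_imp_path[OF that(2)] homotopic_paths_imp_subset[OF that(2)]
      homotopic_paths_imp_pathstart[OF that(2)] homotopic_paths_imp_pathfinish[OF that(2)]
    unfolding loops_def by simp
  have \<rho>_join: "\<rho> (\<beta> +++ \<alpha>) = compose F (\<rho> \<alpha>) (\<rho> \<beta>)" if ab: "\<alpha> \<in> loops B t0" "\<beta> \<in> loops B t0" for \<alpha> \<beta>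
  proof (rule extensionalityI[of _ F])
    fix s assume s: "s \<in> F"
    have 1: "R \<beta> s (\<rho> \<beta> s)" by (rule R\<rho>[OF ab(2) s])
    then have "\<rho> \<beta> s \<in> F" by (simp add: R_def)
    then have 2: "R \<alpha> (\<rho> \<beta> s) (\<rho> \<alpha> (\<rho> \<beta> s))" by (rule R\<rho>[OF ab(1)])
    have "R (\<beta> +++ \<alpha>) s (\<rho> \<alpha> (\<rho> \<beta> s))" using 1 2 Y.lifts_to_join unfolding R_def by blast
    then show "\<rho> (\<beta> +++ \<alpha>) s = compose F (\<rho> \<alpha>) (\<rho> \<beta>) s" using s by (simp add: compose_def \<rho>I)
  qed (auto simp: \<rho>_ext)
  \<comment> \<open>The representative is chosen by \<open>SOME\<close>, as in
    \<open>fiber_monodromy\<close>; \<open>mem\<close> below shows that every other representative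
    gives the same permutation.\<close>
  define \<phi> where "\<phi> A = \<rho> (SOME \<gamma>. \<gamma> \<in> A)" for A
  have mem: "\<alpha> \<in> loops B t0 \<and> \<rho> \<alpha> = \<phi> A" if A: "A \<in> carrier (fundamental_group B t0)" "\<alpha> \<in> A" for A \<alpha>
  proof -
    obtain \<gamma> where \<gamma>: "\<gamma> \<in> loops B t0" "A = {\<delta>. homotopic_paths B \<gamma> \<delta>}"
      using A by (auto simp: fundamental_group_def)
    have "(SOME \<gamma>. \<gamma> \<in> A) \<in> A" using A(2) by (rule someI[of "\<lambda>\<gamma>. \<gamma> \<in> A"])
    then have "homotopic_paths B \<gamma> (SOME \<gamma>. \<gamma> \<in> A)" "homotopic_paths B \<gamma> \<alpha>" using \<gamma> A by auto
    then show ?thesis unfolding \<phi>_def using \<rho>_hom loop_hom[OF \<gamma>(1)] by metis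
  qed
  have ne: "\<exists>\<alpha>. \<alpha> \<in> A" if A: "A \<in> carrier (fundamental_group B t0)" for A
  proof -
    obtain \<gamma> where "\<gamma> \<in> loops B t0" "A = {\<delta>. homotopic_paths B \<gamma> \<delta>}"
      using A by (auto simp: fundamental_group_def)
    then have "\<gamma> \<in> A" by (simp add: loops_def)
    then show ?thesis by blast
  qed
  have "\<phi> \<in> hom (fundamental_group B t0) (BijGroup F)"
  proof (rule homI)
    fix A assume A: "A \<in> carrier (fundamental_group B t0)"
    obtain \<alpha> where "\<alpha> \<in> A" using ne[OF A] by blast
    then show "\<phi> A \<in> carrier (BijGroup F)" using mem[OF A] \<rho>_Bij by (fastforce simp: BijGroup_def)
  next
    fix A A' assume A: "A \<in> carrier (fundamental_group B t0)" "A' \<in> carrier (fundamental_group B t0)"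
    let ?M = "A \<otimes>\<^bsub>fundamental_group B t0\<^esub> A'"
    have M: "?M = {\<delta>. \<exists>\<alpha>\<in>A. \<exists>\<beta>\<in>A'. homotopic_paths B (\<beta> +++ \<alpha>) \<delta>}" by (simp add: fundamental_group_def)
    obtain \<alpha>0 \<beta>0 where "\<alpha>0 \<in> A" "\<beta>0 \<in> A'" using ne A by meson
    moreover have "homotopic_paths B (\<beta>0 +++ \<alpha>0) (\<beta>0 +++ \<alpha>0)"
      using mem[OF A(1) \<open>\<alpha>0 \<in> A\<close>] mem[OF A(2) \<open>\<beta>0 \<in> A'\<close>] by (simp add: loops_def path_image_join)
    ultimately have "\<beta>0 +++ \<alpha>0 \<in> ?M" unfolding M by blast
    then have "(SOME \<gamma>. \<gamma> \<in> ?M) \<in> ?M" by (rule someI[of "\<lambda>\<gamma>. \<gamma> \<in> ?M"])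
    then obtain \<alpha> \<beta> where ab: "\<alpha> \<in> A" "\<beta> \<in> A'" "homotopic_paths B (\<beta> +++ \<alpha>) (SOME \<gamma>. \<gamma> \<in> ?M)"
      unfolding M by blast
    have "\<phi> ?M = \<rho> (\<beta> +++ \<alpha>)" unfolding \<phi>_def using \<rho>_hom[OF ab(3)] by simp
    also have "\<dots> = compose F (\<phi> A) (\<phi> A')" using \<rho>_join mem[OF A(1) ab(1)] mem[OF A(2) ab(2)] by simp
    also have "\<dots> = \<phi> A \<otimes>\<^bsub>BijGroup F\<^esub> \<phi> A'"
      using mem[OF A(1) ab(1)] mem[OF A(2) ab(2)] \<rho>_Bij[of \<alpha>] \<rho>_Bij[of \<beta>] by (simp add: BijGroup_def)
    finally show "\<phi> ?M = \<phi> A \<otimes>\<^bsub>BijGroup F\<^esub> \<phi> A'" .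
  qed
  moreover have "fiber_monodromy X f t0 A = \<phi> (induced_inclusion B A)"
    if A: "A \<in> carrier (fundamental_group B' t0)" for A
  proof -
    obtain \<gamma> where \<gamma>: "\<gamma> \<in> loops B' t0" "A = {\<delta>. homotopic_paths B' \<gamma> \<delta>}"
      using A by (auto simp: fundamental_group_def)
    have "\<gamma> \<in> A" using \<gamma> by (simp add: loops_def)
    define \<gamma>' where "\<gamma>' = (SOME \<gamma>. \<gamma> \<in> A)"
    have g'A: "\<gamma>' \<in> A" unfolding \<gamma>'_def using \<open>\<gamma> \<in> A\<close> by (rule someI[of "\<lambda>\<gamma>. \<gamma> \<in> A"])
    then have g': "homotopic_paths B' \<gamma> \<gamma>'" using \<gamma> by simp
    have g'l: "path \<gamma>'" "path_image \<gamma>' \<subseteq> B'" "pathstart \<gamma>' = t0" "pathfinish \<gamma>' = t0"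
      using homotopic_paths_imp_path[OF g'] homotopic_paths_imp_subset[OF g'] \<gamma>(1)
        homotopic_paths_imp_pathstart[OF g'] homotopic_paths_imp_pathfinish[OF g']
      unfolding loops_def by auto
    let ?I = "induced_inclusion B A"
    have "homotopic_paths B \<gamma>' \<gamma>'" using g'l B' by auto
    then have "\<gamma>' \<in> ?I" unfolding induced_inclusion_def using g'A by blast
    then have "(SOME \<gamma>. \<gamma> \<in> ?I) \<in> ?I" by (rule someI[of "\<lambda>\<gamma>. \<gamma> \<in> ?I"])
    then obtain \<gamma>1 where g1: "\<gamma>1 \<in> A" "homotopic_paths B \<gamma>1 (SOME \<gamma>. \<gamma> \<in> ?I)"
      by (auto simp: induced_inclusion_def)
    have "homotopic_paths B' \<gamma>' \<gamma>1" using g' g1 \<gamma> homotopic_paths_sym homotopic_paths_trans by blast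
    then have "homotopic_paths B \<gamma>' \<gamma>1" using B' homotopic_paths_subset by blast
    then have \<phi>I: "\<phi> ?I = \<rho> \<gamma>'" unfolding \<phi>_def using \<rho>_hom g1(2) by metis
    have "lift_end X f \<gamma>' s = \<rho> \<gamma>' s" if s: "s \<in> F" for s
    proof -
      have "s \<in> {x \<in> {x \<in> X. f x \<in> B'}. f x = pathstart \<gamma>'}" using s g'l t0 by (simp add: F_eq)
      then obtain y where y: "lifts_to {x \<in> X. f x \<in> B'} f \<gamma>' s y" using X.lifts_to_exists g'l by blast
      then have "y \<in> F" using X.lifts_to_in(2)[OF y] g'l t0 by (simp add: F_eq)
      moreover have "lifts_to Y q \<gamma>' (ev s) (ev y)" by (rule lifts_to_compose[OF y ev(1)]) (use ev(2) in auto)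
      ultimately have "\<rho> \<gamma>' s = y" using \<rho>I s by (simp add: R_def)
      moreover have "lift_end X f \<gamma>' s = y" unfolding lift_end_eq
      proof (rule the_equality)
        show "lifts_to X f \<gamma>' s y" using y lifts_to_restrict[OF g'l(2)] by blast
        fix z assume "lifts_to X f \<gamma>' s z"
        then have "lifts_to {x \<in> X. f x \<in> B'} f \<gamma>' s z" using lifts_to_restrict[OF g'l(2)] by blast
        then show "z = y" by (rule X.lifts_to_unique[OF _ y])
      qed
      ultimately show ?thesis by simp
    qed
    then have "(\<lambda>s\<in>F. lift_end X f \<gamma>' s) = \<rho> \<gamma>'" by (intro extensionalityI[of _ F]) (auto simp: \<rho>_ext)
    then show ?thesis unfolding fiber_monodromy_def \<phi>I F_def[symmetric] \<gamma>'_def .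
  qed
  ultimately show ?thesis unfolding F_def by blast
qed

subsection \<open>Charts and normal forms of maps to a line\<close>

lemma proj_holomorphic_on_imp_continuous:
  assumes "proj_holomorphic_on g D" "open D" shows "continuous_on D g"
  unfolding continuous_on_eq_continuous_at[OF \<open>open D\<close>]
proof
  fix z assume "z \<in> D"
  then obtain U F where U: "z \<in> U" "holomorphic_lift U F g"
    using assms by (auto simp: proj_holomorphic_on_def)
  then have "continuous_on U (\<lambda>w. abs_proj (F w))"
    by (intro continuous_on_into_proj) (auto simp: holomorphic_lift_def holomorphic_on_imp_continuous_on)
  then have "continuous_on U g"
    by (rule continuous_on_eq) (use U in \<open>auto simp: holomorphic_lift_def\<close>)
  moreover have "open U" using U by (simp add: holomorphic_lift_def)
  ultimately show "isCont g z" using U continuous_on_eq_continuous_at by blast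
qed

lemma chart_homeomorphism_inj: "chart X D g \<Longrightarrow> inj_on g D"
  unfolding chart_def homeomorphism_def by (metis inj_on_inverseI)

lemma chart_image: "chart X D g \<Longrightarrow> g ` D \<subseteq> X"
  unfolding chart_def using openin_imp_subset by blast

lemma chart_continuous: "chart X D g \<Longrightarrow> continuous_on D g"
  unfolding chart_def homeomorphism_def by blast

lemma chart_open_image:
  assumes c: "chart X D g" and "open V" "V \<subseteq> D"
  shows "openin (top_of_set X) (g ` V)"
proof -
  obtain h where h: "homeomorphism D (g ` D) g h" using c by (auto simp: chart_def)
  have "openin (top_of_set D) V" using assms by (auto simp: openin_open)
  then have "openin (top_of_set (g ` D)) (g ` V)"
    using h homeomorphism_imp_open_map by blast
  then show ?thesis using c openin_trans by (auto simp: chart_def)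
qed

lemma chart_open_preimage:
  assumes c: "chart X D g" and "openin (top_of_set X) V"
  shows "open {w \<in> D. g w \<in> V}"
proof -
  have "openin (top_of_set D) (D \<inter> g -` V)"
    using chart_continuous[OF c] chart_image[OF c] assms(2)
    by (intro continuous_openin_preimage[of D g X]) auto
  moreover have "open D" using c by (simp add: chart_def)
  ultimately show ?thesis by (simp add: openin_open_eq vimage_def Int_def)
qed

text \<open>An injective holomorphic function has an open image and a holomorphic inverse on it, so
  precomposing a chart with it gives a chart again.\<close>

lemma chart_reparam:
  assumes c: "chart X D g" and E: "open E" and h: "h holomorphic_on E" "inj_on h E" "h ` E \<subseteq> D"
  shows "chart X E (\<lambda>w. g (h w))"
proof -
  have "open (h ` E)" using open_mapping_thm3 h E by blast
  have ph: "proj_holomorphic_on (\<lambda>w. g (h w)) E"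
    unfolding proj_holomorphic_on_def
  proof
    fix z assume z: "z \<in> E"
    then have "\<exists>U F. h z \<in> U \<and> U \<subseteq> D \<and> holomorphic_lift U F g"
      using c h unfolding chart_def proj_holomorphic_on_def by blast
    then obtain U F where U: "h z \<in> U" "U \<subseteq> D" "holomorphic_lift U F g" by blast
    have "open (E \<inter> h -` U)"
      using U E h holomorphic_on_imp_continuous_on continuous_open_preimage
      by (metis holomorphic_lift_def)
    moreover have "(\<lambda>w. F (h w) i) holomorphic_on E \<inter> h -` U" for i
      by (rule holomorphic_on_compose_gen[of h _ "\<lambda>w. F w i" U, unfolded o_def])
         (use U h in \<open>auto simp: holomorphic_lift_def intro: holomorphic_on_subset\<close>)
    ultimately have "holomorphic_lift (E \<inter> h -` U) (\<lambda>w. F (h w)) (\<lambda>w. g (h w))"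
      using U by (auto simp: holomorphic_lift_def)
    moreover have "z \<in> E \<inter> h -` U" "E \<inter> h -` U \<subseteq> E" using z U by auto
    ultimately show "\<exists>U F. z \<in> U \<and> U \<subseteq> E \<and> holomorphic_lift U F (\<lambda>w. g (h w))"
      by (intro exI conjI)
  qed
  obtain k where k: "homeomorphism D (g ` D) g k" using c by (auto simp: chart_def)
  obtain j where j: "j holomorphic_on h ` E" "\<And>z. z \<in> E \<Longrightarrow> j (h z) = z"
    using holomorphic_has_inverse[OF h(1) E h(2)] by metis
  have "homeomorphism E (h ` E) h j"
    by (rule homeomorphismI)
       (use j h in \<open>auto intro: holomorphic_on_imp_continuous_on\<close>)
  moreover have "homeomorphism (h ` E) (g ` h ` E) g k"
    by (rule homeomorphism_of_subsets[OF k]) (use h in auto)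
  ultimately have "homeomorphism E (g ` h ` E) (g \<circ> h) (j \<circ> k)" by (rule homeomorphism_compose)
  then have "\<exists>k. homeomorphism E ((\<lambda>w. g (h w)) ` E) (\<lambda>w. g (h w)) k"
    by (auto simp: o_def image_image)
  moreover have "openin (top_of_set X) ((\<lambda>w. g (h w)) ` E)"
    using chart_open_image[OF c \<open>open (h ` E)\<close> h(3)] by (simp add: image_image)
  ultimately show ?thesis using E ph by (simp add: chart_def)
qed

lemma holomorphic_map_continuous:
  assumes "holomorphic_map X Y f" shows "continuous_on X f"
  unfolding continuous_openin_preimage_eq
proof (intro allI impI)
  fix W :: "proj set" assume "open W"
  show "openin (top_of_set X) (X \<inter> f -` W)"
  proof (subst openin_subopen, intro ballI)
    fix x assume x: "x \<in> X \<inter> f -` W"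
    then obtain D g where g: "chart X D g" "x \<in> g ` D" "proj_holomorphic_on (f \<circ> g) D"
      using assms unfolding holomorphic_map_def by blast
    have "open D" using g by (simp add: chart_def)
    then have "continuous_on D (f \<circ> g)" using proj_holomorphic_on_imp_continuous g by blast
    then have "open (D \<inter> (f \<circ> g) -` W)" using \<open>open D\<close> \<open>open W\<close> continuous_open_preimage by blast
    then have "openin (top_of_set X) (g ` (D \<inter> (f \<circ> g) -` W))" by (rule chart_open_image[OF g(1)]) auto
    moreover have "x \<in> g ` (D \<inter> (f \<circ> g) -` W)" using g x by auto
    moreover have "g ` (D \<inter> (f \<circ> g) -` W) \<subseteq> X \<inter> f -` W" using chart_image[OF g(1)] by auto
    ultimately show "\<exists>T. openin (top_of_set X) T \<and> x \<in> T \<and> T \<subseteq> X \<inter> f -` W" by blast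
  qed
qed

text \<open>An affine coordinate on the line \<open>L\<close> together with a holomorphic lift of
  its inverse. Two such coordinates cover the line, so local questions about a map to
  \<open>L\<close> become questions about one holomorphic function.\<close>

locale line_coord =
  fixes L :: "proj set" and \<Lambda> :: "complex \<Rightarrow> nat \<Rightarrow> complex" and num den :: nat
  assumes hv: "\<And>t. \<Lambda> t \<in> hvec" and den1: "\<And>t. \<Lambda> t den = 1" and numt: "\<And>t. \<Lambda> t num = t"
    and hol: "\<And>i. (\<lambda>t. \<Lambda> t i) holomorphic_on UNIV" and inL: "\<And>t. abs_proj (\<Lambda> t) \<in> L"
    and onto: "\<And>x. x \<in> L \<Longrightarrow> rep_proj x den \<noteq> 0 \<Longrightarrow> x = abs_proj (\<Lambda> (ratio num den x))"
begin

definition pt where "pt t = abs_proj (\<Lambda> t)"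

lemma ratio_pt [simp]: "ratio num den (pt t) = t"
  by (simp add: pt_def ratio_abs hv den1 numt)

lemma rep_pt [simp]: "rep_proj (pt t) den \<noteq> 0"
  by (simp add: pt_def rep_abs_zero_iff hv den1)

lemma pt_inj: "pt s = pt t \<longleftrightarrow> s = t" by (metis ratio_pt)

lemma pt_in: "pt t \<in> L" by (simp add: pt_def inL)

lemma pt_abs: "v \<in> hvec \<Longrightarrow> abs_proj v \<in> L \<Longrightarrow> v den \<noteq> 0 \<Longrightarrow> abs_proj v = pt (v num / v den)"
  using onto[of "abs_proj v"] by (simp add: rep_abs_zero_iff ratio_abs pt_def)

lemma chart_pt: "chart L UNIV pt"
proof -
  have "holomorphic_lift UNIV \<Lambda> pt" by (simp add: holomorphic_lift_def hv hol pt_def)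
  then have ph: "proj_holomorphic_on pt UNIV" unfolding proj_holomorphic_on_def by blast
  have im: "range pt = L \<inter> {x. rep_proj x den \<noteq> 0}"
    using onto pt_in by (auto simp: pt_def[symmetric])
  have "homeomorphism UNIV (range pt) pt (ratio num den)"
    unfolding homeomorphism_def
    using proj_holomorphic_on_imp_continuous[OF ph]
    by (auto simp: image_image intro!: continuous_on_ratio)
  then show ?thesis using ph open_rep_nonzero[of den] unfolding chart_def im by blast
qed

lemma pt_continuous: "continuous_on UNIV pt" using chart_continuous[OF chart_pt] .

text \<open>In the coordinate of \<open>L\<close> the map is a holomorphic function
  \<open>T\<close>, which is not constant because the fiber is finite while a chart is injective. If
  \<open>m\<close> is the order of the zero of \<open>T - T z0\<close>, an m-th root
  \<open>q\<close> of this difference has nonzero derivative at \<open>z0\<close>; its inverse is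
  the required change of parameter.\<close>

lemma normal_form:
  assumes c: "chart X D g" "z0 \<in> D" and f: "proj_holomorphic_on (f \<circ> g) D" "f ` X \<subseteq> L"
    and den: "rep_proj (f (g z0)) den \<noteq> 0" and fin: "finite {x \<in> X. f x = f (g z0)}"
  obtains \<epsilon> m e where "\<epsilon> > 0" "m > 0" "chart X (ball 0 \<epsilon>) e" "e 0 = g z0"
    "\<And>\<zeta>. \<zeta> \<in> ball 0 \<epsilon> \<Longrightarrow> f (e \<zeta>) = pt (ratio num den (f (g z0)) + \<zeta> ^ m)"
proof -
  obtain U F where U: "z0 \<in> U" "U \<subseteq> D" "holomorphic_lift U F (f \<circ> g)"
    using f c by (auto simp: proj_holomorphic_on_def)
  define T where "T w = F w num / F w den" for w
  have hF: "F w \<in> hvec" "f (g w) = abs_proj (F w)" if "w \<in> U" for w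
    using U that by (auto simp: holomorphic_lift_def)
  define V where "V = U \<inter> (\<lambda>w. F w den) -` (- {0})"
  have "open V" unfolding V_def using U
    by (intro continuous_open_preimage) (auto simp: holomorphic_lift_def holomorphic_on_imp_continuous_on)
  have "z0 \<in> V" using U den hF[OF U(1)] by (simp add: V_def rep_abs_zero_iff)
  then obtain r where r: "r > 0" "ball z0 r \<subseteq> V" using \<open>open V\<close> openE by blast
  have holT: "T holomorphic_on ball z0 r" unfolding T_def
    by (intro holomorphic_intros) (use U r in \<open>auto simp: V_def holomorphic_lift_def intro: holomorphic_on_subset\<close>)
  have fT: "f (g w) = pt (T w)" if "w \<in> ball z0 r" for w
  proof -
    have w: "w \<in> U" "F w den \<noteq> 0" "w \<in> D" using that r U by (auto simp: V_def)
    then have "f (g w) \<in> L" using f(2) chart_image[OF c(1)] by blast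
    then show ?thesis using pt_abs[of "F w"] hF[of w] w by (simp add: T_def)
  qed
  define b where "b = T z0"
  have b: "ratio num den (f (g z0)) = b" using fT[of z0] r by (simp add: b_def)
  have "\<exists>n>0. (deriv ^^ n) T z0 \<noteq> 0"
  proof (rule ccontr)
    assume "\<not> ?thesis"
    then have d0: "(deriv ^^ n) T z0 = 0" if "0 < n" for n using that by blast
    have "T w = T z0" if "w \<in> ball z0 r" for w
      by (rule holomorphic_fun_eq_const_on_connected[OF holT]) (use that r d0 in auto)
    then have "f (g w) = f (g z0)" if "w \<in> ball z0 r" for w
      using fT[OF that] fT[of z0] that r centre_in_ball by metis
    moreover have "ball z0 r \<subseteq> D" using r U by (auto simp: V_def)
    ultimately have "g ` ball z0 r \<subseteq> {x \<in> X. f x = f (g z0)}"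
      using chart_image[OF c(1)] by auto
    then have "finite (g ` ball z0 r)" using fin finite_subset by blast
    moreover have "inj_on g (ball z0 r)"
      using chart_homeomorphism_inj[OF c(1)] inj_on_subset r U V_def by blast
    ultimately have "finite (ball z0 r)" by (simp add: finite_image_iff)
    then show False using r uncountable_ball countable_finite by blast
  qed
  then obtain n0 where "n0 > 0 \<and> (deriv ^^ n0) T z0 \<noteq> 0" by blast
  define m where "m = (LEAST n. n > 0 \<and> (deriv ^^ n) T z0 \<noteq> 0)"
  have m: "m > 0" "(deriv ^^ m) T z0 \<noteq> 0"
    using LeastI[of "\<lambda>n. n > 0 \<and> (deriv ^^ n) T z0 \<noteq> 0", OF \<open>n0 > 0 \<and> _\<close>] by (auto simp: m_def)
  have mm: "(deriv ^^ i) T z0 = 0" if "0 < i" "i < m" for i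
    using not_less_Least[of i "\<lambda>n. n > 0 \<and> (deriv ^^ n) T z0 \<noteq> 0"] that by (auto simp: m_def)
  obtain g1 r1 where g1: "0 < r1" "g1 holomorphic_on ball z0 r1"
    "\<And>w. w \<in> ball z0 r1 \<Longrightarrow> T w - T z0 = ((w - z0) * g1 w) ^ m" "\<And>w. w \<in> ball z0 r1 \<Longrightarrow> g1 w \<noteq> 0"
    by (rule holomorphic_factor_order_of_zero_strong[OF holT open_ball _ m]) (use r mm in auto)
  define r2 where "r2 = min r r1"
  have r2: "r2 > 0" using r g1 by (simp add: r2_def)
  define q where "q w = (w - z0) * g1 w" for w
  have holq: "q holomorphic_on ball z0 r2" unfolding q_def
    by (intro holomorphic_intros holomorphic_on_subset[OF g1(2)]) (auto simp: r2_def)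
  have "(g1 has_field_derivative deriv g1 z0) (at z0)"
    using g1 by (intro holomorphic_derivI[OF g1(2)]) auto
  then have "(q has_field_derivative (1 * g1 z0 + deriv g1 z0 * (z0 - z0))) (at z0)"
    unfolding q_def by (intro DERIV_mult) (auto intro!: derivative_eq_intros)
  then have "deriv q z0 = g1 z0" by (simp add: DERIV_imp_deriv)
  then have dq: "deriv q z0 \<noteq> 0" using g1 by simp
  obtain r3 where r3: "r3 > 0" "ball z0 r3 \<subseteq> ball z0 r2" "inj_on q (ball z0 r3)"
    by (rule has_complex_derivative_locally_injective[OF holq _ open_ball dq]) (use r2 in auto)
  have holq3: "q holomorphic_on ball z0 r3" using holq r3 holomorphic_on_subset by blast
  obtain h where h: "h holomorphic_on q ` ball z0 r3" "\<And>z. z \<in> ball z0 r3 \<Longrightarrow> h (q z) = z"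
    using holomorphic_has_inverse[OF holq3 open_ball r3(3)] by metis
  have "open (q ` ball z0 r3)" using open_mapping_thm3[OF holq3 open_ball r3(3)] .
  moreover have "0 \<in> q ` ball z0 r3" using r3 by (auto intro!: image_eqI[of _ _ z0] simp: q_def)
  ultimately obtain \<epsilon> where \<epsilon>: "\<epsilon> > 0" "ball 0 \<epsilon> \<subseteq> q ` ball z0 r3" using openE by blast
  have hq: "q (h \<zeta>) = \<zeta>" "h \<zeta> \<in> ball z0 r3" if "\<zeta> \<in> ball 0 \<epsilon>" for \<zeta>
    using that \<epsilon> h(2) by auto
  show ?thesis
  proof
    show "chart X (ball 0 \<epsilon>) (\<lambda>w. g (h w))"
    proof (rule chart_reparam[OF c(1) open_ball])
      show "h holomorphic_on ball 0 \<epsilon>" using h(1) \<epsilon>(2) holomorphic_on_subset by blast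
      show "inj_on h (ball 0 \<epsilon>)" by (rule inj_on_inverseI[of _ q]) (use hq in auto)
      show "h ` ball 0 \<epsilon> \<subseteq> D" using hq(2) r3 r U by (fastforce simp: V_def r2_def)
    qed
    have "h (q z0) = z0" using h r3 by simp
    then show "g (h 0) = g z0" by (simp add: q_def)
    fix \<zeta> :: complex assume z: "\<zeta> \<in> ball 0 \<epsilon>"
    have "h \<zeta> \<in> ball z0 r" "h \<zeta> \<in> ball z0 r1" using hq(2)[OF z] r3 by (auto simp: r2_def)
    then have "T (h \<zeta>) = b + \<zeta> ^ m" using g1(3)[of "h \<zeta>"] hq(1)[OF z] by (simp add: b_def q_def algebra_simps)
    with fT[OF \<open>h \<zeta> \<in> ball z0 r\<close>] show "f (g (h \<zeta>)) = pt (ratio num den (f (g z0)) + \<zeta> ^ m)"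
      unfolding b by simp
  qed (use \<epsilon> m in auto)
qed

lemma critical_of_normal_form:
  assumes c: "chart X (ball 0 \<epsilon>) e" "\<epsilon> > 0" and m: "m \<ge> 2"
    and f: "\<And>\<zeta>. \<zeta> \<in> ball 0 \<epsilon> \<Longrightarrow> f (e \<zeta>) = pt (b + \<zeta> ^ m)"
  shows "critical_point X f (e 0)"
proof -
  have "(\<lambda>w. \<Lambda> (b + w ^ m) i) holomorphic_on ball 0 \<epsilon>" for i
    by (rule holomorphic_on_compose_gen[of "\<lambda>w. b + w ^ m" _ "\<lambda>t. \<Lambda> t i" UNIV, unfolded o_def])
       (auto intro!: holomorphic_intros hol)
  then have "holomorphic_lift (ball 0 \<epsilon>) (\<lambda>w. \<Lambda> (b + w ^ m)) (f \<circ> e)"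
    by (simp add: holomorphic_lift_def hv f pt_def)
  moreover have "deriv (\<lambda>w. \<Lambda> (b + w ^ m) i) 0 = 0 * \<Lambda> (b + 0 ^ m) i" for i
  proof -
    have "((\<lambda>t. \<Lambda> t i) has_field_derivative deriv (\<lambda>t. \<Lambda> t i) (b + 0 ^ m)) (at (b + 0 ^ m))"
      by (rule holomorphic_derivI[OF hol]) auto
    moreover have "((\<lambda>w. b + w ^ m) has_field_derivative 0) (at (0::complex))"
      using m by (auto intro!: derivative_eq_intros)
    ultimately have "((\<lambda>w. \<Lambda> (b + w ^ m) i) has_field_derivative deriv (\<lambda>t. \<Lambda> t i) (b + 0 ^ m) * 0) (at 0)"
      by (rule DERIV_chain2)
    then show ?thesis by (simp add: DERIV_imp_deriv)
  qed
  ultimately show ?thesis unfolding critical_point_def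
    using c by (intro exI[of _ "ball 0 \<epsilon>"] exI[of _ e] exI[of _ "\<lambda>w. \<Lambda> (b + w ^ m)"] exI[of _ 0])
      (auto intro!: exI[of _ 0])
qed

text \<open>A critical point may be witnessed by an arbitrary chart \<open>g\<close> and an
  arbitrary lift \<open>F\<close>. In any of them the coordinate \<open>T\<close> of the map is
  injective near the point, so its derivative is not zero; but if the derivative of \<open>F\<close>
  were a multiple of \<open>F\<close>, the quotient rule would make it zero.\<close>

lemma not_critical_of_normal_form:
  assumes c: "chart X (ball 0 \<epsilon>) e" "\<epsilon> > 0" and into: "f ` X \<subseteq> L"
    and f: "\<And>\<zeta>. \<zeta> \<in> ball 0 \<epsilon> \<Longrightarrow> f (e \<zeta>) = pt (b + \<zeta>)"
  shows "\<not> critical_point X f (e 0)"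
proof
  assume "critical_point X f (e 0)"
  then obtain D g U F z a where g: "chart X D g" "U \<subseteq> D" "z \<in> U" "g z = e 0"
    "holomorphic_lift U F (f \<circ> g)" "\<forall>i. deriv (\<lambda>w. F w i) z = a * F z i"
    unfolding critical_point_def by blast
  have U: "open U" "\<And>w. w \<in> U \<Longrightarrow> F w \<in> hvec \<and> f (g w) = abs_proj (F w)"
    "\<And>i. (\<lambda>w. F w i) holomorphic_on U" using g(5) by (auto simp: holomorphic_lift_def)
  define V where "V = (U \<inter> (\<lambda>w. F w den) -` (- {0})) \<inter> {w \<in> D. g w \<in> e ` ball 0 \<epsilon>}"
  have "open V" unfolding V_def using U
    by (intro open_Int continuous_open_preimage chart_open_preimage[OF g(1)] chart_open_image[OF c(1)])
       (auto simp: holomorphic_on_imp_continuous_on)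
  have "f (e 0) = pt b" using f[of 0] c by simp
  then have Fz: "F z den \<noteq> 0" using U(2)[OF g(3)] g(4) rep_abs_zero_iff by (metis rep_pt)
  have "z \<in> V" using g Fz c by (auto simp: V_def)
  define T where "T w = F w num / F w den" for w
  have fT: "f (g w) = pt (T w)" if "w \<in> V" for w
  proof -
    have w: "w \<in> U" "F w den \<noteq> 0" "w \<in> D" using that by (auto simp: V_def)
    then have "f (g w) \<in> L" using into chart_image[OF g(1)] by blast
    then show ?thesis using pt_abs[of "F w"] U(2)[of w] w by (simp add: T_def)
  qed
  have inj: "inj_on T V"
  proof (rule inj_onI)
    fix w w' assume w: "w \<in> V" "w' \<in> V" "T w = T w'"
    obtain \<zeta> \<zeta>' where z: "\<zeta> \<in> ball 0 \<epsilon>" "g w = e \<zeta>" "\<zeta>' \<in> ball 0 \<epsilon>" "g w' = e \<zeta>'" using w by (auto simp: V_def)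
    have "pt (b + \<zeta>) = pt (b + \<zeta>')" using fT[OF w(1)] fT[OF w(2)] w(3) f z by metis
    then have "g w = g w'" using z by (simp add: pt_inj)
    then show "w = w'" using chart_homeomorphism_inj[OF g(1)] w by (auto simp: V_def inj_on_def)
  qed
  have holT: "T holomorphic_on V" unfolding T_def
    by (intro holomorphic_intros holomorphic_on_subset[OF U(3)]) (auto simp: V_def)
  have "deriv T z \<noteq> 0" by (rule holomorphic_injective_imp_regular[OF holT \<open>open V\<close> inj \<open>z \<in> V\<close>])
  moreover have "((\<lambda>w. F w i) has_field_derivative a * F z i) (at z)" for i
    using holomorphic_derivI[OF U(3) U(1) g(3), of i] g(6) by simp
  then have "(T has_field_derivative (a * F z num * F z den - F z num * (a * F z den)) / (F z den * F z den)) (at z)"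
    unfolding T_def by (intro DERIV_divide Fz)
  then have "deriv T z = 0" by (simp add: DERIV_imp_deriv)
  ultimately show False by simp
qed

end

subsection \<open>Simply branched maps to a line\<close>

text \<open>In the normal forms \<open>f (e \<zeta>) = b + \<zeta>\<^sup>m\<close> at the points over \<open>b\<close> the exponents add up to the
  degree \<open>d\<close>. So a fiber with \<open>d\<close> points is unramified, and one with \<open>d - 1\<close> points contains exactly
  one ramification point, of exponent two.\<close>

locale branched_map =
  c0: line_coord L \<Lambda>0 n0 d0 + c1: line_coord L \<Lambda>1 n1 d1
  for L \<Lambda>0 n0 d0 \<Lambda>1 n1 d1 +
  fixes X :: "proj set" and f :: "proj \<Rightarrow> proj" and d :: nat and \<Delta> :: "proj set"
  assumes compact_X: "compact X" and d3: "d \<ge> 3"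
    and two_coords: "\<And>x. x \<in> L \<Longrightarrow> rep_proj x d0 \<noteq> 0 \<or> rep_proj x d1 \<noteq> 0"
    and \<Delta>0: "\<And>x. x \<in> L \<inter> \<Delta> \<Longrightarrow> rep_proj x d0 \<noteq> 0" and fin\<Delta>: "finite (L \<inter> \<Delta>)"
    and into: "f ` X \<subseteq> L"
    and charts: "\<And>x. x \<in> X \<Longrightarrow> \<exists>D g z. chart X D g \<and> z \<in> D \<and> g z = x \<and> proj_holomorphic_on (f \<circ> g) D"
    and card_generic: "\<And>t. t \<in> L \<Longrightarrow> t \<notin> \<Delta> \<Longrightarrow> card {x \<in> X. f x = t} = d"
    and card_special: "\<And>t. t \<in> L \<Longrightarrow> t \<in> \<Delta> \<Longrightarrow> card {x \<in> X. f x = t} = d - 1"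
begin

lemma finite_fibers: "t \<in> L \<Longrightarrow> finite {x \<in> X. f x = t}"
  using card_generic[of t] card_special[of t] d3 by (cases "t \<in> \<Delta>") (auto intro: card_ge_0_finite)

lemma holomorphic: "holomorphic_map X L f"
  unfolding holomorphic_map_def using into charts by blast

lemma continuous: "continuous_on X f"
  using holomorphic by (rule holomorphic_map_continuous)

text \<open>Simultaneous normal forms at all points over one value: disjoint charts of a common
  radius which contain the nearby fibers completely, with exponents adding up to \<open>d\<close>.
  The condition \<open>\<eta> \<le> \<epsilon> ^ m x\<close> keeps the roots of a number of modulus
  less than \<open>\<eta>\<close> inside the charts.\<close>

definition structure_at ::
    "(complex \<Rightarrow> proj) \<Rightarrow> complex \<Rightarrow> (proj \<Rightarrow> complex \<Rightarrow> proj) \<Rightarrow> (proj \<Rightarrow> nat) \<Rightarrow> real \<Rightarrow> real \<Rightarrow> bool" where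
  "structure_at pt b0 e m \<epsilon> \<eta> \<longleftrightarrow> \<epsilon> > 0 \<and> \<eta> > 0 \<and>
     (\<forall>x \<in> {x \<in> X. f x = pt b0}. chart X (ball 0 \<epsilon>) (e x) \<and> e x 0 = x \<and> m x > 0 \<and> \<eta> \<le> \<epsilon> ^ m x \<and>
        (\<forall>\<zeta>\<in>ball 0 \<epsilon>. f (e x \<zeta>) = pt (b0 + \<zeta> ^ m x))) \<and>
     (\<forall>x \<in> {x \<in> X. f x = pt b0}. \<forall>y \<in> {x \<in> X. f x = pt b0}. x \<noteq> y \<longrightarrow>
        e x ` ball 0 \<epsilon> \<inter> e y ` ball 0 \<epsilon> = {}) \<and>
     (\<forall>r. 0 < cmod r \<and> cmod r < \<eta> \<longrightarrow> pt (b0 + r) \<notin> \<Delta> \<and>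
        {x \<in> X. f x = pt (b0 + r)} = (\<Union>x \<in> {x \<in> X. f x = pt b0}. e x ` {\<zeta>. \<zeta> ^ m x = r})) \<and>
     (\<Sum>x \<in> {x \<in> X. f x = pt b0}. m x) = d"

lemma structure_exists:
  assumes lc: "line_coord L \<Lambda> nn dd"
  shows "\<exists>e m \<epsilon> \<eta>. structure_at (line_coord.pt \<Lambda>) b0 e m \<epsilon> \<eta>"
proof -
  interpret l: line_coord L \<Lambda> nn dd by (rule lc)
  let ?F = "{x \<in> X. f x = l.pt b0}"
  have fin: "finite ?F" using finite_fibers l.pt_in by blast
  define nform where "nform x \<epsilon> m e \<longleftrightarrow> \<epsilon> > 0 \<and> m > 0 \<and> chart X (ball 0 \<epsilon>) e \<and> e 0 = x \<and>
      (\<forall>\<zeta>\<in>ball 0 \<epsilon>. f (e \<zeta>) = l.pt (b0 + \<zeta> ^ m))" for x \<epsilon> m e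
  have "\<forall>x\<in>?F. \<exists>q. nform x (fst q) (fst (snd q)) (snd (snd q))"
  proof
    fix x assume x: "x \<in> ?F"
    obtain D g z where g: "chart X D g" "z \<in> D" "g z = x" "proj_holomorphic_on (f \<circ> g) D"
      using charts x by blast
    have fx: "f (g z) = l.pt b0" using g x by simp
    obtain \<epsilon> m e where N: "\<epsilon> > 0" "m > 0" "chart X (ball 0 \<epsilon>) e" "e 0 = g z"
      "\<And>\<zeta>. \<zeta> \<in> ball 0 \<epsilon> \<Longrightarrow> f (e \<zeta>) = l.pt (ratio nn dd (f (g z)) + \<zeta> ^ m)"
      by (rule l.normal_form[OF g(1,2,4) into]) (use fx fin in auto)
    then have "\<forall>\<zeta>\<in>ball 0 \<epsilon>. f (e \<zeta>) = l.pt (b0 + \<zeta> ^ m)" unfolding fx l.ratio_pt by blast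
    then have "nform x \<epsilon> m e" using N(1-4) g(3) unfolding nform_def by blast
    then show "\<exists>q. nform x (fst q) (fst (snd q)) (snd (snd q))" by (intro exI[of _ "(\<epsilon>, m, e)"]) simp
  qed
  from bchoice[OF this] obtain Q where Q: "\<forall>x\<in>?F. nform x (fst (Q x)) (fst (snd (Q x))) (snd (snd (Q x)))"
    by (elim exE)
  define \<epsilon>0 m e where "\<epsilon>0 x = fst (Q x)" and "m x = fst (snd (Q x))" and "e x = snd (snd (Q x))" for x
  have nf: "\<epsilon>0 x > 0 \<and> m x > 0 \<and> chart X (ball 0 (\<epsilon>0 x)) (e x) \<and> e x 0 = x \<and>
      (\<forall>\<zeta>\<in>ball 0 (\<epsilon>0 x). f (e x \<zeta>) = l.pt (b0 + \<zeta> ^ m x))" if "x \<in> ?F" for x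
    using bspec[OF Q that] unfolding nform_def \<epsilon>0_def m_def e_def .
  obtain N where N: "\<And>y. y \<in> ?F \<Longrightarrow> open (N y) \<and> y \<in> N y"
    "\<And>y z. y \<in> ?F \<Longrightarrow> z \<in> ?F \<Longrightarrow> y \<noteq> z \<Longrightarrow> N y \<inter> N z = {}"
    using finite_t2_separation[OF fin] by blast
  have "\<forall>x\<in>?F. \<exists>\<epsilon>. \<epsilon> > 0 \<and> \<epsilon> \<le> \<epsilon>0 x \<and> e x ` ball 0 \<epsilon> \<subseteq> N x"
  proof
    fix x assume x: "x \<in> ?F"
    have c: "chart X (ball 0 (\<epsilon>0 x)) (e x)" using nf x by blast
    have "openin (top_of_set X) (X \<inter> N x)" using N x by (auto simp: openin_open)
    then have "open {w \<in> ball 0 (\<epsilon>0 x). e x w \<in> X \<inter> N x}" by (rule chart_open_preimage[OF c])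
    moreover have "0 \<in> {w \<in> ball 0 (\<epsilon>0 x). e x w \<in> X \<inter> N x}" using nf[OF x] N[of x] x by auto
    ultimately obtain \<epsilon> where "\<epsilon> > 0" "ball 0 \<epsilon> \<subseteq> {w \<in> ball 0 (\<epsilon>0 x). e x w \<in> X \<inter> N x}" using openE by blast
    then show "\<exists>\<epsilon>. \<epsilon> > 0 \<and> \<epsilon> \<le> \<epsilon>0 x \<and> e x ` ball 0 \<epsilon> \<subseteq> N x"
      by (intro exI[of _ "min \<epsilon> (\<epsilon>0 x)"]) (use nf[OF x] in auto)
  qed
  from bchoice[OF this] obtain \<epsilon>1
    where \<epsilon>1': "\<forall>x\<in>?F. \<epsilon>1 x > 0 \<and> \<epsilon>1 x \<le> \<epsilon>0 x \<and> e x ` ball 0 (\<epsilon>1 x) \<subseteq> N x" by (elim exE)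
  have \<epsilon>1: "\<epsilon>1 x > 0 \<and> \<epsilon>1 x \<le> \<epsilon>0 x \<and> e x ` ball 0 (\<epsilon>1 x) \<subseteq> N x" if "x \<in> ?F" for x
    using bspec[OF \<epsilon>1' that] .
  define \<epsilon> where "\<epsilon> = Min (insert 1 (\<epsilon>1 ` ?F))"
  have \<epsilon>: "\<epsilon> > 0" "\<And>x. x \<in> ?F \<Longrightarrow> \<epsilon> \<le> \<epsilon>1 x" using fin \<epsilon>1 by (auto simp: \<epsilon>_def)
  have sub: "ball 0 \<epsilon> \<subseteq> ball 0 (\<epsilon>0 x)" "e x ` ball 0 \<epsilon> \<subseteq> N x" if "x \<in> ?F" for x
    using \<epsilon>(2)[OF that] \<epsilon>1[OF that] by (auto simp: subset_iff image_subset_iff)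
  have ch: "chart X (ball 0 \<epsilon>) (e x)" if "x \<in> ?F" for x
    using chart_reparam[of X "ball 0 (\<epsilon>0 x)" "e x" "ball 0 \<epsilon>" "\<lambda>z. z"] nf[OF that] sub[OF that] by auto
  have disj: "e x ` ball 0 \<epsilon> \<inter> e y ` ball 0 \<epsilon> = {}" if "x \<in> ?F" "y \<in> ?F" "x \<noteq> y" for x y
    using sub(2)[OF that(1)] sub(2)[OF that(2)] N(2)[OF that] by blast
  \<comment> \<open>Outside the charts \<open>f\<close> avoids the value over \<open>b0\<close>. By
    compactness it also avoids all values close to it, so nearby fibers lie inside the
    charts.\<close>
  define O' where "O' = (\<Union>x\<in>?F. e x ` ball 0 \<epsilon>)"
  have "openin (top_of_set X) O'" unfolding O'_def
    by (intro openin_Union) (auto intro: chart_open_image[OF ch])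
  then obtain V where V: "open V" "O' = X \<inter> V" by (auto simp: openin_open)
  have "X - O' = X \<inter> - V" using V by auto
  then have "compact (X - O')" using V compact_X by (simp add: compact_Int_closed closed_Compl)
  then have "compact (f ` (X - O'))" by (intro compact_continuous_image continuous_on_subset[OF continuous]) auto
  then have "closed (f ` (X - O'))" by (rule compact_imp_closed)
  moreover have "closed (L \<inter> \<Delta> - {l.pt b0})" using fin\<Delta> finite_imp_closed by blast
  ultimately have "open (l.pt -` (- (f ` (X - O') \<union> (L \<inter> \<Delta> - {l.pt b0}))))" (is "open ?W")
    by (intro open_vimage l.pt_continuous open_Compl closed_Un)
  moreover have "b0 \<in> ?W"
  proof -
    have "x \<in> e x ` ball 0 \<epsilon>" if "x \<in> ?F" for x using nf[OF that] \<epsilon> by (auto intro!: image_eqI[of _ _ 0])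
    then show ?thesis by (auto simp: O'_def)
  qed
  ultimately obtain \<eta>0 where \<eta>0: "\<eta>0 > 0" "ball b0 \<eta>0 \<subseteq> ?W" using openE by blast
  define \<eta> where "\<eta> = Min (insert \<eta>0 ((\<lambda>x. \<epsilon> ^ m x) ` ?F))"
  have \<eta>: "\<eta> > 0" "\<eta> \<le> \<eta>0" "\<And>x. x \<in> ?F \<Longrightarrow> \<eta> \<le> \<epsilon> ^ m x" using fin \<epsilon> \<eta>0 by (auto simp: \<eta>_def)
  have nf': "f (e x \<zeta>) = l.pt (b0 + \<zeta> ^ m x)" if "x \<in> ?F" "\<zeta> \<in> ball 0 \<epsilon>" for x \<zeta>
    using nf[OF that(1)] sub(1)[OF that(1)] that(2) by blast
  have root_small: "\<zeta> \<in> ball 0 \<epsilon>" if "x \<in> ?F" "\<zeta> ^ m x = r" "cmod r < \<eta>" for x \<zeta> r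
  proof -
    have "cmod \<zeta> ^ m x < \<epsilon> ^ m x" using that \<eta>(3)[OF that(1)] by (simp flip: norm_power)
    then show ?thesis using \<epsilon>(1) power_less_imp_less_base[of "cmod \<zeta>" "m x" \<epsilon>] by auto
  qed
  have W: "l.pt (b0 + r) \<notin> f ` (X - O')" "l.pt (b0 + r) \<notin> L \<inter> \<Delta> - {l.pt b0}" if "cmod r < \<eta>" for r
  proof -
    have "b0 + r \<in> ball b0 \<eta>0" using that \<eta> by (simp add: dist_norm)
    then show "l.pt (b0 + r) \<notin> f ` (X - O')" "l.pt (b0 + r) \<notin> L \<inter> \<Delta> - {l.pt b0}" using \<eta>0 by auto
  qed
  have fib: "{x \<in> X. f x = l.pt (b0 + r)} = (\<Union>x\<in>?F. e x ` {\<zeta>. \<zeta> ^ m x = r})" if r: "cmod r < \<eta>" for r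
  proof (intro equalityI subsetI)
    fix y assume y: "y \<in> {x \<in> X. f x = l.pt (b0 + r)}"
    then have "y \<in> O'" using W(1)[OF r] by (metis (mono_tags, lifting) DiffI image_eqI mem_Collect_eq)
    then obtain x \<zeta> where x: "x \<in> ?F" "\<zeta> \<in> ball 0 \<epsilon>" "y = e x \<zeta>" unfolding O'_def by blast
    then have "l.pt (b0 + \<zeta> ^ m x) = l.pt (b0 + r)" using nf' y by auto
    then have "\<zeta> ^ m x = r" by (simp add: l.pt_inj)
    with x show "y \<in> (\<Union>x\<in>?F. e x ` {\<zeta>. \<zeta> ^ m x = r})" by blast
  next
    fix y assume "y \<in> (\<Union>x\<in>?F. e x ` {\<zeta>. \<zeta> ^ m x = r})"
    then obtain x \<zeta> where x: "x \<in> ?F" "\<zeta> ^ m x = r" "y = e x \<zeta>" by blast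
    have "\<zeta> \<in> ball 0 \<epsilon>" by (rule root_small[OF x(1,2) r])
    then show "y \<in> {x \<in> X. f x = l.pt (b0 + r)}"
      using nf'[OF x(1)] x chart_image[OF ch[OF x(1)]] by auto
  qed
  have not\<Delta>: "l.pt (b0 + r) \<notin> \<Delta>" if "0 < cmod r" "cmod r < \<eta>" for r
    using W(2)[OF that(2)] that(1) l.pt_in l.pt_inj[of "b0 + r" b0] by auto
  have sum: "(\<Sum>x\<in>?F. m x) = d"
  proof -
    \<comment> \<open>Any nearby value off the center will do: its fiber has \<open>d\<close>
      points, of which the chart at \<open>x\<close> contains one for each of the \<open>m x\<close>
      roots.\<close>
    define r :: complex where "r = of_real (\<eta> / 2)"
    have r: "0 < cmod r" "cmod r < \<eta>" using \<eta> by (simp_all add: r_def)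
    have "d = card {x \<in> X. f x = l.pt (b0 + r)}" using card_generic l.pt_in not\<Delta>[OF r] by simp
    also have "\<dots> = card (\<Union>x\<in>?F. e x ` {\<zeta>. \<zeta> ^ m x = r})" by (simp only: fib[OF r(2)])
    also have "\<dots> = (\<Sum>x\<in>?F. card (e x ` {\<zeta>. \<zeta> ^ m x = r}))"
    proof (rule card_UN_disjoint[OF fin])
      show "\<forall>x\<in>?F. finite (e x ` {\<zeta>. \<zeta> ^ m x = r})"
      proof
        fix x assume "x \<in> ?F"
        then have "card {\<zeta>. \<zeta> ^ m x = r} = m x" "m x > 0" using r nf card_nth_roots[of r "m x"] by auto
        then show "finite (e x ` {\<zeta>. \<zeta> ^ m x = r})" by (metis card_ge_0_finite finite_imageI)
      qed
      show "\<forall>x\<in>?F. \<forall>y\<in>?F. x \<noteq> y \<longrightarrow> e x ` {\<zeta>. \<zeta> ^ m x = r} \<inter> e y ` {\<zeta>. \<zeta> ^ m y = r} = {}"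
      proof (intro ballI impI)
        fix x y assume xy: "x \<in> ?F" "y \<in> ?F" "x \<noteq> y"
        have "e x ` {\<zeta>. \<zeta> ^ m x = r} \<subseteq> e x ` ball 0 \<epsilon>" "e y ` {\<zeta>. \<zeta> ^ m y = r} \<subseteq> e y ` ball 0 \<epsilon>"
          using root_small[OF xy(1) _ r(2)] root_small[OF xy(2) _ r(2)] by blast+
        with disj[OF xy] show "e x ` {\<zeta>. \<zeta> ^ m x = r} \<inter> e y ` {\<zeta>. \<zeta> ^ m y = r} = {}" by blast
      qed
    qed
    also have "\<dots> = (\<Sum>x\<in>?F. m x)"
    proof (rule sum.cong[OF refl])
      fix x assume x: "x \<in> ?F"
      have "inj_on (e x) {\<zeta>. \<zeta> ^ m x = r}"
        using chart_homeomorphism_inj[OF ch[OF x]] root_small[OF x _ r(2)] by (auto simp: inj_on_def)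
      then show "card (e x ` {\<zeta>. \<zeta> ^ m x = r}) = m x"
        using r nf[OF x] card_nth_roots[of r "m x"] by (simp add: card_image)
    qed
    finally show ?thesis by simp
  qed
  have A: "\<forall>x\<in>?F. chart X (ball 0 \<epsilon>) (e x) \<and> e x 0 = x \<and> m x > 0 \<and> \<eta> \<le> \<epsilon> ^ m x \<and>
      (\<forall>\<zeta>\<in>ball 0 \<epsilon>. f (e x \<zeta>) = l.pt (b0 + \<zeta> ^ m x))"
  proof
    fix x assume x: "x \<in> ?F"
    show "chart X (ball 0 \<epsilon>) (e x) \<and> e x 0 = x \<and> m x > 0 \<and> \<eta> \<le> \<epsilon> ^ m x \<and>
      (\<forall>\<zeta>\<in>ball 0 \<epsilon>. f (e x \<zeta>) = l.pt (b0 + \<zeta> ^ m x))"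
      using nf[OF x] by (intro conjI ballI ch[OF x] \<eta>(3)[OF x] nf'[OF x]) simp_all
  qed
  have B: "\<forall>x\<in>?F. \<forall>y\<in>?F. x \<noteq> y \<longrightarrow> e x ` ball 0 \<epsilon> \<inter> e y ` ball 0 \<epsilon> = {}"
    by (intro ballI impI disj)
  have C: "\<forall>r. 0 < cmod r \<and> cmod r < \<eta> \<longrightarrow> l.pt (b0 + r) \<notin> \<Delta> \<and>
        {x \<in> X. f x = l.pt (b0 + r)} = (\<Union>x\<in>?F. e x ` {\<zeta>. \<zeta> ^ m x = r})"
    by (intro allI impI conjI not\<Delta> fib) auto
  have "structure_at l.pt b0 e m \<epsilon> \<eta>"
    unfolding structure_at_def
    by (rule conjI[OF \<epsilon>(1) conjI[OF \<eta>(1) conjI[OF A conjI[OF B conjI[OF C sum]]]]])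
  then show ?thesis by blast
qed

lemma exponents:
  assumes lc: "line_coord L \<Lambda> nn dd" and s: "structure_at (line_coord.pt \<Lambda>) b0 e m \<epsilon> \<eta>"
  shows "line_coord.pt \<Lambda> b0 \<notin> \<Delta> \<Longrightarrow> x \<in> X \<Longrightarrow> f x = line_coord.pt \<Lambda> b0 \<Longrightarrow> m x = 1"
    and "line_coord.pt \<Lambda> b0 \<in> \<Delta> \<Longrightarrow> \<exists>y \<in> X. f y = line_coord.pt \<Lambda> b0 \<and> m y = 2 \<and>
       (\<forall>x \<in> X. f x = line_coord.pt \<Lambda> b0 \<and> x \<noteq> y \<longrightarrow> m x = 1)"
proof -
  interpret l: line_coord L \<Lambda> nn dd by (rule lc)
  let ?F = "{x \<in> X. f x = l.pt b0}"
  have fin: "finite ?F" using finite_fibers l.pt_in by blast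
  have m: "\<And>x. x \<in> ?F \<Longrightarrow> m x \<ge> 1" and sum: "(\<Sum>x\<in>?F. m x) = d"
    using s unfolding structure_at_def by (auto simp: Suc_le_eq)
  have eq: "(\<Sum>x\<in>?F. m x - 1) + card ?F = d"
  proof -
    have "(\<Sum>x\<in>?F. m x) = (\<Sum>x\<in>?F. (m x - 1) + 1)" using m by (intro sum.cong) (auto simp: Suc_le_eq)
    also have "\<dots> = (\<Sum>x\<in>?F. m x - 1) + card ?F" by (simp only: sum.distrib sum_constant mult_1_right of_nat_id)
    finally show ?thesis using sum by simp
  qed
  show "m x = 1" if "l.pt b0 \<notin> \<Delta>" "x \<in> X" "f x = l.pt b0"
  proof -
    have "(\<Sum>x\<in>?F. m x - 1) = 0" using eq card_generic[OF l.pt_in that(1)] by simp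
    then have "m x - 1 = 0" using fin that by simp
    then show ?thesis using m[of x] that by simp
  qed
  show "\<exists>y \<in> X. f y = l.pt b0 \<and> m y = 2 \<and> (\<forall>x \<in> X. f x = l.pt b0 \<and> x \<noteq> y \<longrightarrow> m x = 1)" if "l.pt b0 \<in> \<Delta>"
  proof -
    have 1: "(\<Sum>x\<in>?F. m x - 1) = 1" using eq card_special[OF l.pt_in that] d3 by simp
    then obtain y where y: "y \<in> ?F" "m y - 1 = 1" "\<forall>x\<in>?F. x \<noteq> y \<longrightarrow> m x - 1 = 0"
      using sum_eq_1_iff[OF fin, of "\<lambda>x. m x - 1"] by auto
    then have "m x = 1" if "x \<in> ?F" "x \<noteq> y" for x using m[OF that(1)] that by fastforce
    then show ?thesis using y by (intro bexI[of _ y]) auto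
  qed
qed

lemma critical_iff:
  assumes lc: "line_coord L \<Lambda> nn dd" and s: "structure_at (line_coord.pt \<Lambda>) b0 e m \<epsilon> \<eta>"
    and x: "x \<in> X" "f x = line_coord.pt \<Lambda> b0"
  shows "critical_point X f x \<longleftrightarrow> m x \<noteq> 1"
proof -
  interpret l: line_coord L \<Lambda> nn dd by (rule lc)
  have nf: "chart X (ball 0 \<epsilon>) (e x)" "e x 0 = x" "m x > 0" "\<epsilon> > 0"
    "\<And>\<zeta>. \<zeta> \<in> ball 0 \<epsilon> \<Longrightarrow> f (e x \<zeta>) = l.pt (b0 + \<zeta> ^ m x)"
    using s x unfolding structure_at_def by auto
  show ?thesis
  proof (cases "m x = 1")
    case True
    then show ?thesis using l.not_critical_of_normal_form[OF nf(1,4) into, of b0] nf(2,5) by auto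
  next
    case False
    then have "m x \<ge> 2" using nf(3) by simp
    then show ?thesis using l.critical_of_normal_form[OF nf(1,4) _ nf(5)] nf(2) False by auto
  qed
qed

lemma coordinate_exists:
  assumes "t \<in> L"
  obtains \<Lambda> nn dd b0 where "line_coord L \<Lambda> nn dd" "t = line_coord.pt \<Lambda> b0"
  using two_coords[OF assms] c0.onto[OF assms] c1.onto[OF assms] that c0.line_coord_axioms c1.line_coord_axioms
    c0.pt_def c1.pt_def by metis

lemma branch_points_eq: "branch_points X f = \<Delta> \<inter> L"
proof (intro equalityI subsetI)
  fix t assume "t \<in> branch_points X f"
  then obtain x where x: "x \<in> X" "critical_point X f x" "f x = t" by (auto simp: branch_points_def)
  then have "t \<in> L" using into by auto
  then obtain \<Lambda> nn dd b0 where lc: "line_coord L \<Lambda> nn dd" "t = line_coord.pt \<Lambda> b0"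
    by (rule coordinate_exists)
  obtain e m \<epsilon> \<eta> where s: "structure_at (line_coord.pt \<Lambda>) b0 e m \<epsilon> \<eta>" using structure_exists[OF lc(1)] by blast
  have "m x \<noteq> 1" using critical_iff[OF lc(1) s] x lc by blast
  moreover have "m x = 1" if "t \<notin> \<Delta>"
    by (rule exponents(1)[OF lc(1) s]) (use that x lc in auto)
  ultimately have "t \<in> \<Delta>" by blast
  with \<open>t \<in> L\<close> show "t \<in> \<Delta> \<inter> L" by simp
next
  fix t assume t: "t \<in> \<Delta> \<inter> L"
  then have "t \<in> L" by simp
  then obtain \<Lambda> nn dd b0 where lc: "line_coord L \<Lambda> nn dd" "t = line_coord.pt \<Lambda> b0"
    by (rule coordinate_exists)
  obtain e m \<epsilon> \<eta> where s: "structure_at (line_coord.pt \<Lambda>) b0 e m \<epsilon> \<eta>" using structure_exists[OF lc(1)] by blast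
  obtain y where y: "y \<in> X" "f y = t" "m y = 2" using exponents(2)[OF lc(1) s] t lc by auto
  then have "critical_point X f y" using critical_iff[OF lc(1) s] lc by auto
  with y show "t \<in> branch_points X f" by (auto simp: branch_points_def)
qed

lemma degree: "map_degree X L f d"
  unfolding map_degree_def branch_points_eq fiber_def using card_generic by auto

text \<open>Off the branch locus all exponents are one, so in a chart \<open>f\<close> is a
  translation of the coordinate. This gives openness; the size of the fibers is an assumption of the
  locale.\<close>

lemma cover: "finite_cover {x \<in> X. f x \<in> L - \<Delta>} f (L - \<Delta>) d"
proof
  let ?X = "{x \<in> X. f x \<in> L - \<Delta>}"
  show "continuous_on ?X f" by (rule continuous_on_subset[OF continuous]) auto
  show "d > 0" using d3 by simp
  show "f x \<in> L - \<Delta>" if "x \<in> ?X" for x using that by simp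
  show "card {x \<in> ?X. f x = b} = d" if "b \<in> L - \<Delta>" for b
  proof -
    have "{x \<in> ?X. f x = b} = {x \<in> X. f x = b}" using that by auto
    then show ?thesis using card_generic that by simp
  qed
  fix U :: "proj set" assume "open U"
  show "openin (top_of_set (L - \<Delta>)) (f ` (?X \<inter> U))"
  proof (subst openin_subopen, intro ballI)
    fix t assume "t \<in> f ` (?X \<inter> U)"
    then obtain x where x: "x \<in> X" "x \<in> U" "t = f x" "t \<in> L" "t \<notin> \<Delta>" by auto
    obtain \<Lambda> nn dd b0 where lc: "line_coord L \<Lambda> nn dd" "t = line_coord.pt \<Lambda> b0"
      using coordinate_exists[OF x(4)] by blast
    interpret l: line_coord L \<Lambda> nn dd by (rule lc)
    obtain e m \<epsilon> \<eta> where s: "structure_at l.pt b0 e m \<epsilon> \<eta>" using structure_exists[OF lc(1)] by blast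
    have mx: "m x = 1" by (rule exponents(1)[OF lc(1) s]) (use x lc in auto)
    have nf: "chart X (ball 0 \<epsilon>) (e x)" "e x 0 = x" "\<epsilon> > 0"
      "\<And>\<zeta>. \<zeta> \<in> ball 0 \<epsilon> \<Longrightarrow> f (e x \<zeta>) = l.pt (b0 + \<zeta>)"
      using s x mx lc unfolding structure_at_def by auto
    have "openin (top_of_set X) (X \<inter> U)" using \<open>open U\<close> by (auto simp: openin_open)
    then have "open {w \<in> ball 0 \<epsilon>. e x w \<in> X \<inter> U}" by (rule chart_open_preimage[OF nf(1)])
    moreover have "0 \<in> {w \<in> ball 0 \<epsilon>. e x w \<in> X \<inter> U}" using nf x by auto
    ultimately obtain \<delta> where \<delta>: "\<delta> > 0" "ball 0 \<delta> \<subseteq> {w \<in> ball 0 \<epsilon>. e x w \<in> X \<inter> U}" using openE by blast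
    have "openin (top_of_set L) (l.pt ` ball b0 \<delta>)" by (rule chart_open_image[OF l.chart_pt]) auto
    then obtain V where V: "open V" "l.pt ` ball b0 \<delta> = L \<inter> V" by (auto simp: openin_open)
    have "(L - \<Delta>) \<inter> V \<subseteq> f ` (?X \<inter> U)"
    proof
      fix y assume y: "y \<in> (L - \<Delta>) \<inter> V"
      then obtain z where z: "z \<in> ball b0 \<delta>" "y = l.pt z" using V by blast
      then have "z - b0 \<in> ball 0 \<delta>" by (simp add: dist_norm norm_minus_commute)
      then have "z - b0 \<in> ball 0 \<epsilon>" "e x (z - b0) \<in> X \<inter> U" using \<delta> by auto
      moreover from this have "f (e x (z - b0)) = y" using nf(4)[of "z - b0"] z by simp
      ultimately show "y \<in> f ` (?X \<inter> U)" using y by (intro image_eqI[of _ _ "e x (z - b0)"]) auto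
    qed
    moreover have "l.pt b0 \<in> L \<inter> V" unfolding V(2)[symmetric] using \<delta> by simp
    then have "t \<in> (L - \<Delta>) \<inter> V" using x lc by auto
    moreover have "openin (top_of_set (L - \<Delta>)) ((L - \<Delta>) \<inter> V)" using V by (auto simp: openin_open)
    ultimately show "\<exists>T. openin (top_of_set (L - \<Delta>)) T \<and> t \<in> T \<and> T \<subseteq> f ` (?X \<inter> U)" by blast
  qed
qed

text \<open>Above a full turn of the coordinate around the branch value, the points of the chart
  with exponent two make a half turn and interchange the two square roots. In the charts with
  exponent one the point makes a full turn and comes back.\<close>

lemma simple: "simple_ramification X L f"
  unfolding simple_ramification_def
proof
  fix b assume b: "b \<in> branch_points X f"
  then have bL: "b \<in> L \<inter> \<Delta>" by (auto simp: branch_points_eq)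
  define b0 where "b0 = ratio n0 d0 b"
  have bpt: "b = c0.pt b0" using c0.onto[of b] \<Delta>0[OF bL] bL by (simp add: c0.pt_def b0_def)
  note lc = c0.line_coord_axioms
  obtain e m \<epsilon> \<eta> where s: "structure_at c0.pt b0 e m \<epsilon> \<eta>" using structure_exists[OF lc] by blast
  obtain y where y: "y \<in> X" "f y = b" "m y = 2" "\<And>x. x \<in> X \<Longrightarrow> f x = b \<Longrightarrow> x \<noteq> y \<Longrightarrow> m x = 1"
    using exponents(2)[OF lc s] bL bpt by auto
  let ?F = "{x \<in> X. f x = b}"
  have nf: "chart X (ball 0 \<epsilon>) (e x)" "e x 0 = x" "\<eta> \<le> \<epsilon> ^ m x" "\<And>\<zeta>. \<zeta> \<in> ball 0 \<epsilon> \<Longrightarrow> f (e x \<zeta>) = c0.pt (b0 + \<zeta> ^ m x)"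
    if "x \<in> ?F" for x
    using s that bpt unfolding structure_at_def by auto
  have pos: "\<epsilon> > 0" "\<eta> > 0" using s unfolding structure_at_def by auto
  have disjF: "\<forall>x\<in>?F. \<forall>z\<in>?F. x \<noteq> z \<longrightarrow> e x ` ball 0 \<epsilon> \<inter> e z ` ball 0 \<epsilon> = {}"
    unfolding bpt using s unfolding structure_at_def by (elim conjE) assumption
  have fib: "c0.pt (b0 + r) \<notin> \<Delta>"
     "{x \<in> X. f x = c0.pt (b0 + r)} = (\<Union>x\<in>?F. e x ` {\<zeta>. \<zeta> ^ m x = r})" if "0 < cmod r" "cmod r < \<eta>" for r
    using s that bpt unfolding structure_at_def by auto
  interpret C: finite_cover "{x \<in> X. f x \<in> L - \<Delta>}" f "L - \<Delta>" d by (rule cover)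
  have main: "\<exists>x1\<in>S. \<exists>x2\<in>S. x1 \<noteq> x2 \<and>
       (\<forall>s\<in>S. lift_end X f (c0.pt \<circ> circlepath b0 r) s = Transposition.transpose x1 x2 s)"
    if r: "0 < r" "r < \<eta>" and S: "S = fiber X f (c0.pt (b0 + of_real r))" for r S
  proof -
    define \<gamma> where "\<gamma> = c0.pt \<circ> circlepath b0 r"
    define w where "w u = exp (2 * of_real pi * \<i> * of_real u)" for u :: real
    have \<gamma>: "\<gamma> u = c0.pt (b0 + of_real r * w u)" for u by (simp add: \<gamma>_def circlepath w_def)
    have cw: "cmod (w u) = 1" for u by (simp add: w_def norm_exp_eq_Re)
    have im: "path_image \<gamma> \<subseteq> L - \<Delta>"
    proof -
      have "c0.pt (b0 + of_real r * w u) \<notin> \<Delta>" for u by (rule fib) (use r cw in \<open>auto simp: norm_mult\<close>)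
      then show ?thesis using c0.pt_in by (auto simp: path_image_def \<gamma>)
    qed
    have endI: "lift_end X f \<gamma> s = s'" if l: "lifts_to X f \<gamma> s s'" for s s'
      unfolding lift_end_eq
    proof (rule the_equality[of "lifts_to X f \<gamma> s", OF l])
      fix z assume "lifts_to X f \<gamma> s z"
      then have "lifts_to {x \<in> X. f x \<in> L - \<Delta>} f \<gamma> s z" using lifts_to_restrict[OF im] by blast
      moreover have "lifts_to {x \<in> X. f x \<in> L - \<Delta>} f \<gamma> s s'" using l lifts_to_restrict[OF im] by blast
      ultimately show "z = s'" by (rule C.lifts_to_unique)
    qed
    have liftI: "lifts_to X f \<gamma> (e x (h 0)) (e x (h 1))"
      if x: "x \<in> ?F" and h: "continuous_on {0..1} h" "\<And>u. u \<in> {0..1} \<Longrightarrow> h u ^ m x = of_real r * w u" for x h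
    proof -
      have hb: "h u \<in> ball 0 \<epsilon>" if "u \<in> {0..1}" for u
      proof -
        have "cmod (h u) ^ m x = r" using h(2)[OF that] cw r by (simp add: norm_mult flip: norm_power)
        then have "cmod (h u) ^ m x < \<epsilon> ^ m x" using r nf(3)[OF x] by simp
        then show ?thesis using pos power_less_imp_less_base[of "cmod (h u)" "m x" \<epsilon>] by auto
      qed
      have "continuous_on {0..1} (\<lambda>u. e x (h u))"
        by (rule continuous_on_compose2[OF chart_continuous[OF nf(1)[OF x]] h(1)]) (use hb in auto)
      moreover have "e x (h u) \<in> X \<and> f (e x (h u)) = \<gamma> u" if "u \<in> {0..1}" for u
        using hb[OF that] nf(4)[OF x, of "h u"] h(2)[OF that] chart_image[OF nf(1)[OF x]] by (auto simp: \<gamma>)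
      ultimately show ?thesis unfolding lifts_to_def
        by (intro exI[of _ "\<lambda>u. e x (h u)"]) (auto simp: path_def path_image_def pathstart_def pathfinish_def)
    qed
    have yF: "y \<in> ?F" using y by simp
    define s where "s = complex_of_real (sqrt r)"
    have s2: "s\<^sup>2 = of_real r" using r by (simp add: s_def flip: of_real_power)
    have s0: "s \<noteq> 0" using r by (simp add: s_def)
    have S': "S = (\<Union>x\<in>?F. e x ` {\<zeta>. \<zeta> ^ m x = of_real r})"
      unfolding S fiber_def by (rule fib(2)) (use r in auto)
    have sq: "{\<zeta>. \<zeta>\<^sup>2 = of_real r} = {s, -s}" by (auto simp: s2[symmetric] power2_eq_iff)
    have inb: "s \<in> ball 0 \<epsilon>" "- s \<in> ball 0 \<epsilon>"
    proof -
      have "cmod s ^ 2 < \<epsilon> ^ 2" using nf(3)[OF yF] y(3) r by (simp add: s_def)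
      then show "s \<in> ball 0 \<epsilon>" "- s \<in> ball 0 \<epsilon>" using pos power_less_imp_less_base[of "cmod s" 2 \<epsilon>] by auto
    qed
    have ne: "e y s \<noteq> e y (- s)"
      using chart_homeomorphism_inj[OF nf(1)[OF yF]] inb s0 unfolding inj_on_def by force
    define E where "E u = exp (of_real pi * \<i> * of_real u)" for u :: real
    have half: "(E u)\<^sup>2 = w u" for u
      by (simp add: E_def w_def power2_eq_square mult_ac flip: exp_add)
    have E01: "E 0 = 1" "E 1 = - 1" by (simp_all add: E_def)
    have contE: "continuous_on {0..1} (\<lambda>u. c * E u)" for c unfolding E_def by (intro continuous_intros)
    have w01: "w 0 = 1" "w 1 = 1" by (simp_all add: w_def exp_eq_1)
    have "lifts_to X f \<gamma> (e y (c * E 0)) (e y (c * E 1))" if "c\<^sup>2 = of_real r" for c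
      by (rule liftI[OF yF contE]) (simp add: y(3) power_mult_distrib half that)
    from this[of s] this[of "- s"]
    have l1: "lift_end X f \<gamma> (e y s) = e y (- s)" and l2: "lift_end X f \<gamma> (e y (- s)) = e y s"
      using s2 E01 by (auto intro: endI)
    have l3: "lift_end X f \<gamma> (e x (of_real r)) = e x (of_real r)" if x: "x \<in> ?F" "x \<noteq> y" for x
    proof -
      have "continuous_on {0..1} (\<lambda>u. of_real r * w u)" unfolding w_def by (intro continuous_intros)
      then have "lifts_to X f \<gamma> (e x (of_real r * w 0)) (e x (of_real r * w 1))"
        by (rule liftI[OF x(1)]) (use y(4)[of x] x in auto)
      then show ?thesis unfolding w01 by (intro endI) simp
    qed
    have disj: "e x (of_real r) \<noteq> e y s" "e x (of_real r) \<noteq> e y (- s)" if "x \<in> ?F" "x \<noteq> y" for x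
    proof -
      have "e x ` ball 0 \<epsilon> \<inter> e y ` ball 0 \<epsilon> = {}" using disjF that yF by blast
      moreover have "(of_real r :: complex) \<in> ball 0 \<epsilon>" using nf(3)[OF that(1)] y(4)[of x] that r by simp
      ultimately show "e x (of_real r) \<noteq> e y s" "e x (of_real r) \<noteq> e y (- s)" using inb by blast+
    qed
    have inS: "e y s \<in> S" "e y (- s) \<in> S" unfolding S' using yF y(3) sq by force+
    have "lift_end X f (c0.pt \<circ> circlepath b0 r) z = Transposition.transpose (e y s) (e y (- s)) z"
      if "z \<in> S" for z
    proof -
      from that obtain x \<zeta> where x: "x \<in> ?F" "\<zeta> ^ m x = of_real r" "z = e x \<zeta>" unfolding S' by blast
      show ?thesis
      proof (cases "x = y")
        case True
        then have "\<zeta> = s \<or> \<zeta> = - s" using x y(3) sq by auto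
        then show ?thesis using True x l1 l2 ne by (auto simp flip: \<gamma>_def)
      next
        case False
        then have "\<zeta> = of_real r" using x y(4)[of x] by auto
        then show ?thesis using False x l3 disj by (simp flip: \<gamma>_def add: transpose_apply_other)
      qed
    qed
    with inS ne show ?thesis by blast
  qed
  show "\<exists>D g z. chart L D g \<and> z \<in> D \<and> g z = b \<and>
       (\<forall>\<^sub>F r in at_right 0.
          let S = fiber X f (g (z + of_real r)) in
          \<exists>x\<in>S. \<exists>y\<in>S. x \<noteq> y \<and>
            (\<forall>s\<in>S. lift_end X f (g \<circ> circlepath z r) s = Transposition.transpose x y s))"
  proof (intro exI conjI)
    show "chart L UNIV c0.pt" by (rule c0.chart_pt)
    show "c0.pt b0 = b" using bpt by simp
    have "\<forall>\<^sub>F r in at_right 0. 0 < r \<and> r < \<eta>"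
      using pos(2) eventually_at_right_real by (auto simp: eventually_at_right_field)
    then show "\<forall>\<^sub>F r in at_right 0. let S = fiber X f (c0.pt (b0 + of_real r)) in
          \<exists>x\<in>S. \<exists>y\<in>S. x \<noteq> y \<and>
            (\<forall>s\<in>S. lift_end X f (c0.pt \<circ> circlepath b0 r) s = Transposition.transpose x y s)"
      by (rule eventually_mono) (unfold Let_def, rule main, auto)
  qed simp
qed

end

subsection \<open>Roots of polynomials and implicit functions\<close>

text \<open>Up to sign, \<open>poly p 0\<close> is the leading coefficient times the product of the
  roots.\<close>

lemma poly_root_bound:
  fixes p :: "complex poly"
  assumes "r \<ge> 0" "\<And>z. poly p z = 0 \<Longrightarrow> r \<le> cmod z"
  shows "cmod (lead_coeff p) * r ^ degree p \<le> cmod (poly p 0)"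
  using assms(2)
proof (induct "degree p" arbitrary: p)
  case 0
  then obtain c where "p = [:c:]" using degree_eq_zeroE by metis
  then show ?case by simp
next
  case (Suc m)
  then have "degree p > 0" by simp
  then obtain z where z: "poly p z = 0" using alg_closed_imp_poly_has_root[of p] by auto
  then obtain q where q: "p = [:- z, 1:] * q" by (metis dvdE poly_eq_0_iff_dvd)
  have "q \<noteq> 0" using q Suc(2) by auto
  then have deg: "degree p = Suc (degree q)" unfolding q by (subst degree_mult_eq) auto
  have "cmod (lead_coeff q) * r ^ degree q \<le> cmod (poly q 0)"
    by (rule Suc(1)) (use Suc deg q in auto)
  moreover have "lead_coeff p = lead_coeff q" unfolding q by (simp add: lead_coeff_mult del: mult_pCons_left)
  moreover have "cmod (poly p 0) = cmod z * cmod (poly q 0)" unfolding q by (simp add: norm_mult)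
  moreover have "r \<le> cmod z" using Suc z by blast
  ultimately show ?case using deg assms(1)
    by (simp add: mult.left_commute) (smt (verit) mult_mono norm_ge_zero mult.commute mult.left_commute zero_le_power mult_nonneg_nonneg)
qed

lemma poly_small_root:
  fixes p :: "complex poly"
  assumes "r \<ge> 0" "cmod (poly p 0) < cmod (lead_coeff p) * r ^ degree p"
  obtains z where "poly p z = 0" "cmod z < r"
  using poly_root_bound[OF assms(1), of p] assms(2) by force

text \<open>The distances from \<open>w\<close> to the n-th roots of \<open>c\<close>, counted with
  multiplicity, have the product |w^n - c|; so not all of them can be large.\<close>

lemma nth_root_near:
  assumes "n > 0" "r > 0" "cmod (w ^ n - c) < r ^ n"
  obtains y where "y ^ n = c" "cmod (y - w) < r"
proof -
  define p where "p = [:w, 1:] ^ n + [:- c:]"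
  have c: "coeff ([:w, 1:] ^ n) n = 1" "degree ([:w, 1:] ^ n) = n"
    using coeff_linear_power[of w n] by (simp_all add: degree_power_eq)
  have d: "degree p = n" unfolding p_def using assms(1) c by (subst degree_add_eq_left) auto
  have l: "coeff p n = 1" using assms(1) c by (cases n) (auto simp: p_def)
  have pz: "poly p z = (w + z) ^ n - c" for z by (simp add: p_def poly_power add.commute)
  have "cmod (poly p 0) < cmod (lead_coeff p) * r ^ degree p" using assms(3) by (simp only: pz d l) simp
  then obtain z where "poly p z = 0" "cmod z < r" using poly_small_root assms(2) by (metis less_imp_le)
  then show ?thesis using that[of "w + z"] by (simp add: pz)
qed

text \<open>The equation separates the variables, so the implicit function is a local inverse of
  \<open>f\<close> composed with \<open>h\<close>, and the inverse function theorem in one variable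
  suffices.\<close>

lemma separated_implicit_function:
  fixes f h :: "complex \<Rightarrow> complex"
  assumes f: "f holomorphic_on UNIV" and h: "h holomorphic_on UNIV"
    and eq: "f a0 = h b0" and d: "deriv f a0 \<noteq> 0"
  obtains r \<rho> \<phi> where "r > 0" "\<rho> > 0" "\<phi> holomorphic_on ball b0 r"
    "\<And>w. w \<in> ball b0 r \<Longrightarrow> \<phi> w \<in> ball a0 \<rho> \<and> f (\<phi> w) = h w"
    "\<And>a w. a \<in> ball a0 \<rho> \<Longrightarrow> w \<in> ball b0 r \<Longrightarrow> f a = h w \<Longrightarrow> a = \<phi> w"
proof -
  obtain \<rho> where \<rho>: "\<rho> > 0" "inj_on f (ball a0 \<rho>)"
    using has_complex_derivative_locally_injective[OF f _ open_UNIV d] by auto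
  have f': "f holomorphic_on ball a0 \<rho>" using f holomorphic_on_subset by blast
  have op: "open (f ` ball a0 \<rho>)" by (rule open_mapping_thm3[OF f' open_ball \<rho>(2)])
  obtain g where g: "g holomorphic_on f ` ball a0 \<rho>" "\<And>z. z \<in> ball a0 \<rho> \<Longrightarrow> g (f z) = z"
    using holomorphic_has_inverse[OF f' open_ball \<rho>(2)] by metis
  have "open (h -` (f ` ball a0 \<rho>))"
    by (rule open_vimage[OF op holomorphic_on_imp_continuous_on[OF h]])
  moreover have "b0 \<in> h -` (f ` ball a0 \<rho>)" using eq \<rho>(1) by (metis centre_in_ball image_eqI vimageI)
  ultimately obtain r where r: "r > 0" "ball b0 r \<subseteq> h -` (f ` ball a0 \<rho>)" using openE by blast
  show ?thesis
  proof
    show "(\<lambda>w. g (h w)) holomorphic_on ball b0 r"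
      by (rule holomorphic_on_compose_gen[of h _ g "f ` ball a0 \<rho>", unfolded o_def])
         (use g h r in \<open>auto intro: holomorphic_on_subset\<close>)
    show "g (h w) \<in> ball a0 \<rho> \<and> f (g (h w)) = h w" if w: "w \<in> ball b0 r" for w
    proof -
      have "h w \<in> f ` ball a0 \<rho>" using r w by blast
      then obtain a where a: "a \<in> ball a0 \<rho>" "h w = f a" by blast
      then show ?thesis using g(2)[OF a(1)] by simp
    qed
    show "a = g (h w)" if "a \<in> ball a0 \<rho>" "f a = h w" for a w using g(2) that by metis
  qed (use r \<rho> in auto)
qed

subsection \<open>Algebraic sets\<close>

lemma algebraic_set_Un:
  assumes "algebraic_set N A" "algebraic_set N B" shows "algebraic_set N (A \<union> B)"
proof -
  obtain S where S: "\<forall>F\<in>S. \<exists>d. form N d F" "A = zero_locus N S" using assms(1) by (auto simp: algebraic_set_def)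
  obtain T where T: "\<forall>F\<in>T. \<exists>d. form N d F" "B = zero_locus N T" using assms(2) by (auto simp: algebraic_set_def)
  let ?U = "{F * G |F G. F \<in> S \<and> G \<in> T}"
  have "\<forall>F\<in>?U. \<exists>d. form N d F" using S T form_mult by blast
  moreover have "A \<union> B = zero_locus N ?U"
  proof (intro equalityI subsetI)
    fix x assume "x \<in> A \<union> B"
    then show "x \<in> zero_locus N ?U" by (auto simp: S T zero_locus_def poly_eval_mult)
  next
    fix x assume x: "x \<in> zero_locus N ?U"
    show "x \<in> A \<union> B"
    proof (cases "x \<in> A")
      case False
      then obtain F where F: "F \<in> S" "poly_eval F (rep_proj x) \<noteq> 0" using x by (auto simp: S zero_locus_def)
      have "poly_eval G (rep_proj x) = 0" if "G \<in> T" for G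
      proof -
        have "F * G \<in> ?U" using F that by blast
        then have "poly_eval (F * G) (rep_proj x) = 0" using x unfolding zero_locus_def by blast
        then show ?thesis using F by (simp add: poly_eval_mult)
      qed
      then show ?thesis using x by (auto simp: T zero_locus_def)
    qed simp
  qed
  ultimately show ?thesis unfolding algebraic_set_def by blast
qed

lemma algebraic_set_empty: "algebraic_set N {}"
  unfolding algebraic_set_def
  by (intro exI[of _ "{Const 1}"]) (auto simp: zero_locus_def intro: form_Const)

lemma algebraic_set_point:
  assumes "x \<in> proj_space N" shows "algebraic_set N {x}"
proof -
  define v where "v = rep_proj x"
  have v: "v \<in> hvec" "x = abs_proj v" "\<And>i. i > N \<Longrightarrow> v i = 0"
    using assms rep_proj_space by (auto simp: v_def)
  define S where "S = {Const (v i) * Var j - Const (v j) * Var i |i j. i \<le> N \<and> j \<le> N}"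
  have "\<forall>F\<in>S. \<exists>d. form N d F"
    unfolding S_def by (auto intro!: exI[of _ 1] form_diff form_Const_mult form_Var[unfolded One_nat_def])
  moreover have "{x} = zero_locus N S"
  proof (intro equalityI subsetI)
    fix y assume "y \<in> {x}"
    then show "y \<in> zero_locus N S" using assms v_def
      by (auto simp: zero_locus_def S_def poly_eval_simps)
  next
    fix y assume y: "y \<in> zero_locus N S"
    define w where "w = rep_proj y"
    have w: "w \<in> hvec" "y = abs_proj w" "\<And>i. i > N \<Longrightarrow> w i = 0"
      using y rep_proj_space by (auto simp: w_def zero_locus_def)
    have eq: "v i * w j = v j * w i" if "i \<le> N" "j \<le> N" for i j
    proof -
      have "poly_eval (Const (v i) * Var j - Const (v j) * Var i) w = 0"
        using y that unfolding zero_locus_def S_def w_def by blast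
      then show ?thesis by (simp add: poly_eval_simps)
    qed
    obtain i where i: "v i \<noteq> 0" using v by (auto simp: hvec_def)
    then have iN: "i \<le> N" using v(3) not_less by blast
    have wj: "w j = (w i / v i) * v j" for j
      using eq[OF iN, of j] i v(3)[of j] w(3)[of j] by (cases "j \<le> N") (auto simp: field_simps)
    obtain j where "w j \<noteq> 0" using w by (auto simp: hvec_def)
    then have "w i / v i \<noteq> 0" using wj by (metis mult_zero_left)
    moreover have "w = (\<lambda>j. (w i / v i) * v j)" using wj by blast
    ultimately have "abs_proj v = abs_proj w" using v w abs_proj_eq_iff by blast
    then show "y \<in> {x}" using v w by simp
  qed
  ultimately show ?thesis unfolding algebraic_set_def by blast
qed

lemma algebraic_set_finite:
  assumes "finite A" "A \<subseteq> proj_space N" shows "algebraic_set N A"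
  using assms
proof (induct A rule: finite_induct)
  case (insert x A)
  then show ?case using algebraic_set_Un[OF algebraic_set_point[of x N], of A] by simp
qed (rule algebraic_set_empty)

lemma algebraic_set_subset: "algebraic_set N A \<Longrightarrow> A \<subseteq> proj_space N"
  by (auto simp: algebraic_set_def zero_locus_def)

text \<open>Under the last assumption every proper algebraic subset is finite. An infinite set is
  not the union of two finite ones, which gives irreducibility. Finite sets are algebraic, so a
  finite variety has no proper subvariety, and the dimension is one.\<close>

lemma projective_curveI:
  assumes alg: "algebraic_set N X" and inf: "infinite X"
    and fin: "\<And>F d x. form N d F \<Longrightarrow> infinite {x \<in> X. poly_eval F (rep_proj x) = 0} \<Longrightarrow>
       x \<in> X \<Longrightarrow> poly_eval F (rep_proj x) = 0"
  shows "projective_curve N X"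
proof -
  have sub: "finite A" if A: "algebraic_set N A" "\<not> X \<subseteq> A" "A \<subseteq> X" for A
  proof -
    obtain S where S: "\<forall>F\<in>S. \<exists>d. form N d F" "A = zero_locus N S" using A(1) by (auto simp: algebraic_set_def)
    obtain x where x: "x \<in> X" "x \<notin> A" using A by blast
    then have "x \<in> proj_space N" using algebraic_set_subset[OF alg] by blast
    then obtain F where F: "F \<in> S" "poly_eval F (rep_proj x) \<noteq> 0" using x S by (auto simp: zero_locus_def)
    then obtain d where "form N d F" using S by blast
    then have "finite {x \<in> X. poly_eval F (rep_proj x) = 0}" using fin[OF _ _ x(1)] F(2) by blast
    moreover have "A \<subseteq> {x \<in> X. poly_eval F (rep_proj x) = 0}" using A(3) F S by (auto simp: zero_locus_def)
    ultimately show ?thesis using finite_subset by blast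
  qed
  have var: "variety N X" unfolding variety_def
  proof (intro conjI allI impI)
    show "X \<noteq> {}" using inf by auto
    fix A B assume AB: "algebraic_set N A" "algebraic_set N B" "X = A \<union> B"
    show "X = A \<or> X = B"
    proof (rule ccontr)
      assume "\<not> ?thesis"
      then have "finite A" "finite B" using sub[OF AB(1)] sub[OF AB(2)] AB(3) by blast+
      then show False using inf AB(3) by simp
    qed
  qed (rule alg)
  obtain x where x: "x \<in> X" using inf by fastforce
  then have xN: "x \<in> proj_space N" using algebraic_set_subset[OF alg] by blast
  have "variety N {x}" unfolding variety_def using algebraic_set_point[OF xN] by blast
  moreover have "{x} \<subset> X" using x inf by (metis finite.emptyI finite.insertI empty_subsetI insert_subset psubsetI)
  moreover have "\<not> (\<exists>Y Z. variety N Y \<and> variety N Z \<and> Y \<subset> Z \<and> Z \<subset> X)"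
  proof
    assume "\<exists>Y Z. variety N Y \<and> variety N Z \<and> Y \<subset> Z \<and> Z \<subset> X"
    then obtain Y Z where YZ: "variety N Y" "variety N Z" "Y \<subset> Z" "Z \<subset> X" by blast
    have "finite Z" by (rule sub) (use YZ in \<open>auto simp: variety_def\<close>)
    then have "algebraic_set N (Z - Y)" using YZ algebraic_set_subset[OF alg] by (intro algebraic_set_finite) auto
    moreover have "algebraic_set N Y" "Z = Y \<union> (Z - Y)" "Y \<noteq> {}" using YZ by (auto simp: variety_def)
    ultimately have "Z = Y \<or> Z = Z - Y" using YZ(2) unfolding variety_def by blast
    then show False using YZ \<open>Y \<noteq> {}\<close> by blast
  qed
  ultimately show ?thesis unfolding projective_curve_def using var by blast
qed

text \<open>Partial derivatives of forms are homogeneous as well, so the tangent space can be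
  computed with any coordinates of the point.\<close>

lemma tangent_space_abs:
  assumes "v \<in> hvec"
  shows "tangent_space N X (abs_proj v) = {abs_proj w |w. w \<in> hvec \<and> (\<forall>i>N. w i = 0) \<and>
     (\<forall>F d. form N d F \<longrightarrow> (\<forall>y\<in>X. poly_eval F (rep_proj y) = 0) \<longrightarrow>
        (\<Sum>i\<le>N. partial_deriv i F v * w i) = 0)}"
proof -
  obtain c where c: "c \<noteq> 0" "rep_proj (abs_proj v) = (\<lambda>i. c * v i)" using rep_abs_proj[OF assms] by blast
  have "(\<Sum>i\<le>N. partial_deriv i F (rep_proj (abs_proj v)) * w i) = 0 \<longleftrightarrow> (\<Sum>i\<le>N. partial_deriv i F v * w i) = 0"
    if F: "form N d F" for F d w
  proof -
    have "c * (\<Sum>i\<le>N. partial_deriv i F (\<lambda>i. c * v i) * w i) = c ^ d * (\<Sum>i\<le>N. partial_deriv i F v * w i)"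
      unfolding sum_distrib_left mult.assoc[symmetric]
      by (intro sum.cong refl arg_cong2[where f = "(*)"] partial_deriv_scale[OF F _ c(1)]) auto
    then show ?thesis unfolding c(2) using c(1) by auto
  qed
  then have "(\<forall>F d. form N d F \<longrightarrow> (\<forall>y\<in>X. poly_eval F (rep_proj y) = 0) \<longrightarrow>
        (\<Sum>i\<le>N. partial_deriv i F (rep_proj (abs_proj v)) * w i) = 0) \<longleftrightarrow>
      (\<forall>F d. form N d F \<longrightarrow> (\<forall>y\<in>X. poly_eval F (rep_proj y) = 0) \<longrightarrow>
        (\<Sum>i\<le>N. partial_deriv i F v * w i) = 0)" for w by blast
  then show ?thesis unfolding tangent_space_def by simp
qed

subsection \<open>Cyclic coverings of the projective line\<close>

text \<open>The curve \<open>y\<^sup>n = \<beta>(s, t)\<close> over the projective line, for a binary form \<open>\<beta>\<close> of degree \<open>nk\<close>,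
  embedded by \<open>(s\<^sup>k : s\<^bsup>k-1\<^esup>t : \<dots> : t\<^sup>k : y)\<close>. The boolean argument of \<open>pvec\<close> and \<open>bin1\<close> selects the
  affine part \<open>s = 1\<close> or \<open>t = 1\<close>.\<close>

locale cyclic_curve =
  fixes k n :: nat and b :: "nat \<Rightarrow> complex"
  assumes k1: "k \<ge> 1" and n2: "n \<ge> 2"
begin

definition bin :: "complex \<Rightarrow> complex \<Rightarrow> complex" where
  "bin s t = (\<Sum>j\<le>n * k. b j * s ^ (n * k - j) * t ^ j)"

definition cvec :: "complex \<Rightarrow> complex \<Rightarrow> complex \<Rightarrow> nat \<Rightarrow> complex" where
  "cvec s t y i = (if i \<le> k then s ^ (k - i) * t ^ i else if i = Suc k then y else 0)"

definition cpt where "cpt s t y = abs_proj (cvec s t y)"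

definition curve :: "proj set" where
  "curve = {cpt s t y |s t y. (s, t) \<noteq> (0, 0) \<and> y ^ n = bin s t}"

definition pvec :: "bool \<Rightarrow> complex \<Rightarrow> complex \<Rightarrow> nat \<Rightarrow> complex" where
  "pvec u z y = (if u then cvec 1 z y else cvec z 1 y)"

definition bin1 :: "bool \<Rightarrow> complex \<Rightarrow> complex" where
  "bin1 u z = (if u then bin 1 z else bin z 1)"

text \<open>Reversing the first \<open>k + 1\<close> coordinates exchanges the two affine parts, so
  that both can be treated by the same formulas.\<close>

definition ix :: "bool \<Rightarrow> nat \<Rightarrow> nat" where "ix u i = (if u then i else k - i)"

lemma ix_le: "i \<le> k \<Longrightarrow> ix u i \<le> k" by (simp add: ix_def)

lemma ix_ix: "i \<le> k \<Longrightarrow> ix u (ix u i) = i" by (simp add: ix_def)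

lemma pvec_ix: "i \<le> k \<Longrightarrow> pvec u z y (ix u i) = z ^ i"
  by (simp add: pvec_def ix_def cvec_def)

lemma pvec_eq: "pvec u z y i = (if i \<le> k then z ^ ix u i else if i = Suc k then y else 0)"
  by (simp add: pvec_def ix_def cvec_def)

lemma cvec_hvec: "(s, t) \<noteq> (0, 0) \<Longrightarrow> cvec s t y \<in> hvec"
proof (cases "s = 0")
  case True
  assume "(s, t) \<noteq> (0, 0)"
  then show ?thesis using True by (intro hvecI[of "Suc k" _ k]) (auto simp: cvec_def)
next
  case False then show ?thesis by (intro hvecI[of "Suc k" _ 0]) (auto simp: cvec_def)
qed

lemma pvec_hvec: "pvec u z y \<in> hvec"
  by (simp add: pvec_def cvec_hvec)

text \<open>The parametrization is homogeneous when \<open>s\<close> and \<open>t\<close> have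
  weight 1 and \<open>y\<close> has weight \<open>k\<close>; the equation of the curve is then
  homogeneous of weight \<open>n * k\<close>.\<close>

lemma cvec_scale: "cvec (l * s) (l * t) (l ^ k * y) = (\<lambda>i. l ^ k * cvec s t y i)"
proof
  fix i
  have "l ^ (k - i) * l ^ i = l ^ k" if "i \<le> k" using that by (simp flip: power_add)
  then show "cvec (l * s) (l * t) (l ^ k * y) i = l ^ k * cvec s t y i"
    by (auto simp: cvec_def power_mult_distrib)
qed

lemma cpt_scale: "l \<noteq> 0 \<Longrightarrow> (s, t) \<noteq> (0, 0) \<Longrightarrow> cpt (l * s) (l * t) (l ^ k * y) = cpt s t y"
  unfolding cpt_def cvec_scale by (rule abs_proj_scale) (auto intro: cvec_hvec)

lemma bin_scale: "bin (l * s) (l * t) = l ^ (n * k) * bin s t"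
  unfolding bin_def sum_distrib_left
proof (rule sum.cong[OF refl])
  fix j assume "j \<in> {..n * k}"
  then have "l ^ (n * k - j) * l ^ j = l ^ (n * k)" by (simp flip: power_add)
  then show "b j * (l * s) ^ (n * k - j) * (l * t) ^ j = l ^ (n * k) * (b j * s ^ (n * k - j) * t ^ j)"
    by (simp add: power_mult_distrib)
qed

lemma curve_patch:
  assumes "x \<in> curve" obtains u z y where "x = abs_proj (pvec u z y)" "y ^ n = bin1 u z"
proof -
  obtain s t y where x: "x = cpt s t y" "(s, t) \<noteq> (0, 0)" "y ^ n = bin s t" using assms by (auto simp: curve_def)
  have sc: "(inverse l ^ k * y) ^ n = bin (inverse l * s) (inverse l * t)" for l
    unfolding bin_scale using x(3) by (simp add: power_mult_distrib flip: power_mult) (simp add: mult.commute)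
  show ?thesis
  proof (cases "s = 0")
    case False
    then have "x = cpt 1 (inverse s * t) (inverse s ^ k * y)" using cpt_scale[of "inverse s" s t y] x by simp
    then show ?thesis using that[of True] sc[of s] False by (simp add: cpt_def pvec_def bin1_def)
  next
    case True
    then have "t \<noteq> 0" using x by simp
    then have "x = cpt (inverse t * s) 1 (inverse t ^ k * y)" using cpt_scale[of "inverse t" s t y] x by simp
    then show ?thesis using that[of False] sc[of t] \<open>t \<noteq> 0\<close> by (simp add: cpt_def pvec_def bin1_def)
  qed
qed

lemma ratio_pvec: "ratio (ix u 1) (ix u 0) (abs_proj (pvec u z y)) = z"
  "ratio (Suc k) (ix u 0) (abs_proj (pvec u z y)) = y" "rep_proj (abs_proj (pvec u z y)) (ix u 0) \<noteq> 0"
  using k1 by (simp_all add: ratio_abs pvec_hvec rep_abs_zero_iff pvec_ix[of 1, simplified] pvec_ix[of 0, simplified])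
     (simp add: pvec_eq)

lemma curve_ix:
  assumes "x \<in> curve" "rep_proj x (ix u 0) \<noteq> 0"
  defines "z \<equiv> ratio (ix u 1) (ix u 0) x" and "y \<equiv> ratio (Suc k) (ix u 0) x"
  shows "x = abs_proj (pvec u z y)" "y ^ n = bin1 u z"
proof -
  obtain s t w where x: "x = cpt s t w" "(s, t) \<noteq> (0, 0)" "w ^ n = bin s t" using assms by (auto simp: curve_def)
  define l where "l = (if u then s else t)"
  have "cvec s t w (ix u 0) = l ^ k" by (auto simp: cvec_def ix_def l_def)
  then have l: "l \<noteq> 0" using assms(2) x(1) k1 by (auto simp: cpt_def rep_abs_zero_iff cvec_hvec[OF x(2)])
  define y' where "y' = inverse l ^ k * w"
  define z' where "z' = inverse l * (if u then t else s)"
  have x': "x = abs_proj (pvec u z' y')"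
    using cpt_scale[of "inverse l" s t w] x l by (auto simp: cpt_def pvec_def z'_def y'_def l_def split: if_splits)
  have "y' ^ n = bin (inverse l * s) (inverse l * t)" unfolding bin_scale y'_def
    using x(3) by (simp add: power_mult_distrib flip: power_mult) (simp add: mult.commute)
  then have yn: "y' ^ n = bin1 u z'" using l by (auto simp: bin1_def z'_def l_def split: if_splits)
  have "z = z'" "y = y'" unfolding z_def y_def x' by (rule ratio_pvec)+
  with x' yn show "x = abs_proj (pvec u z y)" "y ^ n = bin1 u z" by simp_all
qed

lemma pvec_in_curve: "y ^ n = bin1 u z \<Longrightarrow> abs_proj (pvec u z y) \<in> curve"
proof -
  assume y: "y ^ n = bin1 u z"
  define s t where "s = (if u then 1 else z)" and "t = (if u then z else 1)"
  have "abs_proj (pvec u z y) = cpt s t y \<and> (s, t) \<noteq> (0, 0) \<and> y ^ n = bin s t"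
    using y by (simp add: s_def t_def pvec_def cpt_def bin1_def split: if_splits)
  then show ?thesis unfolding curve_def by blast
qed

lemma bin1_holomorphic: "bin1 u holomorphic_on S"
proof -
  have "(\<lambda>z. bin1 u z) holomorphic_on S"
    by (cases u) (auto simp: bin1_def bin_def intro!: holomorphic_intros)
  then show ?thesis by simp
qed

lemma pvec_holomorphic:
  assumes "\<phi> holomorphic_on D" "\<eta> holomorphic_on D"
  shows "(\<lambda>w. pvec u (\<phi> w) (\<eta> w) i) holomorphic_on D"
  unfolding pvec_eq by (cases "i \<le> k"; cases "i = Suc k") (use assms in \<open>auto intro!: holomorphic_intros\<close>)

lemma bin_continuous: "continuous_on UNIV (\<lambda>(s, t). bin s t)"
  unfolding bin_def case_prod_unfold by (intro continuous_intros)

lemma cpt_continuous: "continuous_on {p. (fst p, fst (snd p)) \<noteq> (0, 0)} (\<lambda>(s, t, y). cpt s t y)"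
proof -
  have "continuous_on S (\<lambda>p. cvec (fst p) (fst (snd p)) (snd (snd p)) i)" for i S
    by (cases "i \<le> k"; cases "i = Suc k") (auto simp: cvec_def intro!: continuous_intros)
  then show ?thesis unfolding cpt_def case_prod_unfold
    by (intro continuous_on_into_proj cvec_hvec) auto
qed

text \<open>Every point can be scaled so that the larger of |s| and |t| is 1. Then the binary form
  is bounded, and the equation bounds \<open>y\<close>.\<close>

lemma compact_curve: "compact curve"
proof -
  define M where "M = (\<Sum>j\<le>n * k. cmod (b j))"
  define K where "K = {p. max (cmod (fst p)) (cmod (fst (snd p))) = 1 \<and>
      snd (snd p) ^ n = bin (fst p) (fst (snd p))}"
  have "closed K" unfolding K_def bin_def
    by (intro closed_Collect_conj closed_Collect_eq continuous_intros)
  moreover have "K \<subseteq> cball 0 1 \<times> cball 0 1 \<times> cball 0 (1 + M)"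
  proof
    fix p assume p: "p \<in> K"
    obtain s t y where pq: "p = (s, t, y)" by (cases p) auto
    have st: "cmod s \<le> 1" "cmod t \<le> 1" "y ^ n = bin s t" using p by (auto simp: K_def pq)
    have "cmod (bin s t) \<le> M" unfolding bin_def M_def
    proof (rule sum_norm_le)
      fix j
      have "cmod s ^ (n * k - j) \<le> 1" "cmod t ^ j \<le> 1" using st by (auto intro: power_le_one)
      then have "cmod (b j) * (cmod s ^ (n * k - j) * cmod t ^ j) \<le> cmod (b j) * 1"
        by (intro mult_left_mono mult_le_one) auto
      then show "cmod (b j * s ^ (n * k - j) * t ^ j) \<le> cmod (b j)"
        by (simp add: norm_mult norm_power mult.assoc)
    qed
    then have yM: "cmod y ^ n \<le> M" using st by (simp flip: norm_power)
    have "M \<ge> 0" by (simp add: M_def sum_nonneg)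
    have "cmod y \<le> 1 + M"
    proof (cases "cmod y \<le> 1")
      case False
      then have "cmod y ^ 1 \<le> cmod y ^ n" using n2 by (intro power_increasing) auto
      then show ?thesis using yM by simp
    qed (use \<open>M \<ge> 0\<close> in simp)
    then show "p \<in> cball 0 1 \<times> cball 0 1 \<times> cball 0 (1 + M)" using st by (simp add: pq)
  qed
  moreover have "compact (cball (0::complex) 1 \<times> cball (0::complex) 1 \<times> cball (0::complex) (1 + M))"
    by (intro compact_Times compact_cball)
  ultimately have "compact K" by (metis closed_Int_compact inf.absorb_iff1)
  moreover have "continuous_on K (\<lambda>(s, t, y). cpt s t y)"
    by (rule continuous_on_subset[OF cpt_continuous]) (auto simp: K_def)
  moreover have "curve = (\<lambda>(s, t, y). cpt s t y) ` K"
  proof (intro equalityI subsetI)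
    fix x assume "x \<in> curve"
    then obtain s t y where x: "x = cpt s t y" "(s, t) \<noteq> (0, 0)" "y ^ n = bin s t" by (auto simp: curve_def)
    define m where "m = max (cmod s) (cmod t)"
    have m: "m > 0" using x(2) by (auto simp: m_def less_max_iff_disj)
    define l where "l = complex_of_real (inverse m)"
    have l: "l \<noteq> 0" "cmod l = inverse m" using m by (auto simp: l_def norm_inverse)
    have "max (cmod (l * s)) (cmod (l * t)) = inverse m * m"
      using m by (simp add: norm_mult l m_def max_mult_distrib_left)
    then have mx: "max (cmod (l * s)) (cmod (l * t)) = 1" using m by simp
    have "(l ^ k * y) ^ n = bin (l * s) (l * t)" unfolding bin_scale using x(3)
      by (simp add: power_mult_distrib flip: power_mult) (simp add: mult.commute)
    then have "(l * s, l * t, l ^ k * y) \<in> K" using mx by (simp add: K_def)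
    then show "x \<in> (\<lambda>(s, t, y). cpt s t y) ` K"
      using cpt_scale[OF l(1) x(2), of y] x(1) by (intro image_eqI[of _ _ "(l * s, l * t, l ^ k * y)"]) auto
  next
    fix x assume "x \<in> (\<lambda>(s, t, y). cpt s t y) ` K"
    then show "x \<in> curve" by (force simp: K_def curve_def)
  qed
  ultimately show ?thesis by (simp add: compact_continuous_image)
qed

end

locale smooth_cyclic_curve = cyclic_curve +
  assumes squarefree: "\<And>u z. bin1 u z = 0 \<Longrightarrow> deriv (bin1 u) z \<noteq> 0"
    and has_root: "\<exists>s t. (s, t) \<noteq> (0, 0) \<and> bin s t = 0"
begin

text \<open>If \<open>y0\<close> is not zero, the n-th power is locally invertible and
  \<open>z\<close> is a local parameter. If \<open>y0\<close> is zero, \<open>z0\<close> is a simple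
  zero of the binary form and \<open>y\<close> is a local parameter. The parametrization is returned
  along with the chart, since its velocity will span the tangent line.\<close>

lemma affine_chart:
  assumes "y0 ^ n = bin1 u z0"
  obtains r \<phi> \<eta> where "r > 0" "\<phi> holomorphic_on ball 0 r" "\<eta> holomorphic_on ball 0 r"
    "\<phi> 0 = z0" "\<eta> 0 = y0" "\<And>\<zeta>. \<zeta> \<in> ball 0 r \<Longrightarrow> \<eta> \<zeta> ^ n = bin1 u (\<phi> \<zeta>)"
    "deriv \<phi> 0 \<noteq> 0 \<or> deriv \<eta> 0 \<noteq> 0" "chart curve (ball 0 r) (\<lambda>\<zeta>. abs_proj (pvec u (\<phi> \<zeta>) (\<eta> \<zeta>)))"
proof -
  let ?Z = "ratio (ix u 1) (ix u 0)" and ?Y = "ratio (Suc k) (ix u 0)"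
  \<comment> \<open>What the two cases share: \<open>\<psi>\<close> recovers the parameter from the
    affine coordinates \<open>z\<close> and \<open>y\<close>, which are continuous functions on
    their patch of projective space.\<close>
  have chartI: "chart curve (ball 0 r) (\<lambda>\<zeta>. abs_proj (pvec u (\<phi> \<zeta>) (\<eta> \<zeta>)))"
    if r: "r > 0" and hol: "\<phi> holomorphic_on ball 0 r" "\<eta> holomorphic_on ball 0 r"
      and on: "\<And>\<zeta>. \<zeta> \<in> ball 0 r \<Longrightarrow> \<eta> \<zeta> ^ n = bin1 u (\<phi> \<zeta>)"
      and A: "open A" "open B" "\<And>\<zeta>. \<zeta> \<in> ball 0 r \<Longrightarrow> \<phi> \<zeta> \<in> A \<and> \<eta> \<zeta> \<in> B"
      and inv: "\<And>z y. z \<in> A \<Longrightarrow> y \<in> B \<Longrightarrow> y ^ n = bin1 u z \<Longrightarrow>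
        \<psi> z y \<in> ball 0 r \<and> \<phi> (\<psi> z y) = z \<and> \<eta> (\<psi> z y) = y"
      and inv2: "\<And>\<zeta>. \<zeta> \<in> ball 0 r \<Longrightarrow> \<psi> (\<phi> \<zeta>) (\<eta> \<zeta>) = \<zeta>"
      and cont: "continuous_on UNIV (\<lambda>(z, y). \<psi> z y)" for r \<phi> \<eta> \<psi> A B
  proof -
    define g where "g \<zeta> = abs_proj (pvec u (\<phi> \<zeta>) (\<eta> \<zeta>))" for \<zeta>
    define O' where "O' = {x. rep_proj x (ix u 0) \<noteq> 0} \<inter> ({x. rep_proj x (ix u 0) \<noteq> 0} \<inter> ?Z -` A) \<inter>
      ({x. rep_proj x (ix u 0) \<noteq> 0} \<inter> ?Y -` B)"
    have "open O'" unfolding O'_def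
      by (intro open_Int open_rep_nonzero continuous_open_preimage continuous_on_ratio A) auto
    have im: "g ` ball 0 r = curve \<inter> O'"
    proof (intro equalityI subsetI)
      fix x assume "x \<in> g ` ball 0 r"
      then obtain \<zeta> where z: "\<zeta> \<in> ball 0 r" "x = g \<zeta>" by blast
      then show "x \<in> curve \<inter> O'" using on A(3) ratio_pvec
        by (auto simp: g_def O'_def intro!: pvec_in_curve)
    next
      fix x assume x: "x \<in> curve \<inter> O'"
      then have "x = abs_proj (pvec u (?Z x) (?Y x))" "?Y x ^ n = bin1 u (?Z x)" "?Z x \<in> A" "?Y x \<in> B"
        using curve_ix[of x u] by (auto simp: O'_def)
      then show "x \<in> g ` ball 0 r" using inv[of "?Z x" "?Y x"]
        by (intro image_eqI[of _ _ "\<psi> (?Z x) (?Y x)"]) (auto simp: g_def)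
    qed
    have "holomorphic_lift (ball 0 r) (\<lambda>\<zeta>. pvec u (\<phi> \<zeta>) (\<eta> \<zeta>)) g"
      by (simp add: holomorphic_lift_def g_def pvec_hvec pvec_holomorphic hol)
    then have ph: "proj_holomorphic_on g (ball 0 r)" unfolding proj_holomorphic_on_def by blast
    have id: "\<psi> (?Z (g \<zeta>)) (?Y (g \<zeta>)) = \<zeta>" if "\<zeta> \<in> ball 0 r" for \<zeta>
      unfolding g_def ratio_pvec by (rule inv2[OF that])
    have "homeomorphism (ball 0 r) (g ` ball 0 r) g (\<lambda>x. \<psi> (?Z x) (?Y x))"
    proof (rule homeomorphismI)
      show "continuous_on (ball 0 r) g" using proj_holomorphic_on_imp_continuous[OF ph open_ball] .
      have "continuous_on (g ` ball 0 r) (\<lambda>x. (?Z x, ?Y x))" unfolding im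
        by (intro continuous_on_Pair continuous_on_ratio) (auto simp: O'_def)
      then show "continuous_on (g ` ball 0 r) (\<lambda>x. \<psi> (?Z x) (?Y x))"
        using continuous_on_compose2[OF cont, of "g ` ball 0 r" "\<lambda>x. (?Z x, ?Y x)"] by simp
    qed (use id in auto)
    moreover have "openin (top_of_set curve) (g ` ball 0 r)" unfolding im using \<open>open O'\<close> by (auto simp: openin_open)
    ultimately have "chart curve (ball 0 r) g" unfolding chart_def using ph by blast
    then show ?thesis by (simp add: g_def[abs_def])
  qed
  have d1: "deriv (\<lambda>z. z + c) 0 = 1" "deriv (\<lambda>z. c + z) 0 = 1" for c :: complex
    by (auto intro!: DERIV_imp_deriv derivative_eq_intros)
  have hp: "(\<lambda>y::complex. y ^ n) holomorphic_on UNIV" by (intro holomorphic_intros)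
  show ?thesis
  proof (cases "y0 = 0")
    case False
    have "((\<lambda>y. y ^ n) has_field_derivative of_nat n * y0 ^ (n - 1)) (at y0)"
      by (auto intro!: derivative_eq_intros)
    then have dn: "deriv (\<lambda>y. y ^ n) y0 \<noteq> 0" using False n2 by (simp add: DERIV_imp_deriv)
    obtain r \<rho> \<phi> where *: "r > 0" "\<rho> > 0" "\<phi> holomorphic_on ball z0 r"
      "\<And>w. w \<in> ball z0 r \<Longrightarrow> \<phi> w \<in> ball y0 \<rho> \<and> \<phi> w ^ n = bin1 u w"
      "\<And>a w. a \<in> ball y0 \<rho> \<Longrightarrow> w \<in> ball z0 r \<Longrightarrow> a ^ n = bin1 u w \<Longrightarrow> a = \<phi> w"
      by (rule separated_implicit_function[OF hp bin1_holomorphic assms dn]) (rule that)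
    have b: "z0 + \<zeta> \<in> ball z0 r" if "\<zeta> \<in> ball 0 r" for \<zeta> using that by (simp add: dist_norm)
    have b': "z - z0 \<in> ball 0 r" if "z \<in> ball z0 r" for z using that by (simp add: dist_norm norm_minus_commute)
    have hol: "(\<lambda>\<zeta>. \<phi> (z0 + \<zeta>)) holomorphic_on ball 0 r"
      by (rule holomorphic_on_compose_gen[of "\<lambda>\<zeta>. z0 + \<zeta>" _ \<phi> "ball z0 r", unfolded o_def])
         (use * b in \<open>auto intro!: holomorphic_intros\<close>)
    show ?thesis
    proof
      show "chart curve (ball 0 r) (\<lambda>\<zeta>. abs_proj (pvec u (z0 + \<zeta>) (\<phi> (z0 + \<zeta>))))"
      proof (rule chartI[of r _ _ "ball z0 r" "ball y0 \<rho>" "\<lambda>z y. z - z0"])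
        show "\<phi> (z0 + \<zeta>) ^ n = bin1 u (z0 + \<zeta>)" if "\<zeta> \<in> ball 0 r" for \<zeta>
          using *(4)[OF b[OF that]] by blast
        show "z0 + \<zeta> \<in> ball z0 r \<and> \<phi> (z0 + \<zeta>) \<in> ball y0 \<rho>" if "\<zeta> \<in> ball 0 r" for \<zeta>
          using *(4)[OF b[OF that]] b[OF that] by blast
        show "z - z0 \<in> ball 0 r \<and> z0 + (z - z0) = z \<and> \<phi> (z0 + (z - z0)) = y"
          if "z \<in> ball z0 r" "y \<in> ball y0 \<rho>" "y ^ n = bin1 u z" for z y
          using *(5)[OF that(2,1)] that(3) b'[OF that(1)] by simp
        show "continuous_on UNIV (\<lambda>(z, y :: complex). z - z0)"
          unfolding case_prod_unfold by (intro continuous_intros)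
      qed (use *(1) hol in \<open>auto intro!: holomorphic_intros\<close>)
      show "\<phi> (z0 + 0) = y0" using *(5)[of y0 z0] *(1,2) assms by simp
    qed (use * b hol d1 in \<open>auto intro!: holomorphic_intros\<close>)
  next
    case True
    then have "bin1 u z0 = 0" using assms n2 by (simp add: power_0_left)
    then have dn: "deriv (bin1 u) z0 \<noteq> 0" by (rule squarefree)
    obtain r \<rho> \<phi> where *: "r > 0" "\<rho> > 0" "\<phi> holomorphic_on ball y0 r"
      "\<And>w. w \<in> ball y0 r \<Longrightarrow> \<phi> w \<in> ball z0 \<rho> \<and> bin1 u (\<phi> w) = w ^ n"
      "\<And>a w. a \<in> ball z0 \<rho> \<Longrightarrow> w \<in> ball y0 r \<Longrightarrow> bin1 u a = w ^ n \<Longrightarrow> a = \<phi> w"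
      by (rule separated_implicit_function[OF bin1_holomorphic hp assms[symmetric] dn]) (rule that)
    have s4: "w ^ n = bin1 u (\<phi> w)" if "w \<in> ball y0 r" for w using *(4)[OF that] by simp
    have b: "y0 + \<zeta> \<in> ball y0 r" if "\<zeta> \<in> ball 0 r" for \<zeta> using that by (simp add: dist_norm)
    have b': "z - y0 \<in> ball 0 r" if "z \<in> ball y0 r" for z using that by (simp add: dist_norm norm_minus_commute)
    have hol: "(\<lambda>\<zeta>. \<phi> (y0 + \<zeta>)) holomorphic_on ball 0 r"
      by (rule holomorphic_on_compose_gen[of "\<lambda>\<zeta>. y0 + \<zeta>" _ \<phi> "ball y0 r", unfolded o_def])
         (use * b in \<open>auto intro!: holomorphic_intros\<close>)
    show ?thesis
    proof
      show "chart curve (ball 0 r) (\<lambda>\<zeta>. abs_proj (pvec u (\<phi> (y0 + \<zeta>)) (y0 + \<zeta>)))"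
      proof (rule chartI[of r _ _ "ball z0 \<rho>" "ball y0 r" "\<lambda>z y. y - y0"])
        show "(y0 + \<zeta>) ^ n = bin1 u (\<phi> (y0 + \<zeta>))" if "\<zeta> \<in> ball 0 r" for \<zeta>
          using s4[OF b[OF that]] .
        show "\<phi> (y0 + \<zeta>) \<in> ball z0 \<rho> \<and> y0 + \<zeta> \<in> ball y0 r" if "\<zeta> \<in> ball 0 r" for \<zeta>
          using *(4)[OF b[OF that]] b[OF that] by blast
        show "y - y0 \<in> ball 0 r \<and> \<phi> (y0 + (y - y0)) = z \<and> y0 + (y - y0) = y"
          if "z \<in> ball z0 \<rho>" "y \<in> ball y0 r" "y ^ n = bin1 u z" for z y
          using *(5)[OF that(1,2)] that(3) b'[OF that(2)] by simp
        show "continuous_on UNIV (\<lambda>(z :: complex, y). y - y0)"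
          unfolding case_prod_unfold by (intro continuous_intros)
      qed (use *(1) hol in \<open>auto intro!: holomorphic_intros\<close>)
      show "\<phi> (y0 + 0) = z0" using *(5)[of z0 y0] *(1,2) assms by simp
    qed (use * b hol d1 in \<open>auto intro!: holomorphic_intros\<close>)
  qed
qed

lemma infinite_curve: "infinite curve"
proof -
  obtain y where "y ^ n = bin1 True 0"
  proof (cases "bin1 True 0 = 0")
    case True
    then show ?thesis using that[of 0] n2 by simp
  next
    case False
    then have "card {y. y ^ n = bin1 True 0} = n" using n2 by (intro card_nth_roots) auto
    then have "{y. y ^ n = bin1 True 0} \<noteq> {}" using n2 by (metis card.empty not_numeral_le_zero)
    then show ?thesis using that by blast
  qed
  then obtain r \<phi> \<eta> where r: "r > 0" and c: "chart curve (ball 0 r) (\<lambda>\<zeta>. abs_proj (pvec True (\<phi> \<zeta>) (\<eta> \<zeta>)))"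
    by (rule affine_chart)
  have "infinite (ball (0::complex) r)" using uncountable_ball[OF r] countable_finite by blast
  moreover note chart_homeomorphism_inj[OF c] chart_image[OF c]
  ultimately show ?thesis using finite_imageD finite_subset by blast
qed

text \<open>A clopen part of the curve projects onto a clopen part of the line, hence onto the line,
  so it contains the point over a zero of the binary form.\<close>

lemma connected_curve: "connected curve"
proof -
  define P where "P = - {(0::complex, 0::complex)}"
  have connP: "connected P" unfolding P_def by (rule connected_punctured_universe) simp
  \<comment> \<open>The projection is taken in the punctured plane of pairs \<open>(s, t)\<close>
    instead of the projective line, because the former is known to be connected.\<close>
  define q where "q U = {(s, t). (s, t) \<in> P \<and> (\<exists>y. y ^ n = bin s t \<and> cpt s t y \<in> U)}" for U
  have near: "\<exists>\<delta>>0. \<forall>s' t' y'. dist s' s < \<delta> \<and> dist t' t < \<delta> \<and> dist y' y < \<delta> \<and> y' ^ n = bin s' t' \<longrightarrow>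
      (s', t') \<in> P \<and> cpt s' t' y' \<in> U"
    if U: "openin (top_of_set curve) U" "(s, t) \<in> P" "cpt s t y \<in> U" for U s t y
  proof -
    obtain T where T: "open T" "U = curve \<inter> T" using U by (auto simp: openin_open)
    let ?D = "{p. (fst p, fst (snd p)) \<noteq> (0::complex, 0::complex)} :: (complex \<times> complex \<times> complex) set"
    have "open ?D"
    proof -
      have "?D = {p. fst p \<noteq> 0} \<union> {p. fst (snd p) \<noteq> 0}" by auto
      moreover have "open \<dots>" by (intro open_Un open_Collect_neq continuous_intros)
      ultimately show ?thesis by simp
    qed
    define W where "W = ?D \<inter> (\<lambda>(s, t, y). cpt s t y) -` T"
    have W: "(s', t', y') \<in> W \<longleftrightarrow> (s', t') \<noteq> (0, 0) \<and> cpt s' t' y' \<in> T" for s' t' y'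
      by (simp add: W_def)
    have "open W" unfolding W_def by (rule continuous_open_preimage[OF cpt_continuous \<open>open ?D\<close> T(1)])
    moreover have "(s, t, y) \<in> W" using U T by (simp add: W P_def)
    ultimately obtain \<delta> where \<delta>: "\<delta> > 0" "ball (s, t, y) \<delta> \<subseteq> W" using openE by blast
    show ?thesis
    proof (intro exI[of _ "\<delta> / 3"] conjI allI impI)
      fix s' t' y' assume a: "dist s' s < \<delta> / 3 \<and> dist t' t < \<delta> / 3 \<and> dist y' y < \<delta> / 3 \<and> y' ^ n = bin s' t'"
      have "dist (s, t, y) (s', t', y') \<le> dist s s' + dist (t, y) (t', y')"
        by (subst dist_Pair_Pair) (rule sqrt_sum_squares_le_sum; simp)
      moreover have "dist (t, y) (t', y') \<le> dist t t' + dist y y'"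
        by (subst dist_Pair_Pair) (rule sqrt_sum_squares_le_sum; simp)
      ultimately have "(s', t', y') \<in> ball (s, t, y) \<delta>" using a by (simp add: dist_commute)
      then have "(s', t', y') \<in> W" by (rule subsetD[OF \<delta>(2)])
      then have 1: "(s', t') \<noteq> (0, 0) \<and> cpt s' t' y' \<in> T" by (rule W[THEN iffD1])
      then have "cpt s' t' y' \<in> curve" using a unfolding curve_def by blast
      with 1 show "(s', t') \<in> P" "cpt s' t' y' \<in> U" using T by (auto simp: P_def)
    qed (use \<delta> in simp)
  qed
  have bin_near: "\<exists>\<epsilon>>0. \<forall>s' t'. dist s' s < \<epsilon> \<and> dist t' t < \<epsilon> \<longrightarrow> cmod (bin s t - bin s' t') < \<delta>"
    if "\<delta> > 0" for s t and \<delta> :: real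
  proof -
    have "open ((\<lambda>(s, t). bin s t) -` ball (bin s t) \<delta>)" by (rule open_vimage[OF open_ball bin_continuous])
    moreover have "(s, t) \<in> (\<lambda>(s, t). bin s t) -` ball (bin s t) \<delta>" using that by simp
    ultimately obtain \<epsilon> where \<epsilon>: "\<epsilon> > 0" "ball (s, t) \<epsilon> \<subseteq> (\<lambda>(s, t). bin s t) -` ball (bin s t) \<delta>" using openE by blast
    show ?thesis
    proof (intro exI[of _ "\<epsilon> / 2"] conjI allI impI)
      fix s' t' assume a: "dist s' s < \<epsilon> / 2 \<and> dist t' t < \<epsilon> / 2"
      have "dist (s, t) (s', t') \<le> dist s s' + dist t t'" unfolding dist_Pair_Pair
        by (rule sqrt_sum_squares_le_sum) auto
      then have "(s', t') \<in> ball (s, t) \<epsilon>" using a by (simp add: dist_commute)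
      then have "(s', t') \<in> (\<lambda>(s, t). bin s t) -` ball (bin s t) \<delta>" by (rule subsetD[OF \<epsilon>(2)])
      then show "cmod (bin s t - bin s' t') < \<delta>" by (simp add: dist_norm)
    qed (use \<epsilon> in simp)
  qed
  have prodball: "\<exists>V. open V \<and> p \<in> V \<and> (\<forall>s' t'. (s', t') \<in> V \<longrightarrow> dist s' (fst p) < \<epsilon> \<and> dist t' (snd p) < \<epsilon>)"
    if "\<epsilon> > 0" for p :: "complex \<times> complex" and \<epsilon> :: real
    by (intro exI[of _ "ball (fst p) \<epsilon> \<times> ball (snd p) \<epsilon>"])
       (use that in \<open>auto simp: open_Times dist_commute mem_Times_iff\<close>)
  have npos: "n > 0" using n2 by simp
  have q_open: "open (q U)" if U: "openin (top_of_set curve) U" for U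
  proof (subst open_subopen, intro ballI)
    fix p assume "p \<in> q U"
    then obtain s t y where p: "p = (s, t)" "(s, t) \<in> P" "y ^ n = bin s t" "cpt s t y \<in> U" by (auto simp: q_def)
    obtain \<delta> where \<delta>: "\<delta> > 0" "\<And>s' t' y'. dist s' s < \<delta> \<Longrightarrow> dist t' t < \<delta> \<Longrightarrow> dist y' y < \<delta> \<Longrightarrow>
        y' ^ n = bin s' t' \<Longrightarrow> (s', t') \<in> P \<and> cpt s' t' y' \<in> U" using near[OF U p(2,4)] by blast
    obtain \<epsilon> where \<epsilon>: "\<epsilon> > 0" "\<And>s' t'. dist s' s < \<epsilon> \<Longrightarrow> dist t' t < \<epsilon> \<Longrightarrow> cmod (bin s t - bin s' t') < \<delta> ^ n"
      using bin_near[of "\<delta> ^ n" s t] \<delta> by auto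
    obtain V where V: "open V" "p \<in> V" "\<And>s' t'. (s', t') \<in> V \<Longrightarrow> dist s' s < min \<delta> \<epsilon> \<and> dist t' t < min \<delta> \<epsilon>"
      using prodball[of "min \<delta> \<epsilon>" p] \<delta> \<epsilon> p by auto
    have "V \<subseteq> q U"
    proof
      fix v assume v: "v \<in> V"
      obtain s' t' where st: "v = (s', t')" by (cases v)
      have d: "dist s' s < min \<delta> \<epsilon>" "dist t' t < min \<delta> \<epsilon>" using V v st by auto
      have "cmod (y ^ n - bin s' t') < \<delta> ^ n" using \<epsilon>(2)[of s' t'] d p by simp
      then obtain y' where "y' ^ n = bin s' t'" "cmod (y' - y) < \<delta>" using nth_root_near npos \<delta>(1) by blast
      then show "v \<in> q U" using \<delta>(2)[of s' t' y'] d by (auto simp: st q_def dist_norm)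
    qed
    with V show "\<exists>T. open T \<and> p \<in> T \<and> T \<subseteq> q U" by blast
  qed
  have q_closed: "open (P - q U)" if U: "openin (top_of_set curve) (curve - U)" for U
  proof (subst open_subopen, intro ballI)
    fix p assume "p \<in> P - q U"
    then obtain s t where p: "p = (s, t)" "(s, t) \<in> P" "\<And>y. y ^ n = bin s t \<Longrightarrow> cpt s t y \<notin> U"
      by (cases p) (auto simp: q_def)
    let ?R = "{y. y ^ n = bin s t}"
    have fin: "finite ?R" by (rule finite_nth_roots[OF npos])
    have "\<exists>\<delta>>0. \<forall>s' t' y'. dist s' s < \<delta> \<and> dist t' t < \<delta> \<and> dist y' y < \<delta> \<and> y' ^ n = bin s' t' \<longrightarrow>
      (s', t') \<in> P \<and> cpt s' t' y' \<in> curve - U" if "y \<in> ?R" for y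
      by (rule near[OF U p(2)]) (use p that in \<open>auto simp: curve_def P_def\<close>)
    then have "\<forall>y\<in>?R. \<exists>\<delta>. \<delta> > 0 \<and> (\<forall>s' t' y'. dist s' s < \<delta> \<and> dist t' t < \<delta> \<and> dist y' y < \<delta> \<and> y' ^ n = bin s' t' \<longrightarrow>
      (s', t') \<in> P \<and> cpt s' t' y' \<in> curve - U)" by blast
    from bchoice[OF this] obtain D where D: "\<forall>y\<in>?R. D y > 0 \<and> (\<forall>s' t' y'. dist s' s < D y \<and> dist t' t < D y \<and>
      dist y' y < D y \<and> y' ^ n = bin s' t' \<longrightarrow> (s', t') \<in> P \<and> cpt s' t' y' \<in> curve - U)" by (elim exE)
    define \<delta> where "\<delta> = Min (insert 1 (D ` ?R))"
    have \<delta>: "\<delta> > 0" "\<And>y. y \<in> ?R \<Longrightarrow> \<delta> \<le> D y" using fin D by (auto simp: \<delta>_def)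
    obtain \<epsilon> where \<epsilon>: "\<epsilon> > 0" "\<And>s' t'. dist s' s < \<epsilon> \<Longrightarrow> dist t' t < \<epsilon> \<Longrightarrow> cmod (bin s t - bin s' t') < \<delta> ^ n"
      using bin_near[of "\<delta> ^ n" s t] \<delta>(1) by auto
    have "open P" unfolding P_def by (intro open_Compl) simp
    obtain V where V: "open V" "p \<in> V" "\<And>s' t'. (s', t') \<in> V \<Longrightarrow> dist s' s < min \<delta> \<epsilon> \<and> dist t' t < min \<delta> \<epsilon>"
      using prodball[of "min \<delta> \<epsilon>" p] \<delta> \<epsilon> p by auto
    have "V \<inter> P \<subseteq> P - q U"
    proof
      fix v assume v: "v \<in> V \<inter> P"
      obtain s' t' where st: "v = (s', t')" by (cases v)
      have d: "dist s' s < min \<delta> \<epsilon>" "dist t' t < min \<delta> \<epsilon>" using V v st by auto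
      have "cpt s' t' y' \<notin> U" if y': "y' ^ n = bin s' t'" for y'
      proof -
        have "cmod (y' ^ n - bin s t) < \<delta> ^ n" using \<epsilon>(2)[of s' t'] d y' by (simp add: norm_minus_commute)
        then obtain y where y: "y ^ n = bin s t" "cmod (y - y') < \<delta>" using nth_root_near npos \<delta>(1) by blast
        then have "dist s' s < D y" "dist t' t < D y" "dist y' y < D y" using d \<delta>(2)[of y]
          by (auto simp: dist_norm norm_minus_commute)
        then show ?thesis using D y y' by blast
      qed
      then show "v \<in> P - q U" using v by (auto simp: st q_def)
    qed
    with V p \<open>open P\<close> show "\<exists>T. open T \<and> p \<in> T \<and> T \<subseteq> P - q U"
      by (intro exI[of _ "V \<inter> P"]) auto
  qed
  obtain s0 t0 where r: "(s0, t0) \<noteq> (0, 0)" "bin s0 t0 = 0" using has_root by blast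
  have all: "cpt s0 t0 0 \<in> U" if U: "openin (top_of_set curve) U" "openin (top_of_set curve) (curve - U)" "U \<noteq> {}" for U
  proof -
    have "U \<subseteq> curve" using U(1) openin_subset by fastforce
    obtain x where x: "x \<in> U" using U(3) by blast
    then have "x \<in> curve" using \<open>U \<subseteq> curve\<close> by blast
    then obtain s t y where "x = cpt s t y" "(s, t) \<noteq> (0, 0)" "y ^ n = bin s t" unfolding curve_def by blast
    then have "(s, t) \<noteq> (0, 0)" "y ^ n = bin s t" "cpt s t y \<in> U" using x by auto
    then have ne: "q U \<noteq> {}" by (auto simp: q_def P_def)
    have "q U \<subseteq> P" by (auto simp: q_def)
    then have "q U = P \<inter> q U" "P - q U = P \<inter> (P - q U)" by auto
    then have "openin (top_of_set P) (q U)" "openin (top_of_set P) (P - q U)"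
      using q_open[OF U(1)] q_closed[OF U(2)] by (metis openin_open)+
    then have "q U = {} \<or> q U = P" using connP unfolding connected_clopen closedin_def
      using \<open>q U \<subseteq> P\<close> by auto
    then have "(s0, t0) \<in> q U" using ne r by (auto simp: P_def)
    then obtain y where "y ^ n = 0" "cpt s0 t0 y \<in> U" using r by (auto simp: q_def)
    then show ?thesis using npos by simp
  qed
  show ?thesis unfolding connected_clopen
  proof (intro allI impI, rule ccontr)
    fix T assume T: "openin (top_of_set curve) T \<and> closedin (top_of_set curve) T" and n: "\<not> (T = {} \<or> T = curve)"
    have "T \<subseteq> curve" using T openin_subset by fastforce
    have "openin (top_of_set curve) (curve - T)" using T by (simp add: closedin_def)
    moreover have "curve - (curve - T) = T" using \<open>T \<subseteq> curve\<close> by blast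
    ultimately have "cpt s0 t0 0 \<in> T" "cpt s0 t0 0 \<in> curve - T"
      using all[of T] all[of "curve - T"] T n \<open>T \<subseteq> curve\<close> by auto
    then show False by blast
  qed
qed

end

section \<open>Equations of the cyclic curve\<close>

context cyclic_curve
begin

text \<open>The monomial s^(nk-j) t^j has to be written as a product of \<open>n\<close> of the
  coordinates x_i = s^(k-i) t^i. With j = nq + r it is x_q^(n-r) x_(q+1)^r. For j = nk the index q +
  1 is that of the coordinate \<open>y\<close>, but its exponent is zero.\<close>

definition bform :: cpoly where
  "bform = (\<Sum>j\<le>n * k. Const (b j) * (Var (j div n) ^ (n - j mod n) * Var (Suc (j div n)) ^ (j mod n)))"

definition eqn :: cpoly where "eqn = Var (Suc k) ^ n - bform"

definition minor :: "nat \<Rightarrow> nat \<Rightarrow> nat \<Rightarrow> nat \<Rightarrow> cpoly" where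
  "minor i j l m = Var i * Var j - Var l * Var m"

lemma div_le: "j \<le> n * k \<Longrightarrow> j div n \<le> k"
  using n2 by (metis div_le_mono nonzero_mult_div_cancel_left not_numeral_le_zero)

lemma form_bform: "form (Suc k) n bform"
  unfolding bform_def
proof (intro form_sum form_Const_mult)
  fix j assume "j \<in> {..n * k}"
  then have "j div n \<le> k" using div_le by simp
  then have "form (Suc k) ((n - j mod n) + j mod n) (Var (j div n) ^ (n - j mod n) * Var (Suc (j div n)) ^ (j mod n))"
    by (intro form_mult form_Var_power) auto
  moreover have "(n - j mod n) + j mod n = n" using n2 by simp
  ultimately show "form (Suc k) n (Var (j div n) ^ (n - j mod n) * Var (Suc (j div n)) ^ (j mod n))" by simp
qed

lemma form_eqn: "form (Suc k) n eqn"
  unfolding eqn_def by (intro form_diff form_Var_power form_bform) simp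

lemma form_minor: "i \<le> Suc k \<Longrightarrow> j \<le> Suc k \<Longrightarrow> l \<le> Suc k \<Longrightarrow> m \<le> Suc k \<Longrightarrow> form (Suc k) 2 (minor i j l m)"
  unfolding minor_def using form_diff[OF form_mult[OF form_Var form_Var] form_mult[OF form_Var form_Var], of i "Suc k" j l m]
  by (simp add: numeral_2_eq_2)

lemma eval_minor: "poly_eval (minor i j l m) v = v i * v j - v l * v m"
  by (simp add: minor_def poly_eval_simps)

lemma eval_bform: "poly_eval bform (cvec s t y) = bin s t"
  unfolding bform_def bin_def poly_eval_sum
proof (rule sum.cong[OF refl])
  fix j assume j: "j \<in> {..n * k}"
  define q r where "q = j div n" and "r = j mod n"
  have qk: "q \<le> k" using j div_le by (simp add: q_def)
  have jqr: "j = n * q + r" "r < n" using n2 by (simp_all add: q_def r_def)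
  have 1: "cvec s t y q ^ (n - r) = s ^ ((k - q) * (n - r)) * t ^ (q * (n - r))"
    using qk by (simp add: cvec_def power_mult_distrib power_mult)
  show "poly_eval (Const (b j) * (Var (j div n) ^ (n - j mod n) * Var (Suc (j div n)) ^ (j mod n))) (cvec s t y) =
      b j * s ^ (n * k - j) * t ^ j"
  proof (cases "r = 0")
    case True
    then have "n * k - j = (k - q) * n" "j = q * n" using jqr by (simp_all add: algebra_simps diff_mult_distrib2)
    then show ?thesis using 1 True
      by (simp add: poly_eval_simps flip: q_def r_def)
  next
    case False
    then have qk1: "Suc q \<le> k"
    proof -
      have "n * q + r \<le> n * k" using j unfolding jqr(1) by simp
      then have "n * q < n * k" using False by linarith
      then show ?thesis by simp
    qed
    have 2: "cvec s t y (Suc q) ^ r = s ^ ((k - Suc q) * r) * t ^ (Suc q * r)"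
      using qk1 by (simp add: cvec_def power_mult_distrib flip: power_mult power_Suc)
    obtain k' where k': "k = Suc q + k'" using qk1 le_Suc_ex by blast
    obtain n' where n': "n = r + n'" using jqr le_Suc_ex by (metis less_imp_add_positive)
    have e1: "(k - q) * (n - r) + (k - Suc q) * r = n * k - j" unfolding jqr(1) k' n' by (simp add: algebra_simps)
    have e2: "q * (n - r) + Suc q * r = j" unfolding jqr(1) n' by (simp add: algebra_simps)
    have "cvec s t y q ^ (n - r) * cvec s t y (Suc q) ^ r =
        s ^ ((k - q) * (n - r) + (k - Suc q) * r) * t ^ (q * (n - r) + Suc q * r)"
      unfolding 1 2 power_add by (simp only: mult_ac)
    then have "cvec s t y q ^ (n - r) * cvec s t y (Suc q) ^ r = s ^ (n * k - j) * t ^ j"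
      unfolding e1 e2 .
    then show ?thesis by (simp add: poly_eval_simps flip: q_def r_def)
  qed
qed

lemma eval_eqn: "poly_eval eqn (cvec s t y) = y ^ n - bin s t"
  by (simp add: eqn_def poly_eval_simps eval_bform) (simp add: cvec_def)

lemma eval_eqn_pvec: "poly_eval eqn (pvec u z y) = y ^ n - bin1 u z"
  by (simp add: pvec_def bin1_def eval_eqn)

lemma eval_bform_zero:
  assumes "\<And>i. i \<le> k \<Longrightarrow> v i = 0" shows "poly_eval bform v = 0"
  unfolding bform_def poly_eval_sum
proof (rule sum.neutral, rule ballI)
  fix j assume "j \<in> {..n * k}"
  then have "v (j div n) = 0" using div_le assms by simp
  moreover have "n - j mod n > 0" using n2 by simp
  ultimately show "poly_eval (Const (b j) * (Var (j div n) ^ (n - j mod n) * Var (Suc (j div n)) ^ (j mod n))) v = 0"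
    by (simp add: poly_eval_simps zero_power)
qed

lemma curve_subset_proj_space: "curve \<subseteq> proj_space (Suc k)"
proof
  fix x assume "x \<in> curve"
  then obtain s t y where x: "x = cpt s t y" "(s, t) \<noteq> (0, 0)" by (auto simp: curve_def)
  show "x \<in> proj_space (Suc k)"
    unfolding x(1) cpt_def proj_space_abs_iff[OF cvec_hvec[OF x(2)]] by (simp add: cvec_def)
qed

lemma minor_on_cvec:
  assumes "i \<le> k" "j \<le> k" "l \<le> k" "m \<le> k" "i + j = l + m"
  shows "cvec s t y i * cvec s t y j = cvec s t y l * cvec s t y m"
proof -
  have "(k - i) + (k - j) = (k - l) + (k - m)" using assms by simp
  moreover have "cvec s t y i * cvec s t y j = s ^ ((k - i) + (k - j)) * t ^ (i + j)"
    "cvec s t y l * cvec s t y m = s ^ ((k - l) + (k - m)) * t ^ (l + m)"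
    unfolding power_add using assms by (simp_all add: cvec_def mult_ac)
  ultimately show ?thesis using assms(5) by simp
qed

text \<open>The minors define the cone over the rational normal curve of degree \<open>k\<close>.
  Its vertex, where only the last coordinate is nonzero, is excluded by \<open>eqn\<close>, which
  there reduces to y^n = 0.\<close>

lemma curve_eq_zero_locus:
  "curve = zero_locus (Suc k) (insert eqn {minor i (Suc j) (Suc i) j |i j. i < k \<and> j < k})" (is "_ = zero_locus _ ?S")
proof (intro equalityI subsetI)
  fix x assume xc: "x \<in> curve"
  then obtain s t y where x: "x = cpt s t y" "(s, t) \<noteq> (0, 0)" "y ^ n = bin s t" by (auto simp: curve_def)
  have h: "cvec s t y \<in> hvec" using x cvec_hvec by blast
  have "poly_eval eqn (rep_proj x) = 0"
    unfolding x(1) cpt_def poly_eval_rep_abs[OF form_eqn h] eval_eqn using x by simp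
  moreover have "poly_eval (minor i (Suc j) (Suc i) j) (rep_proj x) = 0" if "i < k" "j < k" for i j
  proof -
    have "form (Suc k) 2 (minor i (Suc j) (Suc i) j)" using that by (intro form_minor) auto
    moreover have "poly_eval (minor i (Suc j) (Suc i) j) (cvec s t y) = 0"
      unfolding eval_minor using minor_on_cvec[of i "Suc j" "Suc i" j] that by simp
    ultimately show ?thesis using poly_eval_rep_abs h unfolding x(1) cpt_def by blast
  qed
  ultimately show "x \<in> zero_locus (Suc k) ?S" using xc curve_subset_proj_space by (auto simp: zero_locus_def)
next
  fix x assume x: "x \<in> zero_locus (Suc k) ?S"
  define v where "v = rep_proj x"
  have v: "v \<in> hvec" "x = abs_proj v" "\<And>i. i > Suc k \<Longrightarrow> v i = 0"
    using x rep_proj_space by (auto simp: v_def zero_locus_def)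
  have E: "poly_eval eqn v = 0" using x by (simp add: zero_locus_def v_def)
  have M: "v i * v (Suc j) = v (Suc i) * v j" if "i < k" "j < k" for i j
  proof -
    have "poly_eval (minor i (Suc j) (Suc i) j) v = 0" using x that unfolding zero_locus_def v_def by blast
    then show ?thesis by (simp add: eval_minor)
  qed
  have fin: "x \<in> curve" if c: "c \<noteq> 0" and st: "(s, t) \<noteq> (0, 0)" and w: "v = (\<lambda>i. c * cvec s t y i)" for c s t y
  proof -
    have "c ^ n * (y ^ n - bin s t) = 0" using E unfolding w poly_eval_scale[OF form_eqn] eval_eqn .
    then have "y ^ n = bin s t" using c by simp
    moreover have "x = cpt s t y" unfolding v(2) w cpt_def by (rule abs_proj_scale[OF c cvec_hvec[OF st]])
    ultimately show ?thesis using st unfolding curve_def by blast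
  qed
  show "x \<in> curve"
  proof (cases "v 0 = 0")
    case False
    define z where "z = v 1 / v 0"
    have vi: "v i = v 0 * z ^ i" if "i \<le> k" for i
      using that
    proof (induct i)
      case (Suc i)
      then have "v 0 * v (Suc i) = v 1 * v i" using M[of 0 i] by simp
      then show ?case using Suc False by (simp add: z_def field_simps)
    qed simp
    have "v = (\<lambda>i. v 0 * cvec 1 z (v (Suc k) / v 0) i)"
    proof
      fix i show "v i = v 0 * cvec 1 z (v (Suc k) / v 0) i"
        using vi[of i] v(3)[of i] False by (cases "i \<le> k"; cases "i = Suc k") (simp_all add: cvec_def)
    qed
    then show ?thesis by (rule fin[OF False, rotated]) simp
  next
    \<comment> \<open>Here the minors give v (i+1)^2 = v i * v (i+2) as long as i + 1 < k, so the
      zero propagates to all indices below \<open>k\<close> but not to \<open>k\<close>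
      itself.\<close>
    case True
    have vi: "v i = 0" if "i < k" for i
      using that
    proof (induct i)
      case (Suc i)
      then have "v i * v (Suc (Suc i)) = v (Suc i) * v (Suc i)" using M[of i "Suc i"] by simp
      then show ?case using Suc by simp
    qed (rule True)
    show ?thesis
    proof (cases "v k = 0")
      case False
      have "v = (\<lambda>i. v k * cvec 0 1 (v (Suc k) / v k) i)"
      proof
        fix i show "v i = v k * cvec 0 1 (v (Suc k) / v k) i"
          using vi[of i] v(3)[of i] False
          by (cases "i < k"; cases "i = k"; cases "i = Suc k") (simp_all add: cvec_def)
      qed
      then show ?thesis by (rule fin[OF False, rotated]) simp
    next
      case True
      then have z: "v i = 0" if "i \<le> k" for i using vi that by (cases "i = k") auto
      then have "v (Suc k) ^ n = 0" using E eval_bform_zero[of v] by (simp add: eqn_def poly_eval_simps)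
      then have "v i = 0" for i using z v(3)[of i] by (cases "i \<le> k"; cases "i = Suc k") auto
      then show ?thesis using v(1) by (simp add: hvec_def)
    qed
  qed
qed

lemma curve_algebraic: "algebraic_set (Suc k) curve"
  unfolding algebraic_set_def
proof (intro exI[of _ "insert eqn {minor i (Suc j) (Suc i) j |i j. i < k \<and> j < k}"] conjI ballI)
  show "curve = zero_locus (Suc k) (insert eqn {minor i (Suc j) (Suc i) j |i j. i < k \<and> j < k})"
    by (rule curve_eq_zero_locus)
  fix F assume "F \<in> insert eqn {minor i (Suc j) (Suc i) j |i j. i < k \<and> j < k}"
  then consider "F = eqn" | "F \<in> {minor i (Suc j) (Suc i) j |i j. i < k \<and> j < k}" by blast
  then show "\<exists>d. form (Suc k) d F"
  proof cases
    assume "F = eqn" then show ?thesis using form_eqn by blast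
  next
    assume "F \<in> {minor i (Suc j) (Suc i) j |i j. i < k \<and> j < k}"
    then have "form (Suc k) 2 F" by (auto intro: form_minor)
    then show ?thesis by blast
  qed
qed

lemma curve_plane: "k = 1 \<Longrightarrow> curve = zero_locus 2 {eqn}"
  unfolding curve_eq_zero_locus by (auto simp: zero_locus_def eval_minor numeral_2_eq_2)

definition dvec :: "bool \<Rightarrow> complex \<Rightarrow> complex \<Rightarrow> complex \<Rightarrow> nat \<Rightarrow> complex" where
  "dvec u z dz dy i = (if i \<le> k then of_nat (ix u i) * z ^ (ix u i - 1) * dz else if i = Suc k then dy else 0)"

lemma pvec_derivative:
  assumes "(\<phi> has_field_derivative dz) (at w)" "(\<eta> has_field_derivative dy) (at w)"
  shows "((\<lambda>\<zeta>. pvec u (\<phi> \<zeta>) (\<eta> \<zeta>) i) has_field_derivative dvec u (\<phi> w) dz dy i) (at w)"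
  unfolding pvec_eq dvec_def
  by (cases "i \<le> k"; cases "i = Suc k") (use assms in \<open>auto intro!: derivative_eq_intros\<close>)

lemma bin1_derivative: "(bin1 u has_field_derivative deriv (bin1 u) z) (at z)"
  by (rule holomorphic_derivI[OF bin1_holomorphic[of u UNIV]]) auto

lemma form_vanish_rep:
  assumes "form N D F" "v \<in> hvec" "abs_proj v \<in> X" "\<forall>y\<in>X. poly_eval F (rep_proj y) = 0"
  shows "poly_eval F v = 0"
  using poly_eval_rep_abs[OF assms(1,2)] assms(3,4) by blast

end

section \<open>Identity theorem and smoothness of the cyclic curve\<close>

context smooth_cyclic_curve
begin

text \<open>By compactness an infinite zero set has an accumulation point. Near any such point the
  identity theorem in one variable, applied in a chart, makes the form vanish, so the interior
  \<open>W\<close> of the zero set is closed as well as open, and the curve is connected.\<close>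

lemma curve_identity:
  assumes F: "form (Suc k) D F" and inf: "infinite {x \<in> curve. poly_eval F (rep_proj x) = 0}"
    and x: "x \<in> curve"
  shows "poly_eval F (rep_proj x) = 0"
proof -
  define Z where "Z = {x \<in> curve. poly_eval F (rep_proj x) = 0}"
  define W where "W = {x \<in> curve. \<exists>V. openin (top_of_set curve) V \<and> x \<in> V \<and> V \<subseteq> Z}"
  have lim: "y \<in> W" if y: "y \<in> curve" "y islimpt Z" for y
  proof -
    obtain u z0 y0 where p: "y = abs_proj (pvec u z0 y0)" "y0 ^ n = bin1 u z0" using curve_patch[OF y(1)] by blast
    obtain r \<phi> \<eta> where r: "r > 0" "\<phi> holomorphic_on ball 0 r" "\<eta> holomorphic_on ball 0 r"
      "\<phi> 0 = z0" "\<eta> 0 = y0" "\<And>\<zeta>. \<zeta> \<in> ball 0 r \<Longrightarrow> \<eta> \<zeta> ^ n = bin1 u (\<phi> \<zeta>)"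
      and c: "chart curve (ball 0 r) (\<lambda>\<zeta>. abs_proj (pvec u (\<phi> \<zeta>) (\<eta> \<zeta>)))"
      using affine_chart[OF p(2)] by blast
    define g where "g \<zeta> = abs_proj (pvec u (\<phi> \<zeta>) (\<eta> \<zeta>))" for \<zeta>
    have c: "chart curve (ball 0 r) g" using c by (simp add: g_def[abs_def])
    have Zg: "g \<zeta> \<in> Z \<longleftrightarrow> poly_eval F (pvec u (\<phi> \<zeta>) (\<eta> \<zeta>)) = 0" if "\<zeta> \<in> ball 0 r" for \<zeta>
      using poly_eval_rep_abs[OF F pvec_hvec] chart_image[OF c] that by (auto simp: Z_def g_def)
    define h where "h \<zeta> = poly_eval F (pvec u (\<phi> \<zeta>) (\<eta> \<zeta>))" for \<zeta>
    have "h holomorphic_on ball 0 r" unfolding h_def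
    proof (rule holomorphic_onI)
      fix w :: complex assume w: "w \<in> ball 0 r"
      have "((\<lambda>\<zeta>. pvec u (\<phi> \<zeta>) (\<eta> \<zeta>) i) has_field_derivative dvec u (\<phi> w) (deriv \<phi> w) (deriv \<eta> w) i) (at w)" for i
        by (intro pvec_derivative holomorphic_derivI[OF r(2) open_ball w] holomorphic_derivI[OF r(3) open_ball w])
      from has_field_derivative_at_within[OF partial_deriv_chain[OF F this]]
      show "(\<lambda>\<zeta>. poly_eval F (pvec u (\<phi> \<zeta>) (\<eta> \<zeta>))) field_differentiable at w within ball 0 r"
        unfolding field_differentiable_def by (rule exI)
    qed
    moreover have "0 islimpt {\<zeta> \<in> ball 0 r. g \<zeta> \<in> Z}"
    proof (rule islimptI)
      fix T :: "complex set" assume T: "0 \<in> T" "open T"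
      have "openin (top_of_set curve) (g ` (T \<inter> ball 0 r))" by (rule chart_open_image[OF c]) (use T in auto)
      then obtain O' where O': "open O'" "g ` (T \<inter> ball 0 r) = curve \<inter> O'" by (auto simp: openin_open)
      have "g 0 = y" using p r by (simp add: g_def)
      have "g 0 \<in> g ` (T \<inter> ball 0 r)" using T r(1) by auto
      then have "y \<in> O'" unfolding O'(2) \<open>g 0 = y\<close> by blast
      then obtain y' where y': "y' \<in> Z" "y' \<in> O'" "y' \<noteq> y" using y(2) O'(1) unfolding islimpt_def by blast
      then have "y' \<in> g ` (T \<inter> ball 0 r)" unfolding O'(2) by (auto simp: Z_def)
      then obtain \<zeta> where "\<zeta> \<in> T" "\<zeta> \<in> ball 0 r" "y' = g \<zeta>" by blast
      then show "\<exists>w\<in>{\<zeta> \<in> ball 0 r. g \<zeta> \<in> Z}. w \<in> T \<and> w \<noteq> 0" using y' \<open>g 0 = y\<close> by auto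
    qed
    moreover have hz: "h z = 0" if "z \<in> {\<zeta> \<in> ball 0 r. g \<zeta> \<in> Z}" for z
      using that Zg[of z] by (simp add: h_def)
    moreover have "{\<zeta> \<in> ball 0 r. g \<zeta> \<in> Z} \<subseteq> ball 0 r" by blast
    ultimately have H: "h holomorphic_on ball 0 r" "0 islimpt {\<zeta> \<in> ball 0 r. g \<zeta> \<in> Z}"
      "{\<zeta> \<in> ball 0 r. g \<zeta> \<in> Z} \<subseteq> ball 0 r" by blast+
    have "h \<zeta> = 0" if "\<zeta> \<in> ball 0 r" for \<zeta>
      by (rule analytic_continuation[OF H(1) open_ball _ H(3) _ H(2) hz that]) (use r(1) in auto)
    then have "g ` ball 0 r \<subseteq> Z" using Zg by (auto simp: h_def)
    moreover have "openin (top_of_set curve) (g ` ball 0 r)" by (rule chart_open_image[OF c]) auto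
    moreover have "y \<in> g ` ball 0 r" using p r by (auto simp: g_def intro!: image_eqI[of _ _ 0])
    ultimately show ?thesis using y(1) by (auto simp: W_def)
  qed
  have "Z \<subseteq> curve" by (auto simp: Z_def)
  then obtain y where "y \<in> curve" "y islimpt Z"
    using Heine_Borel_imp_Bolzano_Weierstrass[OF compact_curve] inf Z_def by blast
  then have ne: "W \<noteq> {}" using lim by blast
  have "openin (top_of_set curve) W"
  proof (subst openin_subopen, intro ballI)
    fix y assume "y \<in> W"
    then obtain V where V: "openin (top_of_set curve) V" "y \<in> V" "V \<subseteq> Z" by (auto simp: W_def)
    then have "V \<subseteq> W" using \<open>Z \<subseteq> curve\<close> by (auto simp: W_def)
    with V show "\<exists>T. openin (top_of_set curve) T \<and> y \<in> T \<and> T \<subseteq> W" by blast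
  qed
  moreover have "openin (top_of_set curve) (curve - W)"
  proof (subst openin_subopen, intro ballI)
    fix y assume y: "y \<in> curve - W"
    then have "\<not> y islimpt Z" using lim by blast
    then obtain T where T: "open T" "y \<in> T" "\<And>x. x \<in> Z \<Longrightarrow> x \<in> T \<Longrightarrow> x = y" unfolding islimpt_def by blast
    have "W \<subseteq> Z" by (auto simp: W_def)
    then have "curve \<inter> T \<subseteq> curve - W" using T(3) y by blast
    moreover have "openin (top_of_set curve) (curve \<inter> T)" using T by (auto simp: openin_open)
    ultimately show "\<exists>T. openin (top_of_set curve) T \<and> y \<in> T \<and> T \<subseteq> curve - W" using y T by blast
  qed
  moreover have "W \<subseteq> curve" by (auto simp: W_def)
  ultimately have "W = curve" using connected_curve ne unfolding connected_clopen closedin_def by auto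
  then show ?thesis using x by (auto simp: W_def Z_def)
qed

text \<open>The minors force a tangent vector to be a multiple of \<open>P\<close> plus the
  derivative of \<open>pvec\<close> in a direction \<open>(a, c)\<close> of the affine plane, and
  \<open>eqn\<close> adds the condition A c = B a. This linear equation is not trivial because the
  binary form has simple zeros, and it is satisfied by the velocity of the chart. Conversely, a form
  vanishing on the curve has derivative zero along the chart.\<close>

lemma tangent_line:
  assumes "x \<in> curve" shows "is_line (tangent_space (Suc k) curve x)"
proof -
  obtain u z0 y0 where p: "x = abs_proj (pvec u z0 y0)" "y0 ^ n = bin1 u z0" using curve_patch[OF assms] by blast
  define P where "P = pvec u z0 y0"
  have Ph: "P \<in> hvec" by (simp add: P_def pvec_hvec)
  obtain r \<phi> \<eta> where r: "r > 0" "\<phi> holomorphic_on ball 0 r" "\<eta> holomorphic_on ball 0 r"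
      "\<phi> 0 = z0" "\<eta> 0 = y0" "\<And>\<zeta>. \<zeta> \<in> ball 0 r \<Longrightarrow> \<eta> \<zeta> ^ n = bin1 u (\<phi> \<zeta>)"
      "deriv \<phi> 0 \<noteq> 0 \<or> deriv \<eta> 0 \<noteq> 0"
    using affine_chart[OF p(2)] by blast
  define dz dy where "dz = deriv \<phi> 0" and "dy = deriv \<eta> 0"
  have dphi: "(\<phi> has_field_derivative dz) (at 0)" unfolding dz_def
    by (rule holomorphic_derivI[OF r(2) open_ball]) (use r in simp)
  have deta: "(\<eta> has_field_derivative dy) (at 0)" unfolding dy_def
    by (rule holomorphic_derivI[OF r(3) open_ball]) (use r in simp)
  define Q where "Q = dvec u z0 dz dy"
  define A B where "A = of_nat n * y0 ^ (n - 1)" and "B = deriv (bin1 u) z0"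
  have ev0: "\<forall>\<^sub>F \<zeta> in nhds 0. \<zeta> \<in> ball 0 r" using r(1) by (intro eventually_nhds_in_open) auto
  have rel: "A * dy = B * dz"
  proof -
    have "((\<lambda>\<zeta>. \<eta> \<zeta> ^ n) has_field_derivative A * dy) (at 0)"
      unfolding A_def using r deta by (auto intro!: derivative_eq_intros simp: mult_ac)
    moreover have "((\<lambda>\<zeta>. bin1 u (\<phi> \<zeta>)) has_field_derivative B * dz) (at 0)"
      unfolding B_def using DERIV_chain2[OF _ dphi, of "bin1 u"] bin1_derivative r(4) by auto
    then have "((\<lambda>\<zeta>. \<eta> \<zeta> ^ n) has_field_derivative B * dz) (at 0)"
      by (rule DERIV_cong_ev[THEN iffD1, rotated -1]) (use ev0 r(6) in \<open>auto elim!: eventually_mono\<close>)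
    ultimately show ?thesis by (rule DERIV_unique)
  qed
  have AB: "A \<noteq> 0 \<or> B \<noteq> 0"
  proof (cases "y0 = 0")
    case True
    then have "bin1 u z0 = 0" using p(2) n2 by (simp add: power_0_left)
    then show ?thesis using squarefree by (simp add: B_def)
  qed (use n2 in \<open>simp add: A_def\<close>)
  have P0: "P (ix u 0) = 1" "P (ix u 1) = z0" "P (Suc k) = y0" "\<And>i. i \<le> k \<Longrightarrow> P (ix u i) = z0 ^ i"
    using k1 pvec_ix[of 0 u] pvec_ix[of 1 u] pvec_ix by (auto simp: P_def pvec_eq)
  have dix: "dvec u z0 a c (ix u i) = of_nat i * z0 ^ (i - 1) * a" if "i \<le> k" for i a c
    using that by (simp add: dvec_def ix_le ix_ix)
  have Q0: "Q (ix u 0) = 0" "Q (ix u 1) = dz" "Q (Suc k) = dy" "\<And>i. i > Suc k \<Longrightarrow> Q i = 0"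
    using k1 dix[of 0] dix[of 1] by (auto simp: Q_def dvec_def)
  have Pz: "P i = 0" if "i > Suc k" for i using that by (simp add: P_def pvec_eq)
  have dzdy: "dz \<noteq> 0 \<or> dy \<noteq> 0" using r(7) by (simp add: dz_def dy_def)
  then have Qh: "Q \<in> hvec" using Q0 hvecI[of "Suc k" Q] by metis
  have np: "\<not> proportional P Q"
  proof
    assume "proportional P Q"
    then obtain c where "c \<noteq> 0" "Q = (\<lambda>i. c * P i)" by (auto simp: proportional_def)
    then have "Q (ix u 0) = c * P (ix u 0)" by simp
    then show False using \<open>c \<noteq> 0\<close> P0 Q0 by simp
  qed
  have lin: "(\<Sum>i\<le>Suc k. D i * (s * P i + t * w i)) = s * (\<Sum>i\<le>Suc k. D i * P i) + t * (\<Sum>i\<le>Suc k. D i * w i)"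
    for D s t and w :: "nat \<Rightarrow> complex"
    by (simp add: sum_distrib_left algebra_simps sum.distrib del: sum.atMost_Suc)
  have PX: "P \<in> hvec \<and> abs_proj P \<in> curve" using Ph p assms by (simp add: P_def)
  have "tangent_space (Suc k) curve x = {abs_proj v |v. v \<in> hvec \<and> (\<exists>s t. v = (\<lambda>i. s * P i + t * Q i))}"
    unfolding p(1) P_def[symmetric] tangent_space_abs[OF Ph]
  proof (intro Collect_cong ex_cong1 conj_cong refl, goal_cases)
    case (1 x w)
    show ?case
    proof
      assume w: "(\<forall>i>Suc k. w i = 0) \<and> (\<forall>F d. form (Suc k) d F \<longrightarrow> (\<forall>y\<in>curve. poly_eval F (rep_proj y) = 0) \<longrightarrow>
        (\<Sum>i\<le>Suc k. partial_deriv i F P * w i) = 0)"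
      have der: "(\<Sum>i\<le>Suc k. partial_deriv i F P * w i) = 0"
        if "form (Suc k) d F" "\<forall>y\<in>curve. poly_eval F (rep_proj y) = 0" for F d using w that by blast
      define w0 w1 where "w0 = w (ix u 0)" and "w1 = w (ix u 1)"
      define a c where "a = w1 - z0 * w0" and "c = w (Suc k) - w0 * y0"
      \<comment> \<open>The linearization at \<open>P\<close> of the minor x_0 x_(i+1) - x_1 x_i,
        with the indices reversed on the other patch. It is a recursion for the entries of
        \<open>w\<close>, solved in \<open>wi\<close>.\<close>
      have step: "w0 * z0 ^ Suc i + w (ix u (Suc i)) - w1 * z0 ^ i - z0 * w (ix u i) = 0" if i: "Suc i \<le> k" for i
      proof -
        let ?E = "minor (ix u 0) (ix u (Suc i)) (ix u 1) (ix u i)"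
        have le: "ix u 0 \<le> k" "ix u (Suc i) \<le> k" "ix u 1 \<le> k" "ix u i \<le> k" using i k1 ix_le by auto
        have E: "form (Suc k) 2 ?E" using le by (intro form_minor) auto
        have "ix u 0 + ix u (Suc i) = ix u 1 + ix u i" using i by (auto simp: ix_def)
        then have "poly_eval ?E (rep_proj y) = 0" if y: "y \<in> curve" for y
          using minor_on_cvec[OF le] y poly_eval_rep_abs[OF E cvec_hvec]
          by (auto simp: curve_def cpt_def eval_minor)
        then have 0: "(\<Sum>i\<le>Suc k. partial_deriv i ?E P * w i) = 0" using der[OF E] by blast
        have "((\<lambda>\<zeta>. poly_eval ?E (\<lambda>j. P j + \<zeta> * w j)) has_field_derivative
          (\<Sum>j\<le>Suc k. partial_deriv j ?E (\<lambda>j. P j + 0 * w j) * w j)) (at 0)"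
          by (rule partial_deriv_chain[OF E]) (auto intro!: derivative_eq_intros)
        then have "((\<lambda>\<zeta>. poly_eval ?E (\<lambda>j. P j + \<zeta> * w j)) has_field_derivative 0) (at 0)" using 0 by simp
        moreover have "((\<lambda>\<zeta>. poly_eval ?E (\<lambda>j. P j + \<zeta> * w j)) has_field_derivative
           (w0 * P (ix u (Suc i)) + w (ix u (Suc i)) * P (ix u 0) - (w1 * P (ix u i) + w (ix u i) * P (ix u 1)))) (at 0)"
          unfolding eval_minor w0_def w1_def by (auto intro!: derivative_eq_intros)
        ultimately have "w0 * P (ix u (Suc i)) + w (ix u (Suc i)) * P (ix u 0) - (w1 * P (ix u i) + w (ix u i) * P (ix u 1)) = 0"
          using DERIV_unique by blast
        then show ?thesis using P0 i by (simp add: algebra_simps)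
      qed
      have wi: "w (ix u i) = z0 ^ i * w0 + of_nat i * z0 ^ (i - 1) * a" if "i \<le> k" for i
        using that
      proof (induct i)
        case 0 then show ?case by (simp add: w0_def)
      next
        case (Suc i)
        have "of_nat i * z0 ^ (i - 1) * z0 = of_nat i * z0 ^ i" by (cases i) auto
        then have zz: "z0 * (z0 ^ i * w0 + of_nat i * z0 ^ (i - 1) * a) = z0 ^ Suc i * w0 + of_nat i * z0 ^ i * a"
          by (simp add: algebra_simps)
        have "w (ix u (Suc i)) = z0 * w (ix u i) + z0 ^ i * w1 - z0 ^ Suc i * w0"
          using step[of i] Suc by (simp add: algebra_simps)
        also have "\<dots> = z0 ^ Suc i * w0 + of_nat i * z0 ^ i * a + z0 ^ i * (w1 - z0 * w0)"
          using Suc zz by (simp add: algebra_simps)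
        finally show ?case by (simp add: a_def algebra_simps)
      qed
      have wdec: "w j = w0 * P j + dvec u z0 a c j" for j
      proof (cases "j \<le> k")
        case True
        then show ?thesis using wi[of "ix u j"] dix[of "ix u j"] P0(4)[of "ix u j"] by (simp add: ix_le ix_ix)
      next
        case False
        then show ?thesis using w Pz[of j] P0(3) by (cases "j = Suc k") (auto simp: dvec_def c_def)
      qed
      have eqn0: "\<forall>y\<in>curve. poly_eval eqn (rep_proj y) = 0"
        unfolding curve_eq_zero_locus zero_locus_def by blast
      have "(\<Sum>i\<le>Suc k. partial_deriv i eqn P * w i) = 0" by (rule der[OF form_eqn eqn0])
      moreover have "(\<Sum>i\<le>Suc k. partial_deriv i eqn P * w i) = w0 * (\<Sum>i\<le>Suc k. partial_deriv i eqn P * P i) +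
         1 * (\<Sum>i\<le>Suc k. partial_deriv i eqn P * dvec u z0 a c i)"
        unfolding lin[symmetric] by (simp add: wdec del: sum.atMost_Suc)
      moreover have "(\<Sum>i\<le>Suc k. partial_deriv i eqn P * P i) = 0"
        unfolding euler_identity[OF form_eqn] P_def eval_eqn_pvec using p by simp
      ultimately have "(\<Sum>i\<le>Suc k. partial_deriv i eqn P * dvec u z0 a c i) = 0" by simp
      moreover have "((\<lambda>\<zeta>. poly_eval eqn (pvec u (z0 + a * \<zeta>) (y0 + c * \<zeta>))) has_field_derivative
         (\<Sum>i\<le>Suc k. partial_deriv i eqn (pvec u (z0 + a * 0) (y0 + c * 0)) * dvec u (z0 + a * 0) a c i)) (at 0)"
        by (intro partial_deriv_chain[OF form_eqn] pvec_derivative) (auto intro!: derivative_eq_intros)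
      ultimately have "((\<lambda>\<zeta>. poly_eval eqn (pvec u (z0 + a * \<zeta>) (y0 + c * \<zeta>))) has_field_derivative 0) (at 0)"
        by (simp add: P_def)
      moreover have "((\<lambda>\<zeta>. poly_eval eqn (pvec u (z0 + a * \<zeta>) (y0 + c * \<zeta>))) has_field_derivative A * c - B * a) (at 0)"
      proof -
        have "((\<lambda>\<zeta>. bin1 u (z0 + a * \<zeta>)) has_field_derivative B * a) (at 0)"
          unfolding B_def by (rule DERIV_chain2[of "bin1 u"]) (auto intro!: derivative_eq_intros bin1_derivative)
        then show ?thesis unfolding eval_eqn_pvec A_def
          by (auto intro!: derivative_eq_intros simp: mult_ac)
      qed
      ultimately have AcBa: "A * c = B * a" using DERIV_unique by fastforce
      have "\<exists>\<mu>. a = \<mu> * dz \<and> c = \<mu> * dy"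
      proof (cases "A = 0")
        case False
        then have 1: "dy = B * dz / A" "c = B * a / A" using rel AcBa by (simp_all add: field_simps)
        then have "dz \<noteq> 0" using dzdy by auto
        then show ?thesis using 1 by (intro exI[of _ "a / dz"]) auto
      next
        case True
        then have "B \<noteq> 0" using AB by simp
        then have "a = 0" "dz = 0" using rel AcBa True by auto
        then show ?thesis using dzdy by (intro exI[of _ "c / dy"]) auto
      qed
      then obtain \<mu> where "a = \<mu> * dz" "c = \<mu> * dy" by blast
      then have "dvec u z0 a c j = \<mu> * Q j" for j by (auto simp: Q_def dvec_def)
      then have "w = (\<lambda>i. w0 * P i + \<mu> * Q i)" using wdec by auto
      then show "\<exists>s t. w = (\<lambda>i. s * P i + t * Q i)" by blast
    next
      assume "\<exists>s t. w = (\<lambda>i. s * P i + t * Q i)"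
      then obtain s t where w: "w = (\<lambda>i. s * P i + t * Q i)" by blast
      show "(\<forall>i>Suc k. w i = 0) \<and> (\<forall>F d. form (Suc k) d F \<longrightarrow> (\<forall>y\<in>curve. poly_eval F (rep_proj y) = 0) \<longrightarrow>
        (\<Sum>i\<le>Suc k. partial_deriv i F P * w i) = 0)"
      proof (intro conjI allI impI)
        fix F d assume F: "form (Suc k) d F" "\<forall>y\<in>curve. poly_eval F (rep_proj y) = 0"
        have "poly_eval F P = 0" using form_vanish_rep[OF F(1) Ph _ F(2)] PX by blast
        then have 1: "(\<Sum>i\<le>Suc k. partial_deriv i F P * P i) = 0" using euler_identity[OF F(1)] by simp
        have "((\<lambda>\<zeta>. poly_eval F (pvec u (\<phi> \<zeta>) (\<eta> \<zeta>))) has_field_derivative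
          (\<Sum>i\<le>Suc k. partial_deriv i F (pvec u (\<phi> 0) (\<eta> 0)) * dvec u (\<phi> 0) dz dy i)) (at 0)"
          by (intro partial_deriv_chain[OF F(1)] pvec_derivative dphi deta)
        moreover have "((\<lambda>\<zeta>. poly_eval F (pvec u (\<phi> \<zeta>) (\<eta> \<zeta>))) has_field_derivative 0) (at 0)"
        proof (rule DERIV_cong_ev[THEN iffD2, rotated -1, OF DERIV_const])
          show "\<forall>\<^sub>F \<zeta> in nhds 0. poly_eval F (pvec u (\<phi> \<zeta>) (\<eta> \<zeta>)) = 0"
            using ev0 by (rule eventually_mono)
              (auto intro!: form_vanish_rep[OF F(1) pvec_hvec _ F(2)] pvec_in_curve r(6))
        qed auto
        ultimately have 2: "(\<Sum>i\<le>Suc k. partial_deriv i F P * Q i) = 0"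
          using DERIV_unique r(4,5) unfolding P_def Q_def by blast
        show "(\<Sum>i\<le>Suc k. partial_deriv i F P * w i) = 0" unfolding w lin 1 2 by simp
      qed (simp add: w Pz Q0)
    qed
  qed
  then show ?thesis unfolding is_line_def using Ph Qh np by blast
qed

theorem smooth_curve: "smooth_curve (Suc k) curve"
  unfolding smooth_curve_def smooth_point_def
  by (intro conjI ballI tangent_line projective_curveI[OF curve_algebraic infinite_curve] curve_identity)

end

subsection \<open>Polynomial identities and irreducibility\<close>

lemma digits_unique:
  fixes a b :: "nat \<Rightarrow> nat"
  assumes "\<And>i. a i < B" "\<And>i. b i < B" "(\<Sum>i<N. a i * B ^ i) = (\<Sum>i<N. b i * B ^ i)" "i < N"
  shows "a i = b i"
  using assms
proof (induct N arbitrary: a b i)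
  case (Suc N)
  have B: "B > 0" using Suc(2)[of 0] by simp
  have s: "(\<Sum>i<Suc N. f i * B ^ i) = f 0 + B * (\<Sum>i<N. f (Suc i) * B ^ i)" for f :: "nat \<Rightarrow> nat"
    unfolding sum.lessThan_Suc_shift by (simp add: sum_distrib_left mult_ac)
  have e: "a 0 + B * (\<Sum>i<N. a (Suc i) * B ^ i) = b 0 + B * (\<Sum>i<N. b (Suc i) * B ^ i)"
    using Suc(4) unfolding s .
  then have "(a 0 + B * (\<Sum>i<N. a (Suc i) * B ^ i)) mod B = (b 0 + B * (\<Sum>i<N. b (Suc i) * B ^ i)) mod B" by simp
  then have 0: "a 0 = b 0" using Suc(2)[of 0] Suc(3)[of 0] by simp
  then have "(\<Sum>i<N. a (Suc i) * B ^ i) = (\<Sum>i<N. b (Suc i) * B ^ i)" using e B by simp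
  then have "a (Suc j) = b (Suc j)" if "j < N" for j
    using Suc(1)[of "\<lambda>i. a (Suc i)" "\<lambda>i. b (Suc i)" j] Suc(2,3) that by simp
  then show ?case using 0 Suc(5) by (cases i) auto
qed simp

text \<open>Kronecker substitution \<open>x\<^sub>i = x\<^bsup>B\<^sup>i\<^esup>\<close>.\<close>

lemma poly_eval_eq_0_imp:
  fixes G :: cpoly
  assumes z: "\<And>v. poly_eval G v = 0" shows "G = 0"
proof (rule ccontr)
  assume "G \<noteq> 0"
  then obtain m0 where m0: "m0 \<in> Poly_Mapping.keys G" by (metis all_not_in_conv keys_eq_empty)
  let ?K = "Poly_Mapping.keys G"
  define E where "E = (\<Union>m\<in>?K. Poly_Mapping.lookup m ` Poly_Mapping.keys m)"
  define B where "B = Suc (Max (insert 0 E))"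
  have "finite E" by (simp add: E_def)
  have dig: "Poly_Mapping.lookup m i < B" if "m \<in> ?K" for m i
  proof (cases "i \<in> Poly_Mapping.keys m")
    case True
    then have "Poly_Mapping.lookup m i \<in> insert 0 E" using that by (auto simp: E_def)
    then show ?thesis using \<open>finite E\<close> by (simp add: B_def less_Suc_eq_le)
  qed (simp add: B_def in_keys_iff)
  define N where "N = Suc (Max (insert 0 (\<Union>m\<in>?K. Poly_Mapping.keys m)))"
  have key: "i < N" if "m \<in> ?K" "i \<in> Poly_Mapping.keys m" for m i
  proof -
    have "i \<in> insert 0 (\<Union>m\<in>?K. Poly_Mapping.keys m)" using that by blast
    then show ?thesis by (simp add: N_def less_Suc_eq_le)
  qed
  define w where "w m = (\<Sum>i<N. Poly_Mapping.lookup m i * B ^ i)" for m :: "nat \<Rightarrow>\<^sub>0 nat"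
  have inj: "m = m'" if m: "m \<in> ?K" "m' \<in> ?K" "w m = w m'" for m m'
  proof (rule poly_mapping_eqI)
    fix i
    show "Poly_Mapping.lookup m i = Poly_Mapping.lookup m' i"
    proof (cases "i < N")
      case True
      then show ?thesis using digits_unique[of "Poly_Mapping.lookup m" B "Poly_Mapping.lookup m'" N i]
        dig m by (simp add: w_def)
    next
      case False
      then have "i \<notin> Poly_Mapping.keys m" "i \<notin> Poly_Mapping.keys m'" using key m by blast+
      then show ?thesis by (simp add: in_keys_iff)
    qed
  qed
  define p where "p = (\<Sum>m\<in>?K. monom (Poly_Mapping.lookup G m) (w m))"
  have "poly p x = poly_eval G (\<lambda>i. x ^ (B ^ i))" for x
  proof -
    have "(\<Prod>i\<in>Poly_Mapping.keys m. (x ^ B ^ i) ^ Poly_Mapping.lookup m i) = x ^ w m" if "m \<in> ?K" for m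
    proof -
      have "(\<Prod>i\<in>Poly_Mapping.keys m. (x ^ B ^ i) ^ Poly_Mapping.lookup m i) =
          (\<Prod>i<N. (x ^ B ^ i) ^ Poly_Mapping.lookup m i)"
        by (rule monomial_superset) (use key that in auto)
      also have "\<dots> = x ^ w m" unfolding w_def power_sum by (simp add: mult.commute flip: power_mult)
      finally show ?thesis .
    qed
    then show ?thesis unfolding p_def poly_eval_def poly_sum poly_monom by (intro sum.cong refl) simp
  qed
  then have "poly p x = poly 0 x" for x using z by simp
  then have "p = 0" using poly_eq_poly_eq_iff by blast
  moreover have "coeff p (w m0) = Poly_Mapping.lookup G m0"
  proof -
    have "coeff p (w m0) = (\<Sum>m\<in>?K. if m = m0 then Poly_Mapping.lookup G m else 0)"
      unfolding p_def coeff_sum coeff_monom by (intro sum.cong refl) (use inj m0 in auto)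
    then show ?thesis using m0 by simp
  qed
  ultimately show False using m0 by (simp add: in_keys_iff)
qed

lemma unit_if_constant:
  fixes G :: cpoly
  assumes "\<And>v. poly_eval G v = c" "c \<noteq> 0" shows "G dvd 1"
proof -
  have "G * Const (inverse c) - 1 = 0"
    by (rule poly_eval_eq_0_imp) (simp add: poly_eval_simps assms)
  then show ?thesis by (intro dvdI[of _ _ "Const (inverse c)"]) simp
qed

text \<open>The inner variable is \<open>l\<close> and the outer one \<open>z\<close>, so degree and
  leading coefficient of \<open>P\<close> are taken with respect to \<open>z\<close>.\<close>

definition bipoly :: "(complex \<Rightarrow> complex \<Rightarrow> complex) \<Rightarrow> complex poly poly \<Rightarrow> bool" where
  "bipoly \<phi> P \<longleftrightarrow> (\<forall>l z. \<phi> l z = poly (poly P [:z:]) l)"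

lemma bipoly_unique: assumes "bipoly \<phi> P" "bipoly \<phi> Q" shows "P = Q"
proof (rule ccontr)
  assume "P \<noteq> Q"
  then have "finite {x. poly (P - Q) x = 0}" by (intro poly_roots_finite) simp
  moreover have "range (\<lambda>z::complex. [:z:]) \<subseteq> {x. poly (P - Q) x = 0}"
  proof clarify
    fix z :: complex
    have "poly (poly P [:z:]) = poly (poly Q [:z:])" using assms by (auto simp: bipoly_def fun_eq_iff)
    then show "poly (P - Q) [:z:] = 0" using poly_eq_poly_eq_iff by (metis poly_diff right_minus_eq)
  qed
  ultimately have "finite (range (\<lambda>z::complex. [:z:]))" using finite_subset by blast
  then have "finite (UNIV :: complex set)" by (rule finite_imageD) (simp add: inj_on_def)
  then show False using infinite_UNIV_char_0 by blast
qed

lemma bipoly_exists: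
  fixes u w :: "nat \<Rightarrow> complex"
  shows "\<exists>P. bipoly (\<lambda>l z. poly_eval G (\<lambda>i. u i + l * w i + (if i = 2 then z else 0))) P"
proof -
  define X :: "nat \<Rightarrow> complex poly poly" where
    "X i = [:[:u i, w i:]:] + (if i = 2 then [:0, 1:] else 0)" for i
  define P where "P = (\<Sum>m\<in>Poly_Mapping.keys G. [:[:Poly_Mapping.lookup G m:]:] *
     (\<Prod>i\<in>Poly_Mapping.keys m. X i ^ Poly_Mapping.lookup m i))"
  have X: "poly (poly (X i) [:z:]) l = u i + l * w i + (if i = 2 then z else 0)" for i l z
    by (simp add: X_def)
  have "bipoly (\<lambda>l z. poly_eval G (\<lambda>i. u i + l * w i + (if i = 2 then z else 0))) P"
    unfolding bipoly_def P_def poly_eval_def poly_sum poly_mult poly_prod poly_power X by simp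
  then show ?thesis by blast
qed

text \<open>On a plane through the zero \<open>u\<close> of \<open>F\<close>, spanned by the last
  axis and a direction \<open>w\<close>, the restriction of \<open>F\<close> is monic in
  \<open>z\<close>. On the line through \<open>u\<close> parallel to the last axis it is the pure
  power z^d. Two factors of positive degree would make \<open>F\<close> singular at
  \<open>u\<close>, but its derivative in the first variable is nonzero there. The vectors
  \<open>w\<close> are arbitrary because factors might a priori contain variables of index above
  2.\<close>

lemma irreducible_diagonal:
  fixes e1 e2 :: complex
  assumes d: "d \<ge> 2" and e: "e1 \<noteq> 0" "e2 \<noteq> 0"
    and F: "\<And>v. poly_eval F v = v 2 ^ d + (v 0 ^ d + e1 * v 1 ^ d) / e2"
  shows "irreducible F"
proof -
  have "\<exists>x. x ^ d = - e1"
  proof -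
    have "card {x. x ^ d = - e1} = d" by (rule card_nth_roots) (use d e in auto)
    then have "{x. x ^ d = - e1} \<noteq> {}" using d by (metis card.empty not_numeral_le_zero)
    then show ?thesis by blast
  qed
  then obtain x0 where x0: "x0 ^ d = - e1" by blast
  then have x00: "x0 \<noteq> 0" using e d by (auto simp: power_0_left)
  define u where "u i = (if i = 0 then x0 else if i = 1 then 1 else 0)" for i :: nat
  have Fu: "poly_eval F u = 0" using x0 d by (simp add: F u_def power_0_left)
  show ?thesis
  proof (rule irreducibleI)
    show "F \<noteq> 0"
    proof
      assume "F = 0"
      then have "poly_eval F (\<lambda>i. if i = 2 then 1 else 0) = 0" by simp
      then show False using d by (simp add: F power_0_left)
    qed
    show "\<not> F dvd 1"
    proof
      assume "F dvd 1"
      then obtain G where "1 = F * G" by (elim dvdE)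
      then have "poly_eval 1 u = poly_eval F u * poly_eval G u" by (metis poly_eval_mult)
      then show False using Fu by simp
    qed
    fix G H assume GH: "F = G * H"
    have prod: "poly_eval G v * poly_eval H v = poly_eval F v" for v unfolding GH poly_eval_mult ..
    define pp where "pp w l z i = u i + l * w i + (if i = 2 then z else 0)"
      for w :: "nat \<Rightarrow> complex" and l z :: complex and i :: nat
    have PP: "\<exists>P Q \<alpha> \<beta>. bipoly (\<lambda>l z. poly_eval G (pp w l z)) P \<and> bipoly (\<lambda>l z. poly_eval H (pp w l z)) Q \<and>
        lead_coeff P = [:\<alpha>:] \<and> lead_coeff Q = [:\<beta>:] \<and> \<alpha> \<noteq> 0 \<and> \<beta> \<noteq> 0 \<and> degree P + degree Q = d"
      if w: "w 2 = 0" for w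
    proof -
      obtain P Q where PQ: "bipoly (\<lambda>l z. poly_eval G (pp w l z)) P" "bipoly (\<lambda>l z. poly_eval H (pp w l z)) Q"
        using bipoly_exists[of G u w] bipoly_exists[of H u w] unfolding pp_def by blast
      define R :: "complex poly poly" where
        "R = monom 1 d + [:smult (1 / e2) ([:u 0, w 0:] ^ d + smult e1 ([:u 1, w 1:] ^ d)):]"
      have "bipoly (\<lambda>l z. poly_eval F (pp w l z)) R"
        unfolding bipoly_def R_def using w by (simp add: F pp_def poly_monom u_def)
      moreover have "bipoly (\<lambda>l z. poly_eval F (pp w l z)) (P * Q)"
        using PQ unfolding bipoly_def by (simp flip: prod)
      ultimately have R: "P * Q = R" using bipoly_unique by blast
      have "degree R = d" unfolding R_def using d by (subst degree_add_eq_left) (auto simp: degree_monom_eq)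
      moreover have "coeff R d = 1" unfolding R_def using d by (cases d) auto
      ultimately have "lead_coeff P * lead_coeff Q = 1" "R \<noteq> 0" unfolding lead_coeff_mult[symmetric] R by auto
      moreover from this have "P \<noteq> 0" "Q \<noteq> 0" using R by auto
      then have "degree P + degree Q = d" using \<open>degree R = d\<close> by (simp flip: R add: degree_mult_eq)
      moreover have "lead_coeff P dvd 1" "lead_coeff Q dvd 1"
        using \<open>lead_coeff P * lead_coeff Q = 1\<close> by (metis dvd_triv_left dvd_triv_right)+
      then obtain \<alpha> \<beta> where "lead_coeff P = [:\<alpha>:]" "\<alpha> \<noteq> 0" "lead_coeff Q = [:\<beta>:]" "\<beta> \<noteq> 0"
        unfolding is_unit_poly_iff dvd_field_iff by auto
      ultimately show ?thesis using PQ by blast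
    qed
    \<comment> \<open>Every point lies on one of the planes through \<open>u\<close>, so a
      polynomial that is constant on each of them has the value at \<open>u\<close>
      everywhere.\<close>
    have const: "A dvd 1"
      if A: "\<And>w. w 2 = 0 \<Longrightarrow> \<exists>\<alpha>. \<alpha> \<noteq> 0 \<and> bipoly (\<lambda>l z. poly_eval A (pp w l z)) [:[:\<alpha>:]:]" for A
    proof (rule unit_if_constant)
      obtain \<alpha> where \<alpha>: "\<alpha> \<noteq> 0" "bipoly (\<lambda>l z. poly_eval A (pp (\<lambda>_. 0) l z)) [:[:\<alpha>:]:]" using A[of "\<lambda>_. 0"] by auto
      have "pp (\<lambda>_. 0) 0 0 = u" by (auto simp: pp_def fun_eq_iff)
      then have a: "poly_eval A u = \<alpha>"
        using \<alpha>(2)[unfolded bipoly_def, THEN spec[of _ 0], THEN spec[of _ 0]] by simp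
      show "poly_eval A u \<noteq> 0" using a \<alpha> by simp
      fix v
      define w where "w i = (if i = 2 then 0 else v i - u i)" for i
      obtain \<beta> where "bipoly (\<lambda>l z. poly_eval A (pp w l z)) [:[:\<beta>:]:]" using A[of w] by (auto simp: w_def)
      then have b: "poly_eval A (pp w l z) = \<beta>" for l z by (simp add: bipoly_def)
      have "pp w 0 0 = u" "pp w 1 (v 2) = v" by (auto simp: pp_def w_def u_def fun_eq_iff)
      then show "poly_eval A v = poly_eval A u" using b by metis
    qed
    obtain P0 Q0 \<alpha>0 \<beta>0 where 0: "bipoly (\<lambda>l z. poly_eval G (pp (\<lambda>_. 0) l z)) P0"
      "bipoly (\<lambda>l z. poly_eval H (pp (\<lambda>_. 0) l z)) Q0" "lead_coeff P0 = [:\<alpha>0:]" "lead_coeff Q0 = [:\<beta>0:]"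
      "\<alpha>0 \<noteq> 0" "\<beta>0 \<noteq> 0" "degree P0 + degree Q0 = d" using PP[of "\<lambda>_. 0"] by blast
    text \<open>The degree in the last variable does not change along lines, since the leading
      coefficients are constant.\<close>
    have same: "degree P = degree P' \<and> poly (lead_coeff P) 0 = poly (lead_coeff P') 0"
      if P: "bipoly (\<lambda>l z. poly_eval A (pp w l z)) P" "bipoly (\<lambda>l z. poly_eval A (pp w' l z)) P'"
        "lead_coeff P = [:\<alpha>:]" "lead_coeff P' = [:\<alpha>':]" "\<alpha> \<noteq> 0" "\<alpha>' \<noteq> 0" for A w w' P P' \<alpha> \<alpha>'
    proof -
      have *: "map_poly (\<lambda>c. poly c 0) P = map_poly (\<lambda>c. poly c 0) P'" (is "?p P = ?p P'")
      proof -
        have ev: "poly (?p R) z = poly (poly R [:z:]) 0" for R :: "complex poly poly" and z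
          by (induct R) (simp_all add: map_poly_pCons)
        have "pp w 0 z = pp w' 0 z" for z by (simp add: pp_def fun_eq_iff)
        then have "poly (?p P) z = poly (?p P') z" for z using P(1,2) unfolding ev bipoly_def by metis
        then show ?thesis using poly_eq_poly_eq_iff by blast
      qed
      have "degree (?p R) = degree R" if "lead_coeff R = [:c:]" "c \<noteq> 0" for R :: "complex poly poly" and c :: complex
        by (rule map_poly_degree_eq) (use that in simp)
      then have "degree P = degree P'" using * P by metis
      moreover have "coeff (?p R) i = poly (coeff R i) 0" for R :: "complex poly poly" and i by (simp add: coeff_map_poly)
      ultimately show ?thesis using * by metis
    qed
    show "G dvd 1 \<or> H dvd 1"
    proof (cases "degree P0 = 0 \<or> degree Q0 = 0")
      case True
      have G1: "G dvd 1" if "degree P0 = 0"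
      proof (rule const)
        fix w :: "nat \<Rightarrow> complex" assume "w 2 = 0"
        then obtain P \<alpha> where P: "bipoly (\<lambda>l z. poly_eval G (pp w l z)) P" "lead_coeff P = [:\<alpha>:]" "\<alpha> \<noteq> 0" using PP by blast
        then have "degree P = 0" using same[OF P(1) 0(1) P(2) 0(3) P(3) 0(5)] that by simp
        then have "P = [:[:\<alpha>:]:]" using P(2) by (metis degree_0_id)
        then show "\<exists>\<alpha>. \<alpha> \<noteq> 0 \<and> bipoly (\<lambda>l z. poly_eval G (pp w l z)) [:[:\<alpha>:]:]" using P by blast
      qed
      have H1: "H dvd 1" if "degree Q0 = 0"
      proof (rule const)
        fix w :: "nat \<Rightarrow> complex" assume "w 2 = 0"
        then obtain P \<alpha> where P: "bipoly (\<lambda>l z. poly_eval H (pp w l z)) P" "lead_coeff P = [:\<alpha>:]" "\<alpha> \<noteq> 0" using PP by blast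
        then have "degree P = 0" using same[OF P(1) 0(2) P(2) 0(4) P(3) 0(6)] that by simp
        then have "P = [:[:\<alpha>:]:]" using P(2) by (metis degree_0_id)
        then show "\<exists>\<alpha>. \<alpha> \<noteq> 0 \<and> bipoly (\<lambda>l z. poly_eval H (pp w l z)) [:[:\<alpha>:]:]" using P by blast
      qed
      show ?thesis using True G1 H1 by blast
    next
      case False
      text \<open>Both factors would vanish at the point \<open>u\<close>, where the curve is smooth.\<close>
      have uz: "poly_eval G u = 0 \<and> poly_eval H u = 0"
      proof -
        define p q where "p = poly P0 [:0:]" and "q = poly Q0 [:0:]"
        define gp hp where "gp = map_poly (\<lambda>c. poly c 0) P0" and "hp = map_poly (\<lambda>c. poly c 0) Q0"
        have ev: "poly (map_poly (\<lambda>c. poly c 0) R) z = poly (poly R [:z:]) 0" for R :: "complex poly poly" and z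
          by (induct R) (simp_all add: map_poly_pCons)
        have gz: "poly gp z = poly_eval G (pp (\<lambda>_. 0) 0 z)" for z using 0(1) by (simp add: gp_def ev bipoly_def)
        have hz: "poly hp z = poly_eval H (pp (\<lambda>_. 0) 0 z)" for z using 0(2) by (simp add: hp_def ev bipoly_def)
        have "poly (gp * hp) z = poly (monom 1 d) z" for z
          using x0 by (simp add: gz hz prod F poly_monom) (simp add: pp_def u_def)
        then have "gp * hp = monom 1 d" using poly_eq_poly_eq_iff by blast
        then have gh: "gp * hp = [:- 0, 1:] ^ d" by (simp add: monom_altdef)
        have dg: "degree gp = degree P0" unfolding gp_def
          by (rule map_poly_degree_eq) (use 0 in simp)
        have dh: "degree hp = degree Q0" unfolding hp_def
          by (rule map_poly_degree_eq) (use 0 in simp)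
        have root0: "poly r 0 = 0" if r: "degree r > 0" "r dvd [:- 0, 1:] ^ d" for r :: "complex poly"
        proof -
          obtain z where z: "poly r z = 0" using alg_closed_imp_poly_has_root[of r] r(1) by auto
          obtain r' where "[:- 0, 1:] ^ d = r * r'" using r(2) by (elim dvdE)
          then have "poly ([:- 0, 1:] ^ d) z = 0" using z by simp
          then have "z ^ d = 0" by simp
          then show ?thesis using z by simp
        qed
        have "poly gp 0 = 0" by (rule root0) (use False dg gh in \<open>auto simp: dvd_def intro: sym\<close>)
        moreover have "poly hp 0 = 0" by (rule root0) (use False dh gh in \<open>auto simp: dvd_def mult.commute intro: sym\<close>)
        moreover have "pp (\<lambda>_. 0) 0 0 = u" by (auto simp: pp_def fun_eq_iff)
        ultimately show ?thesis using gz hz by metis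
      qed
      \<comment> \<open>The direction of the first variable, in which \<open>F\<close> has the
        derivative d x0^(d-1) / e2 at \<open>u\<close>.\<close>
      define w where "w i = (if i = 0 then 1 else 0 :: complex)" for i :: nat
      obtain P Q where PQ: "bipoly (\<lambda>l z. poly_eval G (pp w l z)) P" "bipoly (\<lambda>l z. poly_eval H (pp w l z)) Q"
        using PP[of w] by (auto simp: w_def)
      define p q where "p = poly P [:0:]" and "q = poly Q [:0:]"
      have p: "poly p l = poly_eval G (pp w l 0)" and q: "poly q l = poly_eval H (pp w l 0)" for l
        using PQ by (simp_all add: p_def q_def bipoly_def)
      have atw: "pp w 0 0 = u" by (auto simp: pp_def fun_eq_iff)
      have p0: "poly p 0 = 0" "poly q 0 = 0" using uz by (simp_all add: p q atw)
      have "poly p l * poly q l = ((x0 + l) ^ d + e1) / e2" for l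
        unfolding p q prod F using d by (simp add: pp_def u_def w_def power_0_left)
      then have "(\<lambda>l. poly p l * poly q l) = (\<lambda>l. ((x0 + l) ^ d + e1) / e2)" by blast
      moreover have "((\<lambda>l. poly p l * poly q l) has_field_derivative
          poly (pderiv p) 0 * poly q 0 + poly (pderiv q) 0 * poly p 0) (at 0)"
        by (intro DERIV_mult poly_DERIV)
      moreover have "((\<lambda>l. ((x0 + l) ^ d + e1) / e2) has_field_derivative of_nat d * x0 ^ (d - 1) / e2) (at 0)"
        using e by (auto intro!: derivative_eq_intros)
      ultimately have "of_nat d * x0 ^ (d - 1) / e2 = 0" using DERIV_unique p0 by fastforce
      then show ?thesis using d e x00 by simp
    qed
  qed
qed

subsection \<open>The projective plane and its dual\<close>

lemma abs_proj_eqI: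
  assumes "v \<in> hvec" "w \<in> hvec" "\<And>i j. v i * w j = v j * w i"
  shows "abs_proj v = abs_proj w"
proof -
  obtain i where i: "v i \<noteq> 0" using assms(1) by (auto simp: hvec_def)
  have eq: "w j = (w i / v i) * v j" for j using assms(3)[of i j] i by (simp add: field_simps)
  obtain j where "w j \<noteq> 0" using assms(2) by (auto simp: hvec_def)
  with eq have "w i / v i \<noteq> 0" by (metis mult_zero_left)
  moreover have "w = (\<lambda>j. (w i / v i) * v j)" using eq by blast
  ultimately show ?thesis using abs_proj_eq_iff[OF assms(1,2)] by blast
qed

lemma sum_le2: "(\<Sum>i\<le>2. f i) = f 0 + f 1 + f (2::nat)" for f :: "nat \<Rightarrow> 'a::comm_monoid_add"
  by (simp add: numeral_2_eq_2)

definition vec3 :: "complex \<Rightarrow> complex \<Rightarrow> complex \<Rightarrow> nat \<Rightarrow> complex" where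
  "vec3 x y z i = (if i = 0 then x else if i = 1 then y else if i = 2 then z else 0)"

lemma vec3_simps [simp]: "vec3 x y z 0 = x" "vec3 x y z (Suc 0) = y" "vec3 x y z 2 = z"
  "i > 2 \<Longrightarrow> vec3 x y z i = 0"
  by (auto simp: vec3_def)

lemma vec3_hvec: "x \<noteq> 0 \<or> y \<noteq> 0 \<or> z \<noteq> 0 \<Longrightarrow> vec3 x y z \<in> hvec"
  using hvecI[of 2 "vec3 x y z" 0] hvecI[of 2 "vec3 x y z" 1] hvecI[of 2 "vec3 x y z" 2]
  by (auto simp: vec3_def)

lemma vec3_eta:
  assumes "\<And>i. i > 2 \<Longrightarrow> v i = 0" shows "v = vec3 (v 0) (v 1) (v 2)"
proof
  fix i show "v i = vec3 (v 0) (v 1) (v 2) i"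
    using assms[of i] by (cases "i > 2") (auto simp: vec3_def not_less le_Suc_eq numeral_2_eq_2)
qed

lemma hvec_le2:
  assumes "v \<in> hvec" "\<And>i. i > 2 \<Longrightarrow> v i = 0" shows "v 0 \<noteq> 0 \<or> v 1 \<noteq> 0 \<or> v 2 \<noteq> 0"
proof -
  obtain i where "v i \<noteq> 0" using assms(1) by (auto simp: hvec_def)
  then have "i = 0 \<or> i = 1 \<or> i = 2" using assms(2)[of i] by (cases "i > 2") auto
  with \<open>v i \<noteq> 0\<close> show ?thesis by auto
qed

lemma minors_le2:
  fixes v w :: "nat \<Rightarrow> complex"
  assumes "\<And>i. i > 2 \<Longrightarrow> v i = 0" "\<And>i. i > 2 \<Longrightarrow> w i = 0"
    and "v 0 * w 1 = v 1 * w 0" "v 0 * w 2 = v 2 * w 0" "v 1 * w 2 = v 2 * w 1"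
  shows "v i * w j = v j * w i"
proof -
  have "i = 0 \<or> i = 1 \<or> i = 2 \<or> i > 2" "j = 0 \<or> j = 1 \<or> j = 2 \<or> j > 2" by auto
  then show ?thesis using assms by (elim disjE) (simp_all add: mult.commute)
qed

lemma perp_abs:
  assumes "a \<in> hvec" "w \<in> hvec"
  shows "abs_proj w \<in> perp (abs_proj a) \<longleftrightarrow> (\<forall>i>2. w i = 0) \<and> a 0 * w 0 + a 1 * w 1 + a 2 * w 2 = 0"
proof -
  obtain c where c: "c \<noteq> 0" "rep_proj (abs_proj a) = (\<lambda>i. c * a i)" using rep_abs_proj[OF assms(1)] by blast
  obtain e where e: "e \<noteq> 0" "rep_proj (abs_proj w) = (\<lambda>i. e * w i)" using rep_abs_proj[OF assms(2)] by blast
  have "(\<Sum>i\<le>2. rep_proj (abs_proj a) i * rep_proj (abs_proj w) i) = c * e * (a 0 * w 0 + a 1 * w 1 + a 2 * w 2)"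
    unfolding c e sum_le2 by (simp add: algebra_simps)
  then show ?thesis using c(1) e(1) by (simp add: perp_def proj_space_abs_iff[OF assms(2)])
qed

text \<open>Cramer's rule settles the first two coordinates. The third follows from orthogonality to
  \<open>g\<close>, since \<open>g2 = 0\<close> together with the nonzero minor would force
  \<open>g\<close> to vanish.\<close>

lemma span_of_orthogonal_aux:
  fixes g0 :: complex
  assumes "g0 \<noteq> 0 \<or> g1 \<noteq> 0 \<or> g2 \<noteq> 0" "a0 * b1 \<noteq> a1 * b0"
    and "g0 * a0 + g1 * a1 + g2 * a2 = 0" "g0 * b0 + g1 * b1 + g2 * b2 = 0" "g0 * w0 + g1 * w1 + g2 * w2 = 0"
  shows "\<exists>s t. w0 = s * a0 + t * b0 \<and> w1 = s * a1 + t * b1 \<and> w2 = s * a2 + t * b2"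
proof -
  define m where "m = a0 * b1 - a1 * b0"
  have m: "m \<noteq> 0" using assms(2) by (simp add: m_def)
  have g2: "g2 \<noteq> 0"
  proof
    assume "g2 = 0"
    then have "m * g0 = 0" "m * g1 = 0" using assms(3,4) unfolding m_def by algebra+
    then show False using m assms(1) \<open>g2 = 0\<close> by simp
  qed
  define s t where "s = (w0 * b1 - w1 * b0) / m" and "t = (a0 * w1 - a1 * w0) / m"
  have st: "m * s = w0 * b1 - w1 * b0" "m * t = a0 * w1 - a1 * w0" using m by (simp_all add: s_def t_def)
  have "m * (w0 - (s * a0 + t * b0)) = 0" "m * (w1 - (s * a1 + t * b1)) = 0"
    using st unfolding m_def by algebra+
  then have 01: "w0 = s * a0 + t * b0" "w1 = s * a1 + t * b1" using m by simp_all
  have "g2 * (w2 - (s * a2 + t * b2)) = 0" using assms(3-5) unfolding 01 by algebra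
  then show ?thesis using g2 01 by auto
qed

lemma span_of_orthogonal:
  assumes v: "\<And>i. i > 2 \<Longrightarrow> a i = 0" "\<And>i. i > 2 \<Longrightarrow> b i = 0" "\<And>i. i > 2 \<Longrightarrow> w i = 0"
    and ab: "a \<in> hvec" "b \<in> hvec" "\<not> proportional a b"
    and g: "g 0 \<noteq> 0 \<or> g 1 \<noteq> 0 \<or> g 2 \<noteq> (0::complex)"
    and o: "g 0 * a 0 + g 1 * a 1 + g 2 * a 2 = 0" "g 0 * b 0 + g 1 * b 1 + g 2 * b 2 = 0"
      "g 0 * w 0 + g 1 * w 1 + g 2 * w 2 = 0"
  shows "\<exists>s t. w = (\<lambda>i. s * a i + t * b i)"
proof -
  have "\<exists>s t. w 0 = s * a 0 + t * b 0 \<and> w 1 = s * a 1 + t * b 1 \<and> w 2 = s * a 2 + t * b 2"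
  proof -
    consider "a 0 * b 1 \<noteq> a 1 * b 0" | "a 0 * b 2 \<noteq> a 2 * b 0" | "a 1 * b 2 \<noteq> a 2 * b 1"
      using minors_le2[of a b, OF v(1,2)] abs_proj_eqI[OF ab(1,2)] ab abs_proj_eq_iff[OF ab(1,2)]
      unfolding proportional_def by blast
    then show ?thesis
    proof cases
      case 1
      from span_of_orthogonal_aux[OF g 1 o] show ?thesis .
    next
      case 2
      from span_of_orthogonal_aux[of "g 0" "g 2" "g 1" "a 0" "b 2" "a 2" "b 0" "a 1" "b 1" "w 0" "w 2" "w 1"]
      show ?thesis using g 2 o by (auto simp: ac_simps)
    next
      case 3
      from span_of_orthogonal_aux[of "g 1" "g 2" "g 0" "a 1" "b 2" "a 2" "b 1" "a 0" "b 0" "w 1" "w 2" "w 0"]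
      show ?thesis using g 3 o by (auto simp: ac_simps)
    qed
  qed
  then obtain s t where st: "w 0 = s * a 0 + t * b 0" "w 1 = s * a 1 + t * b 1" "w 2 = s * a 2 + t * b 2" by blast
  have "w i = s * a i + t * b i" for i
  proof (cases "i > 2")
    case False
    then have "i = 0 \<or> i = 1 \<or> i = 2" by auto
    then show ?thesis using st by auto
  qed (use v in simp)
  then show ?thesis by blast
qed

lemma line_eq_perp:
  assumes "is_line L" "L \<subseteq> perp l" "l \<in> proj_space 2" shows "L = perp l"
proof
  obtain a b where ab: "a \<in> hvec" "b \<in> hvec" "\<not> proportional a b"
    and L: "L = {abs_proj v |v. v \<in> hvec \<and> (\<exists>s t. v = (\<lambda>i. s * a i + t * b i))}"
    using assms(1) by (auto simp: is_line_def)
  define g where "g = rep_proj l"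
  have g: "g \<in> hvec" "l = abs_proj g" "\<And>i. i > 2 \<Longrightarrow> g i = 0" using rep_proj_space assms(3) by (auto simp: g_def)
  have "abs_proj a \<in> L" unfolding L using ab by (intro CollectI exI[of _ a] conjI exI[of _ 1] exI[of _ 0]) auto
  then have a: "\<forall>i>2. a i = 0" "g 0 * a 0 + g 1 * a 1 + g 2 * a 2 = 0"
    using assms(2) perp_abs[OF g(1) ab(1)] g(2) by blast+
  have "abs_proj b \<in> L" unfolding L using ab by (intro CollectI exI[of _ b] conjI exI[of _ 0] exI[of _ 1]) auto
  then have b: "\<forall>i>2. b i = 0" "g 0 * b 0 + g 1 * b 1 + g 2 * b 2 = 0"
    using assms(2) perp_abs[OF g(1) ab(2)] g(2) by blast+
  show "perp l \<subseteq> L"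
  proof
    fix x assume x: "x \<in> perp l"
    define w where "w = rep_proj x"
    have w: "w \<in> hvec" "x = abs_proj w" by (auto simp: w_def)
    have w2: "\<forall>i>2. w i = 0" "g 0 * w 0 + g 1 * w 1 + g 2 * w 2 = 0"
      using x perp_abs[OF g(1) w(1)] g(2) w(2) by blast+
    have "\<exists>s t. w = (\<lambda>i. s * a i + t * b i)"
      by (rule span_of_orthogonal[OF _ _ _ ab _ a(2) b(2) w2(2)]) (use a b w2 hvec_le2[OF g(1,3)] in auto)
    then show "x \<in> L" unfolding L w(2) using w(1) by blast
  qed
qed (rule assms(2))

lemma perp_inj:
  assumes "l \<in> proj_space 2" "m \<in> proj_space 2" "perp l \<subseteq> perp m" shows "l = m"
proof -
  define g h where "g = rep_proj l" and "h = rep_proj m"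
  have g: "g \<in> hvec" "l = abs_proj g" "\<And>i. i > 2 \<Longrightarrow> g i = 0" using rep_proj_space assms(1) by (auto simp: g_def)
  have h: "h \<in> hvec" "m = abs_proj h" "\<And>i. i > 2 \<Longrightarrow> h i = 0" using rep_proj_space assms(2) by (auto simp: h_def)
  have key: "h 0 * x + h 1 * y + h 2 * z = 0" if "g 0 * x + g 1 * y + g 2 * z = 0" for x y z
  proof (cases "x \<noteq> 0 \<or> y \<noteq> 0 \<or> z \<noteq> 0")
    case True
    then have v: "vec3 x y z \<in> hvec" by (rule vec3_hvec)
    have "abs_proj (vec3 x y z) \<in> perp l" unfolding g(2) perp_abs[OF g(1) v] using that by simp
    then have "abs_proj (vec3 x y z) \<in> perp m" using assms(3) by blast
    then show ?thesis unfolding h(2) perp_abs[OF h(1) v] by simp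
  qed auto
  have "g i * h j = g j * h i" for i j
    by (rule minors_le2[OF g(3) h(3)])
       (use key[of "- g 1" "g 0" 0] key[of "- g 2" 0 "g 0"] key[of 0 "- g 2" "g 1"] in \<open>auto simp: algebra_simps\<close>)
  then show ?thesis using abs_proj_eqI[OF g(1) h(1)] g h by simp
qed

lemma line_through_properties:
  assumes "p \<in> proj_space 2" "y \<in> proj_space 2" "p \<noteq> y"
  shows "line_through p y \<in> proj_space 2" "p \<in> perp (line_through p y)" "y \<in> perp (line_through p y)"
proof -
  define a b where "a = rep_proj p" and "b = rep_proj y"
  have a: "a \<in> hvec" "p = abs_proj a" "\<And>i. i > 2 \<Longrightarrow> a i = 0" using rep_proj_space assms(1) by (auto simp: a_def)
  have b: "b \<in> hvec" "y = abs_proj b" "\<And>i. i > 2 \<Longrightarrow> b i = 0" using rep_proj_space assms(2) by (auto simp: b_def)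
  \<comment> \<open>The cross product of \<open>a\<close> and \<open>b\<close>.\<close>
  define c where "c = vec3 (a 1 * b 2 - a 2 * b 1) (a 2 * b 0 - a 0 * b 2) (a 0 * b 1 - a 1 * b 0)"
  have "\<not> (\<forall>i j. a i * b j = a j * b i)" using abs_proj_eqI[OF a(1) b(1)] a b assms(3) by blast
  then have "a 1 * b 2 - a 2 * b 1 \<noteq> 0 \<or> a 2 * b 0 - a 0 * b 2 \<noteq> 0 \<or> a 0 * b 1 - a 1 * b 0 \<noteq> 0"
    using minors_le2[of a b, OF a(3) b(3)] by (auto simp: algebra_simps)
  then have c: "c \<in> hvec" unfolding c_def by (rule vec3_hvec)
  have "\<exists>!l. l \<in> proj_space 2 \<and> p \<in> perp l \<and> y \<in> perp l"
  proof (rule ex1I[of _ "abs_proj c"])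
    have "p \<in> perp (abs_proj c)" unfolding a(2) perp_abs[OF c a(1)] using a(3) by (simp add: c_def algebra_simps)
    moreover have "y \<in> perp (abs_proj c)" unfolding b(2) perp_abs[OF c b(1)] using b(3) by (simp add: c_def algebra_simps)
    ultimately show "abs_proj c \<in> proj_space 2 \<and> p \<in> perp (abs_proj c) \<and> y \<in> perp (abs_proj c)"
      by (simp add: proj_space_abs_iff[OF c]) (simp add: c_def)
  next
    fix l assume l: "l \<in> proj_space 2 \<and> p \<in> perp l \<and> y \<in> perp l"
    define g where "g = rep_proj l"
    have g: "g \<in> hvec" "l = abs_proj g" "\<And>i. i > 2 \<Longrightarrow> g i = 0" using rep_proj_space l by (auto simp: g_def)
    have 1: "g 0 * a 0 + g 1 * a 1 + g 2 * a 2 = 0" using l perp_abs[OF g(1) a(1)] a g by auto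
    have 2: "g 0 * b 0 + g 1 * b 1 + g 2 * b 2 = 0" using l perp_abs[OF g(1) b(1)] b g by auto
    have "g i * c j = g j * c i" for i j
    proof (rule minors_le2[OF g(3)])
      show "g 0 * c 1 = g 1 * c 0" "g 0 * c 2 = g 2 * c 0" "g 1 * c 2 = g 2 * c 1"
        using 1 2 unfolding c_def by (simp_all, algebra+)
    qed (simp_all add: c_def)
    then show "l = abs_proj c" using abs_proj_eqI[OF g(1) c] g by simp
  qed
  from theI'[OF this] show "line_through p y \<in> proj_space 2" "p \<in> perp (line_through p y)" "y \<in> perp (line_through p y)"
    unfolding line_through_def by auto
qed

subsection \<open>Diagonal plane curves and their duals\<close>

text \<open>The curve x^d + e1 y^d + e2 z^d = 0, regarded as a cyclic covering with root
  \<open>z\<close> over the line with coordinates \<open>x\<close>, \<open>y\<close>. Thus charts,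
  compactness and smoothness are those of the cyclic curve with k = 1.\<close>

locale diagonal_curve =
  fixes d :: nat and e1 e2 :: complex
  assumes d2: "d \<ge> 2" and e1: "e1 \<noteq> 0" and e2: "e2 \<noteq> 0"
begin

definition bf :: "nat \<Rightarrow> complex" where
  "bf j = (if j = 0 then - 1 / e2 else if j = d then - e1 / e2 else 0)"

sublocale C: cyclic_curve "Suc 0" d bf
  by unfold_locales (use d2 in auto)

lemma bin_eq: "C.bin s t = - (s ^ d + e1 * t ^ d) / e2"
proof -
  have "C.bin s t = (\<Sum>j\<in>{0, d}. bf j * s ^ (d - j) * t ^ j)"
    unfolding C.bin_def by (rule sum.mono_neutral_cong_right) (auto simp: bf_def)
  also have "\<dots> = - (s ^ d + e1 * t ^ d) / e2" using d2 e2 by (simp add: bf_def field_simps)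
  finally show ?thesis .
qed

lemma root_exists: "\<exists>x::complex. x ^ d = c"
proof (cases "c = 0")
  case False
  then have "card {x. x ^ d = c} = d" by (intro card_nth_roots) (use d2 in auto)
  then have "{x. x ^ d = c} \<noteq> {}" using d2 by (metis card.empty not_numeral_le_zero)
  then show ?thesis by blast
qed (use d2 in \<open>auto intro!: exI[of _ 0] simp: power_0_left\<close>)

sublocale C: smooth_cyclic_curve "Suc 0" d bf
proof
  show "deriv (C.bin1 u) z \<noteq> 0" if "C.bin1 u z = 0" for u z
  proof -
    define A B where "A = (if u then e1 else 1)" and "B = (if u then 1 else e1)"
    have AB: "A \<noteq> 0" "B \<noteq> 0" using e1 by (auto simp: A_def B_def)
    have b: "C.bin1 u = (\<lambda>z. - (B + A * z ^ d) / e2)"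
      by (auto simp: C.bin1_def bin_eq A_def B_def fun_eq_iff)
    have "z \<noteq> 0" using that AB e2 d2 by (auto simp: b power_0_left)
    moreover have "((\<lambda>z. - (B + A * z ^ d) / e2) has_field_derivative - (A * (of_nat d * z ^ (d - 1))) / e2) (at z)"
      using e2 by (auto intro!: derivative_eq_intros)
    then have "deriv (C.bin1 u) z = - (A * (of_nat d * z ^ (d - 1))) / e2" unfolding b by (rule DERIV_imp_deriv)
    ultimately show ?thesis using AB e2 d2 by simp
  qed
  obtain t where t: "t ^ d = - 1 / e1" using root_exists by blast
  then have "C.bin 1 t = 0" using e1 by (simp add: bin_eq)
  then show "\<exists>s t. (s, t) \<noteq> (0, 0) \<and> C.bin s t = 0" by (intro exI[of _ 1] exI[of _ t]) simp
qed

definition ee :: "nat \<Rightarrow> complex" where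
  "ee i = (if i = 0 then 1 else if i = 1 then e1 else if i = 2 then e2 else 0)"

lemma ee_simps [simp]: "ee 0 = 1" "ee (Suc 0) = e1" "ee 2 = e2" "i > 2 \<Longrightarrow> ee i = 0" by (auto simp: ee_def)

definition dform :: cpoly where
  "dform = Var 0 ^ d + Const e1 * Var 1 ^ d + Const e2 * Var 2 ^ d"

lemma form_dform: "form 2 d dform"
  unfolding dform_def by (intro form_add form_Const_mult form_Var_power) auto

lemma eval_dform: "poly_eval dform v = v 0 ^ d + e1 * v 1 ^ d + e2 * v 2 ^ d"
  by (simp add: dform_def poly_eval_simps)

lemma cvec_eq: "C.cvec s t y = vec3 s t y"
  by (auto simp: C.cvec_def vec3_def fun_eq_iff le_Suc_eq numeral_2_eq_2)

lemma curve_iff: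
  assumes v: "v \<in> hvec"
  shows "abs_proj v \<in> C.curve \<longleftrightarrow> (\<forall>i>2. v i = 0) \<and> v 0 ^ d + e1 * v 1 ^ d + e2 * v 2 ^ d = 0"
proof -
  have "abs_proj v \<in> C.curve \<longleftrightarrow> (\<forall>i>2. v i = 0) \<and> poly_eval C.eqn v = 0"
    unfolding C.curve_plane[OF One_nat_def[symmetric]] zero_locus_def
    using poly_eval_rep_abs[OF C.form_eqn v] proj_space_abs_iff[OF v, of 2] by (simp add: numeral_2_eq_2)
  moreover have "poly_eval C.eqn v = (v 0 ^ d + e1 * v 1 ^ d + e2 * v 2 ^ d) / e2" if "\<forall>i>2. v i = 0"
  proof -
    have "v = C.cvec (v 0) (v 1) (v 2)" unfolding cvec_eq by (rule vec3_eta) (use that in blast)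
    then have "poly_eval C.eqn v = v 2 ^ d - C.bin (v 0) (v 1)" using C.eval_eqn by metis
    then show ?thesis using e2 by (simp add: bin_eq field_simps)
  qed
  ultimately show ?thesis using e2 by auto
qed

lemma curve_in_plane: "C.curve \<subseteq> proj_space 2"
  using C.curve_subset_proj_space by (simp add: numeral_2_eq_2)

lemma smooth: "smooth_curve 2 C.curve"
  using C.smooth_curve by (simp add: numeral_2_eq_2)

lemma degree: "plane_curve_degree C.curve d"
  unfolding plane_curve_degree_def
proof (intro exI conjI)
  show "form 2 d C.eqn" using C.form_eqn by (simp add: numeral_2_eq_2)
  show "C.curve = zero_locus 2 {C.eqn}" by (rule C.curve_plane) simp
  have f: "form 2 d C.eqn" using C.form_eqn by (simp add: numeral_2_eq_2)
  show "irreducible C.eqn"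
  proof (rule irreducible_diagonal[OF d2 e1 e2])
    fix v
    have "poly_eval C.eqn v = poly_eval C.eqn (C.cvec (v 0) (v 1) (v 2))"
      unfolding cvec_eq
      by (rule poly_eval_restrict[OF f]) (auto simp: vec3_def le_Suc_eq numeral_2_eq_2)
    then show "poly_eval C.eqn v = v 2 ^ d + (v 0 ^ d + e1 * v 1 ^ d) / e2"
      using e2 by (simp add: C.eval_eqn bin_eq field_simps)
  qed
qed

text \<open>The gradient of the equation, divided by \<open>d\<close>.\<close>

definition gv :: "(nat \<Rightarrow> complex) \<Rightarrow> nat \<Rightarrow> complex" where
  "gv v i = ee i * v i ^ (d - 1)"

lemma gv_hvec:
  assumes "v \<in> hvec" "\<And>i. i > 2 \<Longrightarrow> v i = 0" shows "gv v \<in> hvec"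
proof -
  have "gv v 0 \<noteq> 0 \<or> gv v 1 \<noteq> 0 \<or> gv v 2 \<noteq> 0"
    using hvec_le2[OF assms] e1 e2 d2 by (auto simp: gv_def)
  moreover have "gv v i = 0" if "i > 2" for i using that by (simp add: gv_def)
  ultimately show ?thesis using hvecI[of 2 "gv v"] by blast
qed

lemma gv_scale: "gv (\<lambda>i. c * v i) = (\<lambda>i. c ^ (d - 1) * gv v i)"
  by (auto simp: gv_def power_mult_distrib fun_eq_iff)

lemma power_d: "x ^ d = x ^ (d - 1) * x" for x :: complex
  using d2 by (cases d) auto

text \<open>Both sides are lines, so one inclusion is enough; it results from testing a tangent
  vector against the equation of the curve.\<close>

lemma tangent_eq:
  assumes v: "v \<in> hvec" "abs_proj v \<in> C.curve"
  shows "tangent_space 2 C.curve (abs_proj v) = perp (abs_proj (gv v))"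
proof -
  have v2: "\<And>i. i > 2 \<Longrightarrow> v i = 0" using curve_iff[OF v(1)] v(2) by blast
  have g: "gv v \<in> hvec" by (rule gv_hvec[OF v(1) v2])
  show ?thesis
  proof (rule line_eq_perp)
    show "is_line (tangent_space 2 C.curve (abs_proj v))"
      using C.tangent_line[OF v(2)] by (simp add: numeral_2_eq_2)
    show "abs_proj (gv v) \<in> proj_space 2" unfolding proj_space_abs_iff[OF g] by (simp add: gv_def)
    show "tangent_space 2 C.curve (abs_proj v) \<subseteq> perp (abs_proj (gv v))"
    proof
      fix x assume "x \<in> tangent_space 2 C.curve (abs_proj v)"
      then obtain w where w: "x = abs_proj w" "w \<in> hvec" "\<forall>i>2. w i = 0"
        "\<forall>F d. form 2 d F \<longrightarrow> (\<forall>y\<in>C.curve. poly_eval F (rep_proj y) = 0) \<longrightarrow>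
          (\<Sum>i\<le>2. partial_deriv i F v * w i) = 0"
        unfolding tangent_space_abs[OF v(1)] by blast
      have "poly_eval dform (rep_proj y) = 0" if "y \<in> C.curve" for y
        using curve_iff[of "rep_proj y"] that by (simp add: eval_dform)
      then have 0: "(\<Sum>i\<le>2. partial_deriv i dform v * w i) = 0" using w(4) form_dform by blast
      have "((\<lambda>z. poly_eval dform (\<lambda>i. v i + z * w i)) has_field_derivative
         (\<Sum>i\<le>2. partial_deriv i dform (\<lambda>i. v i + 0 * w i) * w i)) (at 0)"
        by (rule partial_deriv_chain[OF form_dform]) (auto intro!: derivative_eq_intros)
      moreover have "((\<lambda>z. poly_eval dform (\<lambda>i. v i + z * w i)) has_field_derivative
         of_nat d * (gv v 0 * w 0 + gv v 1 * w 1 + gv v 2 * w 2)) (at 0)"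
        unfolding eval_dform by (auto intro!: derivative_eq_intros simp: gv_def algebra_simps)
      ultimately have "of_nat d * (gv v 0 * w 0 + gv v 1 * w 1 + gv v 2 * w 2) = 0"
        using 0 DERIV_unique by fastforce
      then show "x \<in> perp (abs_proj (gv v))" using w(3) d2 unfolding w(1) perp_abs[OF g w(2)] by simp
    qed
  qed
qed

definition gauss :: "proj \<Rightarrow> proj" where "gauss x = abs_proj (gv (rep_proj x))"

lemma gauss_abs:
  assumes "v \<in> hvec" "\<And>i. i > 2 \<Longrightarrow> v i = 0" shows "gauss (abs_proj v) = abs_proj (gv v)"
proof -
  obtain c where c: "c \<noteq> 0" "rep_proj (abs_proj v) = (\<lambda>i. c * v i)" using rep_abs_proj[OF assms(1)] by blast
  show ?thesis unfolding gauss_def c gv_scale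
    by (rule abs_proj_scale[OF _ gv_hvec[OF assms]]) (use c in simp)
qed

lemma rep_curve: "x \<in> C.curve \<Longrightarrow> i > 2 \<Longrightarrow> rep_proj x i = 0"
  using curve_in_plane rep_proj_space by blast

text \<open>The set of tangent lines is a continuous image of a compact curve all of whose points
  are smooth, so taking the closure adds nothing.\<close>

lemma dual_eq: "dual_curve C.curve = gauss ` C.curve"
proof -
  have "{l \<in> proj_space 2. \<exists>x. smooth_point 2 C.curve x \<and> perp l = tangent_space 2 C.curve x} = gauss ` C.curve"
  proof (intro equalityI subsetI)
    fix l assume "l \<in> {l \<in> proj_space 2. \<exists>x. smooth_point 2 C.curve x \<and> perp l = tangent_space 2 C.curve x}"
    then obtain x where x: "l \<in> proj_space 2" "x \<in> C.curve" "perp l = tangent_space 2 C.curve x"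
      by (auto simp: smooth_point_def)
    have "tangent_space 2 C.curve x = perp (gauss x)"
      using tangent_eq[of "rep_proj x"] x(2) by (simp add: gauss_def)
    moreover have "gauss x \<in> proj_space 2" unfolding gauss_def
      using gv_hvec[of "rep_proj x"] rep_curve[OF x(2)] by (simp add: proj_space_abs_iff gv_def)
    ultimately have "l = gauss x" using perp_inj x by blast
    with x show "l \<in> gauss ` C.curve" by blast
  next
    fix l assume "l \<in> gauss ` C.curve"
    then obtain x where x: "x \<in> C.curve" "l = gauss x" by blast
    have "tangent_space 2 C.curve x = perp (gauss x)"
      using tangent_eq[of "rep_proj x"] x(1) by (simp add: gauss_def)
    moreover have "gauss x \<in> proj_space 2" unfolding gauss_def
      using gv_hvec[of "rep_proj x"] rep_curve[OF x(1)] by (simp add: proj_space_abs_iff gv_def)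
    moreover have "smooth_point 2 C.curve x" using smooth x by (auto simp: smooth_curve_def)
    ultimately show "l \<in> {l \<in> proj_space 2. \<exists>x. smooth_point 2 C.curve x \<and> perp l = tangent_space 2 C.curve x}"
      using x by auto
  qed
  moreover have "compact (gauss ` C.curve)"
  proof (rule compact_continuous_image[OF _ C.compact_curve], rule continuous_on_projI)
    let ?S = "{v \<in> hvec. abs_proj v \<in> C.curve}"
    have S: "i > 2 \<Longrightarrow> v i = 0" if "v \<in> ?S" for v i using that curve_iff by blast
    have "continuous_on ?S (\<lambda>v. abs_proj (gv v))"
    proof (rule continuous_on_into_proj)
      show "continuous_on ?S (\<lambda>v. gv v i)" for i unfolding gv_def by (intro continuous_intros continuous_on_coord)
      show "gv v \<in> hvec" if "v \<in> ?S" for v using gv_hvec[of v] S[OF that] that by blast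
    qed
    then show "continuous_on ?S (\<lambda>v. gauss (abs_proj v))"
      by (rule continuous_on_eq) (use S gauss_abs in force)
  qed
  then have "closed (gauss ` C.curve)" by (rule compact_imp_closed)
  ultimately show ?thesis unfolding dual_curve_def by (simp add: closure_closed)
qed

text \<open>By biduality the tangent of the dual at the tangent line of \<open>x\<close> is the
  pencil through \<open>x\<close>; if the pencil through \<open>p\<close> were tangent to the dual,
  \<open>p\<close> would lie on the curve. Smoothness is needed only at tangents passing through
  \<open>p\<close>. There the Gauss map is an immersion because no coordinate of the point of
  contact vanishes, and the nonzero derivative of \<open>G\<close> bounds the tangent space from
  above.\<close>

lemma transversalI:
  assumes p: "p \<in> hvec" "\<And>i. i > 2 \<Longrightarrow> p i = 0" "p 0 ^ d + e1 * p 1 ^ d + e2 * p 2 ^ d \<noteq> 0"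
    and G: "form 2 D G" "\<And>v. v \<in> hvec \<Longrightarrow> abs_proj v \<in> C.curve \<Longrightarrow> poly_eval G (gv v) = 0"
    and reg: "\<And>v. v \<in> hvec \<Longrightarrow> abs_proj v \<in> C.curve \<Longrightarrow> p 0 * gv v 0 + p 1 * gv v 1 + p 2 * gv v 2 = 0 \<Longrightarrow>
        v 0 \<noteq> 0 \<and> v 1 \<noteq> 0 \<and> v 2 \<noteq> 0 \<and> partial_deriv 2 G (gv v) \<noteq> 0"
  shows "transversal (perp (abs_proj p)) (dual_curve C.curve)"
proof -
  let ?D = "gauss ` C.curve"
  have D: "dual_curve C.curve = ?D" by (rule dual_eq)
  have main: "\<exists>x\<in>C.curve. is_line (tangent_space 2 ?D l) \<and> tangent_space 2 ?D l = perp x"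
    if l: "l \<in> perp (abs_proj p)" "l \<in> ?D" for l
  proof -
    obtain x where x: "x \<in> C.curve" "l = gauss x" using l by blast
    obtain u z0 y0 where pv: "x = abs_proj (C.pvec u z0 y0)" "y0 ^ d = C.bin1 u z0" using C.curve_patch[OF x(1)] by blast
    define P where "P = C.pvec u z0 y0"
    have Ph: "P \<in> hvec" by (simp add: P_def C.pvec_hvec)
    have xP: "abs_proj P \<in> C.curve" using x pv by (simp add: P_def)
    have P2: "P i = 0" if "i > 2" for i using curve_iff[OF Ph] xP that by blast
    define g where "g = gv P"
    have gh: "g \<in> hvec" unfolding g_def by (rule gv_hvec[OF Ph P2])
    have lg: "l = abs_proj g" using gauss_abs[OF Ph P2] x pv by (simp add: P_def g_def)
    have g2: "g i = 0" if "i > 2" for i using that by (simp add: g_def gv_def)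
    have "p 0 * g 0 + p 1 * g 1 + p 2 * g 2 = 0" using l(1) perp_abs[OF p(1) gh] lg by simp
    then have nz: "P 0 \<noteq> 0" "P 1 \<noteq> 0" "P 2 \<noteq> 0" and grad: "partial_deriv 2 G g \<noteq> 0"
      using reg[OF Ph xP] by (simp_all add: g_def)
    obtain r \<phi> \<eta> where r: "r > 0" "\<phi> holomorphic_on ball 0 r" "\<eta> holomorphic_on ball 0 r"
        "\<phi> 0 = z0" "\<eta> 0 = y0" "\<And>\<zeta>. \<zeta> \<in> ball 0 r \<Longrightarrow> \<eta> \<zeta> ^ d = C.bin1 u (\<phi> \<zeta>)"
        "deriv \<phi> 0 \<noteq> 0 \<or> deriv \<eta> 0 \<noteq> 0"
      using C.affine_chart[OF pv(2)] by blast
    define dz dy where "dz = deriv \<phi> 0" and "dy = deriv \<eta> 0"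
    have dphi: "(\<phi> has_field_derivative dz) (at 0)" unfolding dz_def
      by (rule holomorphic_derivI[OF r(2) open_ball]) (use r in simp)
    have deta: "(\<eta> has_field_derivative dy) (at 0)" unfolding dy_def
      by (rule holomorphic_derivI[OF r(3) open_ball]) (use r in simp)
    define Q where "Q = C.dvec u z0 dz dy"
    define V where "V \<zeta> = C.pvec u (\<phi> \<zeta>) (\<eta> \<zeta>)" for \<zeta>
    have V0: "V 0 = P" using r by (simp add: V_def P_def)
    have dV: "((\<lambda>\<zeta>. V \<zeta> i) has_field_derivative Q i) (at 0)" for i
      using C.pvec_derivative[OF dphi deta] r(4) unfolding V_def Q_def by simp
    have ev0: "\<forall>\<^sub>F \<zeta> in nhds 0. \<zeta> \<in> ball 0 r" using r(1) by (intro eventually_nhds_in_open) auto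
    have Vc: "V \<zeta> \<in> hvec" "abs_proj (V \<zeta>) \<in> C.curve" if "\<zeta> \<in> ball 0 r" for \<zeta>
      using C.pvec_hvec C.pvec_in_curve[OF r(6)[OF that]] by (simp_all add: V_def)
    \<comment> \<open>The velocity of the Gauss map along the chart.\<close>
    define R where "R i = ee i * (of_nat (d - 1) * P i ^ (d - 2) * Q i)" for i
    have d21: "d - 1 - Suc 0 = d - 2" by simp
    have dR: "((\<lambda>\<zeta>. gv (V \<zeta>) i) has_field_derivative R i) (at 0)" for i
      unfolding gv_def R_def using dV[of i] V0
      by (auto intro!: derivative_eq_intros simp: d21 numeral_2_eq_2)
    have zero_deriv: "D = 0" if "(f has_field_derivative D) (at 0)" "\<And>\<zeta>. \<zeta> \<in> ball 0 r \<Longrightarrow> f \<zeta> = 0" for f D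
    proof -
      have "(f has_field_derivative 0) (at 0)"
        by (rule DERIV_cong_ev[THEN iffD2, rotated -1, OF DERIV_const])
           (use ev0 that(2) in \<open>auto elim: eventually_mono\<close>)
      then show ?thesis using that(1) DERIV_unique by blast
    qed
    have "((\<lambda>\<zeta>. V \<zeta> 0 ^ d + e1 * V \<zeta> 1 ^ d + e2 * V \<zeta> 2 ^ d) has_field_derivative
        of_nat d * (g 0 * Q 0 + g 1 * Q 1 + g 2 * Q 2)) (at 0)"
      unfolding g_def gv_def using dV[of 0] dV[of 1] dV[of 2] V0
      by (auto intro!: derivative_eq_intros simp: algebra_simps)
    then have "of_nat d * (g 0 * Q 0 + g 1 * Q 1 + g 2 * Q 2) = 0"
      by (rule zero_deriv) (use Vc curve_iff in blast)
    then have gQ: "g 0 * Q 0 + g 1 * Q 1 + g 2 * Q 2 = 0" using d2 by simp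
    have gP: "g 0 * P 0 + g 1 * P 1 + g 2 * P 2 = 0"
      using curve_iff[OF Ph] xP by (simp add: g_def gv_def power_d mult.assoc)
    \<comment> \<open>This is biduality: \<open>P i * R i\<close> is \<open>d - 1\<close> times
      \<open>g i * Q i\<close>, and \<open>g\<close> annihilates the velocity \<open>Q\<close> of
      the curve.\<close>
    have PR: "P 0 * R 0 + P 1 * R 1 + P 2 * R 2 = 0"
    proof -
      have "P i * R i = of_nat (d - 1) * (g i * Q i)" for i
      proof -
        have "P i ^ (d - 1) = P i * P i ^ (d - 2)" using d2 power_Suc[of "P i" "d - 2"] by (metis Suc_diff_le diff_Suc_Suc numeral_2_eq_2 One_nat_def)
        then show ?thesis by (simp add: R_def g_def gv_def)
      qed
      then have "P 0 * R 0 + P 1 * R 1 + P 2 * R 2 = of_nat (d - 1) * (g 0 * Q 0 + g 1 * Q 1 + g 2 * Q 2)"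
        by (simp add: algebra_simps)
      then show ?thesis using gQ by simp
    qed
    \<comment> \<open>The minors of \<open>g\<close> and \<open>R\<close> are those of
      \<open>P\<close> and \<open>Q\<close> up to factors that vanish only if a coordinate of
      \<open>P\<close> does.\<close>
    have cross: "g i * R j - g j * R i = ee i * ee j * of_nat (d - 1) * (P i * P j) ^ (d - 2) * (P i * Q j - P j * Q i)" for i j
    proof -
      have "P i ^ (d - 1) = P i * P i ^ (d - 2)" for i using d2 power_Suc[of "P i" "d - 2"] by (metis Suc_diff_le diff_Suc_Suc numeral_2_eq_2 One_nat_def)
      then show ?thesis by (simp add: R_def g_def gv_def power_mult_distrib algebra_simps)
    qed
    have "\<exists>i j. i \<le> 2 \<and> j \<le> 2 \<and> P i * Q j - P j * Q i \<noteq> 0"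
    proof (rule ccontr)
      assume neg: "\<not> ?thesis"
      let ?i = "C.ix u 0"
      have i0: "P ?i = 1" "Q ?i = 0" "?i \<le> 2"
        using C.pvec_ix[of 0 u] C.ix_ix[of 0 u] C.ix_le[of 0 u] by (simp_all add: P_def Q_def C.dvec_def)
      have Q0: "Q j = 0" if "j \<le> 2" for j using neg i0 that by force
      have "Q (C.ix u 1) = dz" using C.ix_ix[of 1 u] C.ix_le[of 1 u] by (simp add: Q_def C.dvec_def)
      moreover have "Q 2 = dy" by (simp add: Q_def C.dvec_def)
      moreover have "C.ix u 1 \<le> 2" using C.ix_le[of 1 u] by simp
      ultimately show False using Q0 r(7) by (metis dy_def dz_def order_refl)
    qed
    then obtain i j where ij: "i \<le> 2" "j \<le> 2" "P i * Q j - P j * Q i \<noteq> 0" by blast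
    have le2: "i = 0 \<or> i = 1 \<or> i = 2" if "i \<le> 2" for i :: nat using that by auto
    have "ee i \<noteq> 0" "P i \<noteq> 0" if "i \<le> 2" for i using le2[OF that] e1 e2 nz by auto
    then have gR: "g i * R j - g j * R i \<noteq> 0" unfolding cross using ij d2 by simp
    have "R i \<noteq> 0 \<or> R j \<noteq> 0" using gR by auto
    then have Rh: "R \<in> hvec" using hvecI[of 2 R] by (auto simp: R_def)
    have np: "\<not> proportional g R"
    proof
      assume "proportional g R"
      then obtain c where "R = (\<lambda>i. c * g i)" by (auto simp: proportional_def)
      then show False using gR by simp
    qed
    have lin: "(\<Sum>i\<le>2. A i * (s * g i + t * R i)) = s * (\<Sum>i\<le>2. A i * g i) + t * (\<Sum>i\<le>2. A i * R i)"
      for A :: "nat \<Rightarrow> complex" and s t by (simp add: sum_le2 algebra_simps)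
    have tang: "(\<Sum>i\<le>2. partial_deriv i F g * (s * g i + t * R i)) = 0"
      if F: "form 2 m F" "\<forall>y\<in>?D. poly_eval F (rep_proj y) = 0" for F m s t
    proof -
      have FV: "poly_eval F (gv (V \<zeta>)) = 0" if z: "\<zeta> \<in> ball 0 r" for \<zeta>
      proof -
        have "\<forall>i>2. V \<zeta> i = 0" using Vc[OF z] curve_iff by blast
        then have "gv (V \<zeta>) \<in> hvec" "gauss (abs_proj (V \<zeta>)) = abs_proj (gv (V \<zeta>))"
          using gv_hvec gauss_abs Vc(1)[OF z] by blast+
        then show ?thesis using C.form_vanish_rep[OF F(1) _ _ F(2)] Vc(2)[OF z] by (metis imageI)
      qed
      have "poly_eval F g = 0" using FV[of 0] r(1) by (simp add: V0 g_def)
      then have 1: "(\<Sum>i\<le>2. partial_deriv i F g * g i) = 0" using euler_identity[OF F(1)] by simp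
      have "((\<lambda>\<zeta>. poly_eval F (gv (V \<zeta>))) has_field_derivative (\<Sum>i\<le>2. partial_deriv i F (gv (V 0)) * R i)) (at 0)"
        by (rule partial_deriv_chain[OF F(1) dR])
      then have "(\<Sum>i\<le>2. partial_deriv i F (gv (V 0)) * R i) = 0" by (rule zero_deriv) (rule FV)
      then show ?thesis unfolding lin 1 by (simp add: V0 g_def)
    qed
    have GD: "\<forall>y\<in>?D. poly_eval G (rep_proj y) = 0"
    proof
      fix y assume "y \<in> ?D"
      then obtain x where x: "x \<in> C.curve" "y = gauss x" by blast
      have h: "gv (rep_proj x) \<in> hvec" by (rule gv_hvec) (use rep_curve[OF x(1)] in auto)
      show "poly_eval G (rep_proj y) = 0" unfolding x(2) gauss_def poly_eval_rep_abs[OF G(1) h]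
        by (rule G(2)) (use x in auto)
    qed
    have T: "tangent_space 2 ?D l = {abs_proj v |v. v \<in> hvec \<and> (\<exists>s t. v = (\<lambda>i. s * g i + t * R i))}"
      unfolding lg tangent_space_abs[OF gh]
    proof (intro Collect_cong ex_cong1 conj_cong refl, goal_cases)
      case (1 x w)
      show ?case
      proof
        assume w: "(\<forall>i>2. w i = 0) \<and> (\<forall>F d. form 2 d F \<longrightarrow> (\<forall>y\<in>?D. poly_eval F (rep_proj y) = 0) \<longrightarrow>
          (\<Sum>i\<le>2. partial_deriv i F g * w i) = 0)"
        show "\<exists>s t. w = (\<lambda>i. s * g i + t * R i)"
        proof (rule span_of_orthogonal[where g = "\<lambda>i. partial_deriv i G g", OF _ _ _ gh Rh np])
          show "partial_deriv 0 G g * g 0 + partial_deriv 1 G g * g 1 + partial_deriv 2 G g * g 2 = 0"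
            using tang[OF G(1) GD, of 1 0] by (simp add: sum_le2)
          show "partial_deriv 0 G g * R 0 + partial_deriv 1 G g * R 1 + partial_deriv 2 G g * R 2 = 0"
            using tang[OF G(1) GD, of 0 1] by (simp add: sum_le2)
          show "partial_deriv 0 G g * w 0 + partial_deriv 1 G g * w 1 + partial_deriv 2 G g * w 2 = 0"
            using w[THEN conjunct2, rule_format, OF G(1)] GD by (simp add: sum_le2)
        qed (use w g2 grad in \<open>auto simp: R_def\<close>)
      next
        assume "\<exists>s t. w = (\<lambda>i. s * g i + t * R i)"
        then obtain s t where w: "w = (\<lambda>i. s * g i + t * R i)" by blast
        show "(\<forall>i>2. w i = 0) \<and> (\<forall>F d. form 2 d F \<longrightarrow> (\<forall>y\<in>?D. poly_eval F (rep_proj y) = 0) \<longrightarrow>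
          (\<Sum>i\<le>2. partial_deriv i F g * w i) = 0)"
          unfolding w using tang by (auto simp: g2 R_def)
      qed
    qed
    then have line: "is_line (tangent_space 2 ?D l)" unfolding is_line_def using gh Rh np by blast
    have "tangent_space 2 ?D l = perp (abs_proj P)"
    proof (rule line_eq_perp[OF line])
      show "abs_proj P \<in> proj_space 2" using xP curve_in_plane by blast
      show "tangent_space 2 ?D l \<subseteq> perp (abs_proj P)"
      proof
        fix y assume "y \<in> tangent_space 2 ?D l"
        then obtain v s t where v: "y = abs_proj v" "v \<in> hvec" "v = (\<lambda>i. s * g i + t * R i)" unfolding T by blast
        have "P 0 * v 0 + P 1 * v 1 + P 2 * v 2 =
          s * (g 0 * P 0 + g 1 * P 1 + g 2 * P 2) + t * (P 0 * R 0 + P 1 * R 1 + P 2 * R 2)"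
          unfolding v(3) by (simp add: algebra_simps)
        then show "y \<in> perp (abs_proj P)" unfolding v(1) perp_abs[OF Ph v(2)]
          using gP PR g2 v(3) by (simp add: R_def)
      qed
    qed
    then show ?thesis using line xP by blast
  qed
  show ?thesis unfolding transversal_def D
  proof (intro conjI ballI allI impI)
    fix l assume "l \<in> perp (abs_proj p) \<inter> ?D"
    then show "smooth_point 2 ?D l" using main by (auto simp: smooth_point_def)
  next
    fix l assume l: "smooth_point 2 ?D l"
    show "perp (abs_proj p) \<noteq> tangent_space 2 ?D l"
    proof
      assume eq: "perp (abs_proj p) = tangent_space 2 ?D l"
      have lD: "l \<in> ?D" using l by (simp add: smooth_point_def)
      then obtain x where x: "x \<in> C.curve" "l = gauss x" by blast
      have h: "gv (rep_proj x) \<in> hvec" by (rule gv_hvec) (use rep_curve[OF x(1)] in auto)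
      \<comment> \<open>By Euler's identity a point lies on its own tangent, so \<open>l\<close>
        belongs to the pencil of \<open>p\<close> and \<open>main\<close> applies to it.\<close>
      have "l \<in> tangent_space 2 ?D l"
        unfolding x(2)[unfolded gauss_def] tangent_space_abs[OF h]
      proof (intro CollectI exI[of _ "gv (rep_proj x)"] conjI allI impI)
        fix F m assume F: "form 2 m F" "\<forall>y\<in>?D. poly_eval F (rep_proj y) = 0"
        have "poly_eval F (gv (rep_proj x)) = 0"
          using F(2) lD poly_eval_rep_abs[OF F(1) h] by (auto simp: x(2) gauss_def)
        then show "(\<Sum>i\<le>2. partial_deriv i F (gv (rep_proj x)) * gv (rep_proj x) i) = 0"
          by (simp only: euler_identity[OF F(1)] mult_zero_right)
      qed (use h in \<open>auto simp: gv_def\<close>)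
      then obtain x' where x': "x' \<in> C.curve" "perp (abs_proj p) = perp x'" using main[of l] lD eq by auto
      have "abs_proj p \<in> proj_space 2" using p(2) by (simp add: proj_space_abs_iff[OF p(1)])
      then have "abs_proj p = x'" using perp_inj x' curve_in_plane by blast
      then show False using x'(1) curve_iff[OF p(1)] p(3) by auto
    qed
  qed
qed

end

subsection \<open>Pencils of lines\<close>

text \<open>The lines through p = (\<kappa> : -1 : 0) are those with coordinates (a : \<kappa> a :
  c). The affine coordinates c/a and a/c cover the pencil.\<close>

lemma pencil_iff:
  assumes "w \<in> hvec"
  shows "abs_proj w \<in> perp (abs_proj (vec3 \<kappa> (-1) 0)) \<longleftrightarrow> (\<forall>i>2. w i = 0) \<and> w 1 = \<kappa> * w 0"
  unfolding perp_abs[OF vec3_hvec[of \<kappa> "-1" 0] assms, simplified] by auto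

lemma pencil_cases:
  assumes "x \<in> perp (abs_proj (vec3 \<kappa> (-1) 0))"
  shows "rep_proj x 0 \<noteq> 0 \<Longrightarrow> x = abs_proj (vec3 1 \<kappa> (ratio 2 0 x))"
    "rep_proj x 2 \<noteq> 0 \<Longrightarrow> x = abs_proj (vec3 (ratio 0 2 x) (\<kappa> * ratio 0 2 x) 1)"
    "rep_proj x 0 \<noteq> 0 \<or> rep_proj x 2 \<noteq> 0"
proof -
  define w where "w = rep_proj x"
  have w: "w \<in> hvec" "x = abs_proj w" by (auto simp: w_def)
  then have 2: "\<And>i. i > 2 \<Longrightarrow> w i = 0" "w 1 = \<kappa> * w 0" using assms pencil_iff by blast+
  show "x = abs_proj (vec3 1 \<kappa> (ratio 2 0 x))" if "rep_proj x 0 \<noteq> 0"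
    unfolding w(2) ratio_abs[OF w(1)]
    by (rule abs_proj_eqI[OF w(1) vec3_hvec minors_le2]) (use 2 that in \<open>auto simp flip: w_def\<close>)
  show "x = abs_proj (vec3 (ratio 0 2 x) (\<kappa> * ratio 0 2 x) 1)" if "rep_proj x 2 \<noteq> 0"
    unfolding w(2) ratio_abs[OF w(1)]
    by (rule abs_proj_eqI[OF w(1) vec3_hvec minors_le2]) (use 2 that in \<open>auto simp flip: w_def\<close>)
  show "rep_proj x 0 \<noteq> 0 \<or> rep_proj x 2 \<noteq> 0" using hvec_le2[OF w(1) 2(1)] 2(2) by (auto simp: w_def)
qed

lemma vec3_affine:
  "(\<lambda>t. vec3 (if u then 1 else t) (if u then \<kappa> else \<kappa> * t) (if u then t else 1) i) holomorphic_on UNIV"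
  by (cases u; cases "i = 0"; cases "i = 1"; cases "i = 2") (auto simp: vec3_def intro!: holomorphic_intros)

lemma pencil_line_coord0: "line_coord (perp (abs_proj (vec3 \<kappa> (-1) 0))) (\<lambda>t. vec3 1 \<kappa> t) 2 0"
proof
  show v: "vec3 1 \<kappa> t \<in> hvec" for t by (rule vec3_hvec) simp
  show "abs_proj (vec3 1 \<kappa> t) \<in> perp (abs_proj (vec3 \<kappa> (-1) 0))" for t
    unfolding pencil_iff[OF v] by simp
qed (use vec3_affine[of True \<kappa>] pencil_cases in auto)

lemma pencil_line_coord1: "line_coord (perp (abs_proj (vec3 \<kappa> (-1) 0))) (\<lambda>t. vec3 t (\<kappa> * t) 1) 0 2"
proof
  show v: "vec3 t (\<kappa> * t) 1 \<in> hvec" for t by (rule vec3_hvec) simp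
  show "abs_proj (vec3 t (\<kappa> * t) 1) \<in> perp (abs_proj (vec3 \<kappa> (-1) 0))" for t
    unfolding pencil_iff[OF v] by simp
qed (use vec3_affine[of False \<kappa>] pencil_cases in auto)

text \<open>A homogeneous formula \<open>H\<close> for \<open>f\<close> in the affine coordinates
  \<open>z\<close> and \<open>y\<close> of a patch, required to be correct only on the curve
  \<open>R\<close>. Holomorphy is stated after substitution of functions of one variable, which is
  how a chart uses it.\<close>

definition local_lift ::
    "(proj \<Rightarrow> proj) \<Rightarrow> (complex \<Rightarrow> complex \<Rightarrow> proj) \<Rightarrow> (complex \<Rightarrow> complex \<Rightarrow> bool) \<Rightarrow> complex set \<Rightarrow>
     (complex \<Rightarrow> complex \<Rightarrow> nat \<Rightarrow> complex) \<Rightarrow> bool" where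
  "local_lift f P R A H \<longleftrightarrow> open A \<and>
     (\<forall>z\<in>A. \<forall>y. R z y \<longrightarrow> H z y \<in> hvec \<and> f (P z y) = abs_proj (H z y)) \<and>
     (\<forall>D \<phi> \<eta> i. \<phi> holomorphic_on D \<longrightarrow> \<eta> holomorphic_on D \<longrightarrow> (\<lambda>w. H (\<phi> w) (\<eta> w) i) holomorphic_on D)"

context smooth_cyclic_curve
begin

lemma chartsI:
  assumes lift: "\<And>u z y. y ^ n = bin1 u z \<Longrightarrow>
      \<exists>A H. z \<in> A \<and> local_lift f (\<lambda>z y. abs_proj (pvec u z y)) (\<lambda>z y. y ^ n = bin1 u z) A H"
    and x: "x \<in> curve"
  shows "\<exists>D g z. chart curve D g \<and> z \<in> D \<and> g z = x \<and> proj_holomorphic_on (f \<circ> g) D"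
proof -
  obtain u z0 y0 where p: "x = abs_proj (pvec u z0 y0)" "y0 ^ n = bin1 u z0" using curve_patch[OF x] by blast
  obtain r \<phi> \<eta> where r: "r > 0" "\<phi> holomorphic_on ball 0 r" "\<eta> holomorphic_on ball 0 r"
    "\<phi> 0 = z0" "\<eta> 0 = y0" "\<And>\<zeta>. \<zeta> \<in> ball 0 r \<Longrightarrow> \<eta> \<zeta> ^ n = bin1 u (\<phi> \<zeta>)"
    "deriv \<phi> 0 \<noteq> 0 \<or> deriv \<eta> 0 \<noteq> 0" and c: "chart curve (ball 0 r) (\<lambda>\<zeta>. abs_proj (pvec u (\<phi> \<zeta>) (\<eta> \<zeta>)))"
    using p(2) by (rule affine_chart) (rule that; simp)
  let ?g = "\<lambda>\<zeta>. abs_proj (pvec u (\<phi> \<zeta>) (\<eta> \<zeta>))"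
  have "proj_holomorphic_on (f \<circ> ?g) (ball 0 r)"
    unfolding proj_holomorphic_on_def
  proof
    fix w assume w: "w \<in> ball (0::complex) r"
    obtain A H where A: "\<phi> w \<in> A"
      "local_lift f (\<lambda>z y. abs_proj (pvec u z y)) (\<lambda>z y. y ^ n = bin1 u z) A H"
      using lift[OF r(6)[OF w]] by blast
    note H = A(2)[unfolded local_lift_def]
    let ?U = "ball 0 r \<inter> \<phi> -` A"
    have U: "open ?U" using continuous_open_preimage[OF holomorphic_on_imp_continuous_on[OF r(2)]] H by blast
    have "(\<lambda>w. H (\<phi> w) (\<eta> w) i) holomorphic_on ?U" for i
      by (rule H[THEN conjunct2, THEN conjunct2, rule_format]) (auto intro: holomorphic_on_subset[OF r(2)] holomorphic_on_subset[OF r(3)])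
    moreover have "H (\<phi> v) (\<eta> v) \<in> hvec \<and> (f \<circ> ?g) v = abs_proj (H (\<phi> v) (\<eta> v))" if "v \<in> ?U" for v
      using H[THEN conjunct2, THEN conjunct1] r(6)[of v] that by auto
    ultimately have "holomorphic_lift ?U (\<lambda>w. H (\<phi> w) (\<eta> w)) (f \<circ> ?g)"
      unfolding holomorphic_lift_def using U by blast
    then show "\<exists>U F. w \<in> U \<and> U \<subseteq> ball 0 r \<and> holomorphic_lift U F (f \<circ> ?g)"
      using w A(1) by (intro exI[of _ ?U] exI[of _ "\<lambda>w. H (\<phi> w) (\<eta> w)"]) auto
  qed
  then show ?thesis using c r(1,4,5) p(1)
    by (intro exI[of _ "ball 0 r"] exI[of _ ?g] exI[of _ 0]) auto
qed

end

text \<open>Openness of \<open>q\<close> is tested in homogeneous coordinates of the base: it is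
  enough that all coordinate vectors near one fixed \<open>w0\<close> have a preimage in
  \<open>U\<close>.\<close>

lemma finite_cover_criterion:
  fixes Y :: "'a::t2_space set" and q :: "'a \<Rightarrow> proj"
  assumes "continuous_on Y q" "\<And>y. y \<in> Y \<Longrightarrow> q y \<in> B" "\<And>b. b \<in> B \<Longrightarrow> card {y \<in> Y. q y = b} = d" "d > 0"
    and near: "\<And>y U. y \<in> Y \<Longrightarrow> open U \<Longrightarrow> y \<in> U \<Longrightarrow>
      \<exists>w0 W. w0 \<in> hvec \<and> abs_proj w0 = q y \<and> open W \<and> w0 \<in> W \<and>
        (\<forall>w\<in>W \<inter> hvec. abs_proj w \<in> B \<longrightarrow> abs_proj w \<in> q ` (Y \<inter> U))"
  shows "finite_cover Y q B d"
proof
  fix U :: "'a set" assume U: "open U"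
  show "openin (top_of_set B) (q ` (Y \<inter> U))"
  proof (subst openin_subopen, intro ballI)
    fix b assume "b \<in> q ` (Y \<inter> U)"
    then obtain y where y: "y \<in> Y" "y \<in> U" "b = q y" by blast
    obtain w0 W where W: "w0 \<in> hvec" "abs_proj w0 = q y" "open W" "w0 \<in> W"
      "\<forall>w\<in>W \<inter> hvec. abs_proj w \<in> B \<longrightarrow> abs_proj w \<in> q ` (Y \<inter> U)"
      using near[OF y(1) U y(2)] by blast
    have "openin (top_of_set B) (B \<inter> abs_proj ` (hvec \<inter> W))"
      using open_abs_proj_image[OF W(3)] by (simp add: openin_open_Int)
    moreover have "b \<in> B \<inter> abs_proj ` (hvec \<inter> W)" using W assms(2)[OF y(1)] y(3) by (auto intro!: image_eqI[of _ _ w0])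
    moreover have "B \<inter> abs_proj ` (hvec \<inter> W) \<subseteq> q ` (Y \<inter> U)" using W(5) by blast
    ultimately show "\<exists>T. openin (top_of_set B) T \<and> b \<in> T \<and> T \<subseteq> q ` (Y \<inter> U)" by blast
  qed
qed (use assms in auto)

text \<open>The product of the roots of \<open>P w\<close> tends to 0 as \<open>w\<close> approaches
  \<open>w0\<close>, so some root is small and \<open>\<Phi>\<close> maps it into \<open>U\<close>.
  This is the openness of a covering defined by the roots of a polynomial, centered at one of
  them.\<close>

lemma roots_near:
  fixes P :: "(nat \<Rightarrow> complex) \<Rightarrow> complex poly" and \<Phi> :: "(nat \<Rightarrow> complex) \<Rightarrow> complex \<Rightarrow> 'a::topological_space"
  assumes P: "\<And>w. degree (P w) \<le> n" "continuous_on UNIV (\<lambda>w. poly (P w) 0)"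
      "continuous_on UNIV (\<lambda>w. coeff (P w) n)" "coeff (P w0) n \<noteq> 0" "poly (P w0) 0 = 0"
    and \<Phi>: "continuous_on (E \<times> UNIV) (\<lambda>(w, z). \<Phi> w z)" and w0: "w0 \<in> E" and U: "open U" "\<Phi> w0 0 \<in> U"
  shows "\<exists>W. open W \<and> w0 \<in> W \<and> (\<forall>w\<in>W \<inter> E. \<exists>z. poly (P w) z = 0 \<and> \<Phi> w z \<in> U)"
proof -
  obtain T where T: "open T" "T \<inter> (E \<times> UNIV) = (\<lambda>(w, z). \<Phi> w z) -` U \<inter> (E \<times> UNIV)"
    using \<Phi>[unfolded continuous_on_open_invariant, rule_format, OF U(1)] by (elim exE conjE)
  have "(w0, 0) \<in> T" using T(2) w0 U(2) by auto
  then obtain A B where AB: "open A" "open B" "(w0, 0) \<in> A \<times> B" "A \<times> B \<subseteq> T"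
    using open_prod_elim[OF T(1)] by metis
  obtain \<epsilon> where \<epsilon>: "\<epsilon> > 0" "ball 0 \<epsilon> \<subseteq> B" using AB(2,3) open_contains_ball by (metis mem_Sigma_iff)
  define V where "V = {w. cmod (poly (P w) 0) < cmod (coeff (P w) n) * \<epsilon> ^ n}"
  have "open V" unfolding V_def by (intro open_Collect_less continuous_intros P(2,3))
  moreover have "w0 \<in> V" using P(4,5) \<epsilon>(1) by (simp add: V_def)
  moreover have "\<exists>z. poly (P w) z = 0 \<and> \<Phi> w z \<in> U" if w: "w \<in> A \<inter> V" "w \<in> E" for w
  proof -
    have "coeff (P w) n \<noteq> 0" using w(1) by (auto simp: V_def)
    then have "degree (P w) = n" using P(1) le_degree by (metis antisym)
    then have "cmod (poly (P w) 0) < cmod (lead_coeff (P w)) * \<epsilon> ^ degree (P w)" using w(1) by (simp add: V_def)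
    then obtain z where z: "poly (P w) z = 0" "cmod z < \<epsilon>" using poly_small_root[of \<epsilon> "P w"] \<epsilon>(1) by auto
    then have "(w, z) \<in> A \<times> B" using w(1) \<epsilon>(2) by auto
    then have "(w, z) \<in> T \<inter> (E \<times> UNIV)" using AB(4) w(2) by auto
    then show ?thesis using z T(2) by auto
  qed
  ultimately show ?thesis using AB by (intro exI[of _ "A \<inter> V"]) auto
qed

section \<open>Consequences of an isomorphism with the projection\<close>

context diagonal_curve
begin

text \<open>The function \<open>b\<close> is the affine coordinate y/z of the image point. Incidence
  with the line (1 : \<kappa> : t) gives x/z = - \<kappa> b - t, so \<open>b\<close> satisfies the
  equation of the curve and determines the point. The division by z is legitimate: on such a line
  the only point with z = 0 is the center of the pencil, which is not on the curve.\<close>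

lemma isomorphism_function:
  assumes iso: "isomorphism X C.curve \<psi>" "\<And>x. x \<in> X \<Longrightarrow> line_through (abs_proj (vec3 \<kappa> (-1) 0)) (\<psi> x) = f x"
    and f: "f ` X \<subseteq> perp (abs_proj (vec3 \<kappa> (-1) 0))" and p: "\<kappa> ^ d + e1 * (-1) ^ d \<noteq> 0" "(-\<kappa>) ^ d + e1 \<noteq> 0"
  obtains b where "continuous_on {x \<in> X. rep_proj (f x) 0 \<noteq> 0} b"
    "\<And>x t. x \<in> X \<Longrightarrow> f x = abs_proj (vec3 1 \<kappa> t) \<Longrightarrow> (- \<kappa> * b x - t) ^ d + e1 * b x ^ d + e2 = 0"
    "\<And>x x' t. x \<in> X \<Longrightarrow> x' \<in> X \<Longrightarrow> f x = abs_proj (vec3 1 \<kappa> t) \<Longrightarrow> f x' = abs_proj (vec3 1 \<kappa> t) \<Longrightarrow> b x = b x' \<Longrightarrow> x = x'"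
proof -
  let ?p = "vec3 \<kappa> (-1) 0"
  have ph: "?p \<in> hvec" by (rule vec3_hvec) simp
  have pP: "abs_proj ?p \<in> proj_space 2" by (simp add: proj_space_abs_iff[OF ph])
  have pC: "abs_proj ?p \<notin> C.curve" unfolding curve_iff[OF ph] using p(1) d2 by (simp add: power_0_left)
  have \<psi>: "bij_betw \<psi> X C.curve" "continuous_on X \<psi>"
    using iso(1) holomorphic_map_continuous by (auto simp: isomorphism_def)
  have rel: "rep_proj (\<psi> x) 0 + \<kappa> * rep_proj (\<psi> x) 1 + t * rep_proj (\<psi> x) 2 = 0 \<and>
     rep_proj (\<psi> x) 0 ^ d + e1 * rep_proj (\<psi> x) 1 ^ d + e2 * rep_proj (\<psi> x) 2 ^ d = 0 \<and> rep_proj (\<psi> x) 2 \<noteq> 0"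
    (is "?A \<and> ?B \<and> ?C") if x: "x \<in> X" "f x = abs_proj (vec3 1 \<kappa> t)" for x t
  proof -
    define v where "v = rep_proj (\<psi> x)"
    have vC: "\<psi> x \<in> C.curve" using \<psi>(1) x(1) by (auto simp: bij_betw_def)
    have v: "v \<in> hvec" "\<psi> x = abs_proj v" by (auto simp: v_def)
    have B: "v 0 ^ d + e1 * v 1 ^ d + e2 * v 2 ^ d = 0" and v2: "\<And>i. i > 2 \<Longrightarrow> v i = 0"
      using vC curve_iff[OF v(1)] v(2) by auto
    have ne: "abs_proj ?p \<noteq> \<psi> x" using pC vC by metis
    have "\<psi> x \<in> perp (f x)" using line_through_properties(3)[OF pP _ ne] iso(2)[OF x(1)] vC curve_in_plane by auto
    then have A: "v 0 + \<kappa> * v 1 + t * v 2 = 0"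
      unfolding x(2) v(2) perp_abs[OF vec3_hvec[of 1 \<kappa> t] v(1), simplified] by simp
    have "v 2 \<noteq> 0"
    proof
      assume 0: "v 2 = 0"
      then have v0: "v 0 = (- \<kappa>) * v 1" using A by (simp add: add_eq_0_iff)
      then have "((-\<kappa>) ^ d + e1) * v 1 ^ d = 0" using B 0 d2 by (simp only: power_mult_distrib) (simp add: algebra_simps power_0_left)
      then have "v 1 = 0" using p(2) by simp
      then show False using hvec_le2[OF v(1) v2] v0 0 by simp
    qed
    with A B show ?thesis by (simp add: v_def)
  qed
  have t: "f x = abs_proj (vec3 1 \<kappa> (ratio 2 0 (f x)))" if "x \<in> X" "rep_proj (f x) 0 \<noteq> 0" for x
    using pencil_cases(1) f that by blast
  show ?thesis
  proof (rule that[of "ratio 1 2 \<circ> \<psi>"])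
    show "continuous_on {x \<in> X. rep_proj (f x) 0 \<noteq> 0} (ratio 1 2 \<circ> \<psi>)"
    proof (rule continuous_on_compose)
      show "continuous_on {x \<in> X. rep_proj (f x) 0 \<noteq> 0} \<psi>" by (rule continuous_on_subset[OF \<psi>(2)]) auto
      show "continuous_on (\<psi> ` {x \<in> X. rep_proj (f x) 0 \<noteq> 0}) (ratio 1 2)"
        by (rule continuous_on_ratio) (use rel t in blast)
    qed
    fix x t assume x: "x \<in> X" "f x = abs_proj (vec3 1 \<kappa> t)"
    define r0 r1 r2 where "r0 = rep_proj (\<psi> x) 0" and "r1 = rep_proj (\<psi> x) 1" and "r2 = rep_proj (\<psi> x) 2"
    have r: "r0 + \<kappa> * r1 + t * r2 = 0" "r0 ^ d + e1 * r1 ^ d + e2 * r2 ^ d = 0" "r2 \<noteq> 0"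
      using rel[OF x] by (auto simp: r0_def r1_def r2_def)
    have "r0 = - \<kappa> * r1 - t * r2" using r(1) by algebra
    then have 0: "r0 / r2 = - \<kappa> * (r1 / r2) - t" using r(3) by (simp add: field_simps)
    have "(r0 ^ d + e1 * r1 ^ d + e2 * r2 ^ d) / r2 ^ d = (r0 / r2) ^ d + e1 * (r1 / r2) ^ d + e2"
      using r(3) by (simp add: power_divide add_divide_distrib)
    then show "(- \<kappa> * (ratio 1 2 \<circ> \<psi>) x - t) ^ d + e1 * (ratio 1 2 \<circ> \<psi>) x ^ d + e2 = 0"
      unfolding r(2) 0 by (simp add: ratio_def r1_def r2_def)
    fix x' assume x': "x' \<in> X" "f x' = abs_proj (vec3 1 \<kappa> t)" "(ratio 1 2 \<circ> \<psi>) x = (ratio 1 2 \<circ> \<psi>) x'"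
    define s0 s1 s2 where "s0 = rep_proj (\<psi> x') 0" and "s1 = rep_proj (\<psi> x') 1" and "s2 = rep_proj (\<psi> x') 2"
    have s: "s0 + \<kappa> * s1 + t * s2 = 0" "s2 \<noteq> 0"
      using rel[OF x'(1,2)] by (auto simp: s0_def s1_def s2_def)
    have "r1 / r2 = s1 / s2" using x'(3) by (simp add: ratio_def r1_def r2_def s1_def s2_def)
    then have "r1 * s2 = s1 * r2" by (rule iffD1[OF frac_eq_eq[OF r(3) s(2)]])
    then have rs: "r1 * s2 = r2 * s1" by (rule trans) (rule mult.commute)
    have 00: "r0 = - \<kappa> * r1 - t * r2" "s0 = - \<kappa> * s1 - t * s2" using r(1) s(1) by algebra+
    have C: "\<psi> x \<in> C.curve" "\<psi> x' \<in> C.curve" using \<psi>(1) x x' by (auto simp: bij_betw_def)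
    have m: "r0 * s1 = r1 * s0" "r0 * s2 = r2 * s0" using rs unfolding 00 by algebra+
    have "abs_proj (rep_proj (\<psi> x)) = abs_proj (rep_proj (\<psi> x'))"
    proof (rule abs_proj_eqI[OF rep_proj_hvec rep_proj_hvec minors_le2])
      show "rep_proj (\<psi> x) 0 * rep_proj (\<psi> x') 1 = rep_proj (\<psi> x) 1 * rep_proj (\<psi> x') 0"
        "rep_proj (\<psi> x) 0 * rep_proj (\<psi> x') 2 = rep_proj (\<psi> x) 2 * rep_proj (\<psi> x') 0"
        "rep_proj (\<psi> x) 1 * rep_proj (\<psi> x') 2 = rep_proj (\<psi> x) 2 * rep_proj (\<psi> x') 1"
        unfolding r0_def[symmetric] r1_def[symmetric] r2_def[symmetric] s0_def[symmetric] s1_def[symmetric] s2_def[symmetric]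
        by (rule m rs)+
    qed (use rep_curve C in auto)
    then have "\<psi> x = \<psi> x'" by simp
    then show "x = x'" using \<psi>(1) x(1) x'(1) by (auto simp: bij_betw_def inj_on_def)
  qed
qed

text \<open>The last assumption rules out any function \<open>b\<close> as provided by
  \<open>isomorphism_function\<close>, so that each case only has to treat a scalar function on the
  covering curve.\<close>

theorem conclude:
  assumes bm: "branched_map (perp (abs_proj (vec3 \<kappa> (-1) 0))) (\<lambda>t. vec3 1 \<kappa> t) 2 0 (\<lambda>t. vec3 t (\<kappa> * t) 1) 0 2
      X f d (dual_curve C.curve)"
    and X: "smooth_curve N X"
    and tr: "transversal (perp (abs_proj (vec3 \<kappa> (-1) 0))) (dual_curve C.curve)"
    and p: "\<kappa> ^ d + e1 * (-1) ^ d \<noteq> 0" "(-\<kappa>) ^ d + e1 \<noteq> 0"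
    and Y: "finite_cover Y q (proj_space 2 - dual_curve C.curve) d"
    and ev: "continuous_on {x \<in> X. f x \<notin> dual_curve C.curve} ev"
      "\<And>x. x \<in> X \<Longrightarrow> f x \<notin> dual_curve C.curve \<Longrightarrow> ev x \<in> Y \<and> q (ev x) = f x"
      "\<And>x x'. x \<in> X \<Longrightarrow> x' \<in> X \<Longrightarrow> f x \<notin> dual_curve C.curve \<Longrightarrow> f x = f x' \<Longrightarrow> ev x = ev x' \<Longrightarrow> x = x'"
    and noniso: "\<And>b. continuous_on {x \<in> X. rep_proj (f x) 0 \<noteq> 0} b \<Longrightarrow>
      (\<And>x t. x \<in> X \<Longrightarrow> f x = abs_proj (vec3 1 \<kappa> t) \<Longrightarrow> (- \<kappa> * b x - t) ^ d + e1 * b x ^ d + e2 = 0) \<Longrightarrow>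
      (\<And>x x' t. x \<in> X \<Longrightarrow> x' \<in> X \<Longrightarrow> f x = abs_proj (vec3 1 \<kappa> t) \<Longrightarrow> f x' = abs_proj (vec3 1 \<kappa> t) \<Longrightarrow>
        b x = b x' \<Longrightarrow> x = x') \<Longrightarrow> False"
  shows "\<exists>(C :: proj set) (p :: proj) (N :: nat) (C' :: proj set) (\<pi> :: proj \<Rightarrow> proj).
    smooth_curve 2 C \<and> plane_curve_degree C d \<and>
    p \<in> proj_space 2 \<and> transversal (perp p) (dual_curve C) \<and>
    smooth_curve N C' \<and>
    holomorphic_map C' (perp p) \<pi> \<and>
    simple_ramification C' (perp p) \<pi> \<and>
    map_degree C' (perp p) \<pi> d \<and>
    branch_points C' \<pi> = dual_curve C \<inter> perp p \<and>
    (\<forall>t0 \<in> perp p - dual_curve C.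
      \<exists>\<phi> \<in> hom (fundamental_group (proj_space 2 - dual_curve C) t0) (BijGroup (fiber C' \<pi> t0)).
        \<forall>A \<in> carrier (fundamental_group (perp p - dual_curve C) t0).
          fiber_monodromy C' \<pi> t0 A =
            \<phi> (induced_inclusion (proj_space 2 - dual_curve C) A)) \<and>
    \<not> (\<exists>\<psi>. isomorphism C' C \<psi> \<and> (\<forall>x\<in>C'. line_through p (\<psi> x) = \<pi> x))"
proof (rule exI[of _ C.curve], rule exI[of _ "abs_proj (vec3 \<kappa> (-1) 0)"], rule exI[of _ N], rule exI[of _ X],
    rule exI[of _ f], intro conjI)
  let ?L = "perp (abs_proj (vec3 \<kappa> (-1) 0))" and ?D = "dual_curve C.curve"
  interpret B: branched_map ?L "\<lambda>t. vec3 1 \<kappa> t" 2 0 "\<lambda>t. vec3 t (\<kappa> * t) 1" 0 2 X f d ?D by (rule bm)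
  show "abs_proj (vec3 \<kappa> (-1) 0) \<in> proj_space 2"
    by (simp add: proj_space_abs_iff[OF vec3_hvec[of \<kappa> "-1" 0], simplified])
  show "\<forall>t0 \<in> ?L - ?D.
      \<exists>\<phi> \<in> hom (fundamental_group (proj_space 2 - ?D) t0) (BijGroup (fiber X f t0)).
        \<forall>A \<in> carrier (fundamental_group (?L - ?D) t0).
          fiber_monodromy X f t0 A = \<phi> (induced_inclusion (proj_space 2 - ?D) A)"
  proof
    fix t0 assume t0: "t0 \<in> ?L - ?D"
    show "\<exists>\<phi> \<in> hom (fundamental_group (proj_space 2 - ?D) t0) (BijGroup (fiber X f t0)).
        \<forall>A \<in> carrier (fundamental_group (?L - ?D) t0).
          fiber_monodromy X f t0 A = \<phi> (induced_inclusion (proj_space 2 - ?D) A)"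
    proof (rule monodromy_factors[OF Y B.cover _ t0])
      show "?L - ?D \<subseteq> proj_space 2 - ?D" by (auto simp: perp_def)
      show "continuous_on {x \<in> X. f x \<in> ?L - ?D} ev" by (rule continuous_on_subset[OF ev(1)]) auto
    qed (use ev(2,3) in auto)
  qed
  show "\<not> (\<exists>\<psi>. isomorphism X C.curve \<psi> \<and> (\<forall>x\<in>X. line_through (abs_proj (vec3 \<kappa> (-1) 0)) (\<psi> x) = f x))"
  proof
    assume "\<exists>\<psi>. isomorphism X C.curve \<psi> \<and> (\<forall>x\<in>X. line_through (abs_proj (vec3 \<kappa> (-1) 0)) (\<psi> x) = f x)"
    then obtain \<psi> where \<psi>: "isomorphism X C.curve \<psi>"
      "\<And>x. x \<in> X \<Longrightarrow> line_through (abs_proj (vec3 \<kappa> (-1) 0)) (\<psi> x) = f x" by blast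
    show False by (rule isomorphism_function[OF \<psi> B.into p], assumption, rule noniso)
  qed
  show "branch_points X f = ?D \<inter> ?L" by (rule B.branch_points_eq)
qed (rule smooth degree tr X branched_map.holomorphic[OF bm] branched_map.simple[OF bm] branched_map.degree[OF bm])+

end

subsection \<open>The cubic case\<close>

lemma card_simple_roots:
  fixes p :: "complex poly"
  assumes "p \<noteq> 0" "\<And>z. poly p z = 0 \<Longrightarrow> poly (pderiv p) z \<noteq> 0"
  shows "card {z. poly p z = 0} = degree p"
proof -
  have "rsquarefree p" unfolding rsquarefree_roots using assms(2) by blast
  from complex_poly_decompose_rsquarefree[OF this]
  have "smult (lead_coeff p) (\<Prod>z | poly p z = 0. [:- z, 1:]) = p" .
  then have "degree p = degree (smult (lead_coeff p) (\<Prod>z | poly p z = 0. [:- z, 1:]))" by simp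
  also have "\<dots> = degree (\<Prod>z | poly p z = 0. [:- z, 1:])" using assms(1) by simp
  also have "\<dots> = (\<Sum>z | poly p z = 0. degree [:- z, 1:])" by (rule degree_prod_eq_sum_degree) simp
  finally show ?thesis by simp
qed

text \<open>A map defined by a formula in \<open>rep_proj\<close> may be computed with any
  coordinates if the formula is homogeneous; the factor \<open>e\<close> may be any power of
  \<open>c\<close>.\<close>

lemma abs_proj_homogeneous:
  assumes "v \<in> hvec" "M v \<in> hvec" "\<And>c. c \<noteq> 0 \<Longrightarrow> \<exists>e. e \<noteq> 0 \<and> M (\<lambda>i. c * v i) = (\<lambda>i. e * M v i)"
  shows "abs_proj (M (rep_proj (abs_proj v))) = abs_proj (M v)"
proof -
  obtain c where c: "c \<noteq> 0" "rep_proj (abs_proj v) = (\<lambda>i. c * v i)" using rep_abs_proj[OF assms(1)] by blast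
  obtain e where e: "e \<noteq> 0" "M (\<lambda>i. c * v i) = (\<lambda>i. e * M v i)" using assms(3)[OF c(1)] by blast
  show ?thesis unfolding c(2) e(2) by (rule abs_proj_scale[OF e(1) assms(2)])
qed

lemma vec3_scale: "vec3 (c * x) (c * y) (c * z) = (\<lambda>i. c * vec3 x y z i)"
  by (auto simp: vec3_def fun_eq_iff)

lemma vec3_abs_eq_iff:
  assumes "x \<noteq> 0 \<or> y \<noteq> 0 \<or> z \<noteq> 0" "x' \<noteq> 0 \<or> y' \<noteq> 0 \<or> z' \<noteq> 0"
  shows "abs_proj (vec3 x y z) = abs_proj (vec3 x' y' z') \<longleftrightarrow> x * y' = y * x' \<and> x * z' = z * x' \<and> y * z' = z * y'"
    (is "?l \<longleftrightarrow> ?r")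
proof
  note h = vec3_hvec[OF assms(1)] vec3_hvec[OF assms(2)]
  assume ?l
  then obtain c where "vec3 x' y' z' = (\<lambda>i. c * vec3 x y z i)" unfolding abs_proj_eq_iff[OF h] by (elim exE conjE)
  from fun_cong[OF this, of 0] fun_cong[OF this, of 1] fun_cong[OF this, of 2]
  have "x' = c * x" "y' = c * y" "z' = c * z" by simp_all
  then show ?r by (simp add: algebra_simps)
next
  assume r: ?r
  show ?l
  proof (rule abs_proj_eqI[OF vec3_hvec[OF assms(1)] vec3_hvec[OF assms(2)] minors_le2])
    show "vec3 x y z 0 * vec3 x' y' z' 1 = vec3 x y z 1 * vec3 x' y' z' 0"
      "vec3 x y z 0 * vec3 x' y' z' 2 = vec3 x y z 2 * vec3 x' y' z' 0"
      "vec3 x y z 1 * vec3 x' y' z' 2 = vec3 x y z 2 * vec3 x' y' z' 1"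
      using r by (simp_all only: vec3_simps One_nat_def)
  qed auto
qed

lemma continuous_on_fst_coord: "continuous_on S (\<lambda>p. fst p i)"
  for S :: "(('i \<Rightarrow> 'b::topological_space) \<times> 'c::topological_space) set"
  by (rule continuous_on_compose2[OF continuous_on_coord[of UNIV i] continuous_on_fst[OF continuous_on_id]]) auto

text \<open>The critical points of w^3 + 3w are the two square roots of -1, and the critical values
  there are the square roots of -4.\<close>

lemma card_depressed_cubic: "card {w::complex. w ^ 3 + 3 * w = s} = (if s ^ 2 = - 4 then 2 else 3)"
proof (cases "s ^ 2 = - 4")
  case True
  define w0 where "w0 = s / 2"
  have w0: "s = 2 * w0" "w0 ^ 2 = - 1" using True by (simp_all add: w0_def power_divide)
  have "w ^ 3 + 3 * w - s = (w - w0) * (w - w0) * (w + 2 * w0)" for w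
    unfolding w0(1) using w0(2) by algebra
  then have "{w. w ^ 3 + 3 * w = s} = {w0, - 2 * w0}" 
    by (auto simp: eq_neg_iff_add_eq_0 simp flip: right_minus_eq[of _ s])
  moreover have "w0 \<noteq> - 2 * w0" using w0(2) by (auto simp: eq_neg_iff_add_eq_0)
  ultimately show ?thesis using True by simp
next
  case False
  let ?p = "[:- s, 3, 0, 1:]"
  have "card {z. poly ?p z = 0} = degree ?p"
  proof (rule card_simple_roots)
    fix z assume "poly ?p z = 0"
    then have s: "s = z * (3 + z * z)" by (simp add: algebra_simps)
    show "poly (pderiv ?p) z \<noteq> 0"
    proof
      assume "poly (pderiv ?p) z = 0"
      then have "3 * (z * z + 1) = 0" by (simp add: pderiv_pCons algebra_simps)
      then have "z * z + 1 = 0" by (metis mult_eq_0_iff zero_neq_numeral)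
      then have "z * z = - 1" by (simp add: eq_neg_iff_add_eq_0)
      then have "s ^ 2 = - 4" using s by algebra
      then show False using False by simp
    qed
  qed simp
  moreover have "{z. poly ?p z = 0} = {w. w ^ 3 + 3 * w = s}"
    by (auto simp: power3_eq_cube algebra_simps eq_neg_iff_add_eq_0)
  ultimately show ?thesis using False by simp
qed

section \<open>The sextic dual to the cubic\<close>

interpretation cubic: diagonal_curve 3 1 "- 4"
  by standard auto

abbreviation "cubic_dual \<equiv> dual_curve cubic.C.curve"

text \<open>For x^3 + y^3 = 4z^3 and (a, b, c) = (x^2, y^2, -4z^2) one has c^3/4 = - (4z^3)^2 = -
  (x^3 + y^3)^2. Hence a^3 + b^3 + c^3/4 = - 2 x^3 y^3, and the square of this is 4 a^3 b^3.\<close>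

definition cubic_form :: cpoly where
  "cubic_form = (Var 0 ^ 3 + Var 1 ^ 3 + Const (1/4) * Var 2 ^ 3) ^ 2 - Const 4 * (Var 0 ^ 3 * Var 1 ^ 3)"

lemma cubic_form: "form 2 6 cubic_form"
proof -
  have "form 2 (3 * 2) ((Var 0 ^ 3 + Var 1 ^ 3 + Const (1/4) * Var 2 ^ 3) ^ 2 :: cpoly)"
    by (intro form_power form_add form_Const_mult form_Var_power) auto
  moreover have "form 2 (3 + 3) (Const 4 * (Var 0 ^ 3 * Var 1 ^ 3) :: cpoly)"
    by (intro form_Const_mult form_mult form_Var_power) auto
  ultimately show ?thesis unfolding cubic_form_def by (intro form_diff) simp_all
qed

lemma eval_cubic_form:
  "poly_eval cubic_form v = (v 0 ^ 3 + v 1 ^ 3 + v 2 ^ 3 / 4) ^ 2 - 4 * (v 0 ^ 3 * v 1 ^ 3)"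
proof -
  have "poly_eval (- (Const 4 * (Var 0 ^ 3 * Var 1 ^ 3))) v = - (4 * (v 0 ^ 3 * v 1 ^ 3))"
    by (simp add: poly_eval_simps)
  then show ?thesis unfolding cubic_form_def by (simp add: poly_eval_simps)
qed

lemma cubic_gv: "cubic.gv v 0 = v 0 ^ 2" "cubic.gv v (Suc 0) = v 1 ^ 2" "cubic.gv v 2 = - 4 * v 2 ^ 2"
  by (simp_all add: cubic.gv_def)

lemma cubic_form_gv:
  assumes "v \<in> hvec" "abs_proj v \<in> cubic.C.curve" shows "poly_eval cubic_form (cubic.gv v) = 0"
proof -
  have "v 0 ^ 3 + v 1 ^ 3 - 4 * v 2 ^ 3 = 0" using assms(2) unfolding cubic.curve_iff[OF assms(1)] by simp
  then show ?thesis unfolding eval_cubic_form by (simp add: cubic_gv) algebra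
qed

lemma cubic_dual_iff:
  assumes w: "w \<in> hvec" "\<And>i. i > 2 \<Longrightarrow> w i = 0"
  shows "abs_proj w \<in> cubic_dual \<longleftrightarrow> (w 0 ^ 3 + w 1 ^ 3 + w 2 ^ 3 / 4) ^ 2 = 4 * (w 0 ^ 3 * w 1 ^ 3)"
proof
  assume "abs_proj w \<in> cubic_dual"
  then obtain x where x: "x \<in> cubic.C.curve" "abs_proj w = cubic.gauss x" unfolding cubic.dual_eq by blast
  have "poly_eval cubic_form (cubic.gv (rep_proj x)) = 0" by (rule cubic_form_gv) (use x in auto)
  moreover have "cubic.gv (rep_proj x) \<in> hvec" by (rule cubic.gv_hvec) (use cubic.rep_curve x in auto)
  ultimately have "poly_eval cubic_form w = 0"
    using poly_eval_rep_abs[OF cubic_form] w x(2) unfolding cubic.gauss_def by metis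
  then show "(w 0 ^ 3 + w 1 ^ 3 + w 2 ^ 3 / 4) ^ 2 = 4 * (w 0 ^ 3 * w 1 ^ 3)" by (simp add: eval_cubic_form)
next
  assume eq: "(w 0 ^ 3 + w 1 ^ 3 + w 2 ^ 3 / 4) ^ 2 = 4 * (w 0 ^ 3 * w 1 ^ 3)"
  define x0 where "x0 = csqrt (w 0)"
  have x0: "x0 ^ 2 = w 0" by (simp add: x0_def)
  \<comment> \<open>A square root and its negative have opposite cubes. This freedom fixes first the
    sign of the root of the discriminant equation, by the choice of \<open>x1\<close>, and then the
    equation of the cubic itself, by the choice of \<open>x2\<close>.\<close>
  obtain x1 where x1: "x1 ^ 2 = w 1" "w 0 ^ 3 + w 1 ^ 3 + w 2 ^ 3 / 4 = - 2 * x0 ^ 3 * x1 ^ 3"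
  proof -
    define x1 where "x1 = csqrt (w 1)"
    have x1: "x1 ^ 2 = w 1" by (simp add: x1_def)
    have "4 * (w 0 ^ 3 * w 1 ^ 3) = (2 * x0 ^ 3 * x1 ^ 3) ^ 2"
      unfolding x0[symmetric] x1[symmetric] by (simp add: power_mult_distrib flip: power_mult)
    with eq have "(w 0 ^ 3 + w 1 ^ 3 + w 2 ^ 3 / 4) ^ 2 = (2 * x0 ^ 3 * x1 ^ 3) ^ 2" by (rule trans)
    then consider "w 0 ^ 3 + w 1 ^ 3 + w 2 ^ 3 / 4 = - 2 * x0 ^ 3 * x1 ^ 3"
      | "w 0 ^ 3 + w 1 ^ 3 + w 2 ^ 3 / 4 = - 2 * x0 ^ 3 * (- x1) ^ 3"
      unfolding power2_eq_iff by auto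
    then show thesis using that[of x1] that[of "- x1"] x1 by cases auto
  qed
  obtain x2 where x2: "- 4 * x2 ^ 2 = w 2" "4 * x2 ^ 3 = x0 ^ 3 + x1 ^ 3"
  proof -
    define x2 where "x2 = csqrt (- w 2 / 4)"
    have x2: "- 4 * x2 ^ 2 = w 2" by (simp add: x2_def)
    have "w 0 ^ 3 = x0 ^ 6" "w 1 ^ 3 = x1 ^ 6" unfolding x0[symmetric] x1(1)[symmetric] by (simp_all flip: power_mult)
    moreover have "w 2 ^ 3 / 4 = - 16 * x2 ^ 6" unfolding x2[symmetric] by (simp add: power_mult_distrib flip: power_mult)
    ultimately have "x0 ^ 6 + x1 ^ 6 - 16 * x2 ^ 6 = - 2 * x0 ^ 3 * x1 ^ 3" using x1(2) by simp
    then have "(4 * x2 ^ 3) ^ 2 = (x0 ^ 3 + x1 ^ 3) ^ 2" by algebra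
    then consider "4 * x2 ^ 3 = x0 ^ 3 + x1 ^ 3" | "4 * (- x2) ^ 3 = x0 ^ 3 + x1 ^ 3"
      unfolding power2_eq_iff by auto
    then show thesis using that[of x2] that[of "- x2"] x2 by cases auto
  qed
  have nz: "x0 \<noteq> 0 \<or> x1 \<noteq> 0 \<or> x2 \<noteq> 0" using hvec_le2[OF w] x0 x1(1) x2(1) by auto
  let ?v = "vec3 x0 x1 x2"
  have v: "?v \<in> hvec" by (rule vec3_hvec[OF nz])
  have "abs_proj ?v \<in> cubic.C.curve" unfolding cubic.curve_iff[OF v] using x2(2) by simp
  moreover have "cubic.gv ?v i = w i" for i
  proof -
    have "i = 0 \<or> i = 1 \<or> i = 2 \<or> i > 2" by auto
    then show ?thesis using x0 x1(1) x2(1) w(2) by (elim disjE) (auto simp: cubic_gv, simp add: cubic.gv_def)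
  qed
  then have "cubic.gv ?v = w" by blast
  then have "cubic.gauss (abs_proj ?v) = abs_proj w" using cubic.gauss_abs[OF v] by simp
  ultimately show "abs_proj w \<in> cubic_dual" unfolding cubic.dual_eq by force
qed

text \<open>The center (1 : 1 : 0) is chosen because a^3 + b^3 vanishes on its lines (a : -a : c),
  which makes the resolvent a cyclic equation in \<open>c\<close>. A tangent through the center has
  x^2 + y^2 = 0 at its point of contact, which is incompatible with a vanishing coordinate.\<close>

lemma cubic_transversal: "transversal (perp (abs_proj (vec3 (-1) (-1) 0))) cubic_dual"
proof (rule cubic.transversalI[OF _ _ _ cubic_form cubic_form_gv])
  show "vec3 (-1) (-1) 0 \<in> hvec" by (rule vec3_hvec) simp
  fix v assume v: "v \<in> hvec" "abs_proj v \<in> cubic.C.curve"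
    and p: "vec3 (-1) (-1) 0 0 * cubic.gv v 0 + vec3 (-1) (-1) 0 1 * cubic.gv v 1 + vec3 (-1) (-1) 0 2 * cubic.gv v 2 = 0"
  have c: "v 0 ^ 3 + v 1 ^ 3 = 4 * v 2 ^ 3" and v2: "\<And>i. i > 2 \<Longrightarrow> v i = 0"
    using v(2) unfolding cubic.curve_iff[OF v(1)] by auto
  have q: "v 0 ^ 2 + v 1 ^ 2 = 0" using p by (simp add: cubic_gv) algebra
  have n0: "v 0 = 0 \<or> v 1 = 0 \<or> v 2 = 0 \<Longrightarrow> v 0 = 0"
  proof (elim disjE)
    assume "v 1 = 0" then show ?thesis using q by simp
  next
    assume "v 2 = 0"
    then have "v 0 ^ 6 = 0" using q c by algebra
    then show ?thesis by simp
  qed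
  have nz: "v 0 \<noteq> 0"
  proof
    assume 0: "v 0 = 0"
    then have 1: "v 1 = 0" using q by simp
    then have "v 2 = 0" using 0 c by simp
    then show False using hvec_le2[OF v(1) v2] 0 1 by simp
  qed
  with n0 have nz: "v 0 \<noteq> 0" "v 1 \<noteq> 0" "v 2 \<noteq> 0" by auto
  define g where "g = cubic.gv v"
  have "((\<lambda>z. poly_eval cubic_form (g(2 := z))) has_field_derivative
      2 * (g 0 ^ 3 + g 1 ^ 3 + g 2 ^ 3 / 4) * (3 * g 2 ^ 2 / 4)) (at (g 2))"
    unfolding eval_cubic_form by (auto intro!: derivative_eq_intros)
  then have "partial_deriv 2 cubic_form g = 2 * (g 0 ^ 3 + g 1 ^ 3 + g 2 ^ 3 / 4) * (3 * g 2 ^ 2 / 4)"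
    unfolding partial_deriv_def by (rule DERIV_imp_deriv)
  moreover have "g 0 ^ 3 + g 1 ^ 3 + g 2 ^ 3 / 4 = - 2 * v 0 ^ 3 * v 1 ^ 3"
    unfolding g_def using c by (simp add: cubic_gv) algebra
  ultimately have "partial_deriv 2 cubic_form g = 2 * (- 2 * v 0 ^ 3 * v 1 ^ 3) * (3 * g 2 ^ 2 / 4)" by (simp only:)
  moreover have "g 2 \<noteq> 0" using nz by (simp add: g_def cubic_gv)
  ultimately have "partial_deriv 2 cubic_form g \<noteq> 0" using nz by simp
  then show "v 0 \<noteq> 0 \<and> v 1 \<noteq> 0 \<and> v 2 \<noteq> 0 \<and> partial_deriv 2 cubic_form (cubic.gv v) \<noteq> 0"
    using nz by (simp add: g_def)
qed auto

text \<open>The resolvent cubic \<open>r\<^sup>3 - 3abr = a\<^sup>3 + b\<^sup>3 + c\<^sup>3/4\<close> has the equation of the dual curve as its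
  discriminant.\<close>

definition cubic_cover :: "proj set" where
  "cubic_cover = {abs_proj (v(3 := r)) |v r. v \<in> hvec \<and> (\<forall>i>2. v i = 0) \<and> abs_proj v \<notin> cubic_dual \<and>
     r ^ 3 - 3 * v 0 * v 1 * r = v 0 ^ 3 + v 1 ^ 3 + v 2 ^ 3 / 4}"

text \<open>The resolvent equation is homogeneous, so its root serves as a fourth coordinate, and
  the covering map is the projection from the point where only this coordinate is nonzero.\<close>

definition drop3 :: "proj \<Rightarrow> proj" where "drop3 y = abs_proj ((rep_proj y)(3 := 0))"

lemma hvec_upd3: "v \<in> hvec \<Longrightarrow> (\<forall>i>2. v i = 0) \<Longrightarrow> v(3 := r) \<in> hvec"
  using hvec_le2[of v] hvecI[of 3 "v(3 := r)" 0] hvecI[of 3 "v(3 := r)" 1] hvecI[of 3 "v(3 := r)" 2] by auto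

lemma drop3_abs:
  assumes "v \<in> hvec" "v(3 := 0) \<in> hvec" shows "drop3 (abs_proj v) = abs_proj (v(3 := 0))"
  unfolding drop3_def
  by (rule abs_proj_homogeneous[where M = "\<lambda>v. v(3 := 0)", OF assms]) (auto simp: fun_eq_iff)

lemma drop3_upd: "v \<in> hvec \<Longrightarrow> \<forall>i>2. v i = 0 \<Longrightarrow> drop3 (abs_proj (v(3 := r))) = abs_proj v"
  using drop3_abs[of "v(3 := r)"] hvec_upd3[of v r] by (simp add: fun_upd_idem)

lemma cubic_finite_cover: "finite_cover cubic_cover drop3 (proj_space 2 - cubic_dual) 3"
proof (rule finite_cover_criterion)
  show "continuous_on cubic_cover drop3"
  proof (rule continuous_on_projI)
    let ?S = "{u \<in> hvec. abs_proj u \<in> cubic_cover}"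
    have u: "u(3 := 0) \<in> hvec" if "u \<in> ?S" for u
    proof -
      obtain v r where v: "abs_proj u = abs_proj (v(3 := r))" "v \<in> hvec" "\<forall>i>2. v i = 0"
        using \<open>u \<in> ?S\<close> unfolding cubic_cover_def by blast
      then obtain c where c: "c \<noteq> 0" "u = (\<lambda>i. c * (v(3 := r)) i)"
        using abs_proj_eq_iff[OF hvec_upd3[OF v(2,3)], of u r] \<open>u \<in> ?S\<close> by auto
      have "u(3 := 0) = (\<lambda>i. c * v i)" using v(3) unfolding c(2) by (auto simp: fun_eq_iff)
      then show ?thesis using hvec_scale[of c v] c(1) v(2) by simp
    qed
    have "continuous_on ?S (\<lambda>u. abs_proj (u(3 := 0)))"
    proof (rule continuous_on_into_proj[OF _ u])
      show "continuous_on ?S (\<lambda>u. (u(3 := 0)) i)" for i by (cases "i = 3") (auto intro: continuous_on_coord)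
    qed
    then show "continuous_on ?S (\<lambda>u. drop3 (abs_proj u))"
      by (rule continuous_on_eq) (use u drop3_abs in simp)
  qed
  show "drop3 y \<in> proj_space 2 - cubic_dual" if "y \<in> cubic_cover" for y
    using that drop3_upd proj_space_abs_iff unfolding cubic_cover_def by fastforce
next
  fix b assume b: "b \<in> proj_space 2 - cubic_dual"
  define v where "v = rep_proj b"
  have v: "v \<in> hvec" "b = abs_proj v" "\<forall>i>2. v i = 0" using b rep_proj_space by (auto simp: v_def)
  define S where "S = v 0 ^ 3 + v 1 ^ 3 + v 2 ^ 3 / 4"
  have nd: "S ^ 2 \<noteq> 4 * (v 0 ^ 3 * v 1 ^ 3)" using b v cubic_dual_iff[OF v(1)] by (auto simp: S_def)
  let ?R = "{r. r ^ 3 - 3 * v 0 * v 1 * r = S}"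
  have "{y \<in> cubic_cover. drop3 y = b} = (\<lambda>r. abs_proj (v(3 := r))) ` ?R"
  proof (intro equalityI subsetI)
    fix y assume "y \<in> {y \<in> cubic_cover. drop3 y = b}"
    then obtain u r where u: "y = abs_proj (u(3 := r))" "u \<in> hvec" "\<forall>i>2. u i = 0" "drop3 y = b"
      "r ^ 3 - 3 * u 0 * u 1 * r = u 0 ^ 3 + u 1 ^ 3 + u 2 ^ 3 / 4" unfolding cubic_cover_def by blast
    then have "abs_proj u = abs_proj v" using drop3_upd v by metis
    then obtain c where c: "c \<noteq> 0" "v = (\<lambda>i. c * u i)" using abs_proj_eq_iff u v by blast
    have "v(3 := c * r) = (\<lambda>i. c * (u(3 := r)) i)" using c by (auto simp: fun_eq_iff)
    then have "y = abs_proj (v(3 := c * r))" using abs_proj_scale[OF c(1) hvec_upd3[OF u(2,3)], of r] u(1) by simp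
    moreover have "c * r \<in> ?R" using u(5) unfolding S_def c(2) mem_Collect_eq by algebra
    ultimately show "y \<in> (\<lambda>r. abs_proj (v(3 := r))) ` ?R" by blast
  next
    fix y assume "y \<in> (\<lambda>r. abs_proj (v(3 := r))) ` ?R"
    then show "y \<in> {y \<in> cubic_cover. drop3 y = b}"
      using v b drop3_upd[OF v(1,3)] unfolding cubic_cover_def S_def by auto
  qed
  moreover have "inj_on (\<lambda>r. abs_proj (v(3 := r))) ?R"
  proof (rule inj_onI)
    fix r r' assume "abs_proj (v(3 := r)) = abs_proj (v(3 := r'))"
    then obtain c where "v(3 := r') = (\<lambda>i. c * (v(3 := r)) i)"
      using abs_proj_eq_iff[OF hvec_upd3[OF v(1,3)] hvec_upd3[OF v(1,3)]] by blast
    note e = fun_cong[OF this]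
    have "c = 1" using hvec_le2[OF v(1)] v(3) e[of 0] e[of 1] e[of 2] by auto
    then show "r = r'" using e[of 3] by simp
  qed
  moreover have "card ?R = 3"
  proof -
    let ?p = "[:- S, - 3 * v 0 * v 1, 0, 1:]"
    have "card {z. poly ?p z = 0} = degree ?p"
    proof (rule card_simple_roots)
      fix z assume "poly ?p z = 0"
      then have 1: "S = z * (z * z - 3 * v 0 * v 1)" by (simp add: algebra_simps)
      show "poly (pderiv ?p) z \<noteq> 0"
      proof
        \<comment> \<open>A double root has z^2 = ab and hence S = - 2abz, so that S^2 = 4 a^3 b^3
          and the line would belong to the dual curve.\<close>
        assume "poly (pderiv ?p) z = 0"
        then have "3 * (z * z - v 0 * v 1) = 0" by (simp add: pderiv_pCons algebra_simps)
        then have "z * z - v 0 * v 1 = 0" by (metis mult_eq_0_iff zero_neq_numeral)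
        then have "z * z = v 0 * v 1" by simp
        then have "S ^ 2 = 4 * (v 0 ^ 3 * v 1 ^ 3)" using 1 by algebra
        then show False using nd by simp
      qed
    qed simp
    moreover have "{z. poly ?p z = 0} = ?R"
      by (auto simp: power3_eq_cube algebra_simps eq_neg_iff_add_eq_0)
    ultimately show ?thesis by simp
  qed
  ultimately show "card {y \<in> cubic_cover. drop3 y = b} = 3" by (simp add: card_image)
next
  fix y :: proj and U assume y: "y \<in> cubic_cover" and U: "open U" "y \<in> U"
  obtain v r where v: "y = abs_proj (v(3 := r))" "v \<in> hvec" "\<forall>i>2. v i = 0"
      "r ^ 3 - 3 * v 0 * v 1 * r = v 0 ^ 3 + v 1 ^ 3 + v 2 ^ 3 / 4" using y unfolding cubic_cover_def by blast
  \<comment> \<open>The cubic recentered at the given root \<open>r\<close>, so that the root to be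
    followed is 0.\<close>
  define P where "P w = [:r ^ 3 - 3 * w 0 * w 1 * r - (w 0 ^ 3 + w 1 ^ 3 + w 2 ^ 3 / 4),
      3 * r ^ 2 - 3 * w 0 * w 1, 3 * r, 1:]" for w :: "nat \<Rightarrow> complex"
  have evP: "poly (P w) z = (r + z) ^ 3 - 3 * w 0 * w 1 * (r + z) - (w 0 ^ 3 + w 1 ^ 3 + w 2 ^ 3 / 4)" for w z
    by (simp add: P_def power3_eq_cube power2_eq_square algebra_simps)
  let ?E = "{w \<in> hvec. \<forall>i>2. w i = 0}"
  have "\<exists>W. open W \<and> v \<in> W \<and> (\<forall>w\<in>W \<inter> ?E. \<exists>z. poly (P w) z = 0 \<and> abs_proj (w(3 := r + z)) \<in> U)"
  proof (rule roots_near[where n = 3])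
    show "degree (P w) \<le> 3" for w by (simp add: P_def)
    show "continuous_on UNIV (\<lambda>w. poly (P w) 0)" unfolding evP by (intro continuous_intros continuous_on_coord) auto
    show "continuous_on UNIV (\<lambda>w. coeff (P w) 3)" by (simp add: P_def numeral_3_eq_3)
    show "coeff (P v) 3 \<noteq> 0" by (simp add: P_def numeral_3_eq_3)
    show "poly (P v) 0 = 0" unfolding evP using v(4) by simp
    have "continuous_on (?E \<times> UNIV) (\<lambda>p. abs_proj ((fst p)(3 := r + snd p)))"
    proof (rule continuous_on_into_proj)
      show "continuous_on (?E \<times> UNIV) (\<lambda>p. ((fst p)(3 := r + snd p)) i)" for i
        by (cases "i = 3") (auto intro!: continuous_intros continuous_on_fst_coord)
    qed (auto intro: hvec_upd3)
    then show "continuous_on (?E \<times> UNIV) (\<lambda>(w, z). abs_proj (w(3 := r + z)))" by (simp add: case_prod_beta')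
  qed (use v U in auto)
  then obtain W where W: "open W" "v \<in> W"
    "\<forall>w\<in>W \<inter> ?E. \<exists>z. poly (P w) z = 0 \<and> abs_proj (w(3 := r + z)) \<in> U" by blast
  have "abs_proj w \<in> drop3 ` (cubic_cover \<inter> U)" if w: "w \<in> W \<inter> hvec" "abs_proj w \<in> proj_space 2 - cubic_dual" for w
  proof -
    have w2: "w \<in> hvec" "\<forall>i>2. w i = 0" using w proj_space_abs_iff by auto
    then obtain z where z: "poly (P w) z = 0" "abs_proj (w(3 := r + z)) \<in> U" using W(3) w(1) by blast
    have "abs_proj (w(3 := r + z)) \<in> cubic_cover" unfolding cubic_cover_def
      using w2 w(2) z(1) unfolding evP by (intro CollectI exI[of _ w] exI[of _ "r + z"]) simp
    then show ?thesis using z(2) drop3_upd[OF w2, of "r + z"] by (metis IntI imageI)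
  qed
  then show "\<exists>w0 W. w0 \<in> hvec \<and> abs_proj w0 = drop3 y \<and> open W \<and> w0 \<in> W \<and>
        (\<forall>w\<in>W \<inter> hvec. abs_proj w \<in> proj_space 2 - cubic_dual \<longrightarrow> abs_proj w \<in> drop3 ` (cubic_cover \<inter> U))"
    using W(1,2) v(2) drop3_upd[OF v(2,3), of r] v(1) by (intro exI[of _ v] exI[of _ W]) auto
qed simp

section \<open>The completed covering over the pencil, cubic case\<close>

lemma vec3_continuous:
  assumes "continuous_on S x" "continuous_on S y" "continuous_on S z"
  shows "continuous_on S (\<lambda>v. vec3 (x v) (y v) (z v) i)"
  unfolding vec3_def by (cases "i = 0"; cases "i = 1"; cases "i = 2") (use assms in auto)

lemma vec3_holomorphic:
  assumes "x holomorphic_on S" "y holomorphic_on S" "z holomorphic_on S"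
  shows "(\<lambda>v. vec3 (x v) (y v) (z v) i) holomorphic_on S"
  unfolding vec3_def by (cases "i = 0"; cases "i = 1"; cases "i = 2") (use assms in auto)

text \<open>On the line (a : -a : c) the resolvent equation for the root \<open>w\<close> becomes
  c^3 = 12 a^2 w + 4 w^3, a cyclic cubic over the line with coordinates \<open>a\<close>,
  \<open>w\<close>.\<close>

definition cub_b :: "nat \<Rightarrow> complex" where
  "cub_b j = (if j = 1 then 12 else if j = 3 then 4 else 0)"

interpretation cub: cyclic_curve "Suc 0" 3 cub_b
  by standard auto

lemma cub_bin: "cub.bin s t = 12 * s ^ 2 * t + 4 * t ^ 3"
proof -
  have "cub.bin s t = (\<Sum>j\<in>{1, 3}. cub_b j * s ^ (3 - j) * t ^ j)"
    unfolding cub.bin_def by (rule sum.mono_neutral_cong_right) (auto simp: cub_b_def)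
  then show ?thesis by (simp add: cub_b_def numeral_2_eq_2)
qed

interpretation cub: smooth_cyclic_curve "Suc 0" 3 cub_b
proof
  show "deriv (cub.bin1 u) z \<noteq> 0" if 0: "cub.bin1 u z = 0" for u z
  proof (cases u)
    case True
    have "((\<lambda>z. 12 * z + 4 * z ^ 3) has_field_derivative 12 + 12 * z ^ 2) (at z)"
      by (auto intro!: derivative_eq_intros)
    moreover have e: "cub.bin1 u = (\<lambda>z. 12 * z + 4 * z ^ 3)" using True by (auto simp: cub.bin1_def cub_bin fun_eq_iff)
    ultimately have d: "deriv (cub.bin1 u) z = 12 + 12 * z ^ 2" by (simp add: DERIV_imp_deriv)
    have "4 * z * (3 + z ^ 2) = 0" using 0 unfolding e by (simp add: algebra_simps power3_eq_cube power2_eq_square)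
    then have "z = 0 \<or> z ^ 2 = - 3" by (auto simp: eq_neg_iff_add_eq_0 add.commute)
    then show ?thesis unfolding d by auto
  next
    case False
    have "((\<lambda>z. 12 * z ^ 2 + 4) has_field_derivative 24 * z) (at z)"
      by (auto intro!: derivative_eq_intros)
    moreover have e: "cub.bin1 u = (\<lambda>z. 12 * z ^ 2 + 4)" using False by (auto simp: cub.bin1_def cub_bin fun_eq_iff)
    ultimately have d: "deriv (cub.bin1 u) z = 24 * z" by (simp add: DERIV_imp_deriv)
    have "z \<noteq> 0" using 0 unfolding e by auto
    then show ?thesis unfolding d by simp
  qed
  show "\<exists>s t. (s, t) \<noteq> (0, 0) \<and> cub.bin s t = 0" by (intro exI[of _ 1] exI[of _ 0]) (simp add: cub_bin)
qed

lemma cub_cvec: "cub.cvec s t y = vec3 s t y"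
  by (auto simp: cub.cvec_def vec3_def fun_eq_iff le_Suc_eq numeral_2_eq_2)

lemma cub_point:
  assumes "a \<noteq> 0 \<or> w \<noteq> 0" "c ^ 3 = 12 * a ^ 2 * w + 4 * w ^ 3"
  shows "abs_proj (vec3 a w c) \<in> cub.curve"
  using assms unfolding cub.curve_def cub.cpt_def cub_cvec cub_bin by auto

lemma cub_cases:
  assumes "x \<in> cub.curve"
  obtains a w c where "a \<noteq> 0 \<or> w \<noteq> 0" "a \<noteq> 0 \<or> c \<noteq> 0" "c ^ 3 = 12 * a ^ 2 * w + 4 * w ^ 3" "x = abs_proj (vec3 a w c)"
proof -
  obtain a w c where x: "(a, w) \<noteq> (0, 0)" "c ^ 3 = 12 * a ^ 2 * w + 4 * w ^ 3" "x = abs_proj (vec3 a w c)"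
    using assms unfolding cub.curve_def cub.cpt_def cub_cvec cub_bin by blast
  moreover have "a \<noteq> 0 \<or> c \<noteq> 0" using x(1,2) by auto
  ultimately show thesis using that by auto
qed

definition cub_map :: "proj \<Rightarrow> proj" where
  "cub_map x = abs_proj (vec3 (rep_proj x 0) (- rep_proj x 0) (rep_proj x 2))"

definition cub_ev :: "proj \<Rightarrow> proj" where
  "cub_ev x = abs_proj ((vec3 (rep_proj x 0) (- rep_proj x 0) (rep_proj x 2))(3 := rep_proj x 1))"

lemma cub_map_abs:
  assumes "v \<in> hvec" "v 0 \<noteq> 0 \<or> v 2 \<noteq> 0"
  shows "cub_map (abs_proj v) = abs_proj (vec3 (v 0) (- v 0) (v 2))"
  unfolding cub_map_def
proof (rule abs_proj_homogeneous[where M = "\<lambda>v. vec3 (v 0) (- v 0) (v 2)", OF assms(1)])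
  show "vec3 (v 0) (- v 0) (v 2) \<in> hvec" by (rule vec3_hvec) (use assms(2) in auto)
  show "\<exists>e. e \<noteq> 0 \<and> vec3 (c * v 0) (- (c * v 0)) (c * v 2) = (\<lambda>i. e * vec3 (v 0) (- v 0) (v 2) i)" if "c \<noteq> 0" for c
    using vec3_scale[of c "v 0" "- v 0" "v 2"] that by auto
qed

lemma cub_ev_abs:
  assumes "v \<in> hvec" "v 0 \<noteq> 0 \<or> v 2 \<noteq> 0"
  shows "cub_ev (abs_proj v) = abs_proj ((vec3 (v 0) (- v 0) (v 2))(3 := v 1))"
  unfolding cub_ev_def
proof (rule abs_proj_homogeneous[where M = "\<lambda>v. (vec3 (v 0) (- v 0) (v 2))(3 := v 1)", OF assms(1)])
  show "(vec3 (v 0) (- v 0) (v 2))(3 := v 1) \<in> hvec"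
    by (rule hvec_upd3[OF vec3_hvec]) (use assms(2) in auto)
  show "\<exists>e. e \<noteq> 0 \<and> (vec3 (c * v 0) (- (c * v 0)) (c * v 2))(3 := c * v 1) = (\<lambda>i. e * ((vec3 (v 0) (- v 0) (v 2))(3 := v 1)) i)"
    if "c \<noteq> 0" for c
    using that vec3_scale[of c "v 0" "- v 0" "v 2"] by (intro exI[of _ c]) (auto simp: fun_eq_iff)
qed

text \<open>The center (0 : 1 : 0) of the projection to (a : c) is not on the curve.\<close>

lemma cub_coords:
  assumes "v \<in> hvec" "abs_proj v \<in> cub.curve" shows "v 0 \<noteq> 0 \<or> v 2 \<noteq> 0" "\<forall>i>2. v i = 0"
proof -
  obtain a w c where x: "a \<noteq> 0 \<or> w \<noteq> 0" "a \<noteq> 0 \<or> c \<noteq> 0" "abs_proj v = abs_proj (vec3 a w c)"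
    using cub_cases[OF assms(2)] by metis
  then have "vec3 a w c \<in> hvec" by (intro vec3_hvec) auto
  then obtain e where e: "e \<noteq> 0" "v = (\<lambda>i. e * vec3 a w c i)" using x(3) abs_proj_eq_iff[OF _ assms(1)] by metis
  show "v 0 \<noteq> 0 \<or> v 2 \<noteq> 0" "\<forall>i>2. v i = 0" unfolding e(2) using e(1) x(2) by auto
qed

lemma cubic_dual_pencil: "abs_proj (vec3 1 (- 1) t) \<in> cubic_dual \<longleftrightarrow> (t ^ 3 / 4) ^ 2 = - 4"
  "abs_proj (vec3 0 0 1) \<notin> cubic_dual"
  using cubic_dual_iff[OF vec3_hvec[of 1 "-1" t]] cubic_dual_iff[OF vec3_hvec[of 0 0 1]]
  by (simp_all add: power2_eq_square)

abbreviation "cubic_pencil \<equiv> perp (abs_proj (vec3 (- 1) (- 1) 0))"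

lemma cubic_pencil_cases:
  assumes "x \<in> cubic_pencil" obtains t where "x = abs_proj (vec3 1 (- 1) t)" "rep_proj x 0 \<noteq> 0" | "x = abs_proj (vec3 0 0 1)"
proof (cases "rep_proj x 0 = 0")
  case True
  then have "ratio 0 2 x = 0" by (simp add: ratio_def)
  then show ?thesis using that(2) pencil_cases(2,3)[OF assms] True by auto
qed (use that(1) pencil_cases(1)[OF assms] in blast)

text \<open>Over the line with parameter \<open>\<tau>\<close> lie the roots of w^3 + 3w =
  \<tau>^3/4. The line (0 : 0 : 1) at infinity of the pencil is unramified, with the three cube
  roots of 1/4 over it.\<close>

lemma cubic_card:
  assumes "t \<in> cubic_pencil" shows "card {x \<in> cub.curve. cub_map x = t} = (if t \<in> cubic_dual then 2 else 3)"
  using assms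
proof (cases rule: cubic_pencil_cases)
  case (1 \<tau>)
  have "{x \<in> cub.curve. cub_map x = t} = (\<lambda>w. abs_proj (vec3 1 w \<tau>)) ` {w. w ^ 3 + 3 * w = \<tau> ^ 3 / 4}"
  proof (intro equalityI subsetI)
    fix x assume x: "x \<in> {x \<in> cub.curve. cub_map x = t}"
    then obtain a w c where a: "a \<noteq> 0 \<or> w \<noteq> 0" "a \<noteq> 0 \<or> c \<noteq> 0" "c ^ 3 = 12 * a ^ 2 * w + 4 * w ^ 3" "x = abs_proj (vec3 a w c)"
      using cub_cases by blast
    have "abs_proj (vec3 a (- a) c) = abs_proj (vec3 1 (- 1) \<tau>)"
      using x cub_map_abs[OF vec3_hvec[of a w c]] a 1 by auto
    then have c: "c = a * \<tau>" using vec3_abs_eq_iff[of a "- a" c 1 "- 1" \<tau>] a(2) by auto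
    then have a0: "a \<noteq> 0" using a(2) by auto
    have "x = abs_proj (vec3 1 (w / a) \<tau>)" unfolding a(4) using a0 c by (subst vec3_abs_eq_iff) auto
    moreover have "(w / a) ^ 3 + 3 * (w / a) = \<tau> ^ 3 / 4"
    proof -
      have "a ^ 3 * \<tau> ^ 3 = 12 * a ^ 2 * w + 4 * w ^ 3" using a(3) c by (simp add: power_mult_distrib)
      then show ?thesis using a0 by (simp add: field_simps power3_eq_cube power2_eq_square)
    qed
    ultimately show "x \<in> (\<lambda>w. abs_proj (vec3 1 w \<tau>)) ` {w. w ^ 3 + 3 * w = \<tau> ^ 3 / 4}" by blast
  next
    fix x assume "x \<in> (\<lambda>w. abs_proj (vec3 1 w \<tau>)) ` {w. w ^ 3 + 3 * w = \<tau> ^ 3 / 4}"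
    then obtain w where w: "x = abs_proj (vec3 1 w \<tau>)" "w ^ 3 + 3 * w = \<tau> ^ 3 / 4" by blast
    then show "x \<in> {x \<in> cub.curve. cub_map x = t}"
      using cub_point[of 1 w \<tau>] cub_map_abs[OF vec3_hvec[of 1 w \<tau>]] 1 by (simp add: field_simps)
  qed
  moreover have "inj_on (\<lambda>w. abs_proj (vec3 1 w \<tau>)) A" for A by (rule inj_onI) (simp add: vec3_abs_eq_iff)
  ultimately show ?thesis using cubic_dual_pencil(1)[of \<tau>] 1(1) by (simp only: card_image card_depressed_cubic)
next
  case 2
  have "{x \<in> cub.curve. cub_map x = t} = (\<lambda>w. abs_proj (vec3 0 w 1)) ` {w. w ^ 3 = 1 / 4}"
  proof (intro equalityI subsetI)
    fix x assume x: "x \<in> {x \<in> cub.curve. cub_map x = t}"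
    then obtain a w c where a: "a \<noteq> 0 \<or> w \<noteq> 0" "a \<noteq> 0 \<or> c \<noteq> 0" "c ^ 3 = 12 * a ^ 2 * w + 4 * w ^ 3" "x = abs_proj (vec3 a w c)"
      using cub_cases by blast
    have "abs_proj (vec3 a (- a) c) = abs_proj (vec3 0 0 1)"
      using x cub_map_abs[OF vec3_hvec[of a w c]] a 2 by auto
    then have a0: "a = 0" using vec3_abs_eq_iff[of a "- a" c 0 0 1] a(2) by auto
    then have c0: "c \<noteq> 0" using a(2) by auto
    have "x = abs_proj (vec3 0 (w / c) 1)" unfolding a(4) using a0 c0 a(1) by (subst vec3_abs_eq_iff) auto
    moreover have "(w / c) ^ 3 = 1 / 4" using a(1,3) a0 c0 by (simp add: power_divide field_simps)
    ultimately show "x \<in> (\<lambda>w. abs_proj (vec3 0 w 1)) ` {w. w ^ 3 = 1 / 4}" by blast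
  next
    fix x assume "x \<in> (\<lambda>w. abs_proj (vec3 0 w 1)) ` {w. w ^ 3 = 1 / 4}"
    then obtain w where w: "x = abs_proj (vec3 0 w 1)" "w ^ 3 = 1 / 4" by blast
    then have "w \<noteq> 0" by auto
    have "4 * w ^ 3 = 1" unfolding w(2) by simp
    with w \<open>w \<noteq> 0\<close> show "x \<in> {x \<in> cub.curve. cub_map x = t}"
      using cub_point[of 0 w 1] cub_map_abs[OF vec3_hvec[of 0 w 1]] 2 by simp
  qed
  moreover have "inj_on (\<lambda>w. abs_proj (vec3 0 w 1)) A" for A by (rule inj_onI) (simp add: vec3_abs_eq_iff)
  moreover have "card {w. w ^ 3 = 1 / (4::complex)} = 3" by (rule card_nth_roots) auto
  ultimately show ?thesis using cubic_dual_pencil(2) 2 by (simp add: card_image)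
qed

lemma cubic_branched:
  "branched_map cubic_pencil (\<lambda>t. vec3 1 (- 1) t) 2 0 (\<lambda>t. vec3 t (- 1 * t) 1) 0 2 cub.curve cub_map 3 cubic_dual"
proof (intro branched_map.intro pencil_line_coord0 pencil_line_coord1 branched_map_axioms.intro)
  show "compact cub.curve" by (rule cub.compact_curve)
  show "rep_proj x 0 \<noteq> 0 \<or> rep_proj x 2 \<noteq> 0" if "x \<in> cubic_pencil" for x by (rule pencil_cases(3)[OF that])
  show "rep_proj x 0 \<noteq> 0" if "x \<in> cubic_pencil \<inter> cubic_dual" for x
    using that cubic_dual_pencil(2) by (auto elim: cubic_pencil_cases)
  have "cubic_pencil \<inter> cubic_dual \<subseteq> (\<lambda>t. abs_proj (vec3 1 (- 1) t)) ` {t. t ^ 6 = - 64}"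
  proof
    fix x assume x: "x \<in> cubic_pencil \<inter> cubic_dual"
    then obtain t where t: "x = abs_proj (vec3 1 (- 1) t)" using cubic_dual_pencil(2) by (auto elim: cubic_pencil_cases)
    then have "(t ^ 3 / 4) ^ 2 = - 4" using x cubic_dual_pencil(1) by blast
    then have "t ^ 6 = - 64" by (simp add: power_divide flip: power_mult)
    with t show "x \<in> (\<lambda>t. abs_proj (vec3 1 (- 1) t)) ` {t. t ^ 6 = - 64}" by blast
  qed
  then show "finite (cubic_pencil \<inter> cubic_dual)" by (rule finite_subset) (intro finite_imageI finite_nth_roots, simp)
  show "cub_map ` cub.curve \<subseteq> cubic_pencil"
  proof
    fix y assume "y \<in> cub_map ` cub.curve"
    then obtain x where x: "x \<in> cub.curve" "y = cub_map x" by blast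
    obtain a w c where a: "a \<noteq> 0 \<or> w \<noteq> 0" "a \<noteq> 0 \<or> c \<noteq> 0" "x = abs_proj (vec3 a w c)"
      using cub_cases[OF x(1)] by metis
    then have "y = abs_proj (vec3 a (- a) c)" using x(2) cub_map_abs[OF vec3_hvec[of a w c]] by auto
    then show "y \<in> cubic_pencil" using pencil_iff[OF vec3_hvec[of a "- a" c], of "- 1"] a(2) by auto
  qed
  show "\<exists>D g z. chart cub.curve D g \<and> z \<in> D \<and> g z = x \<and> proj_holomorphic_on (cub_map \<circ> g) D"
    if "x \<in> cub.curve" for x
  proof (rule cub.chartsI[OF _ that])
    fix u z y
    let ?H = "\<lambda>z y. vec3 (cub.pvec u z y 0) (- cub.pvec u z y 0) (cub.pvec u z y 2)"
    have "local_lift cub_map (\<lambda>z y. abs_proj (cub.pvec u z y)) (\<lambda>z y. y ^ 3 = cub.bin1 u z) UNIV ?H"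
      unfolding local_lift_def
    proof (intro conjI ballI allI impI)
      fix z y assume "y ^ 3 = cub.bin1 u z"
      then have "cub.pvec u z y 0 \<noteq> 0 \<or> cub.pvec u z y 2 \<noteq> 0"
        by (rule cub_coords(1)[OF cub.pvec_hvec cub.pvec_in_curve])
      then show "?H z y \<in> hvec" "cub_map (abs_proj (cub.pvec u z y)) = abs_proj (?H z y)"
        using cub_map_abs[OF cub.pvec_hvec] vec3_hvec by auto
    next
      fix D \<phi> \<eta> i assume h: "\<phi> holomorphic_on D" "\<eta> holomorphic_on D"
      show "(\<lambda>w. ?H (\<phi> w) (\<eta> w) i) holomorphic_on D"
        by (intro vec3_holomorphic holomorphic_intros cub.pvec_holomorphic h)
    qed simp
    then show "\<exists>A H. z \<in> A \<and> local_lift cub_map (\<lambda>z y. abs_proj (cub.pvec u z y)) (\<lambda>z y. y ^ 3 = cub.bin1 u z) A H"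
      by blast
  qed
qed (simp_all add: cubic_card)

section \<open>Excluding an isomorphism in the cubic case\<close>

lemma sign_constant:
  fixes g :: "real \<Rightarrow> real"
  assumes "a \<le> b" "continuous_on {a..b} g" "\<And>v. v \<in> {a..b} \<Longrightarrow> g v \<noteq> 0" "g a > 0"
  shows "g b > 0"
proof (rule ccontr)
  assume "\<not> g b > 0"
  then obtain x where "a \<le> x" "x \<le> b" "g x = 0" using IVT2'[of g b 0 a] assms by auto
  then show False using assms(3) by simp
qed

lemma cube_two_unique:
  assumes "n ^ 3 = 2" "m ^ 3 = (2::complex)" "Re n > 0" "Re m > 0" shows "n = m"
proof -
  have *: "Im z = 0 \<and> Re z ^ 3 = 2" if z: "z ^ 3 = 2" "Re z > 0" for z :: complex
  proof -
    have "Re (z ^ 3) = Re z * (Re z ^ 2 - 3 * Im z ^ 2)" "Im (z ^ 3) = Im z * (3 * Re z ^ 2 - Im z ^ 2)"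
      by (simp_all add: power3_eq_cube power2_eq_square algebra_simps)
    then have 1: "Re z * (Re z ^ 2 - 3 * Im z ^ 2) = 2" "Im z * (3 * Re z ^ 2 - Im z ^ 2) = 0" using z(1) by simp_all
    have "Im z = 0"
    proof (rule ccontr)
      assume "Im z \<noteq> 0"
      then have "Im z ^ 2 = 3 * Re z ^ 2" using 1(2) by simp
      then have "Re z * (- 8 * Re z ^ 2) = 2" using 1(1) by (simp add: algebra_simps)
      moreover have "Re z * (- 8 * Re z ^ 2) \<le> 0" using z(2) by simp
      ultimately show False by linarith
    qed
    then show ?thesis using 1(1) by (simp add: power3_eq_cube power2_eq_square)
  qed
  have "Re n ^ 3 = Re m ^ 3" using *[of n] *[of m] assms by simp
  then have "Re n = Re m" by (rule power_eq_imp_eq_base[of _ 3]) (use assms(3,4) in simp_all)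
  then show ?thesis using *[of n] *[of m] assms by (simp add: complex_eq_iff)
qed

text \<open>The path joins two points over \<open>t = 0\<close>. Along it the normalized value \<open>n\<close> of \<open>b\<close> is never purely
  imaginary, and only one cube root of two has a positive real part.\<close>

lemma cubic_path:
  assumes b: "continuous_on {x \<in> cub.curve. rep_proj (cub_map x) 0 \<noteq> 0} b"
    and eq: "\<And>x t. x \<in> cub.curve \<Longrightarrow> cub_map x = abs_proj (vec3 1 (- 1) t) \<Longrightarrow> (b x - t) ^ 3 + b x ^ 3 = 4"
    and inj: "\<And>x x' t. x \<in> cub.curve \<Longrightarrow> x' \<in> cub.curve \<Longrightarrow> cub_map x = abs_proj (vec3 1 (- 1) t) \<Longrightarrow>
        cub_map x' = abs_proj (vec3 1 (- 1) t) \<Longrightarrow> b x = b x' \<Longrightarrow> x = x'"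
    and \<omega>: "\<omega> ^ 3 = 1"
  shows "Re (\<omega> ^ 2 * b (abs_proj (vec3 1 0 0))) < 0"
proof -
  \<comment> \<open>For w = - \<i> v the curve equation t^3 = 12 w + 4 w^3 reads (t / (\<omega>
    \<i>))^3 = 4 (3v - v^3). The right-hand side vanishes at v = 0 and v = sqrt 3, the two ends, and
    is greatest at v = 1, where the point passes through ramification.\<close>
  define \<tau> where "\<tau> v = root 3 (4 * (3 * v - v ^ 3))" for v :: real
  have \<tau>3: "complex_of_real (\<tau> v) ^ 3 = 4 * (3 * of_real v - of_real v ^ 3)" for v
  proof -
    have "\<tau> v ^ 3 = 4 * (3 * v - v ^ 3)" unfolding \<tau>_def by (rule odd_real_root_pow) simp
    then have "complex_of_real (\<tau> v ^ 3) = of_real (4 * (3 * v - v ^ 3))" by (simp only:)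
    then show ?thesis by simp
  qed
  define h where "h v = \<i> * of_real (\<tau> v) / 2" for v
  define t where "t v = \<omega> * (2 * h v)" for v
  define \<gamma> where "\<gamma> v = abs_proj (vec3 1 (- \<i> * of_real v) (t v))" for v
  have t3: "t v ^ 3 = 12 * 1 ^ 2 * (- \<i> * of_real v) + 4 * (- \<i> * of_real v) ^ 3" for v
  proof -
    have "t v ^ 3 = \<omega> ^ 3 * (\<i> ^ 3 * complex_of_real (\<tau> v) ^ 3)" by (simp add: t_def h_def power_mult_distrib)
    moreover have "\<i> ^ 3 = - \<i>" by (simp add: power3_eq_cube)
    ultimately have "t v ^ 3 = - \<i> * complex_of_real (\<tau> v) ^ 3" using \<omega> by simp
    then show ?thesis unfolding \<tau>3 by (simp add: power3_eq_cube algebra_simps)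
  qed
  have \<gamma>X: "\<gamma> v \<in> cub.curve" for v unfolding \<gamma>_def by (rule cub_point[OF _ t3]) simp
  have f\<gamma>: "cub_map (\<gamma> v) = abs_proj (vec3 1 (- 1) (t v))" for v
    unfolding \<gamma>_def using cub_map_abs[OF vec3_hvec[of 1 "- \<i> * of_real v" "t v"]] by simp
  have rep: "rep_proj (cub_map (\<gamma> v)) 0 \<noteq> 0" for v
    unfolding f\<gamma> by (simp add: rep_abs_zero_iff vec3_hvec)
  have ch: "continuous_on S h" for S unfolding h_def \<tau>_def by (intro continuous_intros) auto
  have c\<gamma>: "continuous_on S \<gamma>" for S
    unfolding \<gamma>_def
  proof (rule continuous_on_into_proj)
    show "continuous_on S (\<lambda>v. vec3 1 (- \<i> * of_real v) (t v) i)" for i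
      unfolding t_def by (intro vec3_continuous continuous_intros ch)
  qed (simp add: vec3_hvec)
  \<comment> \<open>As \<open>\<omega>^2\<close> is the inverse of \<open>\<omega>\<close>, this
    shifts b / \<omega> to the center of symmetry: the two cubes in the equation for
    \<open>b\<close> become those of n - h and n + h, and the odd powers of \<open>h\<close>
    cancel.\<close>
  define n where "n v = \<omega> ^ 2 * b (\<gamma> v) - h v" for v
  have neq: "n v ^ 3 + 3 * n v * h v ^ 2 = 2" for v
  proof -
    have "b (\<gamma> v) = \<omega> * (n v + h v)" unfolding n_def using \<omega>
      by (simp add: power3_eq_cube power2_eq_square mult.assoc)
    moreover have "(b (\<gamma> v) - t v) ^ 3 + b (\<gamma> v) ^ 3 = 4" by (rule eq[OF \<gamma>X f\<gamma>])
    ultimately have "(\<omega> * (n v - h v)) ^ 3 + (\<omega> * (n v + h v)) ^ 3 = 4" by (simp add: t_def algebra_simps)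
    then have "(n v - h v) ^ 3 + (n v + h v) ^ 3 = 4" using \<omega> by (simp add: power_mult_distrib)
    then have "2 * (n v ^ 3 + 3 * n v * h v ^ 2) = 2 * 2" by (simp add: power3_eq_cube power2_eq_square algebra_simps)
    then show ?thesis by (metis mult_cancel_left zero_neq_numeral)
  qed
  \<comment> \<open>The square of the imaginary number \<open>h\<close> is real, so for imaginary
    \<open>n\<close> the left-hand side of \<open>neq\<close> would be imaginary and could not equal
    2.\<close>
  have nz: "Re (n v) \<noteq> 0" for v
  proof
    assume "Re (n v) = 0"
    then obtain y where y: "n v = \<i> * of_real y" by (metis complex_eq_iff Re_i_times Im_i_times Im_complex_of_real Re_complex_of_real neg_equal_zero)
    have "Re (n v ^ 3 + 3 * n v * h v ^ 2) = 0" unfolding h_def y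
      by (simp add: power3_eq_cube power2_eq_square)
    then show False unfolding neq by simp
  qed
  have "\<not> Re (n 0) > 0"
  proof
    assume pos: "Re (n 0) > 0"
    have "continuous_on {0..sqrt 3} (\<lambda>v. b (\<gamma> v))"
      by (rule continuous_on_compose2[OF b c\<gamma>]) (use \<gamma>X rep in auto)
    then have "continuous_on {0..sqrt 3} (\<lambda>v. Re (n v))" unfolding n_def by (intro continuous_intros ch)
    then have pos': "Re (n (sqrt 3)) > 0" by (rule sign_constant[rotated]) (use nz pos in auto)
    have h0: "h 0 = 0" "h (sqrt 3) = 0" by (simp_all add: h_def \<tau>_def power3_eq_cube)
    have "n 0 = n (sqrt 3)" by (rule cube_two_unique[OF _ _ pos pos']) (use neq[of 0] neq[of "sqrt 3"] h0 in auto)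
    moreover have "\<omega> \<noteq> 0" using \<omega> by auto
    ultimately have "b (\<gamma> 0) = b (\<gamma> (sqrt 3))" using h0 by (simp add: n_def)
    then have "\<gamma> 0 = \<gamma> (sqrt 3)" using inj[OF \<gamma>X \<gamma>X, of 0 "t 0" "sqrt 3"] f\<gamma>[of 0] f\<gamma>[of "sqrt 3"] h0 by (simp add: t_def)
    then show False unfolding \<gamma>_def by (simp add: vec3_abs_eq_iff)
  qed
  moreover have "h 0 = 0" by (simp add: h_def \<tau>_def)
  ultimately show ?thesis using nz[of 0] by (simp add: n_def \<gamma>_def t_def)
qed

text \<open>The paths for the three cube roots of unity start at the same point (1 : 0 : 0). The
  three products of its value \<open>B\<close> with the cube roots of unity have sum zero, so their
  real parts cannot all be negative.\<close>

lemma cubic_not_isomorphic: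
  assumes "continuous_on {x \<in> cub.curve. rep_proj (cub_map x) 0 \<noteq> 0} b"
    and "\<And>x t. x \<in> cub.curve \<Longrightarrow> cub_map x = abs_proj (vec3 1 (- 1) t) \<Longrightarrow> (- (- 1) * b x - t) ^ 3 + 1 * b x ^ 3 + - 4 = 0"
    and "\<And>x x' t. x \<in> cub.curve \<Longrightarrow> x' \<in> cub.curve \<Longrightarrow> cub_map x = abs_proj (vec3 1 (- 1) t) \<Longrightarrow>
        cub_map x' = abs_proj (vec3 1 (- 1) t) \<Longrightarrow> b x = b x' \<Longrightarrow> x = x'"
  shows False
proof -
  define \<omega> where "\<omega> = Complex (- 1 / 2) (sqrt 3 / 2)"
  have s: "1 + \<omega> + \<omega> ^ 2 = 0" by (simp add: \<omega>_def complex_eq_iff power2_eq_square)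
  then have 3: "\<omega> ^ 3 = 1" by algebra
  define B where "B = b (abs_proj (vec3 1 0 0))"
  have eq: "(b x - t) ^ 3 + b x ^ 3 = 4" if "x \<in> cub.curve" "cub_map x = abs_proj (vec3 1 (- 1) t)" for x t
    using assms(2)[OF that] by simp
  note * = cubic_path[OF assms(1) eq assms(3), folded B_def]
  have "Re (1 ^ 2 * B) < 0" "Re (\<omega> ^ 2 * B) < 0" "Re ((\<omega> ^ 2) ^ 2 * B) < 0"
    by (rule *; use 3 in \<open>simp flip: power_mult\<close>; use 3 in algebra)+
  then have "Re (1 ^ 2 * B) + Re (\<omega> ^ 2 * B) + Re ((\<omega> ^ 2) ^ 2 * B) < 0" by linarith
  moreover have "1 ^ 2 * B + \<omega> ^ 2 * B + (\<omega> ^ 2) ^ 2 * B = (1 + \<omega> + \<omega> ^ 2) * ((1 - \<omega> + \<omega> ^ 2) * B)"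
    by (simp add: algebra_simps power2_eq_square)
  then have "1 ^ 2 * B + \<omega> ^ 2 * B + (\<omega> ^ 2) ^ 2 * B = 0" unfolding s by simp
  then have "Re (1 ^ 2 * B) + Re (\<omega> ^ 2 * B) + Re ((\<omega> ^ 2) ^ 2 * B) = 0" by (metis plus_complex.sel(1) zero_complex.sel(1))
  ultimately show False by linarith
qed

section \<open>Comparison with the covering of the whole complement, cubic case\<close>

lemma cub_ev_in_cover:
  assumes x: "x \<in> cub.curve" "cub_map x \<notin> cubic_dual"
  shows "cub_ev x \<in> cubic_cover \<and> drop3 (cub_ev x) = cub_map x"
proof -
  obtain a w c where a: "a \<noteq> 0 \<or> w \<noteq> 0" "a \<noteq> 0 \<or> c \<noteq> 0" "c ^ 3 = 12 * a ^ 2 * w + 4 * w ^ 3" "x = abs_proj (vec3 a w c)"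
    using cub_cases[OF x(1)] by metis
  define v where "v = vec3 a (- a) c"
  have v: "v \<in> hvec" "\<forall>i>2. v i = 0" unfolding v_def using vec3_hvec[of a "- a" c] a(2) by auto
  have m: "cub_map x = abs_proj v" "cub_ev x = abs_proj (v(3 := w))"
    unfolding a(4) v_def using cub_map_abs[OF vec3_hvec[of a w c]] cub_ev_abs[OF vec3_hvec[of a w c]] a(2) by auto
  have "w ^ 3 - 3 * v 0 * v 1 * w = v 0 ^ 3 + v 1 ^ 3 + v 2 ^ 3 / 4"
    unfolding v_def using a(3) by (simp add: power2_eq_square power3_eq_cube)
  then have "cub_ev x \<in> cubic_cover" unfolding cubic_cover_def m(2)
    using v x(2) m(1) by (intro CollectI exI[of _ v] exI[of _ w] conjI) auto
  then show ?thesis using m drop3_upd[OF v] by simp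
qed

lemma cub_ev_inj:
  assumes "x \<in> cub.curve" "x' \<in> cub.curve" "cub_ev x = cub_ev x'" shows "x = x'"
proof -
  define v w where "v = rep_proj x" and "w = rep_proj x'"
  have v: "v \<in> hvec" "x = abs_proj v" and w: "w \<in> hvec" "x' = abs_proj w" by (simp_all add: v_def w_def)
  have nv: "v 0 \<noteq> 0 \<or> v 2 \<noteq> 0" "\<forall>i>2. v i = 0" using cub_coords[OF v(1)] assms(1) v(2) by auto
  have nw: "w 0 \<noteq> 0 \<or> w 2 \<noteq> 0" "\<forall>i>2. w i = 0" using cub_coords[OF w(1)] assms(2) w(2) by auto
  have h: "(vec3 (v 0) (- v 0) (v 2))(3 := v 1) \<in> hvec" "(vec3 (w 0) (- w 0) (w 2))(3 := w 1) \<in> hvec"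
    using hvec_upd3[OF vec3_hvec] nv(1) nw(1) by auto
  obtain c where "c \<noteq> 0" "(vec3 (w 0) (- w 0) (w 2))(3 := w 1) = (\<lambda>i. c * ((vec3 (v 0) (- v 0) (v 2))(3 := v 1)) i)"
    using assms(3) unfolding v(2) w(2) cub_ev_abs[OF v(1) nv(1)] cub_ev_abs[OF w(1) nw(1)] abs_proj_eq_iff[OF h]
    by (elim exE conjE)
  note e = fun_cong[OF this(2)]
  have e': "w 0 = c * v 0" "w 1 = c * v 1" "w 2 = c * v 2" using e[of 0] e[of 3] e[of 2] by simp_all
  show ?thesis unfolding v(2) w(2)
    by (rule abs_proj_eqI[OF v(1) w(1) minors_le2]) (use nv nw e' in auto)
qed

lemma cub_ev_continuous: "continuous_on {x \<in> cub.curve. cub_map x \<notin> cubic_dual} cub_ev"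
proof (rule continuous_on_projI)
  let ?S = "{v \<in> hvec. abs_proj v \<in> {x \<in> cub.curve. cub_map x \<notin> cubic_dual}}"
  have n: "v 0 \<noteq> 0 \<or> v 2 \<noteq> 0" if "v \<in> ?S" for v using that cub_coords(1) by blast
  have "continuous_on ?S (\<lambda>v. abs_proj ((vec3 (v 0) (- v 0) (v 2))(3 := v 1)))"
  proof (rule continuous_on_into_proj)
    show "continuous_on ?S (\<lambda>v. ((vec3 (v 0) (- v 0) (v 2))(3 := v 1)) i)" for i
      unfolding vec3_def
      by (cases "i = 3"; cases "i = 0"; cases "i = 1"; cases "i = 2") (auto intro!: continuous_intros continuous_on_coord)
    show "(vec3 (v 0) (- v 0) (v 2))(3 := v 1) \<in> hvec" if "v \<in> ?S" for v
      using n[OF that] hvec_upd3[OF vec3_hvec] by auto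
  qed
  then show "continuous_on ?S (\<lambda>v. cub_ev (abs_proj v))"
    by (rule continuous_on_eq) (use n cub_ev_abs in simp)
qed

subsection \<open>The quartic case\<close>

interpretation quart: diagonal_curve 4 "- 1" "- 1"
  by standard auto

abbreviation "quartic_dual \<equiv> dual_curve quart.C.curve"

lemma quart_gv: "quart.gv v 0 = v 0 ^ 3" "quart.gv v (Suc 0) = - (v 1 ^ 3)" "quart.gv v 2 = - (v 2 ^ 3)"
  by (simp_all add: quart.gv_def)

text \<open>If P = Q + R, then P^3 - Q^3 - R^3 = 3PQR. With the fourth powers of the coordinates of
  a point for P, Q, R, the fourth powers of the gradient entries are P^3, Q^3, R^3, and cubing the
  identity gives this equation.\<close>

definition quartic_form :: cpoly where
  "quartic_form = (Var 0 ^ 4 + Const (- 1) * Var 1 ^ 4 + Const (- 1) * Var 2 ^ 4) ^ 3 +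
     Const (- 27) * ((Var 0 ^ 4 * Var 1 ^ 4) * Var 2 ^ 4)"

lemma quartic_form: "form 2 12 quartic_form"
proof -
  have "form 2 (4 * 3) ((Var 0 ^ 4 + Const (- 1) * Var 1 ^ 4 + Const (- 1) * Var 2 ^ 4) ^ 3 :: cpoly)"
    by (intro form_power form_add form_Const_mult form_Var_power) auto
  moreover have "form 2 (4 + 4 + 4) (Const (- 27) * ((Var 0 ^ 4 * Var 1 ^ 4) * Var 2 ^ 4) :: cpoly)"
    by (intro form_Const_mult form_mult form_Var_power) auto
  ultimately show ?thesis unfolding quartic_form_def by (intro form_add) simp_all
qed

lemma eval_quartic_form:
  "poly_eval quartic_form v = (v 0 ^ 4 - v 1 ^ 4 - v 2 ^ 4) ^ 3 - 27 * (v 0 ^ 4 * v 1 ^ 4 * v 2 ^ 4)"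
  unfolding quartic_form_def by (simp add: poly_eval_simps)

lemma quartic_curve_iff:
  assumes "v \<in> hvec" shows "abs_proj v \<in> quart.C.curve \<longleftrightarrow> (\<forall>i>2. v i = 0) \<and> v 0 ^ 4 = v 1 ^ 4 + v 2 ^ 4"
  unfolding quart.curve_iff[OF assms] by (auto simp: algebra_simps)

lemma quartic_gv_sum:
  assumes "v 0 ^ 4 = v 1 ^ 4 + v 2 ^ 4"
  shows "quart.gv v 0 ^ 4 - quart.gv v 1 ^ 4 - quart.gv v 2 ^ 4 = 3 * (v 0 ^ 4 * v 1 ^ 4 * v 2 ^ 4)"
proof -
  have "quart.gv v 0 ^ 4 = (v 0 ^ 4) ^ 3" "quart.gv v 1 ^ 4 = (v 1 ^ 4) ^ 3" "quart.gv v 2 ^ 4 = (v 2 ^ 4) ^ 3"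
    by (simp_all add: quart_gv flip: power_mult)
  then show ?thesis unfolding assms by (simp add: power3_eq_cube algebra_simps)
qed

lemma quartic_form_gv:
  assumes "v \<in> hvec" "abs_proj v \<in> quart.C.curve" shows "poly_eval quartic_form (quart.gv v) = 0"
proof -
  have v: "v 0 ^ 4 = v 1 ^ 4 + v 2 ^ 4" using assms(2) unfolding quartic_curve_iff[OF assms(1)] by simp
  have "(3 * (v 0 ^ 4 * v 1 ^ 4 * v 2 ^ 4)) ^ 3 = 27 * (quart.gv v 0 ^ 4 * quart.gv v 1 ^ 4 * quart.gv v 2 ^ 4)"
    by (simp add: quart_gv power_mult_distrib flip: power_mult)
  then show ?thesis unfolding eval_quartic_form quartic_gv_sum[OF v] by simp
qed

text \<open>The parametrization (v^2, v^3) of the cuspidal cubic is onto: \<open>w\<close> decides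
  which square root of \<open>X\<close> to take.\<close>

lemma square_cube:
  assumes "w ^ 2 = X ^ 3" obtains v :: complex where "v ^ 2 = X" "v ^ 3 = w"
proof -
  define x where "x = csqrt X"
  have x: "x ^ 2 = X" by (simp add: x_def)
  have "(x ^ 3) ^ 2 = w ^ 2" unfolding assms x[symmetric] by (simp flip: power_mult)
  then have "x ^ 3 = w \<or> (- x) ^ 3 = w" unfolding power2_eq_iff by auto
  then show ?thesis using that[of x] that[of "- x"] x by auto
qed

text \<open>The squares of the coordinates of a point of the quartic satisfy X^2 = Y^2 + Z^2, and
  the squares of the gradient entries are X^3, Y^3, Z^3. Conversely the signs of the square roots
  can be chosen to fit. So the dual is the preimage under squaring of a curve parametrized by a
  conic.\<close>

lemma quartic_dual_iff:
  assumes w: "w \<in> hvec" "\<And>i. i > 2 \<Longrightarrow> w i = 0"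
  shows "abs_proj w \<in> quartic_dual \<longleftrightarrow> (\<exists>X Y Z. X ^ 2 = Y ^ 2 + Z ^ 2 \<and> w 0 ^ 2 = X ^ 3 \<and> w 1 ^ 2 = Y ^ 3 \<and> w 2 ^ 2 = Z ^ 3)"
proof
  assume "abs_proj w \<in> quartic_dual"
  then obtain x where x: "x \<in> quart.C.curve" "abs_proj w = quart.gauss x" unfolding quart.dual_eq by blast
  define v where "v = rep_proj x"
  have v: "v \<in> hvec" "abs_proj v \<in> quart.C.curve" using x(1) by (simp_all add: v_def)
  then have g: "quart.gv v \<in> hvec" by (intro quart.gv_hvec) (auto simp: quartic_curve_iff)
  have "abs_proj (quart.gv v) = abs_proj w" using x(2) by (simp add: quart.gauss_def v_def)
  then obtain c where c: "w = (\<lambda>i. c * quart.gv v i)" unfolding abs_proj_eq_iff[OF g w(1)] by (elim exE conjE)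
  \<comment> \<open>The factor c^2 by which the squares of \<open>w\<close> and of the gradient
    differ has to be absorbed into the cubes of the conic coordinates.\<close>
  obtain e where e: "e ^ 3 = c ^ 2" using cubic.root_exists by blast
  have "v 0 ^ 4 = v 1 ^ 4 + v 2 ^ 4" using v(2) unfolding quartic_curve_iff[OF v(1)] by blast
  then have "(e * v 0 ^ 2) ^ 2 = (e * v 1 ^ 2) ^ 2 + (e * v 2 ^ 2) ^ 2"
    by (simp add: power_mult_distrib flip: power_mult) (simp add: algebra_simps)
  moreover have "w 0 ^ 2 = (e * v 0 ^ 2) ^ 3" "w 1 ^ 2 = (e * v 1 ^ 2) ^ 3" "w 2 ^ 2 = (e * v 2 ^ 2) ^ 3"
    unfolding c by (simp_all add: quart_gv power_mult_distrib e flip: power_mult)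
  ultimately show "\<exists>X Y Z. X ^ 2 = Y ^ 2 + Z ^ 2 \<and> w 0 ^ 2 = X ^ 3 \<and> w 1 ^ 2 = Y ^ 3 \<and> w 2 ^ 2 = Z ^ 3" by blast
next
  assume "\<exists>X Y Z. X ^ 2 = Y ^ 2 + Z ^ 2 \<and> w 0 ^ 2 = X ^ 3 \<and> w 1 ^ 2 = Y ^ 3 \<and> w 2 ^ 2 = Z ^ 3"
  then obtain X Y Z where XYZ: "X ^ 2 = Y ^ 2 + Z ^ 2" "w 0 ^ 2 = X ^ 3" "w 1 ^ 2 = Y ^ 3" "w 2 ^ 2 = Z ^ 3" by blast
  obtain x where x: "x ^ 2 = X" "x ^ 3 = w 0" using XYZ(2) by (rule square_cube)
  have "(- w 1) ^ 2 = Y ^ 3" "(- w 2) ^ 2 = Z ^ 3" using XYZ by simp_all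
  then obtain y z where y: "y ^ 2 = Y" "y ^ 3 = - w 1" and z: "z ^ 2 = Z" "z ^ 3 = - w 2" by (metis square_cube)
  have nz: "x \<noteq> 0 \<or> y \<noteq> 0 \<or> z \<noteq> 0" using hvec_le2[OF w] x(2) y(2) z(2) by auto
  let ?v = "vec3 x y z"
  have v: "?v \<in> hvec" by (rule vec3_hvec[OF nz])
  have "x ^ 4 = y ^ 4 + z ^ 4" using XYZ(1) unfolding x(1)[symmetric] y(1)[symmetric] z(1)[symmetric]
    by (simp flip: power_mult)
  then have "abs_proj ?v \<in> quart.C.curve" unfolding quartic_curve_iff[OF v] by simp
  moreover have "quart.gv ?v i = w i" for i
  proof -
    have "i = 0 \<or> i = 1 \<or> i = 2 \<or> i > 2" by auto
    then show ?thesis using x y z w(2) by (elim disjE) (auto simp: quart_gv, simp add: quart.gv_def)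
  qed
  then have "quart.gv ?v = w" by blast
  then have "quart.gauss (abs_proj ?v) = abs_proj w" using quart.gauss_abs[OF v] by simp
  ultimately show "abs_proj w \<in> quartic_dual" unfolding quart.dual_eq by force
qed

text \<open>\<open>kap\<close> is the maximum of the function \<open>\<tau>\<close> along the path in \<open>quartic_path\<close>.\<close>

definition kap :: real where "kap = sqrt (sqrt 2 / 4)"

abbreviation "qk \<equiv> complex_of_real kap"

lemma kap: "kap > 0" "kap ^ 2 = sqrt 2 / 4" "kap ^ 4 = 1 / 8"
proof -
  show "kap > 0" by (simp add: kap_def)
  show 2: "kap ^ 2 = sqrt 2 / 4" by (simp add: kap_def)
  have "kap ^ 4 = (kap ^ 2) ^ 2" by simp
  then show "kap ^ 4 = 1 / 8" unfolding 2 by (simp add: power_divide)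
qed

lemma qk4: "qk ^ 4 = 1 / 8"
proof -
  have "qk ^ 4 = complex_of_real (kap ^ 4)" by simp
  then show ?thesis unfolding kap(3) by simp
qed

lemma quartic_transversal: "transversal (perp (abs_proj (vec3 qk (-1) 0))) quartic_dual"
proof (rule quart.transversalI[OF _ _ _ quartic_form quartic_form_gv])
  show "vec3 qk (-1) 0 \<in> hvec" by (rule vec3_hvec) simp
  show "vec3 qk (-1) 0 0 ^ 4 + - 1 * vec3 qk (-1) 0 1 ^ 4 + - 1 * vec3 qk (-1) 0 2 ^ 4 \<noteq> 0" by (simp add: qk4)
  fix v assume v: "v \<in> hvec" "abs_proj v \<in> quart.C.curve"
    and p: "vec3 qk (-1) 0 0 * quart.gv v 0 + vec3 qk (-1) 0 1 * quart.gv v 1 + vec3 qk (-1) 0 2 * quart.gv v 2 = 0"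
  have c: "v 0 ^ 4 = v 1 ^ 4 + v 2 ^ 4" and v2: "\<And>i. i > 2 \<Longrightarrow> v i = 0"
    using v(2) unfolding quartic_curve_iff[OF v(1)] by auto
  \<comment> \<open>The tangent passes through the center of the pencil. As \<kappa>^4 = 1/8, this
    gives B^3 = A^3/8 for the fourth powers A, B of the first two coordinates, which excludes all
    degenerate cases below.\<close>
  have q: "v 1 ^ 3 = - qk * v 0 ^ 3" using p by (simp add: quart_gv eq_neg_iff_add_eq_0 add.commute)
  have "(v 1 ^ 4) ^ 3 = (v 1 ^ 3) ^ 4" by (simp flip: power_mult)
  then have q12: "(v 1 ^ 4) ^ 3 = 1 / 8 * (v 0 ^ 4) ^ 3" unfolding q by (simp add: power_mult_distrib qk4 flip: power_mult)
  have v0: "v 0 \<noteq> 0"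
  proof
    assume 0: "v 0 = 0"
    then have 1: "v 1 = 0" using q by simp
    then have "v 2 = 0" using 0 c by simp
    then show False using hvec_le2[OF v(1) v2] 0 1 by simp
  qed
  then have v1: "v 1 \<noteq> 0" using q12 by auto
  have v2': "v 2 \<noteq> 0" using c q12 v0 by auto
  define g where "g = quart.gv v"
  define A B where "A = v 0 ^ 4" and "B = v 1 ^ 4"
  have C: "v 2 ^ 4 = A - B" using c by (simp add: A_def B_def)
  have "((\<lambda>z. poly_eval quartic_form (g(2 := z))) has_field_derivative
      3 * (g 0 ^ 4 - g 1 ^ 4 - g 2 ^ 4) ^ 2 * (- 4 * g 2 ^ 3) - 27 * (g 0 ^ 4 * g 1 ^ 4 * (4 * g 2 ^ 3))) (at (g 2))"
    unfolding eval_quartic_form by (auto intro!: derivative_eq_intros)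
  then have "partial_deriv 2 quartic_form g =
      3 * (g 0 ^ 4 - g 1 ^ 4 - g 2 ^ 4) ^ 2 * (- 4 * g 2 ^ 3) - 27 * (g 0 ^ 4 * g 1 ^ 4 * (4 * g 2 ^ 3))"
    unfolding partial_deriv_def by (rule DERIV_imp_deriv)
  moreover have "g 0 ^ 4 - g 1 ^ 4 - g 2 ^ 4 = 3 * (A * B * (A - B))"
    unfolding g_def using quartic_gv_sum[OF c] by (simp only: C A_def[symmetric] B_def[symmetric])
  moreover have "g 0 ^ 4 = A ^ 3" "g 1 ^ 4 = B ^ 3" by (simp_all add: g_def quart_gv A_def B_def flip: power_mult)
  ultimately have "partial_deriv 2 quartic_form g =
      3 * (3 * (A * B * (A - B))) ^ 2 * (- 4 * g 2 ^ 3) - 27 * (A ^ 3 * B ^ 3 * (4 * g 2 ^ 3))" by (simp only:)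
  also have "\<dots> = - 108 * g 2 ^ 3 * (A * B) ^ 2 * (A ^ 2 - A * B + B ^ 2)" by algebra
  finally have pd: "partial_deriv 2 quartic_form g = - 108 * g 2 ^ 3 * (A * B) ^ 2 * (A ^ 2 - A * B + B ^ 2)" .
  have nz: "A \<noteq> 0" "B \<noteq> 0" "g 2 \<noteq> 0" using v0 v1 v2' by (simp_all add: A_def B_def g_def quart_gv)
  have "A ^ 2 - A * B + B ^ 2 \<noteq> 0"
  proof
    assume "A ^ 2 - A * B + B ^ 2 = 0"
    then have "A ^ 3 + B ^ 3 = 0" by algebra
    moreover have "B ^ 3 = 1 / 8 * A ^ 3" using q12 by (simp only: A_def B_def)
    ultimately have "A ^ 3 + 1 / 8 * A ^ 3 = 0" by (simp only:)
    then have "A ^ 3 = 0" by (simp add: field_simps)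
    then show False using nz(1) by simp
  qed
  then have "partial_deriv 2 quartic_form g \<noteq> 0" unfolding pd using nz by simp
  then show "v 0 \<noteq> 0 \<and> v 1 \<noteq> 0 \<and> v 2 \<noteq> 0 \<and> partial_deriv 2 quartic_form (quart.gv v) \<noteq> 0"
    using v0 v1 v2' by (simp add: g_def)
qed auto

text \<open>In the coordinates \<open>X = s\<^sup>2 + t\<^sup>2\<close>, \<open>Y = s\<^sup>2 - t\<^sup>2\<close>, \<open>Z = 2st\<close> of the conic \<open>X\<^sup>2 = Y\<^sup>2 + Z\<^sup>2\<close> this is
  \<open>a\<^sup>2YZ - X(b\<^sup>2Z + c\<^sup>2Y)\<close>. It has a double zero iff \<open>(a\<^sup>2, b\<^sup>2, c\<^sup>2)\<close> is proportional to \<open>(X\<^sup>3, Y\<^sup>3, Z\<^sup>3)\<close>.\<close>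

definition bq :: "(nat \<Rightarrow> complex) \<Rightarrow> complex \<Rightarrow> complex \<Rightarrow> complex" where
  "bq w s t = - (w 2 ^ 2) * s ^ 4 + 2 * (w 0 ^ 2 - w 1 ^ 2) * s ^ 3 * t - 2 * (w 0 ^ 2 + w 1 ^ 2) * s * t ^ 3 + w 2 ^ 2 * t ^ 4"

section \<open>The binary quartic form and its zeros\<close>

lemma bq_scale: "bq w (l * s) (l * t) = l ^ 4 * bq w s t" "bq (\<lambda>i. c * w i) s t = c ^ 2 * bq w s t"
  unfolding bq_def by algebra+

text \<open>The restriction of the quartic form to a line of the (s, t)-plane, with expanded
  coefficients, so that the degree bound and the leading coefficient \<open>bq w s1 t1\<close> can
  be read off.\<close>

definition bq_line :: "(nat \<Rightarrow> complex) \<Rightarrow> complex \<Rightarrow> complex \<Rightarrow> complex \<Rightarrow> complex \<Rightarrow> complex poly" where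
  "bq_line w s0 t0 s1 t1 = (let C = w 2 ^ 2; E = 2 * (w 0 ^ 2 - w 1 ^ 2); F = - 2 * (w 0 ^ 2 + w 1 ^ 2) in
     [:- C * s0 ^ 4 + E * s0 ^ 3 * t0 + F * s0 * t0 ^ 3 + C * t0 ^ 4,
       - 4 * C * s0 ^ 3 * s1 + E * (3 * s0 ^ 2 * s1 * t0 + s0 ^ 3 * t1) + F * (s1 * t0 ^ 3 + 3 * s0 * t0 ^ 2 * t1) + 4 * C * t0 ^ 3 * t1,
       - 6 * C * s0 ^ 2 * s1 ^ 2 + E * (3 * s0 * s1 ^ 2 * t0 + 3 * s0 ^ 2 * s1 * t1) + F * (3 * s1 * t0 ^ 2 * t1 + 3 * s0 * t0 * t1 ^ 2) + 6 * C * t0 ^ 2 * t1 ^ 2,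
       - 4 * C * s0 * s1 ^ 3 + E * (s1 ^ 3 * t0 + 3 * s0 * s1 ^ 2 * t1) + F * (3 * s1 * t0 * t1 ^ 2 + s0 * t1 ^ 3) + 4 * C * t0 * t1 ^ 3,
       - C * s1 ^ 4 + E * s1 ^ 3 * t1 + F * s1 * t1 ^ 3 + C * t1 ^ 4:])"

lemma poly_bq_line: "poly (bq_line w s0 t0 s1 t1) z = bq w (s0 + z * s1) (t0 + z * t1)"
  unfolding bq_line_def bq_def Let_def poly_pCons poly_0 by algebra

lemma degree_bq_line: "degree (bq_line w s0 t0 s1 t1) \<le> 4" "coeff (bq_line w s0 t0 s1 t1) 4 = bq w s1 t1"
  by (simp_all add: bq_line_def bq_def Let_def eval_nat_numeral) (simp add: algebra_simps)

text \<open>\<open>bqs\<close> and \<open>bqt\<close> are the partial derivatives of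
  \<open>bq w\<close> with respect to \<open>s\<close> and \<open>t\<close>.\<close>

definition bqs :: "(nat \<Rightarrow> complex) \<Rightarrow> complex \<Rightarrow> complex \<Rightarrow> complex" where
  "bqs w s t = - 4 * w 2 ^ 2 * s ^ 3 + 6 * (w 0 ^ 2 - w 1 ^ 2) * s ^ 2 * t - 2 * (w 0 ^ 2 + w 1 ^ 2) * t ^ 3"

definition bqt :: "(nat \<Rightarrow> complex) \<Rightarrow> complex \<Rightarrow> complex \<Rightarrow> complex" where
  "bqt w s t = 2 * (w 0 ^ 2 - w 1 ^ 2) * s ^ 3 - 6 * (w 0 ^ 2 + w 1 ^ 2) * s * t ^ 2 + 4 * w 2 ^ 2 * t ^ 3"

lemma bq_euler: "s * bqs w s t + t * bqt w s t = 4 * bq w s t"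
  unfolding bqs_def bqt_def bq_def by algebra

lemma bq_derivative:
  "((\<lambda>z. bq w (s0 + z * s1) (t0 + z * t1)) has_field_derivative
     s1 * bqs w (s0 + z * s1) (t0 + z * t1) + t1 * bqt w (s0 + z * s1) (t0 + z * t1)) (at z)"
proof -
  define s t where "s = s0 + z * s1" and "t = t0 + z * t1"
  have "((\<lambda>z. bq w (s0 + z * s1) (t0 + z * t1)) has_field_derivative
     - (w 2 ^ 2) * (4 * s ^ 3 * s1) + 2 * (w 0 ^ 2 - w 1 ^ 2) * (3 * s ^ 2 * s1 * t + s ^ 3 * t1)
      - 2 * (w 0 ^ 2 + w 1 ^ 2) * (s1 * t ^ 3 + s * (3 * t ^ 2 * t1)) + w 2 ^ 2 * (4 * t ^ 3 * t1)) (at z)"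
    unfolding bq_def s_def t_def by (rule derivative_eq_intros refl | simp add: algebra_simps)+
  moreover have "- (w 2 ^ 2) * (4 * s ^ 3 * s1) + 2 * (w 0 ^ 2 - w 1 ^ 2) * (3 * s ^ 2 * s1 * t + s ^ 3 * t1)
      - 2 * (w 0 ^ 2 + w 1 ^ 2) * (s1 * t ^ 3 + s * (3 * t ^ 2 * t1)) + w 2 ^ 2 * (4 * t ^ 3 * t1) =
      s1 * bqs w s t + t1 * bqt w s t" unfolding bqs_def bqt_def by algebra
  ultimately show ?thesis unfolding s_def t_def by simp
qed

lemma proportional_triple:
  fixes A B C :: complex
  assumes "A * y = B * x" "A * z = C * x" "B * z = C * y" "x \<noteq> 0 \<or> y \<noteq> 0 \<or> z \<noteq> 0"
  obtains m where "A = m * x" "B = m * y" "C = m * z"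
proof -
  consider "x \<noteq> 0" | "y \<noteq> 0" | "z \<noteq> 0" using assms(4) by blast
  then show thesis
  proof cases
    case 1 then show thesis using that[of "A / x"] assms(1,2) by (simp add: field_simps)
  next
    case 2 then show thesis using that[of "B / y"] assms(1,3) by (simp add: field_simps)
  next
    case 3 then show thesis using that[of "C / z"] assms(2,3) by (simp add: field_simps)
  qed
qed

text \<open>For fixed \<open>s\<close> and \<open>t\<close> the partial derivatives are two linear
  forms in the squares (A, B, C) of the entries of \<open>w\<close>. The cross product of their
  coefficient vectors is -8 times (x^3, y^3, z^3) for the conic point (x, y, z) with parameter (s,
  t), so common vanishing makes (A, B, C) proportional to these cubes.\<close>

lemma bq_double_root:
  assumes w: "w \<in> hvec" "\<And>i. i > 2 \<Longrightarrow> w i = 0" and st: "(s, t) \<noteq> (0, 0)" and 0: "bqs w s t = 0" "bqt w s t = 0"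
  shows "abs_proj w \<in> quartic_dual"
proof -
  define x y z where "x = s ^ 2 + t ^ 2" and "y = s ^ 2 - t ^ 2" and "z = 2 * s * t"
  define A B C where "A = w 0 ^ 2" and "B = w 1 ^ 2" and "C = w 2 ^ 2"
  have P: "- 4 * C * s ^ 3 + 6 * (A - B) * s ^ 2 * t - 2 * (A + B) * t ^ 3 = 0"
    and Q: "2 * (A - B) * s ^ 3 - 6 * (A + B) * s * t ^ 2 + 4 * C * t ^ 3 = 0"
    using 0 by (simp_all only: bqs_def bqt_def A_def B_def C_def)
  have "- 8 * (B * z ^ 3 - C * y ^ 3) =
      (6 * s ^ 2 * t - 2 * t ^ 3) * (2 * (A - B) * s ^ 3 - 6 * (A + B) * s * t ^ 2 + 4 * C * t ^ 3) -
      (2 * s ^ 3 - 6 * s * t ^ 2) * (- 4 * C * s ^ 3 + 6 * (A - B) * s ^ 2 * t - 2 * (A + B) * t ^ 3)"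
    unfolding y_def z_def by algebra
  then have 1: "B * z ^ 3 = C * y ^ 3" unfolding P Q by simp
  have "- 8 * (C * x ^ 3 - A * z ^ 3) =
      (- 6 * s ^ 2 * t - 2 * t ^ 3) * (2 * (A - B) * s ^ 3 - 6 * (A + B) * s * t ^ 2 + 4 * C * t ^ 3) -
      (- 2 * s ^ 3 - 6 * s * t ^ 2) * (- 4 * C * s ^ 3 + 6 * (A - B) * s ^ 2 * t - 2 * (A + B) * t ^ 3)"
    unfolding x_def z_def by algebra
  then have 2: "A * z ^ 3 = C * x ^ 3" unfolding P Q by simp
  have "- 8 * (A * y ^ 3 - B * x ^ 3) =
      (- 4 * s ^ 3) * (2 * (A - B) * s ^ 3 - 6 * (A + B) * s * t ^ 2 + 4 * C * t ^ 3) -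
      (4 * t ^ 3) * (- 4 * C * s ^ 3 + 6 * (A - B) * s ^ 2 * t - 2 * (A + B) * t ^ 3)"
    unfolding x_def y_def by algebra
  then have 3: "A * y ^ 3 = B * x ^ 3" unfolding P Q by simp
  have "x ^ 3 \<noteq> 0 \<or> y ^ 3 \<noteq> 0 \<or> z ^ 3 \<noteq> 0" using st by (auto simp: x_def y_def z_def)
  then obtain m where m: "A = m * x ^ 3" "B = m * y ^ 3" "C = m * z ^ 3" using proportional_triple[OF 3 2 1] by blast
  obtain e where e: "e ^ 3 = m" using cubic.root_exists by blast
  have "(e * x) ^ 2 = (e * y) ^ 2 + (e * z) ^ 2" unfolding x_def y_def z_def by algebra
  moreover have "w 0 ^ 2 = (e * x) ^ 3" "w 1 ^ 2 = (e * y) ^ 3" "w 2 ^ 2 = (e * z) ^ 3"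
    using m unfolding A_def B_def C_def by (simp_all add: power_mult_distrib e)
  ultimately have "\<exists>X Y Z. X ^ 2 = Y ^ 2 + Z ^ 2 \<and> w 0 ^ 2 = X ^ 3 \<and> w 1 ^ 2 = Y ^ 3 \<and> w 2 ^ 2 = Z ^ 3" by blast
  then show ?thesis using quartic_dual_iff[of w] w by simp
qed

text \<open>The rational normal curve of degree four places the parameter line inside
  \<open>proj\<close>. The degree is four because the first five coordinates of the cyclic curve
  with k = 4 are then the same monomials.\<close>

definition nvec :: "complex \<Rightarrow> complex \<Rightarrow> nat \<Rightarrow> complex" where
  "nvec s t i = (if i \<le> 4 then s ^ (4 - i) * t ^ i else 0)"

definition npt where "npt s t = abs_proj (nvec s t)"

lemma nvec_hvec: "(s, t) \<noteq> (0, 0) \<Longrightarrow> nvec s t \<in> hvec"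
  using hvecI[of 4 "nvec s t" 0] hvecI[of 4 "nvec s t" 4] by (auto simp: nvec_def)

lemma nvec_scale: "nvec (l * s) (l * t) = (\<lambda>i. l ^ 4 * nvec s t i)"
proof
  fix i
  have "l ^ (4 - i) * l ^ i = l ^ 4" if "i \<le> 4" using that by (simp flip: power_add)
  then show "nvec (l * s) (l * t) i = l ^ 4 * nvec s t i"
    by (auto simp: nvec_def power_mult_distrib)
qed

lemma parallel:
  fixes s t s' t' :: complex
  assumes "(s, t) \<noteq> (0, 0)" "(s', t') \<noteq> (0, 0)" "s * t' = t * s'"
  shows "\<exists>l. l \<noteq> 0 \<and> s' = l * s \<and> t' = l * t"
proof (cases "s = 0")
  case True
  then show ?thesis using assms by (intro exI[of _ "t' / t"]) auto
next
  case False
  then have "s' \<noteq> 0" using assms(2,3) by auto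
  with False show ?thesis using assms(3) by (intro exI[of _ "s' / s"]) (simp add: field_simps)
qed

lemma npt_eq_iff:
  assumes "(s, t) \<noteq> (0, 0)" "(s', t') \<noteq> (0, 0)"
  shows "npt s t = npt s' t' \<longleftrightarrow> s * t' = t * s'"
proof
  assume "npt s t = npt s' t'"
  then obtain c where c: "c \<noteq> 0" "nvec s' t' = (\<lambda>i. c * nvec s t i)"
    unfolding npt_def abs_proj_eq_iff[OF nvec_hvec[OF assms(1)] nvec_hvec[OF assms(2)]] by (elim exE conjE)
  note e = fun_cong[OF c(2)]
  have e: "s' ^ 4 = c * s ^ 4" "s' ^ 3 * t' = c * (s ^ 3 * t)" "s' * t' ^ 3 = c * (s * t ^ 3)" "t' ^ 4 = c * t ^ 4"
    using e[of 0] e[of 1] e[of 3] e[of 4] by (simp_all add: nvec_def)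
  show "s * t' = t * s'"
  proof (cases "s = 0")
    case True
    then show ?thesis using e(1) by simp
  next
    case False
    have "(s' ^ 3 * s ^ 3 * c) * (s * t' - t * s') = 0" using e(1,2) by algebra
    moreover have "s' \<noteq> 0" using e(1) False c(1) by auto
    ultimately show ?thesis using False c(1) by simp
  qed
next
  assume eq: "s * t' = t * s'"
  obtain l where l: "l \<noteq> 0" "s' = l * s" "t' = l * t" using parallel[OF assms eq] by blast
  show "npt s t = npt s' t'" unfolding npt_def l(2,3) nvec_scale
    by (rule abs_proj_scale[OF _ nvec_hvec[OF assms(1)], symmetric]) (use l(1) in simp)
qed

definition bq_roots :: "(nat \<Rightarrow> complex) \<Rightarrow> proj set" where
  "bq_roots w = {npt s t |s t. (s, t) \<noteq> (0, 0) \<and> bq w s t = 0}"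

lemma bq_roots_scale: "c \<noteq> 0 \<Longrightarrow> bq_roots (\<lambda>i. c * w i) = bq_roots w"
  by (simp add: bq_roots_def bq_scale)

lemma bq_roots_rep: assumes "w \<in> hvec" shows "bq_roots (rep_proj (abs_proj w)) = bq_roots w"
  using rep_abs_proj[OF assms] bq_roots_scale by metis

lemma bq_nonroot:
  assumes w: "w \<in> hvec" "\<And>i. i > 2 \<Longrightarrow> w i = 0" obtains m where "bq w 1 m \<noteq> 0"
proof -
  let ?p = "[:- (w 2 ^ 2), 2 * (w 0 ^ 2 - w 1 ^ 2), 0, - 2 * (w 0 ^ 2 + w 1 ^ 2), w 2 ^ 2:]"
  have "w 0 ^ 2 = 0 \<and> w 1 ^ 2 = 0" if "w 0 ^ 2 - w 1 ^ 2 = 0" "w 0 ^ 2 + w 1 ^ 2 = 0"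
  proof -
    have "2 * w 0 ^ 2 = 0" "2 * w 1 ^ 2 = 0" using that by algebra+
    then show ?thesis by simp
  qed
  then have "?p \<noteq> 0" using hvec_le2[OF w] by (auto simp: eq_diff_eq)
  then have "finite {m. poly ?p m = 0}" by (rule poly_roots_finite)
  then obtain m where "poly ?p m \<noteq> 0" using ex_new_if_finite[OF infinite_UNIV_char_0] by blast
  moreover have "poly ?p m = bq w 1 m" by (simp add: bq_def) algebra
  ultimately show thesis using that by metis
qed

text \<open>With a nonzero (1, m) of the form moved to infinity, all zeros are finite and a
  polynomial of degree exactly four remains. At a multiple root Euler's identity makes both partial
  derivatives vanish, so the line would belong to the dual.\<close>

lemma card_bq_roots:
  assumes w: "w \<in> hvec" "\<And>i. i > 2 \<Longrightarrow> w i = 0" and nd: "abs_proj w \<notin> quartic_dual"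
  shows "card (bq_roots w) = 4"
proof -
  obtain m where m: "bq w 1 m \<noteq> 0" using w by (rule bq_nonroot)
  define Q where "Q = bq_line w 0 1 1 m"
  have Q: "poly Q z = bq w z (1 + z * m)" for z by (simp add: Q_def poly_bq_line)
  have ne: "(z, 1 + z * m) \<noteq> (0, 0)" for z by auto
  have deg: "degree Q = 4" using degree_bq_line[of w 0 1 1 m] m le_degree[of Q 4] by (simp add: Q_def)
  have "card {z. poly Q z = 0} = degree Q"
  proof (rule card_simple_roots)
    show "Q \<noteq> 0" using deg by auto
    fix z assume z: "poly Q z = 0"
    let ?P = "bqs w z (1 + z * m)" and ?R = "bqt w z (1 + z * m)"
    have "poly Q = (\<lambda>z. bq w (0 + z * 1) (1 + z * m))" using Q by (simp add: fun_eq_iff)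
    then have "(poly Q has_field_derivative ?P + m * ?R) (at z)" using bq_derivative[of w 0 1 1 m z] by simp
    then have d: "poly (pderiv Q) z = ?P + m * ?R" using poly_DERIV DERIV_unique by blast
    show "poly (pderiv Q) z \<noteq> 0"
    proof
      assume 0: "poly (pderiv Q) z = 0"
      have "z * ?P + (1 + z * m) * ?R = 0" unfolding bq_euler using z Q by simp
      then have R: "?R = 0" using 0 d by algebra
      then have "?P = 0" using 0 d by simp
      then show False using bq_double_root[OF w ne _ R] nd by simp
    qed
  qed
  moreover have "bq_roots w = (\<lambda>z. npt z (1 + z * m)) ` {z. poly Q z = 0}"
  proof (intro equalityI subsetI)
    fix x assume "x \<in> bq_roots w"
    then obtain s t where st: "x = npt s t" "(s, t) \<noteq> (0, 0)" "bq w s t = 0" unfolding bq_roots_def by blast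
    define e where "e = t - m * s"
    have e: "e \<noteq> 0"
    proof
      assume "e = 0"
      then have "bq w s t = s ^ 4 * bq w 1 m" using bq_scale(1)[of w s 1 m] by (simp add: e_def mult.commute)
      then have "s = 0" using st(3) m by simp
      then show False using st(2) \<open>e = 0\<close> by (simp add: e_def)
    qed
    have t: "t = e + m * s" by (simp add: e_def)
    have "npt s t = npt (s / e) (1 + s / e * m)" using npt_eq_iff[OF st(2) ne[of "s / e"]] e by (simp add: t field_simps)
    moreover have "bq w (s / e) (1 + s / e * m) = (1 / e) ^ 4 * bq w s t"
      using bq_scale(1)[of w "1 / e" s t] e by (simp add: t field_simps)
    ultimately show "x \<in> (\<lambda>z. npt z (1 + z * m)) ` {z. poly Q z = 0}" using st(1,3) Q[of "s / e"]
      by (intro image_eqI[of _ _ "s / e"]) simp_all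
  next
    fix x assume "x \<in> (\<lambda>z. npt z (1 + z * m)) ` {z. poly Q z = 0}"
    then obtain z where z: "x = npt z (1 + z * m)" "bq w z (1 + z * m) = 0" using Q by auto
    then show "x \<in> bq_roots w" unfolding bq_roots_def using ne[of z]
      by (intro CollectI exI[of _ z] exI[of _ "1 + z * m"] conjI)
  qed
  moreover have "inj_on (\<lambda>z. npt z (1 + z * m)) A" for A
    by (rule inj_onI) (simp add: npt_eq_iff[OF ne ne] algebra_simps)
  ultimately show ?thesis using deg by (simp add: card_image)
qed

text \<open>The total space is a set of pairs, since the roots have no natural place among the
  coordinates of the line; \<open>finite_cover\<close> admits any Hausdorff space.\<close>

definition quartic_cover :: "(proj \<times> proj) set" where
  "quartic_cover = {(l, u). l \<in> proj_space 2 - quartic_dual \<and> u \<in> bq_roots (rep_proj l)}"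

lemma quartic_finite_cover: "finite_cover quartic_cover fst (proj_space 2 - quartic_dual) 4"
proof (rule finite_cover_criterion)
  show "continuous_on quartic_cover fst" by (intro continuous_intros)
  show "fst y \<in> proj_space 2 - quartic_dual" if "y \<in> quartic_cover" for y using that by (auto simp: quartic_cover_def)
next
  fix b assume b: "b \<in> proj_space 2 - quartic_dual"
  then have "{y \<in> quartic_cover. fst y = b} = {b} \<times> bq_roots (rep_proj b)" by (auto simp: quartic_cover_def)
  moreover have "rep_proj b i = 0" if "i > 2" for i using that b rep_proj_space by blast
  then have "card (bq_roots (rep_proj b)) = 4" using card_bq_roots[OF rep_proj_hvec[of b]] b by simp
  ultimately show "card {y \<in> quartic_cover. fst y = b} = 4" by (simp add: card_cartesian_product_singleton)
next
  fix y U assume y: "y \<in> quartic_cover" and U: "open U" "y \<in> U"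
  define w0 where "w0 = rep_proj (fst y)"
  have w0: "w0 \<in> hvec" "abs_proj w0 = fst y" "\<And>i. i > 2 \<Longrightarrow> w0 i = 0"
    using y rep_proj_space by (auto simp: w0_def quartic_cover_def)
  obtain s0 t0 where st: "snd y = npt s0 t0" "(s0, t0) \<noteq> (0, 0)" "bq w0 s0 t0 = 0"
    using y unfolding w0_def quartic_cover_def bq_roots_def by auto
  \<comment> \<open>The root is moved in a direction (1, m) where the form is not zero. Thus the
    leading coefficient does not vanish at \<open>w0\<close>, and the moving pair never becomes (0,
    0), as this would make the root proportional to (1, m).\<close>
  obtain m where m: "bq w0 1 m \<noteq> 0" using w0(1,3) by (rule bq_nonroot)
  have ne: "(s0 + z * 1, t0 + z * m) \<noteq> (0, 0)" for z
  proof
    assume "(s0 + z * 1, t0 + z * m) = (0, 0)"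
    then have e: "s0 = (- z) * 1" "t0 = (- z) * m" by (simp_all add: eq_neg_iff_add_eq_0)
    then have "(- z) ^ 4 * bq w0 1 m = 0" using st(3) bq_scale(1)[of w0 "- z" 1 m] by simp
    then have "z = 0" using m by simp
    then show False using e st(2) by simp
  qed
  let ?E = "{w \<in> hvec. \<forall>i>2. w i = 0}"
  let ?\<Phi> = "\<lambda>w z. (abs_proj w, npt (s0 + z * 1) (t0 + z * m))"
  have "\<exists>W. open W \<and> w0 \<in> W \<and> (\<forall>w\<in>W \<inter> ?E. \<exists>z. poly (bq_line w s0 t0 1 m) z = 0 \<and> ?\<Phi> w z \<in> U)"
  proof (rule roots_near[where n = 4])
    show "degree (bq_line w s0 t0 1 m) \<le> 4" for w by (rule degree_bq_line)
    show "continuous_on UNIV (\<lambda>w. poly (bq_line w s0 t0 1 m) 0)"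
      unfolding poly_bq_line bq_def by (intro continuous_intros continuous_on_coord)
    show "continuous_on UNIV (\<lambda>w. coeff (bq_line w s0 t0 1 m) 4)"
      unfolding degree_bq_line bq_def by (intro continuous_intros continuous_on_coord)
    show "coeff (bq_line w0 s0 t0 1 m) 4 \<noteq> 0" unfolding degree_bq_line by (rule m)
    show "poly (bq_line w0 s0 t0 1 m) 0 = 0" unfolding poly_bq_line using st(3) by simp
    have "continuous_on (?E \<times> UNIV) (\<lambda>p. (abs_proj (fst p), npt (s0 + snd p * 1) (t0 + snd p * m)))"
    proof (rule continuous_on_Pair)
      show "continuous_on (?E \<times> UNIV) (\<lambda>p. abs_proj (fst p))"
        by (rule continuous_on_compose2[OF continuous_on_abs_proj continuous_on_fst[OF continuous_on_id]]) auto
      show "continuous_on (?E \<times> UNIV) (\<lambda>p. npt (s0 + snd p * 1) (t0 + snd p * m))"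
        unfolding npt_def
      proof (rule continuous_on_into_proj)
        show "continuous_on (?E \<times> UNIV) (\<lambda>p. nvec (s0 + snd p * 1) (t0 + snd p * m) i)" for i
          unfolding nvec_def by (cases "i \<le> 4") (simp_all, intro continuous_intros)
      qed (use nvec_hvec ne in blast)
    qed
    then show "continuous_on (?E \<times> UNIV) (\<lambda>(w, z). ?\<Phi> w z)" by (simp add: case_prod_beta')
    show "?\<Phi> w0 0 \<in> U" using U(2) w0(2) st(1) by (metis add_0_right mult_zero_left prod.collapse)
  qed (use w0 U in auto)
  then obtain W where W: "open W" "w0 \<in> W"
    "\<forall>w\<in>W \<inter> ?E. \<exists>z. poly (bq_line w s0 t0 1 m) z = 0 \<and> ?\<Phi> w z \<in> U" by blast
  have "abs_proj w \<in> fst ` (quartic_cover \<inter> U)" if w: "w \<in> W \<inter> hvec" "abs_proj w \<in> proj_space 2 - quartic_dual" for w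
  proof -
    have w2: "w \<in> hvec" "\<forall>i>2. w i = 0" using w proj_space_abs_iff by auto
    then obtain z where z: "poly (bq_line w s0 t0 1 m) z = 0" "?\<Phi> w z \<in> U" using W(3) w(1) by blast
    have "npt (s0 + z * 1) (t0 + z * m) \<in> bq_roots w" using z(1) ne[of z] unfolding poly_bq_line bq_roots_def by blast
    then have "?\<Phi> w z \<in> quartic_cover" unfolding quartic_cover_def using w(2) bq_roots_rep[OF w2(1)] by simp
    then show ?thesis using z(2) by force
  qed
  then show "\<exists>w0 W. w0 \<in> hvec \<and> abs_proj w0 = fst y \<and> open W \<and> w0 \<in> W \<and>
        (\<forall>w\<in>W \<inter> hvec. abs_proj w \<in> proj_space 2 - quartic_dual \<longrightarrow> abs_proj w \<in> fst ` (quartic_cover \<inter> U))"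
    using W(1,2) w0(1,2) by blast
qed simp

abbreviation "qp \<equiv> 2 * (1 - qk ^ 2)"
abbreviation "qq \<equiv> 2 * (1 + qk ^ 2)"

text \<open>On the line (a : \<kappa> a : c) the quartic form is a^2 \<beta> - c^2 \<alpha>, where
  \<alpha> = XY = s^4 - t^4 and \<beta> = Z (Y - \<kappa>^2 X) = \<open>qp\<close> s^3 t -
  \<open>qq\<close> s t^3. The substitution y = \<alpha> c / a turns its zeros into the
  hyperelliptic curve y^2 = \<alpha> \<beta>, whose octic has these coefficients.\<close>

definition quart_b :: "nat \<Rightarrow> complex" where
  "quart_b j = (if j = 1 then qp else if j = 3 then - qq else if j = 5 then - qp else if j = 7 then qq else 0)"

lemma qpq: "qp \<noteq> 0" "qq \<noteq> 0" "qp \<noteq> qq" "qp \<noteq> - qq"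
proof -
  have K: "(qk ^ 2) ^ 2 = 1 / 8" using qk4 by (simp flip: power_mult)
  have "qk ^ 2 \<noteq> 1" "qk ^ 2 \<noteq> - 1" "qk ^ 2 \<noteq> 0"
  proof -
    show "qk ^ 2 \<noteq> 1" proof assume "qk ^ 2 = 1" then show False using K by simp qed
    show "qk ^ 2 \<noteq> - 1" proof assume "qk ^ 2 = - 1" then show False using K by simp qed
    show "qk ^ 2 \<noteq> 0" proof assume "qk ^ 2 = 0" then show False using K by simp qed
  qed
  moreover define k where "k = qk ^ 2"
  ultimately have "k \<noteq> 1" "k \<noteq> - 1" "k \<noteq> 0" by simp_all
  then show "2 * (1 - qk ^ 2) \<noteq> 0" "2 * (1 + qk ^ 2) \<noteq> 0" "2 * (1 - qk ^ 2) \<noteq> 2 * (1 + qk ^ 2)" "2 * (1 - qk ^ 2) \<noteq> - (2 * (1 + qk ^ 2))"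
    unfolding k_def[symmetric] by (auto simp: add_eq_0_iff algebra_simps)
qed

section \<open>The completed covering over the pencil, quartic case\<close>

interpretation qc: cyclic_curve 4 2 quart_b
  by standard auto

lemma qc_bin: "qc.bin s t = (s ^ 4 - t ^ 4) * (qp * s ^ 3 * t - qq * s * t ^ 3)"
proof -
  have "qc.bin s t = (\<Sum>j\<in>{1, 3, 5, 7}. quart_b j * s ^ (8 - j) * t ^ j)"
    unfolding qc.bin_def by (rule sum.mono_neutral_cong_right) (auto simp: quart_b_def)
  also have "\<dots> = qp * s ^ 7 * t - qq * s ^ 5 * t ^ 3 - qp * s ^ 3 * t ^ 5 + qq * s * t ^ 7"
    by (simp add: quart_b_def algebra_simps)
  also have "\<dots> = (s ^ 4 - t ^ 4) * (qp * s ^ 3 * t - qq * s * t ^ 3)" by algebra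
  finally show ?thesis .
qed

text \<open>Up to the factor z the octic on the affine part is (1 - u)(1 + u)(p - q u) with u = z^2,
  and the assumptions on \<open>p\<close> and \<open>q\<close> keep its roots in \<open>u\<close>
  distinct and nonzero.\<close>

lemma squarefree_octic:
  fixes p q z :: complex
  assumes p: "p \<noteq> 0" "q \<noteq> 0" "p \<noteq> q" "p \<noteq> - q" and "p * z - q * z ^ 3 - p * z ^ 5 + q * z ^ 7 = 0"
  shows "p - 3 * q * z ^ 2 - 5 * p * z ^ 4 + 7 * q * z ^ 6 \<noteq> 0"
proof
  assume d: "p - 3 * q * z ^ 2 - 5 * p * z ^ 4 + 7 * q * z ^ 6 = 0"
  have z: "z \<noteq> 0" using d p(1) by auto
  define u where "u = z ^ 2"
  have u: "u \<noteq> 0" using z by (simp add: u_def)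
  have "z * ((1 - u) * (1 + u) * (p - q * u)) = p * z - q * z ^ 3 - p * z ^ 5 + q * z ^ 7"
    unfolding u_def by algebra
  then have "(1 - u) * (1 + u) * (p - q * u) = 0" using assms(5) z by simp
  moreover have d': "p - 3 * q * u - 5 * p * u ^ 2 + 7 * q * u ^ 3 = 0" using d by (simp add: u_def flip: power_mult)
  ultimately consider "u = 1" | "u = - 1" | "p = q * u" by (auto simp: add_eq_0_iff)
  then show False
  proof cases
    case 1
    then have "4 * (q - p) = 0" using d' by (simp add: algebra_simps)
    then show False using p(3) by simp
  next
    case 2
    then have "4 * (p + q) = 0" using d' by algebra
    then have "p + q = 0" by (metis mult_eq_0_iff zero_neq_numeral)
    then show False using p(4) by (simp add: eq_neg_iff_add_eq_0)
  next
    case 3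
    then have "2 * (q * u) * ((u - 1) * (u + 1)) = 0" using d' by algebra
    then have "u = 1 \<or> u = - 1" using p(2) u by (auto simp: eq_neg_iff_add_eq_0)
    then show False using 3 p(3,4) by auto
  qed
qed

interpretation qc: smooth_cyclic_curve 4 2 quart_b
proof
  show "deriv (qc.bin1 u) z \<noteq> 0" if 0: "qc.bin1 u z = 0" for u z
  proof -
    define p q where "p = (if u then qp else qq)" and "q = (if u then qq else qp)"
    have n: "p \<noteq> 0" "q \<noteq> 0" "p \<noteq> q" "p \<noteq> - q" using qpq by (auto simp: p_def q_def equation_minus_iff)
    have e: "qc.bin1 u = (\<lambda>z. p * z - q * z ^ 3 - p * z ^ 5 + q * z ^ 7)"
    proof
      fix z :: complex
      have "(1 - z ^ 4) * (A * z - B * z ^ 3) = A * z - B * z ^ 3 - A * z ^ 5 + B * z ^ 7"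
        "(z ^ 4 - 1) * (A * z ^ 3 - B * z) = B * z - A * z ^ 3 - B * z ^ 5 + A * z ^ 7" for A B
        by algebra+
      note * = this[of qp qq]
      show "qc.bin1 u z = p * z - q * z ^ 3 - p * z ^ 5 + q * z ^ 7"
        unfolding p_def q_def using * by (cases u) (simp_all only: qc.bin1_def qc_bin if_True if_False power_one mult_1_right mult_1)
    qed
    have "((\<lambda>z. p * z - q * z ^ 3 - p * z ^ 5 + q * z ^ 7) has_field_derivative
        p - 3 * q * z ^ 2 - 5 * p * z ^ 4 + 7 * q * z ^ 6) (at z)"
      by (auto intro!: derivative_eq_intros)
    then have "deriv (qc.bin1 u) z = p - 3 * q * z ^ 2 - 5 * p * z ^ 4 + 7 * q * z ^ 6"
      unfolding e by (rule DERIV_imp_deriv)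
    then show ?thesis using squarefree_octic[OF n] 0 unfolding e by simp
  qed
  show "\<exists>s t. (s, t) \<noteq> (0, 0) \<and> qc.bin s t = 0" by (intro exI[of _ 1] exI[of _ 0]) (simp add: qc_bin)
qed

definition qal :: "(nat \<Rightarrow> complex) \<Rightarrow> complex" where "qal v = v 0 - v 4"
definition qbe :: "(nat \<Rightarrow> complex) \<Rightarrow> complex" where "qbe v = qp * v 1 - qq * v 3"

lemma qal_qbe_scale: "qal (\<lambda>i. c * v i) = c * qal v" "qbe (\<lambda>i. c * v i) = c * qbe v"
  by (simp_all add: qal_def qbe_def algebra_simps)

lemma qal_qbe_cvec: "qal (qc.cvec s t y) = s ^ 4 - t ^ 4" "qbe (qc.cvec s t y) = qp * s ^ 3 * t - qq * s * t ^ 3"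
  "qc.cvec s t y 5 = y"
  by (simp_all add: qal_def qbe_def qc.cvec_def algebra_simps)

lemma qal_qbe_nonzero:
  assumes "(s, t) \<noteq> (0, 0)" shows "s ^ 4 - t ^ 4 \<noteq> 0 \<or> qp * s ^ 3 * t - qq * s * t ^ 3 \<noteq> 0"
proof (rule ccontr)
  assume "\<not> ?thesis"
  then have 1: "s ^ 4 = t ^ 4" and 2: "qp * s ^ 3 * t - qq * s * t ^ 3 = 0" by auto
  have nz: "s \<noteq> 0" "t \<noteq> 0" using 1 assms by auto
  have "A * s ^ 3 * t - B * s * t ^ 3 = s * t * (A * s ^ 2 - B * t ^ 2)" for A B by algebra
  from this[of qp qq] have 3: "qp * s ^ 2 = qq * t ^ 2" using 2 nz by simp
  have "(s ^ 2) ^ 2 = (t ^ 2) ^ 2" using 1 by (simp flip: power_mult)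
  then have "s ^ 2 = t ^ 2 \<or> s ^ 2 = - (t ^ 2)" by (simp only: power2_eq_iff)
  then show False
  proof
    assume "s ^ 2 = t ^ 2"
    then have "qp * t ^ 2 = qq * t ^ 2" using 3 by (simp only:)
    then show False using qpq(3) nz(2) by (metis mult_right_cancel power_not_zero)
  next
    assume "s ^ 2 = - (t ^ 2)"
    then have "(- qp) * t ^ 2 = qq * t ^ 2" using 3 by (simp only: mult_minus_right mult_minus_left)
    then have "- qp = qq" using nz(2) by (metis mult_right_cancel power_not_zero)
    then show False using qpq(4) by (metis minus_minus)
  qed
qed

text \<open>On the curve c/a = y/\<alpha>. Where \<alpha> = 0 also y = 0, but \<beta> is nonzero,
  and y/\<alpha> = \<beta>/y becomes infinite; this explains the value (0 : 0 : 1).\<close>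

definition quart_map :: "proj \<Rightarrow> proj" where
  "quart_map x = (let v = rep_proj x in
     if qal v \<noteq> 0 then abs_proj (vec3 (qal v) (qk * qal v) (v 5)) else abs_proj (vec3 0 0 1))"

lemma quart_map1:
  assumes "v \<in> hvec" "qal v \<noteq> 0" shows "quart_map (abs_proj v) = abs_proj (vec3 (qal v) (qk * qal v) (v 5))"
proof -
  obtain c where c: "c \<noteq> 0" "rep_proj (abs_proj v) = (\<lambda>i. c * v i)" using rep_abs_proj[OF assms(1)] by blast
  have "vec3 (c * qal v) (qk * (c * qal v)) (c * v 5) = (\<lambda>i. c * vec3 (qal v) (qk * qal v) (v 5) i)"
    using vec3_scale[of c "qal v" "qk * qal v" "v 5"] by (simp add: mult.left_commute)
  then show ?thesis unfolding quart_map_def Let_def c(2) qal_qbe_scale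
    using c(1) assms(2) abs_proj_scale[OF c(1) vec3_hvec[of "qal v"]] by simp
qed

lemma quart_map0: "v \<in> hvec \<Longrightarrow> qal v = 0 \<Longrightarrow> quart_map (abs_proj v) = abs_proj (vec3 0 0 1)"
  by (rule rep_abs_proj[of v]) (auto simp: quart_map_def qal_qbe_scale)

text \<open>By y^2 = \<alpha> \<beta> the points (\<alpha> : \<kappa> \<alpha> : y) and (y :
  \<kappa> y : \<beta>) agree. As \<alpha> and \<beta> have no common zero, the two formulas
  together describe the map holomorphically on the whole curve.\<close>

lemma quart_map2:
  assumes "v \<in> hvec" "v 5 ^ 2 = qal v * qbe v" "qbe v \<noteq> 0"
  shows "quart_map (abs_proj v) = abs_proj (vec3 (v 5) (qk * v 5) (qbe v))"
proof (cases "qal v = 0")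
  case True
  then have "v 5 = 0" using assms(2) by simp
  then show ?thesis using quart_map0[OF assms(1) True] assms(3) by (simp add: vec3_abs_eq_iff)
next
  case False
  have "abs_proj (vec3 (qal v) (qk * qal v) (v 5)) = abs_proj (vec3 (v 5) (qk * v 5) (qbe v))"
    using assms(2,3) False by (subst vec3_abs_eq_iff) (auto simp: power2_eq_square algebra_simps)
  then show ?thesis using quart_map1[OF assms(1) False] by simp
qed

definition quart_nu :: "proj \<Rightarrow> proj" where "quart_nu x = abs_proj ((rep_proj x)(5 := 0))"

lemma cvec_nvec: "(qc.cvec s t y)(5 := 0) = nvec s t"
  by (auto simp: qc.cvec_def nvec_def fun_eq_iff)

lemma quart_nu_cpt: "(s, t) \<noteq> (0, 0) \<Longrightarrow> quart_nu (qc.cpt s t y) = npt s t"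
  unfolding quart_nu_def qc.cpt_def npt_def cvec_nvec[of s t y, symmetric]
proof (rule abs_proj_homogeneous[where M = "\<lambda>v. v(5 := 0)"])
  show "\<exists>e. e \<noteq> 0 \<and> (\<lambda>i. c * qc.cvec s t y i)(5 := 0) = (\<lambda>i. e * ((qc.cvec s t y)(5 := 0)) i)" if "c \<noteq> 0" for c
    using that by (intro exI[of _ c]) (auto simp: fun_eq_iff)
qed (simp_all add: qc.cvec_hvec cvec_nvec nvec_hvec)

lemma quart_point:
  assumes "(s, t) \<noteq> (0, 0)" "y ^ 2 = qc.bin s t"
  shows "qc.cvec s t y \<in> hvec" "(qc.cvec s t y) 5 ^ 2 = qal (qc.cvec s t y) * qbe (qc.cvec s t y)"
    "qal (qc.cvec s t y) \<noteq> 0 \<or> qbe (qc.cvec s t y) \<noteq> 0"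
  using assms qal_qbe_nonzero[OF assms(1)] unfolding qal_qbe_cvec qc_bin by (simp_all add: qc.cvec_hvec)

text \<open>Once (s, t) is known, \<open>y\<close> is determined by the image line if \<alpha> is
  nonzero, and is zero otherwise.\<close>

lemma quart_nu_inj:
  assumes x: "x \<in> qc.curve" "x' \<in> qc.curve" "quart_map x = quart_map x'" "quart_nu x = quart_nu x'"
  shows "x = x'"
proof -
  obtain s t y where s: "x = qc.cpt s t y" "(s, t) \<noteq> (0, 0)" "y ^ 2 = qc.bin s t" using x(1) unfolding qc.curve_def by blast
  obtain s' t' y' where s': "x' = qc.cpt s' t' y'" "(s', t') \<noteq> (0, 0)" "y' ^ 2 = qc.bin s' t'" using x(2) unfolding qc.curve_def by blast
  have "npt s t = npt s' t'" using x(4) s s' quart_nu_cpt by metis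
  then have "s * t' = t * s'" using npt_eq_iff[OF s(2) s'(2)] by simp
  then obtain l where l: "l \<noteq> 0" "s' = l * s" "t' = l * t" using parallel[OF s(2) s'(2)] by blast
  define y'' where "y'' = y' / l ^ 4"
  have y': "y' = l ^ 4 * y''" using l(1) by (simp add: y''_def)
  have x'': "x' = qc.cpt s t y''" unfolding s'(1) l y' by (rule qc.cpt_scale[OF l(1) s(2)])
  have "l ^ 8 * y'' ^ 2 = l ^ 8 * qc.bin s t"
    using s'(3) qc.bin_scale[of l s t] unfolding l y' by (simp add: power_mult_distrib flip: power_mult)
  then have y'': "y'' ^ 2 = qc.bin s t" using l(1) by simp
  have "y = y''"
  proof (cases "s ^ 4 - t ^ 4 = 0")
    case True
    then show ?thesis using s(3) y'' unfolding qc_bin True by simp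
  next
    case False
    then have "abs_proj (vec3 (s ^ 4 - t ^ 4) (qk * (s ^ 4 - t ^ 4)) y) = abs_proj (vec3 (s ^ 4 - t ^ 4) (qk * (s ^ 4 - t ^ 4)) y'')"
      using x(3) quart_map1[OF qc.cvec_hvec[OF s(2)], unfolded qal_qbe_cvec] unfolding s(1) x'' qc.cpt_def by simp
    then have "(s ^ 4 - t ^ 4) * y'' = y * (s ^ 4 - t ^ 4)" using False vec3_abs_eq_iff by blast
    then show ?thesis using False by (simp add: mult.commute)
  qed
  then show ?thesis using s(1) x'' by simp
qed

abbreviation "quartic_pencil \<equiv> perp (abs_proj (vec3 qk (- 1) 0))"

lemma bq_pencil:
  assumes "w 1 = qk * w 0"
  shows "bq w s t = w 0 ^ 2 * (qp * s ^ 3 * t - qq * s * t ^ 3) - w 2 ^ 2 * (s ^ 4 - t ^ 4)"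
  unfolding bq_def assms by (simp add: power_mult_distrib algebra_simps)

lemma quart_map_in_pencil:
  assumes "x \<in> qc.curve" shows "quart_map x \<in> quartic_pencil"
proof -
  obtain s t y where s: "x = abs_proj (qc.cvec s t y)" "(s, t) \<noteq> (0, 0)" using assms unfolding qc.curve_def qc.cpt_def by blast
  have h: "qc.cvec s t y \<in> hvec" by (rule qc.cvec_hvec[OF s(2)])
  show ?thesis
  proof (cases "qal (qc.cvec s t y) = 0")
    case True
    then show ?thesis unfolding s(1) quart_map0[OF h True] using pencil_iff[OF vec3_hvec[of 0 0 1]] by simp
  next
    case False
    then show ?thesis unfolding s(1) quart_map1[OF h False]
      using pencil_iff[OF vec3_hvec[of "qal (qc.cvec s t y)"]] by simp
  qed
qed

text \<open>A zero (s, t) of the quartic form of the line lifts to the curve by y = \<alpha> c / a,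
  or y = 0 if \<alpha> = 0.\<close>

lemma quart_fiber:
  assumes l: "l \<in> quartic_pencil"
  shows "bij_betw quart_nu {x \<in> qc.curve. quart_map x = l} (bq_roots (rep_proj l))"
proof -
  define w where "w = rep_proj l"
  have w: "w \<in> hvec" "l = abs_proj w" by (simp_all add: w_def)
  then have w1: "\<And>i. i > 2 \<Longrightarrow> w i = 0" "w 1 = qk * w 0" using l pencil_iff by blast+
  have lv: "l = abs_proj (vec3 (w 0) (qk * w 0) (w 2))" unfolding w(2) w1(2)[symmetric] using vec3_eta[of w] w1(1) by simp
  have nz: "w 0 \<noteq> 0 \<or> w 2 \<noteq> 0" using hvec_le2[OF w(1) w1(1)] w1(2) by auto
  have main: "quart_map (qc.cpt s t y) = l \<longleftrightarrow> (if s ^ 4 - t ^ 4 = 0 then w 0 = 0 else (s ^ 4 - t ^ 4) * w 2 = y * w 0)"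
    if s: "(s, t) \<noteq> (0, 0)" for s t y
  proof (cases "s ^ 4 - t ^ 4 = 0")
    case True
    then have "quart_map (qc.cpt s t y) = abs_proj (vec3 0 0 1)"
      unfolding qc.cpt_def by (intro quart_map0 qc.cvec_hvec[OF s]) (simp add: qal_qbe_cvec)
    then show ?thesis unfolding lv using vec3_abs_eq_iff[of 0 0 1 "w 0" "qk * w 0" "w 2"] nz True by auto
  next
    case False
    then have "quart_map (qc.cpt s t y) = abs_proj (vec3 (s ^ 4 - t ^ 4) (qk * (s ^ 4 - t ^ 4)) y)"
      unfolding qc.cpt_def using quart_map1[OF qc.cvec_hvec[OF s], unfolded qal_qbe_cvec] by simp
    then show ?thesis unfolding lv using vec3_abs_eq_iff[of "s ^ 4 - t ^ 4" "qk * (s ^ 4 - t ^ 4)" y "w 0" "qk * w 0" "w 2"] nz False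
      by (auto simp: algebra_simps)
  qed
  have "quart_nu ` {x \<in> qc.curve. quart_map x = l} = bq_roots w"
  proof (intro equalityI subsetI)
    fix u assume "u \<in> quart_nu ` {x \<in> qc.curve. quart_map x = l}"
    then obtain s t y where s: "u = quart_nu (qc.cpt s t y)" "(s, t) \<noteq> (0, 0)" "y ^ 2 = qc.bin s t" "quart_map (qc.cpt s t y) = l"
      unfolding qc.curve_def by blast
    define A B where "A = s ^ 4 - t ^ 4" and "B = qp * s ^ 3 * t - qq * s * t ^ 3"
    have y: "y ^ 2 = A * B" using s(3) by (simp only: qc_bin A_def B_def)
    have m: "if A = 0 then w 0 = 0 else A * w 2 = y * w 0" using main[OF s(2)] s(4) unfolding A_def by blast
    have "w 0 ^ 2 * B - w 2 ^ 2 * A = 0"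
    proof (cases "A = 0")
      case False
      then have e: "A * w 2 = y * w 0" using m by simp
      have "A * (w 0 ^ 2 * B - w 2 ^ 2 * A) = 0" using e y by algebra
      then show ?thesis using False by simp
    qed (use m in simp)
    then have "bq w s t = 0" unfolding bq_pencil[where w = w, OF w1(2)] A_def B_def .
    then show "u \<in> bq_roots w" unfolding s(1) quart_nu_cpt[OF s(2)] bq_roots_def using s(2) by blast
  next
    fix u assume "u \<in> bq_roots w"
    then obtain s t where s: "u = npt s t" "(s, t) \<noteq> (0, 0)" "bq w s t = 0" unfolding bq_roots_def by blast
    define A B where "A = s ^ 4 - t ^ 4" and "B = qp * s ^ 3 * t - qq * s * t ^ 3"
    have AB: "A \<noteq> 0 \<or> B \<noteq> 0" using qal_qbe_nonzero[OF s(2)] unfolding A_def B_def .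
    have e: "w 0 ^ 2 * B = w 2 ^ 2 * A" using s(3) unfolding bq_pencil[where w = w, OF w1(2)] A_def B_def by simp
    define y where "y = (if A = 0 then 0 else A * w 2 / w 0)"
    have w0: "A \<noteq> 0 \<Longrightarrow> w 0 \<noteq> 0" using e nz by auto
    have "y ^ 2 = A * B"
    proof (cases "A = 0")
      case False
      have yw: "y * w 0 = A * w 2" using False w0 by (simp add: y_def)
      have "w 0 ^ 2 * (y ^ 2 - A * B) = 0" using yw e by algebra
      then show ?thesis using w0[OF False] by simp
    qed (simp add: y_def)
    then have y: "y ^ 2 = qc.bin s t" by (simp only: qc_bin A_def B_def)
    have "if A = 0 then w 0 = 0 else A * w 2 = y * w 0" using e AB w0 by (auto simp: y_def)
    then have "quart_map (qc.cpt s t y) = l" using main[OF s(2)] unfolding A_def by blast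
    moreover have "qc.cpt s t y \<in> qc.curve" unfolding qc.curve_def using s(2) y by blast
    ultimately show "u \<in> quart_nu ` {x \<in> qc.curve. quart_map x = l}" using s(1) quart_nu_cpt[OF s(2), of y] by force
  qed
  moreover have "inj_on quart_nu {x \<in> qc.curve. quart_map x = l}" by (rule inj_onI) (use quart_nu_inj in auto)
  ultimately show ?thesis unfolding bij_betw_def w_def by blast
qed

text \<open>The double zero comes from the factorization
  \<open>YZ - X(Y\<^sub>0\<^sup>3Z + Z\<^sub>0\<^sup>3Y) = (Y\<^sub>0Y + Z\<^sub>0Z - X)(Z\<^sub>0Y + Y\<^sub>0Z + Y\<^sub>0Z\<^sub>0X)\<close> on the conic.\<close>

lemma card_bq_roots_special:
  assumes w: "w \<in> hvec" "\<And>i. i > 2 \<Longrightarrow> w i = 0" "w 1 = qk * w 0" and dual: "abs_proj w \<in> quartic_dual"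
  shows "card (bq_roots w) = 3"
proof -
  define K where "K = qk ^ 2"
  have K2: "K ^ 2 = 1 / 8" using qk4 by (simp add: K_def flip: power_mult)
  obtain X Y Z where XYZ: "X ^ 2 = Y ^ 2 + Z ^ 2" "w 0 ^ 2 = X ^ 3" "w 1 ^ 2 = Y ^ 3" "w 2 ^ 2 = Z ^ 3"
    using dual quartic_dual_iff[of w] w(1,2) by auto
  have X: "X \<noteq> 0"
  proof
    assume "X = 0"
    then have 0: "w 0 = 0" "w 1 = 0" using XYZ(2) w(3) by simp_all
    then have "Y = 0" using XYZ(3) by simp
    then have "w 2 = 0" using XYZ(1,4) \<open>X = 0\<close> by simp
    then show False using hvec_le2[OF w(1,2)] 0 by simp
  qed
  \<comment> \<open>The point (1 : Y0 : Z0) of the conic at which the double zero is expected; the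
    restriction to the pencil says that Y0^3 = \<kappa>^2.\<close>
  define Y0 Z0 where "Y0 = Y / X" and "Z0 = Z / X"
  have YZ: "Y = X * Y0" "Z = X * Z0" using X by (simp_all add: Y0_def Z0_def)
  have "X ^ 2 * (Y0 ^ 2 + Z0 ^ 2 - 1) = 0" using XYZ(1) unfolding YZ by algebra
  then have c: "Y0 ^ 2 + Z0 ^ 2 = 1" using X by simp
  have "X ^ 3 * (Y0 ^ 3 - K) = 0" using XYZ(2,3) unfolding w(3) YZ K_def by algebra
  then have Y3: "Y0 ^ 3 = K" using X by simp
  have Y6: "Y0 ^ 6 = 1 / 8"
  proof -
    have "Y0 ^ 6 = (Y0 ^ 3) ^ 2" by (simp flip: power_mult)
    then show ?thesis unfolding Y3 K2 .
  qed
  have Z0: "Z0 \<noteq> 0"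
  proof
    assume "Z0 = 0"
    then have "(Y0 ^ 2) ^ 3 = 1" using c by simp
    then show False using Y6 by (simp flip: power_mult)
  qed
  have Y0: "Y0 \<noteq> 0" "1 + Y0 \<noteq> 0"
  proof -
    show "Y0 \<noteq> 0" using Y6 by auto
    show "1 + Y0 \<noteq> 0" proof assume "1 + Y0 = 0" then have "Y0 = - 1" by (simp add: add_eq_0_iff) then show False using Y6 by simp qed
  qed
  \<comment> \<open>Half-angle formulas: (s0, t0) is the parameter of the conic point (1 : Y0 :
    Z0).\<close>
  obtain s0 t0 where st: "2 * s0 ^ 2 = 1 + Y0" "2 * t0 ^ 2 = 1 - Y0" "2 * s0 * t0 = Z0"
  proof -
    define s0 t0 where "s0 = csqrt ((1 + Y0) / 2)" and "t0 = csqrt ((1 - Y0) / 2)"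
    have st: "2 * s0 ^ 2 = 1 + Y0" "2 * t0 ^ 2 = 1 - Y0" by (simp_all add: s0_def t0_def)
    have "(2 * s0 * t0) ^ 2 = Z0 ^ 2" using st c by algebra
    then have "2 * s0 * t0 = Z0 \<or> 2 * s0 * (- t0) = Z0" unfolding power2_eq_iff by auto
    then show thesis using that[of s0 t0] that[of s0 "- t0"] st by auto
  qed
  \<comment> \<open>The second factor of the quartic form is the quadratic form a s^2 + 2 Y0 s t - g
    t^2, whose zeros are obtained from the square root \<open>\<delta>\<close> of its
    discriminant.\<close>
  define a g where "a = Z0 * (1 + Y0)" and "g = Z0 * (1 - Y0)"
  have a: "a \<noteq> 0" using Z0 Y0 by (simp add: a_def)
  define \<delta> where "\<delta> = csqrt (Y0 ^ 2 + a * g)"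
  have \<delta>: "\<delta> ^ 2 = Y0 ^ 2 + a * g" by (simp add: \<delta>_def)
  have \<delta>0: "\<delta> \<noteq> 0"
  proof
    assume "\<delta> = 0"
    then have "Y0 ^ 2 + a * g = 0" using \<delta> by simp
    then have "Y0 ^ 2 * (1 - Y0 ^ 2) = 1" using c unfolding a_def g_def by algebra
    then have "Y0 ^ 6 = - 1" by algebra
    then show False using Y6 by simp
  qed
  have fac: "a * bq w s t = - 2 * X ^ 3 * (t0 * s - s0 * t) ^ 2 * ((a * s + (Y0 - \<delta>) * t) * (a * s + (Y0 + \<delta>) * t))" for s t
  proof -
    define x y z where "x = s ^ 2 + t ^ 2" and "y = s ^ 2 - t ^ 2" and "z = 2 * s * t"
    have conic: "x ^ 2 = y ^ 2 + z ^ 2" unfolding x_def y_def z_def by algebra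
    have "bq w s t = w 0 ^ 2 * (z * (y - K * x)) - w 2 ^ 2 * (x * y)"
      unfolding bq_pencil[where w = w, OF w(3)] K_def x_def y_def z_def by algebra
    also have "\<dots> = X ^ 3 * (z * (y - Y0 ^ 3 * x) - Z0 ^ 3 * (x * y))"
      unfolding XYZ(2,4) YZ(2) Y3 by algebra
    also have "z * (y - Y0 ^ 3 * x) - Z0 ^ 3 * (x * y) = (Y0 * y + Z0 * z - x) * (Z0 * y + Y0 * z + Y0 * Z0 * x)"
      using conic c by algebra
    also have "Y0 * y + Z0 * z - x = - 2 * (t0 * s - s0 * t) ^ 2"
      using st unfolding x_def y_def z_def by algebra
    also have "Z0 * y + Y0 * z + Y0 * Z0 * x = a * s ^ 2 + 2 * Y0 * s * t - g * t ^ 2"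
      unfolding x_def y_def z_def a_def g_def by algebra
    finally have bq: "bq w s t = X ^ 3 * (- 2 * (t0 * s - s0 * t) ^ 2 * (a * s ^ 2 + 2 * Y0 * s * t - g * t ^ 2))" .
    have q: "(a * s + (Y0 - \<delta>) * t) * (a * s + (Y0 + \<delta>) * t) = a * (a * s ^ 2 + 2 * Y0 * s * t - g * t ^ 2)"
      using \<delta> by algebra
    show ?thesis unfolding bq q by (simp only: mult_ac)
  qed
  have "(s0, t0) \<noteq> (0, 0)" using st Z0 by auto
  have n1: "(\<delta> - Y0, a) \<noteq> (0, 0)" and n2: "(- \<delta> - Y0, a) \<noteq> (0, 0)" using a by auto
  note n0 = \<open>(s0, t0) \<noteq> (0, 0)\<close>
  have root: "bq w s t = 0 \<longleftrightarrow> s * t0 = t * s0 \<or> s * a = t * (\<delta> - Y0) \<or> s * a = t * (- \<delta> - Y0)" for s t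
  proof -
    have "bq w s t = 0 \<longleftrightarrow> t0 * s - s0 * t = 0 \<or> a * s + (Y0 - \<delta>) * t = 0 \<or> a * s + (Y0 + \<delta>) * t = 0"
      using fac[of s t] a X by auto
    moreover have "t0 * s - s0 * t = s * t0 - t * s0" "a * s + (Y0 - \<delta>) * t = s * a - t * (\<delta> - Y0)"
      "a * s + (Y0 + \<delta>) * t = s * a - t * (- \<delta> - Y0)" by algebra+
    ultimately show ?thesis by (simp only: right_minus_eq)
  qed
  have "bq_roots w = {npt s0 t0, npt (\<delta> - Y0) a, npt (- \<delta> - Y0) a}"
  proof (intro equalityI subsetI)
    fix u assume "u \<in> bq_roots w"
    then obtain s t where s: "u = npt s t" "(s, t) \<noteq> (0, 0)" "bq w s t = 0" unfolding bq_roots_def by blast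
    then show "u \<in> {npt s0 t0, npt (\<delta> - Y0) a, npt (- \<delta> - Y0) a}"
      unfolding root s(1) using npt_eq_iff[OF s(2) n0] npt_eq_iff[OF s(2) n1] npt_eq_iff[OF s(2) n2] by blast
  next
    fix u assume "u \<in> {npt s0 t0, npt (\<delta> - Y0) a, npt (- \<delta> - Y0) a}"
    then consider "u = npt s0 t0" | "u = npt (\<delta> - Y0) a" | "u = npt (- \<delta> - Y0) a" by blast
    then show "u \<in> bq_roots w"
    proof cases
      case 1 then show ?thesis unfolding bq_roots_def using n0 root[of s0 t0] by (auto simp: mult.commute)
    next
      case 2
      have "bq w (\<delta> - Y0) a = 0" unfolding root by (simp add: mult.commute)
      then show ?thesis unfolding bq_roots_def 2 using n1 by blast
    next
      case 3
      have "bq w (- \<delta> - Y0) a = 0" unfolding root by (simp add: mult.commute)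
      then show ?thesis unfolding bq_roots_def 3 using n2 by blast
    qed
  qed
  moreover have "npt (\<delta> - Y0) a \<noteq> npt (- \<delta> - Y0) a"
    unfolding npt_eq_iff[OF n1 n2] using a \<delta>0 by (simp add: algebra_simps)
  \<comment> \<open>At (s0, t0) the quadratic form has the value 3 Y0 Z0, so the double zero is not
    a triple one.\<close>
  moreover have q0: "(a * s0 + (Y0 - \<delta>) * t0) * (a * s0 + (Y0 + \<delta>) * t0) \<noteq> 0"
  proof
    assume "(a * s0 + (Y0 - \<delta>) * t0) * (a * s0 + (Y0 + \<delta>) * t0) = 0"
    then have "a * (a * s0 ^ 2 + 2 * Y0 * (s0 * t0) - g * t0 ^ 2) = 0" using \<delta> by algebra
    then have "a * s0 ^ 2 + 2 * Y0 * (s0 * t0) - g * t0 ^ 2 = 0" using a by (metis mult_eq_0_iff)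
    then have "a * (2 * s0 ^ 2) + 2 * Y0 * (2 * s0 * t0) - g * (2 * t0 ^ 2) = 0" by algebra
    then have "6 * (Y0 * Z0) = 0" unfolding st a_def g_def by (simp add: algebra_simps)
    then show False using Y0 Z0 by simp
  qed
  have "npt s0 t0 \<noteq> npt (\<delta> - Y0) a" unfolding npt_eq_iff[OF n0 n1]
  proof
    assume "s0 * a = t0 * (\<delta> - Y0)"
    then have "a * s0 + (Y0 - \<delta>) * t0 = 0" by algebra
    then show False using q0 by simp
  qed
  moreover have "npt s0 t0 \<noteq> npt (- \<delta> - Y0) a" unfolding npt_eq_iff[OF n0 n2]
  proof
    assume "s0 * a = t0 * (- \<delta> - Y0)"
    then have "a * s0 + (Y0 + \<delta>) * t0 = 0" by algebra
    then show False using q0 by simp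
  qed
  ultimately show ?thesis by simp
qed

lemma quart_pvec:
  assumes "y ^ 2 = qc.bin1 u z"
  shows "(qc.pvec u z y) 5 ^ 2 = qal (qc.pvec u z y) * qbe (qc.pvec u z y)"
    "qal (qc.pvec u z y) \<noteq> 0 \<or> qbe (qc.pvec u z y) \<noteq> 0"
proof -
  define s t where "s = (if u then 1 else z)" and "t = (if u then z else 1)"
  have "qc.pvec u z y = qc.cvec s t y" "(s, t) \<noteq> (0, 0)" "y ^ 2 = qc.bin s t"
    using assms by (auto simp: s_def t_def qc.pvec_def qc.bin1_def)
  then show "(qc.pvec u z y) 5 ^ 2 = qal (qc.pvec u z y) * qbe (qc.pvec u z y)"
    "qal (qc.pvec u z y) \<noteq> 0 \<or> qbe (qc.pvec u z y) \<noteq> 0" using quart_point by simp_all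
qed

lemma qal_qbe_pvec:
  "qal (qc.pvec u z y) = z ^ qc.ix u 0 - z ^ qc.ix u 4" "qbe (qc.pvec u z y) = qp * z ^ qc.ix u 1 - qq * z ^ qc.ix u 3"
  by (simp_all add: qal_def qbe_def qc.pvec_eq)

lemma quart_charts:
  assumes "x \<in> qc.curve"
  shows "\<exists>D g z. chart qc.curve D g \<and> z \<in> D \<and> g z = x \<and> proj_holomorphic_on (quart_map \<circ> g) D"
proof (rule qc.chartsI[OF _ assms])
  fix u z y assume y: "y ^ 2 = qc.bin1 u z"
  let ?R = "\<lambda>z y. y ^ 2 = qc.bin1 u z" and ?P = "\<lambda>z y. abs_proj (qc.pvec u z y)"
  let ?A1 = "{z::complex. z ^ qc.ix u 0 - z ^ qc.ix u 4 \<noteq> 0}" and ?A2 = "{z::complex. qp * z ^ qc.ix u 1 - qq * z ^ qc.ix u 3 \<noteq> 0}"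
  let ?H1 = "\<lambda>z y. vec3 (qc.pvec u z y 0 - qc.pvec u z y 4) (qk * (qc.pvec u z y 0 - qc.pvec u z y 4)) (qc.pvec u z y 5)"
  let ?H2 = "\<lambda>z y. vec3 (qc.pvec u z y 5) (qk * qc.pvec u z y 5) (qp * qc.pvec u z y 1 - qq * qc.pvec u z y 3)"
  have L1: "local_lift quart_map ?P ?R ?A1 ?H1"
    unfolding local_lift_def
  proof (intro conjI ballI allI impI)
    show "open ?A1" by (intro open_Collect_neq continuous_intros)
    fix z y assume "z \<in> ?A1" "?R z y"
    then have q: "qal (qc.pvec u z y) \<noteq> 0" unfolding qal_qbe_pvec by simp
    then show "?H1 z y \<in> hvec" by (intro vec3_hvec) (simp add: qal_def)
    show "quart_map (?P z y) = abs_proj (?H1 z y)" using quart_map1[OF qc.pvec_hvec q] by (simp add: qal_def)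
  next
    fix D \<phi> \<eta> i assume h: "\<phi> holomorphic_on D" "\<eta> holomorphic_on D"
    show "(\<lambda>w. ?H1 (\<phi> w) (\<eta> w) i) holomorphic_on D"
      by (intro vec3_holomorphic holomorphic_intros qc.pvec_holomorphic h)
  qed
  have L2: "local_lift quart_map ?P ?R ?A2 ?H2"
    unfolding local_lift_def
  proof (intro conjI ballI allI impI)
    show "open ?A2" by (intro open_Collect_neq continuous_intros)
    fix z y assume z: "z \<in> ?A2" and y: "?R z y"
    then have q: "qbe (qc.pvec u z y) \<noteq> 0" unfolding qal_qbe_pvec by simp
    then show "?H2 z y \<in> hvec" by (intro vec3_hvec) (simp add: qbe_def)
    show "quart_map (?P z y) = abs_proj (?H2 z y)"
      using quart_map2[OF qc.pvec_hvec quart_pvec(1)[OF y] q] by (simp add: qbe_def)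
  next
    fix D \<phi> \<eta> i assume h: "\<phi> holomorphic_on D" "\<eta> holomorphic_on D"
    show "(\<lambda>w. ?H2 (\<phi> w) (\<eta> w) i) holomorphic_on D"
      by (intro vec3_holomorphic holomorphic_intros qc.pvec_holomorphic h)
  qed
  have "z \<in> ?A1 \<or> z \<in> ?A2" using quart_pvec(2)[OF y] unfolding qal_qbe_pvec mem_Collect_eq .
  then show "\<exists>A H. z \<in> A \<and> local_lift quart_map ?P ?R A H"
  proof
    assume "z \<in> ?A1"
    with L1 show ?thesis by (intro exI[of _ ?A1] exI[of _ ?H1] conjI)
  next
    assume "z \<in> ?A2"
    with L2 show ?thesis by (intro exI[of _ ?A2] exI[of _ ?H2] conjI)
  qed
qed

lemma quartic_dual_pencil:
  "abs_proj (vec3 1 qk t) \<in> quartic_dual \<Longrightarrow> \<exists>X Y. X ^ 3 = 1 \<and> Y ^ 3 = qk ^ 2 \<and> t ^ 4 = (X ^ 2 - Y ^ 2) ^ 3"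
  "abs_proj (vec3 0 0 1) \<notin> quartic_dual"
proof -
  assume "abs_proj (vec3 1 qk t) \<in> quartic_dual"
  then obtain X Y Z where X: "X ^ 2 = Y ^ 2 + Z ^ 2" "1 = X ^ 3" "qk ^ 2 = Y ^ 3" "t ^ 2 = Z ^ 3"
    using quartic_dual_iff[OF vec3_hvec[of 1 qk t]] by auto
  have "t ^ 4 = (t ^ 2) ^ 2" "(Z ^ 3) ^ 2 = (Z ^ 2) ^ 3" by (simp_all flip: power_mult)
  then have "t ^ 4 = (X ^ 2 - Y ^ 2) ^ 3" using X(1,4) by simp
  with X show "\<exists>X Y. X ^ 3 = 1 \<and> Y ^ 3 = qk ^ 2 \<and> t ^ 4 = (X ^ 2 - Y ^ 2) ^ 3" by metis
next
  show "abs_proj (vec3 0 0 1) \<notin> quartic_dual" using quartic_dual_iff[OF vec3_hvec[of 0 0 1]] by auto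
qed

lemma quartic_branched:
  "branched_map quartic_pencil (\<lambda>t. vec3 1 qk t) 2 0 (\<lambda>t. vec3 t (qk * t) 1) 0 2 qc.curve quart_map 4 quartic_dual"
proof (intro branched_map.intro pencil_line_coord0 pencil_line_coord1 branched_map_axioms.intro)
  show "compact qc.curve" by (rule qc.compact_curve)
  show "rep_proj x 0 \<noteq> 0 \<or> rep_proj x 2 \<noteq> 0" if "x \<in> quartic_pencil" for x by (rule pencil_cases(3)[OF that])
  show rep0: "rep_proj x 0 \<noteq> 0" if x: "x \<in> quartic_pencil \<inter> quartic_dual" for x
  proof
    assume 0: "rep_proj x 0 = 0"
    then have "x = abs_proj (vec3 0 0 1)" using pencil_cases(2,3)[of x qk] x by (simp add: ratio_def)
    then show False using x quartic_dual_pencil(2) by simp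
  qed
  have "quartic_pencil \<inter> quartic_dual \<subseteq>
      (\<lambda>t. abs_proj (vec3 1 qk t)) ` (\<Union>X\<in>{X. X ^ 3 = 1}. \<Union>Y\<in>{Y. Y ^ 3 = qk ^ 2}. {t. t ^ 4 = (X ^ 2 - Y ^ 2) ^ 3})"
  proof
    fix x assume x: "x \<in> quartic_pencil \<inter> quartic_dual"
    then have e: "x = abs_proj (vec3 1 qk (ratio 2 0 x))" using rep0[OF x] pencil_cases(1) by blast
    then have "abs_proj (vec3 1 qk (ratio 2 0 x)) \<in> quartic_dual" using x by simp
    from quartic_dual_pencil(1)[OF this] obtain X Y where
      "X ^ 3 = 1" "Y ^ 3 = qk ^ 2" "ratio 2 0 x ^ 4 = (X ^ 2 - Y ^ 2) ^ 3" by blast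
    then show "x \<in> (\<lambda>t. abs_proj (vec3 1 qk t)) ` (\<Union>X\<in>{X. X ^ 3 = 1}. \<Union>Y\<in>{Y. Y ^ 3 = qk ^ 2}. {t. t ^ 4 = (X ^ 2 - Y ^ 2) ^ 3})"
      using e by blast
  qed
  then show "finite (quartic_pencil \<inter> quartic_dual)"
    by (rule finite_subset) (intro finite_imageI finite_UN_I finite_nth_roots; simp)
  show "quart_map ` qc.curve \<subseteq> quartic_pencil" using quart_map_in_pencil by blast
  show "\<exists>D g z. chart qc.curve D g \<and> z \<in> D \<and> g z = x \<and> proj_holomorphic_on (quart_map \<circ> g) D"
    if "x \<in> qc.curve" for x by (rule quart_charts[OF that])
  fix t assume t: "t \<in> quartic_pencil"
  have c: "card {x \<in> qc.curve. quart_map x = t} = card (bq_roots (rep_proj t))"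
    by (rule bij_betw_same_card[OF quart_fiber[OF t]])
  define w where "w = rep_proj t"
  have w: "w \<in> hvec" "t = abs_proj w" by (simp_all add: w_def)
  then have w1: "\<And>i. i > 2 \<Longrightarrow> w i = 0" "w 1 = qk * w 0" using t pencil_iff by blast+
  show "card {x \<in> qc.curve. quart_map x = t} = 4" if "t \<notin> quartic_dual"
    unfolding c w_def[symmetric] by (rule card_bq_roots[OF w(1) w1(1)]) (use that w(2) in simp_all)
  show "card {x \<in> qc.curve. quart_map x = t} = 4 - 1" if "t \<in> quartic_dual"
    using card_bq_roots_special[OF w(1) w1(1) w1(2)] that w(2) unfolding c w_def[symmetric] by simp
qed simp

section \<open>Comparison with the whole covering and exclusion of an isomorphism, quartic
  case\<close>

definition quart_ev :: "proj \<Rightarrow> proj \<times> proj" where "quart_ev x = (quart_map x, quart_nu x)"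

lemma quart_ev_in_cover:
  assumes "x \<in> qc.curve" "quart_map x \<notin> quartic_dual"
  shows "quart_ev x \<in> quartic_cover \<and> fst (quart_ev x) = quart_map x"
proof -
  have l: "quart_map x \<in> quartic_pencil" by (rule quart_map_in_pencil[OF assms(1)])
  have "quart_nu x \<in> bq_roots (rep_proj (quart_map x))" using bij_betw_apply[OF quart_fiber[OF l], of x] assms(1) by simp
  moreover have "quart_map x \<in> proj_space 2" using l by (simp add: perp_def)
  ultimately show ?thesis using assms(2) by (simp add: quart_ev_def quartic_cover_def)
qed

lemma quart_ev_inj: "x \<in> qc.curve \<Longrightarrow> x' \<in> qc.curve \<Longrightarrow> quart_ev x = quart_ev x' \<Longrightarrow> x = x'"
  by (rule quart_nu_inj) (simp_all add: quart_ev_def)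

lemma quart_ev_continuous: "continuous_on {x \<in> qc.curve. quart_map x \<notin> quartic_dual} quart_ev"
  unfolding quart_ev_def
proof (rule continuous_on_Pair)
  show "continuous_on {x \<in> qc.curve. quart_map x \<notin> quartic_dual} quart_map"
    by (rule continuous_on_subset[OF branched_map.continuous[OF quartic_branched]]) auto
  show "continuous_on {x \<in> qc.curve. quart_map x \<notin> quartic_dual} quart_nu"
  proof (rule continuous_on_subset[of qc.curve])
    show "continuous_on qc.curve quart_nu"
    proof (rule continuous_on_projI)
      let ?S = "{v \<in> hvec. abs_proj v \<in> qc.curve}"
      have S: "v(5 := 0) \<in> hvec" if v: "v \<in> ?S" for v
      proof -
        obtain s t y where s: "abs_proj v = abs_proj (qc.cvec s t y)" "(s, t) \<noteq> (0, 0)"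
          using v unfolding qc.curve_def qc.cpt_def by blast
        obtain c where c: "c \<noteq> 0" "v = (\<lambda>i. c * qc.cvec s t y i)"
          using s(1) v abs_proj_eq_iff[OF qc.cvec_hvec[OF s(2)], of v y] by auto
        have "v(5 := 0) = (\<lambda>i. c * nvec s t i)" unfolding c(2) cvec_nvec[of s t y, symmetric] by (auto simp: fun_eq_iff)
        then show ?thesis using hvec_scale[of c "nvec s t"] nvec_hvec[OF s(2)] c(1) by simp
      qed
      have "continuous_on ?S (\<lambda>v. abs_proj (v(5 := 0)))"
      proof (rule continuous_on_into_proj[OF _ S])
        show "continuous_on ?S (\<lambda>v. (v(5 := 0)) i)" for i by (cases "i = 5") (auto intro: continuous_on_coord)
      qed
      moreover have "abs_proj (v(5 := 0)) = quart_nu (abs_proj v)" if "v \<in> ?S" for v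
        unfolding quart_nu_def using that S[OF that]
        by (intro abs_proj_homogeneous[where M = "\<lambda>v. v(5 := 0)", symmetric]) (auto simp: fun_eq_iff)
      ultimately show "continuous_on ?S (\<lambda>v. quart_nu (abs_proj v))" by (rule continuous_on_eq)
    qed
  qed auto
qed

text \<open>On the axes e^4 = u^2 with u = |e|^2, so |\<kappa> e + \<tau>|^4 = u^2 + 1. If Re e is
  not positive, the mixed term in |\<kappa> e + \<tau>|^2 is not positive either, so with \<tau> at
  most \<kappa> this fourth power is at most \<kappa>^4 (u + 1)^2 = (u + 1)^2 / 8, which is too
  small.\<close>

lemma no_axis_root:
  fixes e :: complex and \<tau> :: real
  assumes e: "(qk * e + of_real \<tau>) ^ 4 = e ^ 4 + 1" and \<tau>: "0 \<le> \<tau>" "\<tau> \<le> kap"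
    and ax: "Re e \<le> 0" "Re e = 0 \<or> Im e = 0"
  shows False
proof -
  define u where "u = Re e ^ 2 + Im e ^ 2"
  have "e ^ 2 = of_real u \<or> e ^ 2 = - of_real u"
    using ax(2) by (auto simp: u_def complex_eq_iff power2_eq_square)
  then have "(e ^ 2) ^ 2 = of_real u ^ 2" by (elim disjE) (simp_all only: power2_minus)
  moreover have "(e ^ 2) ^ 2 = e ^ 4" by (simp flip: power_mult)
  ultimately have "e ^ 4 + 1 = of_real (u ^ 2 + 1)" by simp
  moreover have "cmod (of_real (u ^ 2 + 1)) = u ^ 2 + 1" by (simp only: norm_of_real) simp
  ultimately have n1: "cmod (qk * e + of_real \<tau>) ^ 4 = u ^ 2 + 1" using e by (metis norm_power)
  have "cmod (qk * e + of_real \<tau>) ^ 2 = kap ^ 2 * u + \<tau> ^ 2 + 2 * (kap * \<tau> * Re e)"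
    unfolding cmod_power2 u_def by (simp add: power2_eq_square algebra_simps)
  moreover have "kap * \<tau> * Re e \<le> 0" using kap(1) \<tau>(1) ax(1) by (simp add: mult_nonneg_nonpos)
  moreover have "\<tau> ^ 2 \<le> kap ^ 2" using \<tau> by (simp add: power_mono)
  ultimately have le: "cmod (qk * e + of_real \<tau>) ^ 2 \<le> kap ^ 2 * (u + 1)" by (simp add: algebra_simps)
  have "cmod (qk * e + of_real \<tau>) ^ 4 = (cmod (qk * e + of_real \<tau>) ^ 2) ^ 2" by simp
  also have "\<dots> \<le> (kap ^ 2 * (u + 1)) ^ 2" by (rule power_mono[OF le]) simp
  also have "\<dots> = (u + 1) ^ 2 / 8" using kap(3) by (simp add: power_mult_distrib)
  finally have "8 * (u ^ 2 + 1) \<le> (u + 1) ^ 2" unfolding n1 by simp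
  moreover have "(u + 1) ^ 2 = u ^ 2 + 2 * u + 1" by (simp add: power2_eq_square algebra_simps)
  moreover have "2 * u \<le> u ^ 2 + 1" using sum_squares_bound[of u 1] by simp
  moreover have "u ^ 2 \<ge> 0" by simp
  ultimately show False by argo
qed

text \<open>Fourth roots of one number differ by quarter turns, and a nontrivial quarter turn leads
  out of an open quadrant.\<close>

lemma fourth_root_unique:
  fixes e f :: complex
  assumes "e ^ 4 = f ^ 4" "Re e < 0" "Re f < 0" "Im e > 0 \<longleftrightarrow> Im f > 0" "Im e \<noteq> 0" "Im f \<noteq> 0"
  shows "e = f"
proof -
  have "(e - f) * (e + f) * (e - \<i> * f) * (e + \<i> * f) = e ^ 4 - f ^ 4"
    by (simp add: algebra_simps power4_eq_xxxx)
  then have "e = f \<or> e = - f \<or> e = \<i> * f \<or> e = - (\<i> * f)" using assms(1) by (auto simp: add_eq_0_iff2)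
  then show ?thesis
  proof (elim disjE)
    assume "e = - f" then show ?thesis using assms(2,3) by simp
  next
    assume "e = \<i> * f" then show ?thesis using assms by auto
  next
    assume "e = - (\<i> * f)" then show ?thesis using assms by auto
  qed
qed

text \<open>For r = tan (\<theta>/2) the bound says that sin \<theta> - \<kappa>^2 tan \<theta> is
  at most \<kappa>^2. The left side is greatest when cos \<theta> is the real cube root of
  \<kappa>^2, with value (sin \<theta>)^3. The choice \<kappa>^2 = sqrt 2 / 4 puts this maximum at
  \<theta> = \<pi>/4, where it equals \<kappa>^2. Hence equality at r = sqrt 2 - 1 and the square
  factor in the proof.\<close>

lemma tau_bound:
  fixes r :: real
  assumes "0 \<le> r" "r \<le> 1"
  shows "2 * (1 - kap ^ 2) * r - 2 * (1 + kap ^ 2) * r ^ 3 \<le> kap ^ 2 * (1 - r ^ 4)"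
proof -
  define R where "R = sqrt 2"
  have R: "R * R = 2" "R > 0" by (simp_all add: R_def)
  have "R * r ^ 2 \<le> R * 1" using R(2) assms by (intro mult_left_mono) (auto simp: power_le_one)
  moreover have "4 * (R + 1) * r \<ge> 0" using R(2) assms(1) by simp
  ultimately have "(3 * R + 4) + 4 * (R + 1) * r - R * r ^ 2 \<ge> 0" using R(2) by linarith
  then have "(r - R + 1) ^ 2 * ((3 * R + 4) + 4 * (R + 1) * r - R * r ^ 2) \<ge> 0" by simp
  \<comment> \<open>A polynomial identity in \<open>R\<close> and \<open>r\<close>; its last summand
    disappears because R^2 = 2.\<close>
  also have "(r - R + 1) ^ 2 * ((3 * R + 4) + 4 * (R + 1) * r - R * r ^ 2) = R - (8 - 2 * R) * r + (8 + 2 * R) * r ^ 3 - R * r ^ 4 +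
      (R * R - 2) * ((3 + 4 * r - r ^ 2) * R + (4 + 4 * r - 2 * (r + 1) * (3 + 4 * r - r ^ 2)))"
    by algebra
  finally have "0 \<le> R - (8 - 2 * R) * r + (8 + 2 * R) * r ^ 3 - R * r ^ 4" using R(1) by simp
  then show ?thesis unfolding kap(2) R_def[symmetric] by (simp add: field_simps)
qed

text \<open>The parameter \<sigma> \<tau>(r) of the line runs from 0 to the branch value \<sigma>
  \<kappa> and back. By \<open>no_axis_root\<close> the value e = \<sigma> b never meets the
  imaginary axis or the negative real axis, so a path starting in the left half-plane stays in one
  open quadrant. At both ends e^4 = -8/7, which has one solution in each quadrant; so
  \<open>b\<close> would not separate the two end points.\<close>

lemma quartic_path:
  fixes \<sigma> :: real
  assumes b: "continuous_on {x \<in> qc.curve. rep_proj (quart_map x) 0 \<noteq> 0} b"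
    and eq: "\<And>x t. x \<in> qc.curve \<Longrightarrow> quart_map x = abs_proj (vec3 1 qk t) \<Longrightarrow> (qk * b x + t) ^ 4 = b x ^ 4 + 1"
    and inj: "\<And>x x' t. x \<in> qc.curve \<Longrightarrow> x' \<in> qc.curve \<Longrightarrow> quart_map x = abs_proj (vec3 1 qk t) \<Longrightarrow>
        quart_map x' = abs_proj (vec3 1 qk t) \<Longrightarrow> b x = b x' \<Longrightarrow> x = x'"
    and \<sigma>: "\<sigma> = 1 \<or> \<sigma> = - 1"
  shows "Re (of_real \<sigma> * b (qc.cpt 1 0 0)) > 0"
proof -
  define K where "K = kap ^ 2"
  have K: "0 < K" "K < 1"
  proof -
    show "0 < K" using kap(1) by (simp add: K_def)
    have "sqrt 2 < sqrt 4" by (rule real_sqrt_less_mono) simp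
    then show "K < 1" unfolding K_def kap(2) by simp
  qed
  \<comment> \<open>The positive zero of \<open>B\<close>, where \<open>\<tau>\<close> returns to
    0.\<close>
  define r1 where "r1 = sqrt ((1 - K) / (1 + K))"
  have r1s: "(1 + K) * r1 ^ 2 = 1 - K" using K by (simp add: r1_def)
  have r1: "0 < r1" "r1 < 1" using K by (simp_all add: r1_def)
  define A B where "A r = 1 - r ^ 4" and "B r = 2 * (1 - K) * r - 2 * (1 + K) * r ^ 3" for r :: real
  define \<tau> where "\<tau> r = sqrt (B r / A r)" for r
  have A: "A r > 0" if "r \<in> {0..r1}" for r
  proof -
    have "r < 1" "r \<ge> 0" using that r1(2) by auto
    then show ?thesis using power_strict_mono[of r 1 4] by (simp add: A_def)
  qed
  have B: "B r \<ge> 0" if "r \<in> {0..r1}" for r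
  proof -
    have "(1 + K) * r ^ 2 \<le> (1 + K) * r1 ^ 2" using that K by (intro mult_left_mono power_mono) auto
    then have "0 \<le> 2 * r * ((1 - K) - (1 + K) * r ^ 2)" using that r1s by simp
    then show ?thesis by (simp add: B_def algebra_simps power2_eq_square power3_eq_cube)
  qed
  have \<tau>0: "\<tau> r \<ge> 0" if "r \<in> {0..r1}" for r using A[OF that] B[OF that] by (simp add: \<tau>_def)
  have \<tau>2: "\<tau> r ^ 2 * A r = B r" if "r \<in> {0..r1}" for r using A[OF that] B[OF that] by (simp add: \<tau>_def)
  have \<tau>k: "\<tau> r \<le> kap" if "r \<in> {0..r1}" for r
  proof -
    have "B r \<le> K * A r" using tau_bound[of r] that r1 by (simp add: A_def B_def K_def)
    then have "B r / A r \<le> kap ^ 2" using A[OF that] by (simp add: pos_divide_le_eq K_def)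
    then show ?thesis unfolding \<tau>_def using kap(1) by (simp add: real_le_lsqrt)
  qed
  have \<sigma>2: "\<sigma> ^ 2 = 1" using \<sigma> by auto
  \<comment> \<open>The last coordinate is y = \<alpha> c / a for the line with c / a = \<sigma>
    \<tau>.\<close>
  define \<gamma> where "\<gamma> r = qc.cpt 1 (of_real r) (of_real (\<sigma> * A r * \<tau> r))" for r
  have ybin: "complex_of_real (\<sigma> * A r * \<tau> r) ^ 2 = qc.bin 1 (of_real r)" if "r \<in> {0..r1}" for r
  proof -
    have "(\<sigma> * A r * \<tau> r) ^ 2 = \<sigma> ^ 2 * (A r * (\<tau> r ^ 2 * A r))" by algebra
    then have "(\<sigma> * A r * \<tau> r) ^ 2 = A r * B r" unfolding \<sigma>2 \<tau>2[OF that] by simp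
    then have "complex_of_real ((\<sigma> * A r * \<tau> r) ^ 2) = of_real (A r * B r)" by (simp only:)
    then show ?thesis by (simp add: qc_bin A_def B_def K_def)
  qed
  have \<gamma>X: "\<gamma> r \<in> qc.curve" if "r \<in> {0..r1}" for r
    unfolding \<gamma>_def qc.curve_def using ybin[OF that] by (intro CollectI exI conjI) (rule refl, simp, assumption)
  have f\<gamma>: "quart_map (\<gamma> r) = abs_proj (vec3 1 qk (of_real (\<sigma> * \<tau> r)))" if "r \<in> {0..r1}" for r
  proof -
    define a where "a = complex_of_real (A r)"
    have a: "a \<noteq> 0" using A[OF that] by (simp add: a_def)
    have q: "qal (qc.cvec 1 (of_real r) y) = a" for y by (simp add: qal_qbe_cvec a_def A_def)
    have "quart_map (\<gamma> r) = abs_proj (vec3 a (qk * a) (of_real (\<sigma> * A r * \<tau> r)))"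
      unfolding \<gamma>_def qc.cpt_def
      using quart_map1[of "qc.cvec 1 (of_real r) (of_real (\<sigma> * A r * \<tau> r))"] qc.cvec_hvec[of 1 "of_real r"] a
      by (simp only: q qal_qbe_cvec(3) not_False_eq_True prod.inject one_neq_zero simp_thms)
    also have "\<dots> = abs_proj (vec3 1 qk (of_real (\<sigma> * \<tau> r)))"
      using a by (subst vec3_abs_eq_iff) (auto simp: a_def)
    finally show ?thesis .
  qed
  have rep: "rep_proj (quart_map (\<gamma> r)) 0 \<noteq> 0" if "r \<in> {0..r1}" for r
    unfolding f\<gamma>[OF that] by (simp add: rep_abs_zero_iff vec3_hvec)
  have A0: "\<forall>r\<in>{0..r1}. 1 - r ^ 4 \<noteq> 0" using A unfolding A_def by force
  have c\<tau>: "continuous_on {0..r1} \<tau>" unfolding \<tau>_def A_def B_def by (intro continuous_intros A0)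
  have c\<gamma>: "continuous_on {0..r1} \<gamma>"
    unfolding \<gamma>_def qc.cpt_def
  proof (rule continuous_on_into_proj)
    show "continuous_on {0..r1} (\<lambda>r. qc.cvec 1 (of_real r) (of_real (\<sigma> * A r * \<tau> r)) i)" for i
      unfolding qc.cvec_def A_def by (cases "i \<le> 4"; cases "i = 5") (auto intro!: continuous_intros c\<tau>)
  qed (simp add: qc.cvec_hvec)
  define e where "e r = of_real \<sigma> * b (\<gamma> r)" for r
  have ce: "continuous_on {0..r1} e" unfolding e_def
    by (intro continuous_intros continuous_on_compose2[OF b c\<gamma>]) (use \<gamma>X rep in auto)
  have eeq: "(qk * e r + of_real (\<tau> r)) ^ 4 = e r ^ 4 + 1" if "r \<in> {0..r1}" for r
  proof -
    have s: "complex_of_real \<sigma> ^ 2 = 1" using \<sigma> by auto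
    have "qk * b (\<gamma> r) + of_real (\<sigma> * \<tau> r) = of_real \<sigma> * (qk * e r + of_real (\<tau> r))"
      using s by (simp add: e_def power2_eq_square algebra_simps)
    moreover have "b (\<gamma> r) = of_real \<sigma> * e r" using s by (simp add: e_def power2_eq_square)
    moreover have "complex_of_real \<sigma> ^ 4 = 1" using \<sigma> by auto
    ultimately show ?thesis using eq[OF \<gamma>X[OF that] f\<gamma>[OF that]] by (simp add: power_mult_distrib)
  qed
  have Re0: "Re (e r) \<noteq> 0" if "r \<in> {0..r1}" for r
    using no_axis_root[OF eeq[OF that] \<tau>0[OF that] \<tau>k[OF that]] by auto
  have ends: "0 \<in> {0..r1}" "r1 \<in> {0..r1}" using r1 by auto
  have \<tau>e: "\<tau> 0 = 0" "\<tau> r1 = 0"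
  proof -
    have "B r1 = 2 * r1 * ((1 - K) - (1 + K) * r1 ^ 2)" by (simp add: B_def algebra_simps power2_eq_square power3_eq_cube)
    then show "\<tau> r1 = 0" using r1s by (simp add: \<tau>_def)
  qed (simp add: \<tau>_def B_def)
  have "\<not> Re (e 0) < 0"
  proof
    assume neg: "Re (e 0) < 0"
    have negr: "Re (e r) < 0" if r: "r \<in> {0..r1}" for r
    proof -
      have "continuous_on {0..r} (\<lambda>v. - Re (e v))"
        by (intro continuous_intros continuous_on_subset[OF ce]) (use r in auto)
      then have "- Re (e r) > 0" by (rule sign_constant[rotated]) (use r neg Re0 in auto)
      then show ?thesis by simp
    qed
    have Im0: "Im (e r) \<noteq> 0" if "r \<in> {0..r1}" for r
      using no_axis_root[OF eeq[OF that] \<tau>0[OF that] \<tau>k[OF that]] negr[OF that] by auto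
    have cI: "continuous_on {0..r1} (\<lambda>v. Im (e v))" by (intro continuous_intros ce)
    have "Im (e 0) > 0 \<longleftrightarrow> Im (e r1) > 0"
    proof
      show "Im (e r1) > 0" if "Im (e 0) > 0" by (rule sign_constant[OF _ cI]) (use that r1 Im0 in auto)
      show "Im (e 0) > 0" if pos: "Im (e r1) > 0"
      proof (rule ccontr)
        assume "\<not> Im (e 0) > 0"
        then have "- Im (e 0) > 0" using Im0[OF ends(1)] by simp
        then have "- Im (e r1) > 0" by (intro sign_constant[of 0 r1 "\<lambda>v. - Im (e v)"] continuous_intros cI) (use r1 Im0 in auto)
        then show False using pos by simp
      qed
    qed
    moreover have "e 0 ^ 4 = e r1 ^ 4"
    proof -
      have "1 / 8 * e 0 ^ 4 = e 0 ^ 4 + 1" "1 / 8 * e r1 ^ 4 = e r1 ^ 4 + 1"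
        using eeq[OF ends(1)] eeq[OF ends(2)] \<tau>e qk4 by (simp_all add: power_mult_distrib)
      then show ?thesis by algebra
    qed
    ultimately have "e 0 = e r1" using fourth_root_unique negr Im0 ends by metis
    then have "b (\<gamma> 0) = b (\<gamma> r1)" using \<sigma> by (auto simp: e_def)
    then have "\<gamma> 0 = \<gamma> r1" using inj[OF \<gamma>X[OF ends(1)] \<gamma>X[OF ends(2)], of 0] f\<gamma>[OF ends(1)] f\<gamma>[OF ends(2)] \<tau>e by simp
    then have "npt 1 (of_real 0) = npt 1 (of_real r1)" unfolding \<gamma>_def using quart_nu_cpt by (metis prod.inject zero_neq_one)
    then show False using r1 npt_eq_iff[of 1 "of_real 0" 1 "of_real r1"] by simp
  qed
  moreover have "\<gamma> 0 = qc.cpt 1 0 0" using \<tau>e by (simp add: \<gamma>_def)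
  then have "e 0 = of_real \<sigma> * b (qc.cpt 1 0 0)" by (simp only: e_def)
  ultimately show ?thesis using Re0[OF ends(1)] by (simp only:)
qed

text \<open>Over the parameter 0 the value y is zero at the starting point, so the paths for both
  signs begin at the same point, where Re b and its negative would both be positive.\<close>

lemma quartic_not_isomorphic:
  assumes "continuous_on {x \<in> qc.curve. rep_proj (quart_map x) 0 \<noteq> 0} b"
    and "\<And>x t. x \<in> qc.curve \<Longrightarrow> quart_map x = abs_proj (vec3 1 qk t) \<Longrightarrow> (- qk * b x - t) ^ 4 + - 1 * b x ^ 4 + - 1 = 0"
    and "\<And>x x' t. x \<in> qc.curve \<Longrightarrow> x' \<in> qc.curve \<Longrightarrow> quart_map x = abs_proj (vec3 1 qk t) \<Longrightarrow>
        quart_map x' = abs_proj (vec3 1 qk t) \<Longrightarrow> b x = b x' \<Longrightarrow> x = x'"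
  shows False
proof -
  have eq: "(qk * b x + t) ^ 4 = b x ^ 4 + 1" if "x \<in> qc.curve" "quart_map x = abs_proj (vec3 1 qk t)" for x t
  proof -
    have "(- qk * b x - t) ^ 4 = (qk * b x + t) ^ 4" by algebra
    then show ?thesis using assms(2)[OF that] by (simp add: algebra_simps)
  qed
  have "Re (of_real 1 * b (qc.cpt 1 0 0)) > 0" "Re (of_real (- 1) * b (qc.cpt 1 0 0)) > 0"
    by (rule quartic_path[OF assms(1) eq assms(3)]; simp)+
  then show False by simp
qed

theorem proposition5p1:
  fixes d :: nat
  assumes "d = 3 \<or> d = 4"
  shows "\<exists>(C :: proj set) (p :: proj) (N :: nat) (C' :: proj set) (\<pi> :: proj \<Rightarrow> proj).
    smooth_curve 2 C \<and> plane_curve_degree C d \<and>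
    p \<in> proj_space 2 \<and> transversal (perp p) (dual_curve C) \<and>
    smooth_curve N C' \<and>
    holomorphic_map C' (perp p) \<pi> \<and>
    simple_ramification C' (perp p) \<pi> \<and>
    map_degree C' (perp p) \<pi> d \<and>
    branch_points C' \<pi> = dual_curve C \<inter> perp p \<and>
    (\<forall>t0 \<in> perp p - dual_curve C.
      \<exists>\<phi> \<in> hom (fundamental_group (proj_space 2 - dual_curve C) t0) (BijGroup (fiber C' \<pi> t0)).
        \<forall>A \<in> carrier (fundamental_group (perp p - dual_curve C) t0).
          fiber_monodromy C' \<pi> t0 A =
            \<phi> (induced_inclusion (proj_space 2 - dual_curve C) A)) \<and>
    \<not> (\<exists>\<psi>. isomorphism C' C \<psi> \<and> (\<forall>x\<in>C'. line_through p (\<psi> x) = \<pi> x))"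
  using assms
proof
  assume d: "d = 3"
  show ?thesis unfolding d
    by (rule cubic.conclude[OF cubic_branched cub.smooth_curve cubic_transversal _ _ cubic_finite_cover
      cub_ev_continuous cub_ev_in_cover cub_ev_inj cubic_not_isomorphic]) (simp | assumption)+
next
  assume d: "d = 4"
  show ?thesis unfolding d
    by (rule quart.conclude[OF quartic_branched qc.smooth_curve quartic_transversal _ _ quartic_finite_cover
      quart_ev_continuous quart_ev_in_cover quart_ev_inj quartic_not_isomorphic]) (simp add: qk4 | assumption)+
qed

end
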